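(* Let $X$ be a topological space admitting an amenable open cover $\mathcal{U}$ of multiplicity $k$. Then for every $n\geq k$ and every $\alpha\in H_n(X;\mathbb{R})$, the class $\alpha$ is $\ell^1$-invisible, i.e. $\iota_n(\alpha)=0$ in $H_n^{\ell^1}(X;\mathbb{R})$.
   Context: A subset $U\subseteq X$ (not necessarily path connected) is amenable in $X$ if for every $x_0\in U$ the image of $\pi_1(U,x_0)\to\pi_1(X,x_0)$ induced by inclusion is an amenable group. A cover $\mathcal{U}=\{U_i\}_{i\in I}$ of $X$ is open if each $U_i$ is open, amenable if each $U_i$ is amenable in $X$, and its multiplicity is $\sup\{\#J : J\subseteq I,\ \bigcap_{i\in J}U_i\neq\emptyset\}$. $H_*(X;\mathbb{R})$ is real singular homology. $C_n(X)$ denotes real singular $n$-chains with the $\ell^1$-norm $\|\sum a_\sigma\sigma\|_1=\sum|a_\sigma|$ (over singular simplices $\sigma$); $C_n^{\ell^1}(X)$ is its metric completion (possibly infinite combinations $\sum a_\sigma\sigma$ with $\sum|a_\sigma|<\infty$), with the boundary operator extended by continuity, and $H_*^{\ell^1}(X;\mathbb{R})$ is the homology of this complex ($\ell^1$-homology). $\iota_*\colon H_*(X;\mathbb{R})\to H_*^{\ell^1}(X;\mathbb{R})$ is induced by the inclusion $C_*(X)\hookrightarrow C_*^{\ell^1}(X)$. A class $\alpha$ is called $\ell^1$-invisible if $\iota_n(\alpha)=0$. *)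

theory Defs
  imports "HOL-Analysis.Analysis" "HOL-Homology.Homology"
begin

definition loops :: "'a topology \<Rightarrow> 'a \<Rightarrow> (real \<Rightarrow> 'a) set" where
  "loops X x0 = {p. continuous_map (top_of_set {0..1}) X p \<and> p 0 = x0 \<and> p 1 = x0}"

definition loop_homotopic :: "'a topology \<Rightarrow> 'a \<Rightarrow> (real \<Rightarrow> 'a) \<Rightarrow> (real \<Rightarrow> 'a) \<Rightarrow> bool" where
  "loop_homotopic X x0 p q =
     homotopic_with (\<lambda>h. h 0 = x0 \<and> h 1 = x0) (top_of_set {0..1}) X p q"

definition loop_class :: "'a topology \<Rightarrow> 'a \<Rightarrow> (real \<Rightarrow> 'a) \<Rightarrow> (real \<Rightarrow> 'a) set" where
  "loop_class X x0 p = {q \<in> loops X x0. loop_homotopic X x0 p q}"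

definition loop_concat :: "(real \<Rightarrow> 'a) \<Rightarrow> (real \<Rightarrow> 'a) \<Rightarrow> real \<Rightarrow> 'a" where
  "loop_concat p q = (\<lambda>t. if t \<le> 1/2 then p (2 * t) else q (2 * t - 1))"

definition fundamental_group :: "'a topology \<Rightarrow> 'a \<Rightarrow> (real \<Rightarrow> 'a) set monoid" where
  "fundamental_group X x0 =
     \<lparr>carrier = loop_class X x0 ` loops X x0,
      mult = (\<lambda>A B. {q \<in> loops X x0. \<exists>p\<in>A. \<exists>p'\<in>B. loop_homotopic X x0 (loop_concat p p') q}),
      one = loop_class X x0 (\<lambda>t. x0)\<rparr>"

definition fundamental_group_image :: "'a topology \<Rightarrow> 'a set \<Rightarrow> 'a \<Rightarrow> (real \<Rightarrow> 'a) set monoid" where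
  "fundamental_group_image X U x0 =
     (fundamental_group X x0)\<lparr>carrier := loop_class X x0 ` loops (subtopology X U) x0\<rparr>"

definition amenable_group :: "('g, 'b) monoid_scheme \<Rightarrow> bool" where
  "amenable_group G \<longleftrightarrow> group G \<and>
     (\<exists>\<mu> :: 'g set \<Rightarrow> real.
        (\<forall>A. A \<subseteq> carrier G \<longrightarrow> 0 \<le> \<mu> A) \<and>
        \<mu> (carrier G) = 1 \<and>
        (\<forall>A B. A \<subseteq> carrier G \<longrightarrow> B \<subseteq> carrier G \<longrightarrow> A \<inter> B = {} \<longrightarrow> \<mu> (A \<union> B) = \<mu> A + \<mu> B) \<and>
        (\<forall>g\<in>carrier G. \<forall>A. A \<subseteq> carrier G \<longrightarrow> \<mu> ((\<lambda>x. g \<otimes>\<^bsub>G\<^esub> x) ` A) = \<mu> A))"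

definition amenable_in :: "'a topology \<Rightarrow> 'a set \<Rightarrow> bool" where
  "amenable_in X U \<longleftrightarrow> (\<forall>x0\<in>U. amenable_group (fundamental_group_image X U x0))"

definition cover_multiplicity :: "'a topology \<Rightarrow> 'i set \<Rightarrow> ('i \<Rightarrow> 'a set) \<Rightarrow> nat \<Rightarrow> bool" where
  "cover_multiplicity X I U k \<longleftrightarrow>
     (\<forall>J. J \<subseteq> I \<longrightarrow> topspace X \<inter> \<Inter>(U ` J) \<noteq> {} \<longrightarrow> finite J \<and> card J \<le> k) \<and>
     (\<exists>J. J \<subseteq> I \<and> finite J \<and> card J = k \<and> topspace X \<inter> \<Inter>(U ` J) \<noteq> {})"

type_synonym 'a rchain = "((nat \<Rightarrow> real) \<Rightarrow> 'a) \<Rightarrow> real"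

definition real_chain :: "nat \<Rightarrow> 'a topology \<Rightarrow> 'a rchain \<Rightarrow> bool" where
  "real_chain p X c \<longleftrightarrow> finite {s. c s \<noteq> 0} \<and> (\<forall>s. c s \<noteq> 0 \<longrightarrow> singular_simplex p X s)"

text \<open>Element of the completion: possibly infinite combination with finite l1-norm.\<close>
definition l1_chain :: "nat \<Rightarrow> 'a topology \<Rightarrow> 'a rchain \<Rightarrow> bool" where
  "l1_chain p X c \<longleftrightarrow> (\<lambda>s. norm (c s)) summable_on UNIV \<and> (\<forall>s. c s \<noteq> 0 \<longrightarrow> singular_simplex p X s)"

text \<open>Boundary operator (on finite chains the usual one; on l1-chains its continuous extension).\<close>
definition rchain_boundary :: "nat \<Rightarrow> 'a rchain \<Rightarrow> 'a rchain" where
  "rchain_boundary p c = (\<lambda>t. if p = 0 then 0 else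
      (\<Sum>k\<le>p. (-1) ^ k * (\<Sum>\<^sub>\<infinity>s\<in>{s. singular_face p k s = t}. c s)))"

end

theory Submission
  imports Defs
begin

text \<open>For a subset \<open>V\<close> of a member of the cover let \<open>K\<^sub>V\<close> consist of the simplices of \<open>X\<close> with vertices in \<open>V\<close>
  and edges homotopic, relative to their end points, to paths in \<open>V\<close>. This is a Kan complex whose
  fundamental groups are subgroups of amenable groups and whose higher homotopy groups are abelian.
  Averaging over the fillers of horns therefore yields for every simplex \<open>\<sigma>\<close> a mean on the cones over
  \<open>\<sigma>\<close> that is compatible with faces. Dually this is a contraction of norm one of the bounded cochains
  in positive degrees, and by Hahn--Banach every \<open>\<ell>\<^sup>1\<close>-cycle of positive degree on \<open>K\<^sub>V\<close> is an
  \<open>\<ell>\<^sup>1\<close>-boundary.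

  A cycle on \<open>X\<close> is subdivided until each of its simplices lies in a member of the cover, and is then
  pushed through the Cech double complex of the cover. The zigzag dies in column \<open>k\<close>, and on the way
  back only cycles of degree at least \<open>n - k + 1 \<ge> 1\<close> on the complexes \<open>K\<^sub>V\<close>, with \<open>V\<close> an intersection
  of members of the cover, have to be filled.\<close>

section \<open>Kan complexes\<close>

text \<open>The singular complex of \<open>V\<close> itself would not do: amenability concerns the
  image of the loops of \<open>V\<close> in the fundamental group of \<open>X\<close>, so a cycle in
  \<open>V\<close> may bound only after leaving \<open>V\<close>. Homotopy groups are never formed.
  Their place is taken by canonical fillers of a fixed boundary, on which pairs of simplices act by
  translation; that a group is abelian becomes the statement that translations commute. The obstacle
  is that means are only finitely additive, so iterated means cannot be interchanged. The order in
  which fillers are averaged is therefore part of the construction, and compatibility with faces has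
  to be proved for this very order. Only the fillers through one edge of the cone, from the apex 0
  to the vertex 1, are averaged; all other faces through the apex are forced by them. Deleting a
  vertex other than 1 then merely drops variables, whereas deleting 1 changes the distinguished
  edge, and this is where invariance of the means enters.\<close>

definition pos :: "nat set => nat => nat" where
 "pos B v = card {b \<in> B. b < v}"

lemma pos_less_card: "finite B ==> v \<in> B ==> pos B v < card B"
 unfolding pos_def by (rule psubset_card_mono) auto

lemma pos_strict_mono: "finite B ==> v \<in> B ==> v < w ==> pos B v < pos B w"
 unfolding pos_def by (rule psubset_card_mono) auto

lemma pos_eq_iff: "finite B ==> v \<in> B ==> w \<in> B ==> pos B v = pos B w \<longleftrightarrow> v = w"
 by (metis linorder_neqE_nat order_less_irrefl pos_strict_mono)

lemma pos_Diff:
 assumes "finite B" "w \<in> B"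
 shows "pos (B - {w}) v = pos B v - (if w < v then 1 else 0)"
proof -
 have "{b \<in> B - {w}. b < v} = (if w < v then {b \<in> B. b < v} - {w} else {b \<in> B. b < v})"
  by auto
 then show ?thesis
  using assms by (simp add: pos_def)
qed

lemma pos_surj:
 assumes "finite B" "i < card B"
 shows "\<exists>b\<in>B. pos B b = i"
proof -
 have "inj_on (pos B) B"
  using assms by (auto simp: inj_on_def pos_eq_iff)
 then have "card (pos B ` B) = card B"
  by (rule card_image)
 moreover have "pos B ` B \<subseteq> {..<card B}"
  using assms pos_less_card by auto
 ultimately have "pos B ` B = {..<card B}"
  by (simp add: card_subset_eq)
 then show ?thesis
  using assms by (metis imageE lessThan_iff)
qed

lemma pos_image:
 assumes "strict_mono_on B f" "v \<in> B"
 shows "pos (f ` B) (f v) = pos B v"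
proof -
 have "{b \<in> f ` B. b < f v} = f ` {b \<in> B. b < v}"
  using assms by (auto simp: strict_mono_on_less)
 moreover have "inj_on f {b \<in> B. b < v}"
  using assms(1) by (metis (no_types, lifting) inj_on_subset mem_Collect_eq strict_mono_on_imp_inj_on subsetI)
 ultimately show ?thesis
  by (simp add: pos_def card_image)
qed

text \<open>A Kan complex given by its faces alone: \<open>K n\<close> holds the simplices of
  dimension n and \<open>d n k\<close> is the k-th face operator. Degeneracies are not part of the
  data, and horns are filled from dimension two on; edges with a prescribed end have to be supplied
  otherwise.\<close>

locale kan =
 fixes K :: "nat => 's set" and d :: "nat => nat => 's => 's"
 assumes face_in: "\<And>p k x. x \<in> K (Suc p) ==> k \<le> Suc p ==> d (Suc p) k x \<in> K p"
  and face_face: "\<And>p i k x. x \<in> K (Suc (Suc p)) ==> i < k ==> k \<le> Suc (Suc p) ==>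
   d (Suc p) i (d (Suc (Suc p)) k x) = d (Suc p) (k - 1) (d (Suc (Suc p)) i x)"
  and horn: "\<And>p j x. j \<le> Suc (Suc p) ==>
   (\<And>i. i \<le> Suc (Suc p) ==> i \<noteq> j ==> x i \<in> K (Suc p)) ==>
   (\<And>i k. i < k ==> k \<le> Suc (Suc p) ==> i \<noteq> j ==> k \<noteq> j ==>
     d (Suc p) i (x k) = d (Suc p) (k - 1) (x i)) ==>
   \<exists>t\<in>K (Suc (Suc p)). \<forall>i\<le>Suc (Suc p). i \<noteq> j --> d (Suc (Suc p)) i t = x i"
begin

text \<open>Simplices are labelled by finite vertex sets: \<open>fc B v t\<close> is the face opposite to \<open>v\<close> of a simplex \<open>t\<close> with
 vertex set \<open>B\<close>.\<close>

definition fc :: "nat set => nat => 's => 's" where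
 "fc B v t = d (card B - 1) (pos B v) t"

lemma fc_in:
 assumes "finite B" "2 \<le> card B" "v \<in> B" "t \<in> K (card B - 1)"
 shows "fc B v t \<in> K (card (B - {v}) - 1)"
proof -
 obtain p where p: "card B = Suc (Suc p)"
  using assms(2) that[of "card B - 2"] by simp
 then show ?thesis
  using assms face_in[of t p "pos B v"] pos_less_card[of B v] by (simp add: fc_def)
qed

text \<open>Labels absorb the index shift of the simplicial identity: deleting the smaller label
  lowers the position of the larger one by one, which is the \<open>k - 1\<close> of
  \<open>face_face\<close>.\<close>

lemma fc_comm:
 assumes "finite B" "3 \<le> card B" "v \<in> B" "w \<in> B" "v \<noteq> w" "t \<in> K (card B - 1)"
 shows "fc (B - {w}) v (fc B w t) = fc (B - {v}) w (fc B v t)"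
proof -
 obtain p where p: "card B = Suc (Suc (Suc p))"
  using assms(2) that[of "card B - 3"] by simp
 have *: "fc (B - {w}) v (fc B w t) = fc (B - {v}) w (fc B v t)"
  if "v \<in> B" "w \<in> B" "v < w" for v w
 proof -
  have "pos B v < pos B w" "pos B w \<le> Suc (Suc p)"
   using that assms p pos_strict_mono[of B v w] pos_less_card[of B w] by auto
  then show ?thesis
   using that assms p face_face[of t p "pos B v" "pos B w"]
   by (simp add: fc_def pos_Diff)
 qed
 show ?thesis
 proof (cases "v < w")
  case True
  then show ?thesis using *[of v w] assms by simp
 next
  case False
  then show ?thesis using *[of w v] assms by simp
 qed
qed

lemma horn_lab:
 assumes fin: "finite A" and card: "3 \<le> card A" and v: "v \<in> A"
  and x: "\<And>b. b \<in> A ==> b \<noteq> v ==> x b \<in> K (card A - 2)"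
  and compat: "\<And>b c. b \<in> A ==> c \<in> A ==> b \<noteq> v ==> c \<noteq> v ==> b \<noteq> c ==>
   fc (A - {b}) c (x b) = fc (A - {c}) b (x c)"
 shows "\<exists>t\<in>K (card A - 1). \<forall>b\<in>A. b \<noteq> v --> fc A b t = x b"
proof -
 obtain p where p: "card A = Suc (Suc (Suc p))"
  using card that[of "card A - 3"] by simp
 define e where "e i = (SOME b. b \<in> A \<and> pos A b = i)" for i
 have e: "e i \<in> A" "pos A (e i) = i" if "i \<le> Suc (Suc p)" for i
  using someI_ex[of "\<lambda>b. b \<in> A \<and> pos A b = i"] pos_surj[OF fin, of i] that p
  by (auto simp: e_def)
 have ep: "e (pos A b) = b" if "b \<in> A" for b
  using e[of "pos A b"] that pos_less_card[OF fin that] p fin by (simp add: pos_eq_iff)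
 have "\<exists>t\<in>K (Suc (Suc p)). \<forall>i\<le>Suc (Suc p). i \<noteq> pos A v --> d (Suc (Suc p)) i t = x (e i)"
 proof (rule horn)
  show "pos A v \<le> Suc (Suc p)"
   using pos_less_card[OF fin v] p by simp
  show "x (e i) \<in> K (Suc p)" if "i \<le> Suc (Suc p)" "i \<noteq> pos A v" for i
  proof -
   have "e i \<noteq> v"
    using e(2)[of i] that by metis
   then show ?thesis
    using x[of "e i"] e(1)[of i] that p by simp
  qed
  show "d (Suc p) i (x (e k)) = d (Suc p) (k - 1) (x (e i))"
   if "i < k" "k \<le> Suc (Suc p)" "i \<noteq> pos A v" "k \<noteq> pos A v" for i k
  proof -
   have "e i < e k"
    using e[of i] e[of k] that pos_strict_mono[OF fin, of "e k" "e i"] by (cases "e i" "e k" rule: linorder_cases) auto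
   moreover have "e i \<noteq> v" "e k \<noteq> v" "e i \<in> A" "e k \<in> A"
    using e[of i] e[of k] that by auto
   ultimately show ?thesis
    using compat[of "e k" "e i"] e[of i] e[of k] that fin p
    by (simp add: fc_def pos_Diff)
  qed
 qed
 then obtain t where t: "t \<in> K (Suc (Suc p))"
  "\<And>i. i\<le>Suc (Suc p) ==> i \<noteq> pos A v ==> d (Suc (Suc p)) i t = x (e i)"
  by blast
 have "fc A b t = x b" if "b \<in> A" "b \<noteq> v" for b
  using t(2)[of "pos A b"] that pos_less_card[OF fin, of b] p ep pos_eq_iff[OF fin, of b v] v
  by (simp add: fc_def)
 then show ?thesis
  using t(1) p by auto
qed

text \<open>A map from the abstract simplicial complex \<open>F\<close>, with vertices ordered as
  numbers, into \<open>K\<close>. Closure of \<open>F\<close> under passage to nonempty faces is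
  built in.\<close>

definition fam :: "nat set set => (nat set => 's) => bool" where
 "fam F s \<longleftrightarrow> (\<forall>B\<in>F. finite B \<and> B \<noteq> {} \<and> s B \<in> K (card B - 1) \<and>
   (2 \<le> card B --> (\<forall>v\<in>B. B - {v} \<in> F \<and> fc B v (s B) = s (B - {v}))))"

lemma famD:
 assumes "fam F s" "B \<in> F"
 shows "finite B" "B \<noteq> {}" "s B \<in> K (card B - 1)"
  "2 \<le> card B ==> v \<in> B ==> B - {v} \<in> F"
  "2 \<le> card B ==> v \<in> B ==> fc B v (s B) = s (B - {v})"
 using assms by (auto simp: fam_def)

lemma fam_cong: "fam F s ==> (\<And>B. B \<in> F ==> s' B = s B) ==> fam F s'"
 by (auto simp: fam_def)

lemma fam_subset:
 assumes "fam F s" "G \<subseteq> F" "\<And>B v. B \<in> G ==> v \<in> B ==> 2 \<le> card B ==> B - {v} \<in> G"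
 shows "fam G s"
 using assms unfolding fam_def by blast

text \<open>Besides adding a simplex this also serves to overwrite one that is already in
  \<open>F\<close>; the last hypothesis then asks that every coface present in \<open>F\<close> has
  the new value as its face.\<close>

lemma fam_upd:
 assumes "fam F s" "finite A" "A \<noteq> {}" "y \<in> K (card A - 1)"
  and "\<And>v. v \<in> A ==> 2 \<le> card A ==> A - {v} \<in> F \<and> fc A v y = s (A - {v})"
  and "\<And>B v. B \<in> F ==> v \<in> B ==> B \<noteq> A ==> B - {v} = A ==> fc B v (s B) = y"
 shows "fam (insert A F) (s(A := y))"
 unfolding fam_def
proof (intro ballI conjI impI)
 fix B assume B: "B \<in> insert A F"
 show "finite B" "B \<noteq> {}" "(s(A := y)) B \<in> K (card B - 1)"
  using B assms famD[OF assms(1), of B] by auto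
 fix v assume v: "2 \<le> card B" "v \<in> B"
 show "B - {v} \<in> insert A F"
  using B v assms(5) famD(4)[OF assms(1), of B v] by blast
 show "fc B v ((s(A := y)) B) = (s(A := y)) (B - {v})"
 proof (cases "B = A")
  case True
  then have "B - {v} \<noteq> A"
   using v by auto
  then show ?thesis
   using True v assms(5)[of v] by simp
 next
  case False
  then show ?thesis
   using B v assms(6)[of B v] famD(5)[OF assms(1), of B v] by auto
 qed
qed

text \<open>A family over a cone with apex \<open>a\<close> extends over the whole simplex: the missing faces come in
 pairs \<open>B\<close>, \<open>insert a B\<close>, and filling in order of size only ever uses horns.\<close>

lemma fam_extend:
 assumes "finite V" "fam F s" "F \<subseteq> Pow V" "\<And>v. v \<in> V ==> {v} \<in> F" "a \<in> V"
  and "\<And>B. B \<in> F ==> insert a B \<in> F"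
 shows "\<exists>s'. fam (Pow V - {{}}) s' \<and> (\<forall>B\<in>F. s' B = s B)"
 using assms(2-6)
proof (induction "card (Pow V - {{}} - F)" arbitrary: F s rule: less_induct)
 case less
 show ?case
 proof (cases "F = Pow V - {{}}")
  case True
  then show ?thesis
   using less.prems(1) by blast
 next
  case False
  define M where "M = {B \<in> Pow V - {{}} - F. a \<notin> B}"
  have FV: "F \<subseteq> Pow V - {{}}"
   using less.prems(1,2) famD(2) by fastforce
  then obtain C where C: "C \<subseteq> V" "C \<noteq> {}" "C \<notin> F"
   using False by blast
  have "C - {a} \<in> M"
  proof -
   have "C - {a} \<noteq> {}"
    using C less.prems(3)[of a] less.prems(4) by (metis Diff_eq_empty_iff subset_singletonD)
   moreover have "C - {a} \<notin> F"
   proof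
    assume *: "C - {a} \<in> F"
    then have "insert a (C - {a}) \<in> F"
     using less.prems(5) by blast
    then show False
     using C * by (metis Diff_empty Diff_insert0 insert_Diff)
   qed
   ultimately show ?thesis
    using C by (auto simp: M_def)
  qed
  then obtain B where B: "B \<in> M" "\<And>B'. B' \<in> M ==> card B \<le> card B'"
   using arg_min_nat_lemma[of "\<lambda>x. x \<in> M" _ card] by blast
  have BV: "B \<subseteq> V" "B \<noteq> {}" "B \<notin> F" "a \<notin> B" "finite B"
   using B(1) assms(1) by (auto simp: M_def intro: finite_subset)
  have card2: "2 \<le> card B"
  proof (rule ccontr)
   assume "\<not> 2 \<le> card B"
   then have "card B = 1"
    using BV by (metis One_nat_def card_0_eq less_2_cases not_le)
   then show False
    using BV less.prems(3) by (auto simp: card_1_singleton_iff)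
  qed
  have proper: "B - {b} \<in> F" if "b \<in> B" for b
  proof (rule ccontr)
   assume "B - {b} \<notin> F"
   moreover have "B - {b} \<noteq> {}"
    using card2 that BV card_Diff_singleton[of b B] by force
   ultimately have "B - {b} \<in> M"
    using BV by (auto simp: M_def)
   then show False
    using B(2)[of "B - {b}"] that BV by (metis card_Diff1_less not_le)
  qed
  let ?A = "insert a B"
  have finA: "finite ?A" and cardA: "card ?A = Suc (card B)"
   using BV by auto
  have eqA: "?A - {b} = insert a (B - {b})" if "b \<in> B" for b
   using that BV by auto
  have inA: "?A - {b} \<in> F" if "b \<in> B" for b
   using less.prems(5)[OF proper[OF that]] eqA[OF that] by simp
  have "\<exists>t\<in>K (card ?A - 1). \<forall>b\<in>?A. b \<noteq> a --> fc ?A b t = s (?A - {b})"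
  proof (rule horn_lab[OF finA])
   show "3 \<le> card ?A" "a \<in> ?A"
    using cardA card2 by auto
   show "s (?A - {b}) \<in> K (card ?A - 2)" if "b \<in> ?A" "b \<noteq> a" for b
    using famD(3)[OF less.prems(1) inA[of b]] that cardA finA by (simp add: numeral_2_eq_2)
   show "fc (?A - {b}) c (s (?A - {b})) = fc (?A - {c}) b (s (?A - {c}))"
    if "b \<in> ?A" "c \<in> ?A" "b \<noteq> a" "c \<noteq> a" "b \<noteq> c" for b c
   proof -
    have "2 \<le> card (?A - {b})" "2 \<le> card (?A - {c})"
     using that cardA card2 finA by auto
    then have "fc (?A - {b}) c (s (?A - {b})) = s (?A - {b} - {c})"
     "fc (?A - {c}) b (s (?A - {c})) = s (?A - {c} - {b})"
     using famD(5)[OF less.prems(1) inA[of b], of c] famD(5)[OF less.prems(1) inA[of c], of b] that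
     by auto
    moreover have "?A - {b} - {c} = ?A - {c} - {b}"
     by auto
    ultimately show ?thesis
     by simp
   qed
  qed
  then obtain t where t: "t \<in> K (card ?A - 1)"
   "\<And>b. b \<in> B ==> fc ?A b t = s (?A - {b})"
   using BV(4) by fastforce
  have noB: "X - {v} \<noteq> B" if "X \<in> F" "v \<in> X" for X v
  proof
   assume *: "X - {v} = B"
   have "card (X - {v}) \<le> card X"
    by (rule card_mono[OF famD(1)[OF less.prems(1) that(1)]]) blast
   then have "2 \<le> card X"
    using card2 by (simp only: *)
   then show False
    using famD(4)[OF less.prems(1) that(1) _ that(2)] BV(3) unfolding * by blast
  qed
  have noA: "X - {v} \<noteq> ?A" if "X \<in> F" "v \<in> X" for X v
  proof
   assume *: "X - {v} = ?A"
   have X: "2 \<le> card X"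
   proof -
    have "card (X - {v}) \<le> card X"
     by (rule card_mono[OF famD(1)[OF less.prems(1) that(1)]]) blast
    then show ?thesis
     using card2 cardA by (simp only: *)
   qed
   have "?A \<in> F"
    using famD(4)[OF less.prems(1) that(1) X that(2)] by (simp only: *)
   then have "?A - {a} \<in> F"
    using famD(4)[OF less.prems(1), of ?A a] cardA card2 by simp
   then show False
    using BV by simp
  qed
  have AF: "?A \<notin> F"
   using famD(4)[OF less.prems(1), of ?A a] cardA card2 BV by auto
  define y where "y = fc ?A a t"
  have yK: "y \<in> K (card B - 1)"
   using fc_in[OF finA _ _ t(1), of a] cardA card2 BV by (simp add: y_def)
  have yf: "fc B v y = s (B - {v})" if "v \<in> B" for v
  proof -
   have "fc (?A - {a}) v (fc ?A a t) = fc (?A - {v}) a (fc ?A v t)"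
    using that finA cardA card2 t(1) BV by (intro fc_comm) auto
   also have "\<dots> = s (?A - {v} - {a})"
    using famD(5)[OF less.prems(1) inA[OF that], of a] that t(2) cardA card2 finA BV by auto
   also have "?A - {v} - {a} = B - {v}"
    using BV by auto
   finally show ?thesis
    using BV by (simp add: y_def)
  qed
  have f1: "fam (insert B F) (s(B := y))"
   using less.prems(1) BV yK proper yf noB by (intro fam_upd) auto
  have f2: "fam (insert ?A (insert B F)) ((s(B := y))(?A := t))"
  proof (rule fam_upd[OF f1 finA _ t(1)])
   show "insert a B \<noteq> {}" by simp
   show "?A - {v} \<in> insert B F \<and> fc ?A v t = (s(B := y)) (?A - {v})" if "v \<in> ?A" for v
   proof (cases "v = a")
    case True
    then show ?thesis
     using BV by (simp add: y_def)
   next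
    case False
    then have "?A - {v} \<noteq> B"
     using BV by auto
    then show ?thesis
     using False that inA t(2) by auto
   qed
   show "fc X v ((s(B := y)) X) = t"
    if "X \<in> insert B F" "v \<in> X" "X \<noteq> ?A" "X - {v} = ?A" for X v
    using that noA BV by auto
  qed
  let ?F = "insert ?A (insert B F)"
  have "card (Pow V - {{}} - ?F) < card (Pow V - {{}} - F)"
   using BV assms(1) by (intro psubset_card_mono) auto
  moreover have "?F \<subseteq> Pow V" "\<And>v. v \<in> V ==> {v} \<in> ?F" "\<And>X. X \<in> ?F ==> insert a X \<in> ?F"
   using less.prems BV by auto
  ultimately obtain s' where "fam (Pow V - {{}}) s'" "\<forall>X\<in>?F. s' X = ((s(B := y))(?A := t)) X"
   using less.hyps[of ?F "(s(B := y))(?A := t)"] f2 less.prems(4) by blast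
  then have "fam (Pow V - {{}}) s'" "\<forall>X\<in>F. s' X = s X"
   using BV AF by auto
  then show ?thesis
   by blast
 qed
qed

end

lemma Diff_singleton_nonempty:
 assumes "2 \<le> card B"
 shows "B - {v} \<noteq> {}"
proof
 assume "B - {v} = {}"
 then have "B \<subseteq> {v}"
  by blast
 then show False
  using card_mono[of "{v}" B] assms by simp
qed

section \<open>Faces spanned by subsets of the vertices, and gluing of simplices\<close>

context kan begin

function sub :: "nat set => 's => nat set => 's" where
 "sub Z t B = (if finite Z \<and> B \<subset> Z then sub (Z - {Max (Z - B)}) (fc Z (Max (Z - B)) t) B else t)"
 by auto
termination
proof (relation "Wellfounded.measure (\<lambda>(Z, t, B). card Z)", goal_cases)
 case (2 Z t B)
 then have "Max (Z - B) \<in> Z - B"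
  by (intro Max_in) auto
 then show ?case
  using 2 card_Diff1_less[of Z "Max (Z - B)"] by auto
qed simp

declare sub.simps[simp del]

lemma sub_self [simp]: "sub Z t Z = t"
 by (subst sub.simps) simp

text \<open>The deletion of \<open>w\<close> is moved to the front by induction on the number of
  vertices still to be deleted, and then past the deletion of the maximum by
  \<open>fc_comm\<close>.\<close>

lemma sub_remove:
 assumes "finite Z" "B \<subseteq> Z" "B \<noteq> {}" "w \<in> Z - B" "t \<in> K (card Z - 1)"
 shows "sub Z t B = sub (Z - {w}) (fc Z w t) B"
 using assms
proof (induction "card (Z - B)" arbitrary: Z t w rule: less_induct)
 case less
 define v where "v = Max (Z - B)"
 have v: "v \<in> Z - B"
  unfolding v_def using less.prems by (intro Max_in) auto
 have eq: "sub Z t B = sub (Z - {v}) (fc Z v t) B"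
  using less.prems by (subst sub.simps) (auto simp: v_def)
 show ?case
 proof (cases "w = v")
  case False
  have "B \<subseteq> Z - {v} - {w}"
   using less.prems v by auto
  then have "card B \<le> card (Z - {v} - {w})"
   using less.prems by (intro card_mono) auto
  moreover have "card (Z - {v} - {w}) = card Z - 2"
   using less.prems v False by (simp add: numeral_2_eq_2)
  moreover have "card B > 0"
   using less.prems by (metis card_gt_0_iff finite_subset)
  ultimately have c3: "3 \<le> card Z"
   by simp
  have "card (Z - {v} - B) < card (Z - B)"
   using less.prems v by (intro psubset_card_mono) auto
  then have "sub (Z - {v}) (fc Z v t) B = sub (Z - {v} - {w}) (fc (Z - {v}) w (fc Z v t)) B"
   using less.prems v False c3 fc_in[of Z v t] by (intro less.hyps) auto
  also have "\<dots> = sub (Z - {w} - {v}) (fc (Z - {w}) v (fc Z w t)) B"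
  proof -
   have "Z - {v} - {w} = Z - {w} - {v}"
    by auto
   moreover have "fc (Z - {v}) w (fc Z v t) = fc (Z - {w}) v (fc Z w t)"
    using less.prems v False c3 by (intro fc_comm) auto
   ultimately show ?thesis
    by simp
  qed
  also have "\<dots> = sub (Z - {w}) (fc Z w t) B"
  proof -
   have "Max (Z - {w} - B) = v"
    unfolding v_def using less.prems v False
    by (intro Max_eqI) (auto simp: v_def)
   moreover have "finite (Z - {w})" "B \<subset> Z - {w}"
    using less.prems v False by blast+
   ultimately show ?thesis
    using sub.simps[of "Z - {w}" "fc Z w t" B] by (simp only: if_True simp_thms)
  qed
  finally show ?thesis
   using eq by simp
 qed (use eq in simp)
qed

lemma sub_in:
 assumes "finite Z" "B \<subseteq> Z" "B \<noteq> {}" "t \<in> K (card Z - 1)"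
 shows "sub Z t B \<in> K (card B - 1)"
 using assms
proof (induction "card (Z - B)" arbitrary: Z t rule: less_induct)
 case less
 show ?case
 proof (cases "B = Z")
  case False
  then obtain w where w: "w \<in> Z - B"
   using less.prems by blast
  have "B \<subseteq> Z - {w}" "card B > 0"
   using less.prems w by (auto simp: card_gt_0_iff intro: finite_subset)
  then have "2 \<le> card Z"
   using card_mono[of "Z - {w}" B] less.prems w by (simp add: card_Diff_singleton)
  moreover have "card (Z - {w} - B) < card (Z - B)"
   using less.prems w by (intro psubset_card_mono) auto
  ultimately show ?thesis
   using less.prems w sub_remove[of Z B w t] fc_in[of Z w t] less.hyps[of "Z - {w}" "fc Z w t"] by auto
 qed (use less in simp)
qed

lemma fc_sub:
 assumes "finite Z" "B \<subseteq> Z" "v \<in> B" "2 \<le> card B" "t \<in> K (card Z - 1)"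
 shows "fc B v (sub Z t B) = sub Z t (B - {v})"
 using assms
proof (induction "card (Z - B)" arbitrary: Z t rule: less_induct)
 case less
 have ne: "B - {v} \<noteq> {}"
  using less.prems by (intro Diff_singleton_nonempty)
 show ?case
 proof (cases "B = Z")
  case True
  then show ?thesis
   using less.prems ne sub_remove[of Z "Z - {v}" v t] by auto
 next
  case False
  then obtain w where w: "w \<in> Z - B"
   using less.prems by blast
  have "card B \<le> card Z"
   using less.prems by (intro card_mono) auto
  moreover have "card (Z - {w} - B) < card (Z - B)"
   using less.prems w by (intro psubset_card_mono) auto
  moreover have "B \<noteq> {}" "B - {v} \<subseteq> Z" "w \<in> Z - (B - {v})" "B \<subseteq> Z - {w}"
   using less.prems w by auto
  moreover have "fc Z w t \<in> K (card (Z - {w}) - 1)"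
   using less.prems w \<open>card B \<le> card Z\<close> by (intro fc_in) auto
  ultimately have "fc B v (sub (Z - {w}) (fc Z w t) B) = sub (Z - {w}) (fc Z w t) (B - {v})"
   "sub Z t B = sub (Z - {w}) (fc Z w t) B" "sub Z t (B - {v}) = sub (Z - {w}) (fc Z w t) (B - {v})"
   using less.prems w ne sub_remove[of Z B w t] sub_remove[of Z "B - {v}" w t]
    less.hyps[of "Z - {w}" "fc Z w t"] by simp_all
  then show ?thesis
   by simp
 qed
qed

lemma sub_Diff: 
 assumes "finite Z" "v \<in> Z" "2 \<le> card Z" "t \<in> K (card Z - 1)"
 shows "sub Z t (Z - {v}) = fc Z v t"
 using fc_sub[of Z Z v t] assms by simp

lemma fam_sub:
 assumes "finite Z" "t \<in> K (card Z - 1)"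
 shows "fam (Pow Z - {{}}) (sub Z t)"
 unfolding fam_def
proof (intro ballI conjI impI)
 fix B assume B: "B \<in> Pow Z - {{}}"
 show "finite B" "B \<noteq> {}" "sub Z t B \<in> K (card B - 1)"
  using B assms sub_in[of Z B t] by (auto intro: finite_subset)
 fix v assume v: "2 \<le> card B" "v \<in> B"
 show "B - {v} \<in> Pow Z - {{}}"
  using B Diff_singleton_nonempty[OF v(1), of v] by blast
 show "fc B v (sub Z t B) = sub Z t (B - {v})"
  using B v assms by (intro fc_sub) auto
qed

text \<open>In a family a simplex determines all its faces, so two families need to be compared on
  maximal simplices only.\<close>

lemma fam_eq_sub:
 assumes "fam F s" "Z \<in> F" "B \<subseteq> Z" "B \<noteq> {}"
 shows "s B = sub Z (s Z) B"
 using assms(2,3)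
proof (induction "card (Z - B)" arbitrary: Z rule: less_induct)
 case less
 show ?case
 proof (cases "B = Z")
  case False
  have fin: "finite Z"
   using famD(1)[OF assms(1)] less.prems by blast
  obtain w where w: "w \<in> Z - B"
   using False less.prems by blast
  have "B \<subseteq> Z - {w}" "card B > 0"
   using less.prems w assms(4) fin by (auto simp: card_gt_0_iff intro: finite_subset)
  then have c2: "2 \<le> card Z"
   using card_mono[of "Z - {w}" B] fin w by (simp add: card_Diff_singleton)
  have "card (Z - {w} - B) < card (Z - B)"
   using fin w by (intro psubset_card_mono) auto
  then have "s B = sub (Z - {w}) (s (Z - {w})) B"
   using less.prems w famD(4)[OF assms(1) less.prems(1) c2] by (intro less.hyps) auto
  moreover have "s (Z - {w}) = fc Z w (s Z)"
   using famD(5)[OF assms(1) less.prems(1) c2, of w] w by simp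
  ultimately show ?thesis
   using sub_remove[OF fin less.prems(2) assms(4) w famD(3)[OF assms(1) less.prems(1)]] by simp
 qed simp
qed

lemma fam_fam_eq:
 assumes "fam F s" "Z \<in> F" "fam G s'" "Z \<in> G" "s Z = s' Z" "B \<subseteq> Z" "B \<noteq> {}"
 shows "s B = s' B"
 using fam_eq_sub[OF assms(1,2)] fam_eq_sub[OF assms(3,4)] assms(5-7) by simp

text \<open>The faces of the three simplices form a complex in which \<open>b\<close> can be joined
  to every face, so \<open>fam_extend\<close> with apex \<open>b\<close> supplies the simplex on the
  union. Agreement on pairwise intersections is what makes the union of the three a family.\<close>

lemma glue3:
 assumes fin: "finite P" "finite Q" "finite R"
  and t: "t \<in> K (card P - 1)" "u \<in> K (card Q - 1)" "w \<in> K (card R - 1)"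
  and b: "b \<in> P" "b \<in> Q" "b \<in> R"
  and eq: "sub P t (P \<inter> Q) = sub Q u (P \<inter> Q)" "sub P t (P \<inter> R) = sub R w (P \<inter> R)"
   "sub Q u (Q \<inter> R) = sub R w (Q \<inter> R)"
 shows "\<exists>s. fam (Pow (P \<union> Q \<union> R) - {{}}) s \<and> s P = t \<and> s Q = u \<and> s R = w"
proof -
 define s where "s B = (if B \<subseteq> P then sub P t B else if B \<subseteq> Q then sub Q u B else sub R w B)" for B
 define F where "F = (Pow P \<union> Pow Q \<union> Pow R) - {{}}"
 have *: "sub P t B = sub Q u B"
  if "finite P" "finite Q" "t \<in> K (card P - 1)" "u \<in> K (card Q - 1)" "b \<in> P" "b \<in> Q"
   "sub P t (P \<inter> Q) = sub Q u (P \<inter> Q)" "B \<subseteq> P" "B \<subseteq> Q" "B \<noteq> {}" for P Q t u b B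
 proof -
  have "sub P t B = sub (P \<inter> Q) (sub P t (P \<inter> Q)) B" "sub Q u B = sub (P \<inter> Q) (sub Q u (P \<inter> Q)) B"
   using fam_eq_sub[OF fam_sub[of P t], of "P \<inter> Q" B] fam_eq_sub[OF fam_sub[of Q u], of "P \<inter> Q" B] that
   by blast+
  then show ?thesis
   using that by simp
 qed
 have sP: "s B = sub P t B" if "B \<subseteq> P" for B
  using that by (simp add: s_def)
 have sQ: "s B = sub Q u B" if "B \<subseteq> Q" "B \<noteq> {}" for B
  using that *[of P Q t u b B] assms by (simp add: s_def)
 have sR: "s B = sub R w B" if "B \<subseteq> R" "B \<noteq> {}" for B
  using that *[of P R t w b B] *[of Q R u w b B] assms by (simp add: s_def)
 have "fam F s"
  unfolding fam_def
 proof
  fix B assume "B \<in> F"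
  then consider "B \<in> Pow P - {{}}" | "B \<in> Pow Q - {{}}" | "B \<in> Pow R - {{}}"
   by (auto simp: F_def)
  then show "finite B \<and> B \<noteq> {} \<and> s B \<in> K (card B - 1) \<and>
   (2 \<le> card B --> (\<forall>v\<in>B. B - {v} \<in> F \<and> fc B v (s B) = s (B - {v})))"
  proof cases
   case 1
   have f: "fam (Pow P - {{}}) s"
    using fam_sub[OF fin(1) t(1)] by (rule fam_cong) (simp add: sP)
   show ?thesis
    using famD[OF f 1] by (auto simp: F_def)
  next
   case 2
   have f: "fam (Pow Q - {{}}) s"
    using fam_sub[OF fin(2) t(2)] by (rule fam_cong) (simp add: sQ)
   show ?thesis
    using famD[OF f 2] by (auto simp: F_def)
  next
   case 3
   have f: "fam (Pow R - {{}}) s"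
    using fam_sub[OF fin(3) t(3)] by (rule fam_cong) (simp add: sR)
   show ?thesis
    using famD[OF f 3] by (auto simp: F_def)
  qed
 qed
 moreover have "F \<subseteq> Pow (P \<union> Q \<union> R)" "\<And>v. v \<in> P \<union> Q \<union> R ==> {v} \<in> F" "b \<in> P \<union> Q \<union> R"
  "\<And>B. B \<in> F ==> insert b B \<in> F"
  using b by (auto simp: F_def)
 ultimately obtain s' where s': "fam (Pow (P \<union> Q \<union> R) - {{}}) s'" "\<forall>B\<in>F. s' B = s B"
  using fam_extend[of "P \<union> Q \<union> R" F s b] fin by auto
 moreover have "s' P = t" "s' Q = u" "s' R = w"
  using s'(2) sP[of P] sQ[of Q] sR[of R] b by (auto simp: F_def)
 ultimately show ?thesis
  by blast
qed

lemma glue2: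
 assumes "finite P" "finite Q" "t \<in> K (card P - 1)" "u \<in> K (card Q - 1)" "b \<in> P" "b \<in> Q"
  and "sub P t (P \<inter> Q) = sub Q u (P \<inter> Q)"
 shows "\<exists>s. fam (Pow (P \<union> Q) - {{}}) s \<and> s P = t \<and> s Q = u"
 using glue3[of P Q Q t u u b] assms by auto

text \<open>The boundary of \<open>A\<close> prescribed by \<open>s\<close> bounds a simplex. The
  value \<open>s A\<close> does not enter.\<close>

definition fill :: "(nat set => 's) => nat set => bool" where
 "fill s A \<longleftrightarrow> (\<exists>t\<in>K (card A - 1). \<forall>v\<in>A. fc A v t = s (A - {v}))"

text \<open>Fillers of the other facets, together with all faces of codimension at least two, form a
  horn; the simplex filling it has the missing facet among its faces. In this form horns transfer
  solvability from all facets but one to the remaining one.\<close>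

lemma fill_last:
 assumes V: "finite V" "3 \<le> card V" "e \<in> V"
  and f: "fam {B. B \<subseteq> V \<and> B \<noteq> {} \<and> card B \<le> card V - 2} s"
  and fl: "\<And>b. b \<in> V ==> b \<noteq> e ==> fill s (V - {b})"
 shows "fill s (V - {e})"
proof -
 define F where "F = {B. B \<subseteq> V \<and> B \<noteq> {} \<and> card B \<le> card V - 2}"
 define G where "G = (\<lambda>b. V - {b}) ` (V - {e})"
 define g where "g b = (SOME t. t \<in> K (card (V - {b}) - 1) \<and> (\<forall>v\<in>V - {b}. fc (V - {b}) v t = s (V - {b} - {v})))" for b
 have g: "g b \<in> K (card (V - {b}) - 1)" "\<And>v. v \<in> V - {b} ==> fc (V - {b}) v (g b) = s (V - {b} - {v})"
  if "b \<in> V" "b \<noteq> e" for b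
  using someI_ex[of "\<lambda>t. t \<in> K (card (V - {b}) - 1) \<and> (\<forall>v\<in>V - {b}. fc (V - {b}) v t = s (V - {b} - {v}))"]
   fl[OF that] unfolding g_def fill_def by blast+
 define s' where "s' B = (if B \<in> G then g (the_elem (V - B)) else s B)" for B
 have cG: "card B = card V - 1" if "B \<in> G" for B
  using that V by (auto simp: G_def)
 have s'F: "s' B = s B" if "B \<in> F" for B
 proof -
  have "B \<notin> G"
  proof
   assume "B \<in> G"
   then have "card B = card V - 1"
    by (rule cG)
   moreover have "card B \<le> card V - 2"
    using that unfolding F_def by simp
   ultimately show False
    using V(2) by linarith
  qed
  then show ?thesis
   unfolding s'_def by simp
 qed
 have s'G: "s' (V - {b}) = g b" if "b \<in> V" "b \<noteq> e" for b
 proof -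
  have "V - (V - {b}) = {b}"
   using that by auto
  then show ?thesis
   using that by (auto simp: s'_def G_def)
 qed
 have "fam (F \<union> G) s'"
  unfolding fam_def
 proof
  fix B assume B: "B \<in> F \<union> G"
  show "finite B \<and> B \<noteq> {} \<and> s' B \<in> K (card B - 1) \<and>
   (2 \<le> card B --> (\<forall>v\<in>B. B - {v} \<in> F \<union> G \<and> fc B v (s' B) = s' (B - {v})))"
  proof (cases "B \<in> F")
   case True
   then show ?thesis
    using famD[OF f, of B] s'F by (auto simp flip: F_def)
  next
   case False
   then obtain b where b: "b \<in> V" "b \<noteq> e" "B = V - {b}"
    using B by (auto simp: G_def)
   have "B - {v} \<in> F" if "v \<in> B" for v
   proof -
    have "card (B - {v}) = card V - 2"
     using b that V by (simp add: numeral_2_eq_2)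
    moreover have "B - {v} \<noteq> {}"
     using b V by (intro Diff_singleton_nonempty) auto
    ultimately show ?thesis
     using b by (auto simp: F_def)
   qed
   then show ?thesis
    using b g[OF b(1,2)] s'G[OF b(1,2)] s'F V by auto
  qed
 qed
 moreover have "F \<union> G \<subseteq> Pow V"
  by (auto simp: F_def G_def)
 moreover have "{v} \<in> F \<union> G" if "v \<in> V" for v
  using that V by (auto simp: F_def)
 \<comment> \<open>Joining \<open>e\<close> to a set of size \<open>card V - 2\<close> that avoids
   \<open>e\<close> yields a facet containing \<open>e\<close>, and these are exactly the sets in
   \<open>G\<close>.\<close>
 moreover have "insert e B \<in> F \<union> G" if B: "B \<in> F \<union> G" for B
 proof (cases "B \<in> F")
  case True
  show ?thesis
  proof (cases "card (insert e B) \<le> card V - 2")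
   case True
   then show ?thesis
    using \<open>B \<in> F\<close> V by (auto simp: F_def)
  next
   case False
   have fB: "finite B"
    using \<open>B \<in> F\<close> V by (auto simp: F_def intro: finite_subset)
   then have "card (insert e B) = card V - 1"
    using \<open>B \<in> F\<close> False V by (unfold F_def card_insert_if, force)
   then have "card (V - insert e B) = 1"
    using \<open>B \<in> F\<close> V fB by (subst card_Diff_subset) (auto simp: F_def)
   then obtain b where b: "V - insert e B = {b}"
    by (auto simp: card_1_singleton_iff)
   then have "insert e B = V - {b}" "b \<in> V - {e}"
    using \<open>B \<in> F\<close> V by (auto simp: F_def)
   then show ?thesis
    by (auto simp: G_def)
  qed
 next
  case False
  then show ?thesis
   using B V by (auto simp: G_def insert_absorb)
 qed
 ultimately obtain s'' where s'': "fam (Pow V - {{}}) s''" "\<forall>B\<in>F \<union> G. s'' B = s' B"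
  using fam_extend[of V "F \<union> G" s' e] V by auto
 have c: "card (V - {e}) = card V - 1"
  using V by simp
 have ne: "V - {e} \<noteq> {}"
  using V by (intro Diff_singleton_nonempty) auto
 have "fc (V - {e}) v (s'' (V - {e})) = s (V - {e} - {v})" if "v \<in> V - {e}" for v
 proof -
  have "card (V - {e} - {v}) = card V - 2"
   using V that by (simp add: numeral_2_eq_2)
  moreover have "V - {e} - {v} \<noteq> {}"
   using V by (intro Diff_singleton_nonempty) auto
  ultimately have "V - {e} - {v} \<in> F"
   by (auto simp: F_def)
  then show ?thesis
   using famD(5)[OF s''(1), of "V - {e}" v] ne that V s''(2) s'F by auto
 qed
 moreover have "s'' (V - {e}) \<in> K (card (V - {e}) - 1)"
  using famD(3)[OF s''(1), of "V - {e}"] ne by auto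
 ultimately show ?thesis
  unfolding fill_def by blast
qed

end

section \<open>Simplices with equal boundary, and homotopy relative to the boundary\<close>

context kan begin

lemma card_neqD: "card X \<noteq> card Y ==> X \<noteq> Y"
 by auto

lemma fam_Pow_fc:
 assumes "fam (Pow V - {{}}) W" "B \<subseteq> V" "2 \<le> card B" "v \<in> B"
 shows "fc B v (W B) = W (B - {v})"
 using famD(5)[OF assms(1) _ assms(3,4)] assms(2,4) by blast

lemma fam_Pow_in:
 assumes "fam (Pow V - {{}}) W" "B \<subseteq> V" "B \<noteq> {}"
 shows "W B \<in> K (card B - 1)"
 using famD(3)[OF assms(1), of B] assms(2,3) by blast

definition par :: "nat => 's => 's => bool" where
 "par m x y \<longleftrightarrow> x \<in> K m \<and> y \<in> K m \<and> (\<forall>i\<le>m. d m i x = d m i y)"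

lemma par_refl: "x \<in> K m ==> par m x x"
 by (simp add: par_def)

lemma par_sym: "par m x y ==> par m y x"
 by (simp add: par_def)

lemma par_trans: "par m x y ==> par m y z ==> par m x z"
 by (simp add: par_def)

lemma par_fc:
 assumes "finite A" "card A = Suc m"
 shows "par m x y \<longleftrightarrow> x \<in> K m \<and> y \<in> K m \<and> (\<forall>b\<in>A. fc A b x = fc A b y)"
proof
 assume "par m x y"
 then show "x \<in> K m \<and> y \<in> K m \<and> (\<forall>b\<in>A. fc A b x = fc A b y)"
  using assms pos_less_card[OF assms(1)] by (auto simp: par_def fc_def less_Suc_eq_le)
next
 assume *: "x \<in> K m \<and> y \<in> K m \<and> (\<forall>b\<in>A. fc A b x = fc A b y)"
 have "d m i x = d m i y" if i: "i \<le> m" for i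
 proof -
  obtain b where "b \<in> A" "pos A b = i"
   using pos_surj[OF assms(1), of i] assms i by auto
  then show ?thesis
   using * assms by (auto simp: fc_def)
 qed
 then show "par m x y"
  using * by (simp add: par_def)
qed

text \<open>Every facet of the face opposite \<open>q\<close> also lies in the face opposite
  \<open>p\<close>, where the boundaries agree, or in a face on which \<open>D\<close> and
  \<open>D'\<close> coincide.\<close>

lemma par_face:
 assumes P: "finite P" "card P = Suc (Suc m)" "1 \<le> m" "p \<in> P" "q \<in> P" "p \<noteq> q"
  and D: "D \<in> K (Suc m)" "D' \<in> K (Suc m)"
  and eq: "\<And>b. b \<in> P ==> b \<noteq> p ==> b \<noteq> q ==> fc P b D = fc P b D'"
  and par: "par m (fc P p D) (fc P p D')"
 shows "par m (fc P q D) (fc P q D')"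
proof -
 have c: "card (P - {x}) = Suc m" "finite (P - {x})" if "x \<in> P" for x
  using P that by auto
 have K: "fc P x E \<in> K m" if "x \<in> P" "E \<in> K (Suc m)" for x E
  using fc_in[of P x E] P that by simp
 have "fc (P - {q}) b (fc P q D) = fc (P - {q}) b (fc P q D')" if b: "b \<in> P - {q}" for b
 proof -
  have 1: "fc (P - {q}) b (fc P q E) = fc (P - {b}) q (fc P b E)" if "E \<in> K (Suc m)" for E
   using P b that by (intro fc_comm) auto
  show ?thesis
  proof (cases "b = p")
   case True
   have "fc (P - {p}) q (fc P p D) = fc (P - {p}) q (fc P p D')"
    using par P(5,6) unfolding par_fc[OF c(2,1)[OF P(4)]] by simp
   then show ?thesis
    using 1 D True by simp
  next
   case False
   then show ?thesis
    using 1 D b eq[of b] by simp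
  qed
 qed
 then show ?thesis
  using K[OF P(5) D(1)] K[OF P(5) D(2)] unfolding par_fc[OF c(2,1)[OF P(5)]] by simp
qed

text \<open>Prescribe \<open>w\<close> opposite \<open>p\<close>, keep the other faces, leave the
  face opposite \<open>q\<close> open and fill this horn: the face opposite \<open>q\<close> absorbs
  the change.\<close>

lemma move:
 assumes Q: "finite Q" "card Q = Suc (Suc m)" "1 \<le> m" "p \<in> Q" "q \<in> Q" "p \<noteq> q"
  and E: "E \<in> K (Suc m)" "par m w (fc Q p E)"
 shows "\<exists>F\<in>K (Suc m). fc Q p F = w \<and> (\<forall>b\<in>Q. b \<noteq> p --> b \<noteq> q --> fc Q b F = fc Q b E)"
proof -
 define x where "x b = (if b = p then w else fc Q b E)" for b
 have "\<exists>t\<in>K (card Q - 1). \<forall>b\<in>Q. b \<noteq> q --> fc Q b t = x b"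
 proof (rule horn_lab)
  show "finite Q" "3 \<le> card Q" "q \<in> Q"
   using Q by auto
  show "x b \<in> K (card Q - 2)" if "b \<in> Q" "b \<noteq> q" for b
   using that Q E fc_in[of Q b E] by (auto simp: x_def par_def)
  have w: "fc (Q - {p}) c w = fc (Q - {p}) c (fc Q p E)" if "c \<in> Q" "c \<noteq> p" for c
   using E(2) par_fc[of "Q - {p}" m w "fc Q p E"] Q that by auto
  have cm: "fc (Q - {b}) c (fc Q b E) = fc (Q - {c}) b (fc Q c E)" if "b \<in> Q" "c \<in> Q" "b \<noteq> c" for b c
   using that Q E by (intro fc_comm) auto
  show "fc (Q - {b}) c (x b) = fc (Q - {c}) b (x c)"
   if "b \<in> Q" "c \<in> Q" "b \<noteq> q" "c \<noteq> q" "b \<noteq> c" for b c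
   using that w cm[of b c] by (auto simp: x_def)
 qed
 then obtain t where t: "t \<in> K (card Q - 1)" "\<forall>b\<in>Q. b \<noteq> q --> fc Q b t = x b"
  by blast
 show ?thesis
  by (rule bexI[of _ t]) (use t Q in \<open>auto simp: x_def\<close>)
qed

text \<open>Homotopy relative to the boundary, witnessed by two fillers of the same horn.\<close>

definition hom :: "nat => 's => 's => bool" where
 "hom m x y \<longleftrightarrow> (\<exists>t\<in>K (Suc m). \<exists>t'\<in>K (Suc m). \<exists>j\<le>Suc m. d (Suc m) j t = x \<and> d (Suc m) j t' = y \<and>
   (\<forall>i\<le>Suc m. i \<noteq> j --> d (Suc m) i t = d (Suc m) i t'))"

lemma homI:
 assumes "finite Z" "card Z = Suc (Suc m)" "v \<in> Z" "t \<in> K (Suc m)" "t' \<in> K (Suc m)"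
  and "\<And>w. w \<in> Z ==> w \<noteq> v ==> fc Z w t = fc Z w t'"
 shows "hom m (fc Z v t) (fc Z v t')"
proof -
 have "d (Suc m) i t = d (Suc m) i t'" if i: "i \<le> Suc m" "i \<noteq> pos Z v" for i
 proof -
  obtain b where "b \<in> Z" "pos Z b = i"
   using pos_surj[OF assms(1), of i] assms(2) i by auto
  then show ?thesis
   using assms(6)[of b] i assms(2) by (auto simp: fc_def)
 qed
 moreover have "pos Z v \<le> Suc m"
  using pos_less_card[OF assms(1,3)] assms(2) by simp
 ultimately show ?thesis
  unfolding hom_def using assms(2,4,5)
  by (intro bexI[of _ t] bexI[of _ t'] exI[of _ "pos Z v"]) (auto simp: fc_def)
qed

lemma hom_sym: "hom m x y ==> hom m y x"
 unfolding hom_def by (metis  )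

lemma hom_par:
 assumes "hom m x y" "1 \<le> m"
 shows "par m x y"
proof -
 obtain t t' j where t: "t\<in>K (Suc m)" "t'\<in>K (Suc m)" "j \<le> Suc m" "d (Suc m) j t = x" "d (Suc m) j t' = y"
  "\<And>i. i\<le>Suc m ==> i \<noteq> j ==> d (Suc m) i t = d (Suc m) i t'"
  using assms unfolding hom_def by blast
 let ?P = "{..Suc m}"
 have pos: "pos ?P i = i" if "i \<le> Suc m" for i
 proof -
  have "{b \<in> {..Suc m}. b < i} = {..<i}"
   using that by auto
  then show ?thesis by (simp add: pos_def)
 qed
 then have fc: "fc ?P i u = d (Suc m) i u" if "i \<le> Suc m" for i u
  using that by (simp add: fc_def)
 obtain p where p: "p \<le> Suc m" "p \<noteq> j"
  using that[of 0] that[of 1] by (cases "j = 0") auto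
 have "par m (fc ?P j t) (fc ?P j t')"
 proof (rule par_face[where p = p])
  show "par m (fc ?P p t) (fc ?P p t')"
   using t p face_in[of t m p] by (simp add: fc par_refl)
 qed (use t p assms in \<open>auto simp: fc\<close>)
 then show ?thesis
  using t by (simp add: fc)
qed

text \<open>The horn witnessing \<open>hom\<close> is open at some index \<open>j\<close> that is
  unrelated to \<open>l\<close>. Gluing \<open>r\<close> to the first filler along \<open>x\<close>,
  and exchanging that filler for the second one, carries the replacement from \<open>j\<close> to
  \<open>l\<close>. Transitivity of \<open>hom\<close> and the freedom to use it at any face rest on
  this.\<close>

lemma hom_replace_index:
 assumes m: "1 \<le> m" and h: "hom m x y" and r: "r \<in> K (Suc m)" "l \<le> Suc m" "d (Suc m) l r = x"
 shows "\<exists>r'\<in>K (Suc m). d (Suc m) l r' = y \<and> (\<forall>i\<le>Suc m. i \<noteq> l --> d (Suc m) i r' = d (Suc m) i r)"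
proof -
 obtain t t' j where t: "t\<in>K (Suc m)" "t'\<in>K (Suc m)" "j \<le> Suc m" "d (Suc m) j t = x" "d (Suc m) j t' = y"
  "\<And>i. i\<le>Suc m ==> i \<noteq> j ==> d (Suc m) i t = d (Suc m) i t'"
  using h unfolding hom_def by blast
 \<comment> \<open>The residues modulo 3 keep the two new vertices apart from each other and from
   \<open>A\<close>. Relative to \<open>A\<close>, the vertex \<open>v\<close> has position
   \<open>j\<close> and \<open>u\<close> has position \<open>l\<close>, so that both simplices carry
   their common face \<open>x\<close> on \<open>A\<close>.\<close>
 define A where "A = (\<lambda>i. 3 * i + 2) ` {..m}"
 define v where "v = 3 * j"
 define u where "u = 3 * l + 1"
 define P where "P = insert v A"
 define Q where "Q = insert u A"
 define V where "V = insert u P"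
 have A: "finite A" "card A = Suc m" "2 \<in> A" "A \<noteq> {}"
  by (auto simp: A_def card_image inj_on_def image_iff)
 have nin: "v \<notin> A" "u \<notin> A" "u \<noteq> v"
  unfolding A_def v_def u_def by (auto, presburger+)
 have P: "finite P" "card P = Suc (Suc m)" "P - {v} = A" "v \<in> P"
  and Q: "finite Q" "card Q = Suc (Suc m)" "Q - {u} = A" "u \<in> Q"
  using A nin by (auto simp: P_def Q_def)
 have V: "finite V" "V = P \<union> Q" "card V = Suc (Suc (Suc m))"
  using P Q nin by (auto simp: V_def P_def Q_def)
 have "{b \<in> P. b < v} = (\<lambda>i. 3 * i + 2) ` {..<j}"
  using t(3) by (auto simp: P_def A_def v_def)
 then have pv: "pos P v = j"
  by (simp add: pos_def card_image inj_on_def)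
 have "{b \<in> Q. b < u} = (\<lambda>i. 3 * i + 2) ` {..<l}"
  using r(2) by (auto simp: Q_def A_def u_def)
 then have pu: "pos Q u = l"
  by (simp add: pos_def card_image inj_on_def)
 have fcP: "fc P v t = x" "fc P v t' = y"
  using t P pv by (auto simp: fc_def)
 have fcP': "fc P b t = fc P b t'" if "b \<in> A" for b
 proof -
  have "b \<in> P" "b \<noteq> v"
   using that nin by (auto simp: P_def)
  then have "pos P b \<noteq> j" "pos P b \<le> Suc m"
   using pv pos_eq_iff[of P b v] pos_less_card[of P b] P by auto
  then show ?thesis
   using t(6) P by (simp add: fc_def)
 qed
 have fcQ: "fc Q u r = x"
  using r Q pu by (auto simp: fc_def)
 have PQ: "P \<inter> Q = A" 
  using nin by (auto simp: P_def Q_def)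
 have "\<exists>s. fam (Pow (P \<union> Q) - {{}}) s \<and> s P = t \<and> s Q = r"
 proof (rule glue2[where b = 2])
  have "sub P t A = x"
   using sub_Diff[of P v t] P t(1) fcP by simp
  moreover have "sub Q r A = x"
   using sub_Diff[of Q u r] Q r(1) fcQ by simp
  ultimately show "sub P t (P \<inter> Q) = sub Q r (P \<inter> Q)"
   by (simp add: PQ)
 qed (use P Q A t r in \<open>auto simp: P_def Q_def\<close>)
 then obtain W where W: "fam (Pow V - {{}}) W" "W P = t" "W Q = r"
  using V by auto
 have WA: "W A = x"
  using fam_Pow_fc[OF W(1), of P v] P V(2) W(2) fcP by simp
 have par: "par m x y"
  using hom_par[OF h m] .
 \<comment> \<open>The sets properly containing \<open>A\<close> are \<open>P\<close>,
   \<open>Q\<close> and \<open>V\<close>. Without them nothing prevents \<open>A\<close> from being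
   overwritten by the parallel simplex \<open>y\<close>.\<close>
 define F0 where "F0 = Pow V - {{}} - {V, Q, P}"
 have F0: "fam F0 W"
 proof (rule fam_subset[OF W(1)])
  show "F0 \<subseteq> Pow V - {{}}" by (auto simp: F0_def)
  show "B - {w} \<in> F0" if B: "B \<in> F0" "w \<in> B" "2 \<le> card B" for B w
  proof -
   have "B \<subset> V" "B \<noteq> P" "B \<noteq> Q"
    using B by (auto simp: F0_def)
   have "B - {w} \<noteq> P \<and> B - {w} \<noteq> Q \<and> B - {w} \<noteq> V"
   proof (intro conjI notI)
    have cB: "card (B - {w}) < Suc (Suc m)"
     using psubset_card_mono[OF V(1) \<open>B \<subset> V\<close>] B(2,3) V(3) by (simp add: card_Diff_singleton)
    show False if "B - {w} = P" using cB P by (simp add: that)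
    show False if "B - {w} = Q" using cB Q by (simp add: that)
    show False if "B - {w} = V" using cB V by (simp add: that)
   qed
   then show ?thesis
    using B Diff_singleton_nonempty[OF B(3), of w] by (auto simp: F0_def)
  qed
 qed
 have F1: "fam (insert A F0) (W(A := y))"
 proof (rule fam_upd[OF F0 A(1,4)])
  show "y \<in> K (card A - 1)"
   using par A by (simp add: par_def)
  show "A - {b} \<in> F0 \<and> fc A b y = W (A - {b})" if "b \<in> A" "2 \<le> card A" for b
  proof
   have "A - {b} \<noteq> V" "A - {b} \<noteq> P" "A - {b} \<noteq> Q"
    using nin by (auto simp: V_def P_def Q_def)
   then show "A - {b} \<in> F0"
    using Diff_singleton_nonempty[OF that(2), of b] by (auto simp: F0_def V_def P_def)
   have "fc A b y = fc A b x"
    using par that par_fc[OF A(1,2)] by auto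
   then show "fc A b y = W (A - {b})"
    using fam_Pow_fc[OF W(1), of A b] that WA V(2) by (auto simp: P_def)
  qed
  show "fc B b (W B) = y" if B: "B \<in> F0" "b \<in> B" "B \<noteq> A" "B - {b} = A" for B b
  proof -
   have "b \<in> {u, v}" "B = insert b A"
    using B by (auto simp: F0_def V_def P_def)
   then show ?thesis
    using B by (auto simp: F0_def P_def Q_def)
  qed
 qed
 have AF0: "insert A F0 = F0"
  using A nin by (auto simp: F0_def V_def P_def Q_def)
 have F2: "fam (insert P F0) ((W(A := y))(P := t'))"
 proof (rule fam_upd)
  show "fam F0 (W(A := y))" "finite P" "P \<noteq> {}" "t' \<in> K (card P - 1)"
   using F1 AF0 P t by auto
  show "P - {b} \<in> F0 \<and> fc P b t' = (W(A := y)) (P - {b})" if "b \<in> P" "2 \<le> card P" for b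
  proof (cases "b = v")
   case True
   then show ?thesis
    using P AF0 fcP by auto
  next
   case False
   then have b: "b \<in> A" "P - {b} \<noteq> A"
    using that nin by (auto simp: P_def)
   have "card (P - {b}) = Suc m"
    using P(1,2) that by simp
   then have "P - {b} \<noteq> P" "P - {b} \<noteq> Q" "P - {b} \<noteq> V"
    using P(2) Q(2) V(3) by (intro card_neqD, linarith)+
   moreover have "P - {b} \<noteq> {}"
    using Diff_singleton_nonempty[OF that(2)] .
   ultimately have "P - {b} \<in> F0"
    by (auto simp: F0_def V_def)
   moreover have "fc P b t' = W (P - {b})"
    using fam_Pow_fc[OF W(1), of P b] W(2) that V(2) fcP'[OF b(1)] by simp
   ultimately show ?thesis
    using b by simp
  qed
  show "fc B b ((W(A := y)) B) = t'" if B: "B \<in> F0" "b \<in> B" "B \<noteq> P" "B - {b} = P" for B b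
  proof -
   have "B = insert b P" "b \<in> V - P"
    using B by (auto simp: F0_def)
   then show ?thesis
    using B by (auto simp: F0_def V_def)
  qed
 qed
 \<comment> \<open>With \<open>P\<close> filled by \<open>t'\<close> only \<open>Q\<close> and
   \<open>V\<close> are missing, and the rest is a cone with apex \<open>v\<close>. The value
   obtained on \<open>Q\<close> is the required simplex.\<close>
 have "\<exists>s'. fam (Pow V - {{}}) s' \<and> (\<forall>B\<in>insert P F0. s' B = ((W(A := y))(P := t')) B)"
 proof (rule fam_extend[OF V(1) F2])
  show "insert P F0 \<subseteq> Pow V" "v \<in> V"
   by (auto simp: F0_def V_def P_def)
  show "{b} \<in> insert P F0" if "b \<in> V" for b
  proof -
   have "card {b} = 1"
    by simp
   then have "{b} \<noteq> P" "{b} \<noteq> Q" "{b} \<noteq> V"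
    using P(2) Q(2) V(3) by (intro card_neqD, linarith)+
   then show ?thesis
    using that by (auto simp: F0_def)
  qed
  show "insert v B \<in> insert P F0" if "B \<in> insert P F0" for B
  proof (cases "B = P \<or> v \<in> B")
   case True
   then show ?thesis
    using that P(4) by (auto simp: insert_absorb)
  next
   case False
   then have B: "B \<in> F0" "v \<notin> B" "B \<noteq> P"
    using that by auto
   have "insert v B \<noteq> V"
   proof
    assume "insert v B = V"
    then have "B = Q"
     using B(2) nin by (auto simp: V_def P_def Q_def)
    then show False
     using B by (simp add: F0_def)
   qed
   moreover have "insert v B \<noteq> Q"
    using nin by (auto simp: Q_def)
   ultimately show ?thesis
    using B by (auto simp: F0_def V_def P_def)
  qed
 qed
 then obtain s' where s': "fam (Pow V - {{}}) s'" "\<And>B. B\<in>insert P F0 ==> s' B = ((W(A := y))(P := t')) B"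
  by blast
 have AP: "A \<noteq> P"
  using nin by (auto simp: P_def)
 have sQ: "s' Q \<in> K (Suc m)"
  using fam_Pow_in[OF s'(1), of Q] V(2) Q(2,4) by auto
 have "fc Q b (s' Q) = (if b = u then y else fc Q b r)" if b: "b \<in> Q" for b
 proof -
  have "fc Q b (s' Q) = s' (Q - {b})"
   using fam_Pow_fc[OF s'(1), of Q b] V(2) Q(2) b by auto
  also have "\<dots> = (if b = u then y else fc Q b r)"
  proof (cases "b = u")
   case True
   then show ?thesis
    using s'(2)[of A] AF0 Q(3) AP by auto
  next
   case False
   have "card (Q - {b}) = Suc m"
    using Q(1,2) b by simp
   then have "Q - {b} \<noteq> P" "Q - {b} \<noteq> Q" "Q - {b} \<noteq> V"
    using P(2) Q(2) V(3) by (intro card_neqD, linarith)+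
   moreover have "Q - {b} \<noteq> {}"
    using Diff_singleton_nonempty[of Q b] Q(2) by simp
   ultimately have "Q - {b} \<in> F0"
    using V(2) by (auto simp: F0_def)
   moreover have "Q - {b} \<noteq> A"
    using False b nin by (auto simp: Q_def)
   ultimately have "s' (Q - {b}) = W (Q - {b})"
    using s'(2)[of "Q - {b}"] \<open>Q - {b} \<noteq> P\<close> by simp
   then show ?thesis
    using fam_Pow_fc[OF W(1), of Q b] V(2) Q(2) b W(3) False by auto
  qed
  finally show ?thesis .
 qed
 note fcQ' = this
 have "d (Suc m) i (s' Q) = (if i = l then y else d (Suc m) i r)" if i: "i \<le> Suc m" for i
 proof -
  obtain b where "b \<in> Q" "pos Q b = i"
   using pos_surj[OF Q(1), of i] Q i by auto
  then show ?thesis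
   using fcQ'[of b] pu pos_eq_iff[of Q b u] Q(1,2,4) by (auto simp: fc_def)
 qed
 then show ?thesis
  using sQ r(2) by (intro bexI[of _ "s' Q"]) auto
qed

end

context kan begin

lemma hom_replace:
 assumes Z: "finite Z" "card Z = Suc (Suc m)" "v \<in> Z" and m: "1 \<le> m"
  and h: "hom m x y" and r: "r \<in> K (Suc m)" "fc Z v r = x"
 shows "\<exists>r'\<in>K (Suc m). fc Z v r' = y \<and> (\<forall>w\<in>Z. w \<noteq> v --> fc Z w r' = fc Z w r)"
proof -
 have l: "pos Z v \<le> Suc m"
  using pos_less_card[OF Z(1,3)] Z by simp
 then obtain r' where r': "r' \<in> K (Suc m)" "d (Suc m) (pos Z v) r' = y"
  "\<And>i. i \<le> Suc m ==> i \<noteq> pos Z v ==> d (Suc m) i r' = d (Suc m) i r"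
  using hom_replace_index[OF m h r(1) l] r(2) Z(2) by (auto simp: fc_def)
 have "fc Z w r' = fc Z w r" if "w \<in> Z" "w \<noteq> v" for w
  using r'(3)[of "pos Z w"] that pos_less_card[OF Z(1), of w] pos_eq_iff[OF Z(1), of w v] Z
  by (simp add: fc_def)
 then show ?thesis
  using r' Z(2) by (intro bexI[of _ r']) (auto simp: fc_def)
qed

text \<open>In place of a degeneracy, the new vertex is attached by a second copy of an edge of
  \<open>x\<close>. The copied edge joins the least and the greatest vertex, so that one of its ends
  fits the order wherever \<open>v\<close> is inserted.\<close>

lemma extend_simplex:
 assumes A: "finite A" "card A = Suc m" "1 \<le> m" and x: "x \<in> K m" and v: "v \<notin> A"
 shows "\<exists>t\<in>K (Suc m). fc (insert v A) v t = x"
proof -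
 define a where "a = Min A"
 define b where "b = Max A"
 have ne: "A \<noteq> {}"
  using A by auto
 have ab: "a \<in> A" "b \<in> A"
  using A ne by (auto simp: a_def b_def)
 have "a < b"
 proof -
  have "a \<le> b"
   using ab A by (simp add: b_def)
  moreover have "a \<noteq> b"
  proof
   assume "a = b"
   then have "A \<subseteq> {a}"
    using A by (metis Max_ge Min_le a_def b_def order_antisym singletonI subsetI)
   then show False
    using card_mono[of "{a}" A] A by simp
  qed
  ultimately show ?thesis by simp
 qed
 define e where "e = sub A x {a, b}"
 have cab: "card {a, b} = 2"
  using \<open>a < b\<close> by simp
 have eK: "e \<in> K 1"
  using sub_in[of A "{a,b}" x] A x ab cab by (auto simp: e_def)
 have e_a: "d 1 1 e = sub A x {a}" "d 1 0 e = sub A x {b}"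
 proof -
  have "pos {a,b} b = 1" "pos {a,b} a = 0"
  proof -
   have "{x \<in> {a,b}. x < b} = {a}" "{x \<in> {a,b}. x < a} = {}"
    using \<open>a < b\<close> by auto
   then show "pos {a,b} b = 1" "pos {a,b} a = 0"
    by (simp_all add: pos_def)
  qed
  moreover have "fc {a,b} b e = sub A x ({a,b} - {b})" "fc {a,b} a e = sub A x ({a,b} - {a})"
   unfolding e_def using A x ab cab by (intro fc_sub; auto)+
  moreover have "{a,b} - {b} = {a}" "{a,b} - {a} = {b}"
   using \<open>a < b\<close> by auto
  ultimately show "d 1 1 e = sub A x {a}" "d 1 0 e = sub A x {b}"
   using cab by (simp_all add: fc_def)
 qed
 \<comment> \<open>The end of the copied edge that stays on \<open>x\<close>: its first vertex if
   \<open>v\<close> comes after \<open>a\<close>, its last vertex if \<open>v\<close> precedes all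
   of \<open>A\<close>.\<close>
 define c where "c = (if a < v then a else b)"
 have c: "c \<in> A" "c \<noteq> v"
  using ab v by (auto simp: c_def)
 have fcv: "sub {c, v} e {c} = sub A x {c}"
 proof -
  have "sub {c,v} e ({c,v} - {v}) = fc {c,v} v e"
   using c eK by (intro sub_Diff) auto
  moreover have "{c,v} - {v} = {c}"
   using c by auto
  moreover have "pos {c,v} v = (if a < v then 1 else 0)"
  proof -
   have "{x \<in> {c,v}. x < v} = (if a < v then {c} else {})"
    using \<open>a < b\<close> by (auto simp: c_def)
   then show ?thesis
    by (simp add: pos_def)
  qed
  ultimately show ?thesis
   using e_a c by (auto simp: fc_def c_def)
 qed
 have Acv: "A \<inter> {c, v} = {c}"
  using c v by auto
 have "\<exists>s. fam (Pow (A \<union> {c, v}) - {{}}) s \<and> s A = x \<and> s {c, v} = e"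
  by (rule glue2[where b = c], unfold Acv) (use A x c eK fcv in auto)
 then obtain s where s: "fam (Pow (A \<union> {c, v}) - {{}}) s" "s A = x"
  by blast
 have "A \<union> {c, v} = insert v A"
  using c by auto
 then have s': "fam (Pow (insert v A) - {{}}) s"
  using s by simp
 have "fc (insert v A) v (s (insert v A)) = s (insert v A - {v})"
  using A v by (intro fam_Pow_fc[OF s']) auto
 moreover have "insert v A - {v} = A"
  using v by auto
 ultimately have "fc (insert v A) v (s (insert v A)) = x"
  using s(2) by (simp only:)
 moreover have "s (insert v A) \<in> K (Suc m)"
  using fam_Pow_in[OF s', of "insert v A"] A v by simp
 ultimately show ?thesis
  by blast
qed

lemma hom_refl: "x \<in> K m ==> 1 \<le> m ==> hom m x x"
proof -
 assume x: "x \<in> K m" "1 \<le> m"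
 obtain t where t: "t \<in> K (Suc m)" "fc (insert (Suc m) {..m}) (Suc m) t = x"
  using extend_simplex[of "{..m}" m x "Suc m"] x by auto
 have "hom m (fc (insert (Suc m) {..m}) (Suc m) t) (fc (insert (Suc m) {..m}) (Suc m) t)"
  using t by (intro homI) auto
 then show ?thesis
  using t by simp
qed

lemma hom_trans:
 assumes "hom m x y" "hom m y z" "1 \<le> m"
 shows "hom m x z"
proof -
 obtain t t' j where t: "t\<in>K (Suc m)" "t'\<in>K (Suc m)" "j \<le> Suc m" "d (Suc m) j t = x" "d (Suc m) j t' = y"
  "\<And>i. i\<le>Suc m ==> i \<noteq> j ==> d (Suc m) i t = d (Suc m) i t'"
  using assms unfolding hom_def by blast
 obtain r where r: "r \<in> K (Suc m)" "d (Suc m) j r = z"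
  "\<And>i. i\<le>Suc m ==> i \<noteq> j ==> d (Suc m) i r = d (Suc m) i t'"
  using hom_replace_index[OF assms(3,2) t(2,3,5)] by blast
 show ?thesis
  unfolding hom_def using t r by (intro bexI[of _ t] bexI[of _ r] exI[of _ j]) auto
qed

text \<open>A chosen representative of the homotopy class replaces the quotient, so that classes of
  fillers remain simplices that can serve as faces.\<close>

definition rep :: "nat => 's => 's" where
 "rep m x = (SOME y. hom m x y)"

lemma hom_rep: "x \<in> K m ==> 1 \<le> m ==> hom m x (rep m x)"
 unfolding rep_def by (rule someI) (rule hom_refl)

lemma rep_eq:
 assumes "hom m x y" "1 \<le> m"
 shows "rep m x = rep m y"
proof -
 have "hom m x z \<longleftrightarrow> hom m y z" for z
  using hom_trans[OF assms(1) _ assms(2)] hom_trans[OF hom_sym[OF assms(1)] _ assms(2)] by blast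
 then show ?thesis
  by (simp add: rep_def)
qed

lemma rep_rep: "x \<in> K m ==> 1 \<le> m ==> rep m (rep m x) = rep m x"
 using rep_eq[OF hom_rep] by simp

lemma rep_par: "x \<in> K m ==> 1 \<le> m ==> par m x (rep m x)"
 using hom_par hom_rep by blast

lemma hom_in: "hom m x y ==> 1 \<le> m ==> x \<in> K m \<and> y \<in> K m"
 using hom_par by (auto simp: par_def)

text \<open>The four codimension-two faces opposite \<open>{a',e'}\<close>, \<open>{a,e'}\<close>, \<open>{a',e}\<close>, \<open>{a,e}\<close> of the simplex on
 \<open>V\<close> form a square of transports; changing the face opposite \<open>{a,a'}\<close> keeps it commutative.\<close>

lemma square:
 assumes V: "finite V" "card V = Suc (Suc (Suc m))" "1 \<le> m"
  and lab: "a \<in> V" "a' \<in> V" "e' \<in> V" "distinct [a, a', e']"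
  and W: "fam (Pow V - {{}}) W"
  and x: "par m x (W (V - {a', e'}))" and u: "par m u (W (V - {a, e'}))" and w: "par m w (W (V - {a, a'}))"
  and s_def: "s = W(V - {a', e'} := x, V - {a, e'} := u, V - {a, a'} := w)"
  and fP: "fill s (V - {e'})" and pq: "{p, q} = {a, a'}" and fQ: "fill s (V - {p})"
 shows "fill s (V - {q})"
proof (rule fill_last)
 have q: "q \<in> {a, a'}" "p \<in> {a, a'}"
  using pq by auto
 show "finite V" "3 \<le> card V" "q \<in> V"
  using V lab q by auto
 have c2: "card (V - {b, c}) = Suc m" if "b \<in> V" "c \<in> V" "b \<noteq> c" for b c
  using that V by (simp add: card_Diff_subset)
 have *: "fam {B. B \<subseteq> V \<and> B \<noteq> {} \<and> card B \<le> card V - 2} (r(V - {b, c} := y))"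
  if r: "fam {B. B \<subseteq> V \<and> B \<noteq> {} \<and> card B \<le> card V - 2} r"
   and bc: "b \<in> V" "c \<in> V" "b \<noteq> c" and y: "par m y (r (V - {b, c}))" for r b c y
 proof -
  let ?F = "{B. B \<subseteq> V \<and> B \<noteq> {} \<and> card B \<le> card V - 2}"
  have c: "card (V - {b, c}) = Suc m"
   using c2 bc by blast
  then have ne: "V - {b, c} \<noteq> {}"
   by force
  have inF: "V - {b, c} \<in> ?F"
   using c ne V by auto
  have "fam (insert (V - {b, c}) ?F) (r(V - {b, c} := y))"
  proof (rule fam_upd[OF r])
   show "finite (V - {b, c})" "V - {b, c} \<noteq> {}" "y \<in> K (card (V - {b, c}) - 1)"
    using V ne y c by (auto simp: par_def)
   show "V - {b, c} - {v} \<in> ?F \<and> fc (V - {b, c}) v y = r (V - {b, c} - {v})"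
    if "v \<in> V - {b, c}" "2 \<le> card (V - {b, c})" for v
    using famD(4,5)[OF r inF that(2,1)] y that par_fc[of "V - {b, c}" m y] c V by auto
   show "fc B v (r B) = y" if "B \<in> ?F" "v \<in> B" "B \<noteq> V - {b, c}" "B - {v} = V - {b, c}" for B v
   proof -
    have "finite B"
     using that V finite_subset by auto
    then have "card B = Suc (card (V - {b, c}))"
     using that by (metis card_Suc_Diff1)
    then show ?thesis
     using that c V by simp
   qed
  qed
  moreover have "insert (V - {b, c}) ?F = ?F"
   using inF by blast
  ultimately show ?thesis
   by simp
 qed
 have sub: "fam {B. B \<subseteq> V \<and> B \<noteq> {} \<and> card B \<le> card V - 2} W"
 proof (rule fam_subset[OF W])
  show "B - {v} \<in> {B. B \<subseteq> V \<and> B \<noteq> {} \<and> card B \<le> card V - 2}"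
   if B: "B \<in> {B. B \<subseteq> V \<and> B \<noteq> {} \<and> card B \<le> card V - 2}" "v \<in> B" "2 \<le> card B" for B v
   using B Diff_singleton_nonempty[OF B(3), of v] card_Diff1_le[of B v] by auto
 qed auto
 have ne: "V - {a, e'} \<noteq> V - {a', e'}" "V - {a, a'} \<noteq> V - {a', e'}" "V - {a, a'} \<noteq> V - {a, e'}"
  using lab by auto
 show "fam {B. B \<subseteq> V \<and> B \<noteq> {} \<and> card B \<le> card V - 2} s"
  unfolding s_def using lab x u w ne by (intro * sub) simp_all
 show "fill s (V - {b})" if b: "b \<in> V" "b \<noteq> q" for b
 proof (cases "b \<in> {a, a', e'}")
  case True
  then show ?thesis
   using b pq fP fQ by fastforce
 next
  case False
  \<comment> \<open>The three altered sets all contain a fourth vertex \<open>b\<close>, hence are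
    not faces of the facet opposite \<open>b\<close>, which is still filled by
    \<open>W\<close>.\<close>
  have "s (V - {b} - {v}) = W (V - {b} - {v})" if "v \<in> V - {b}" for v
  proof -
   have "b \<in> V - {a', e'}" "b \<in> V - {a, e'}" "b \<in> V - {a, a'}" "b \<notin> V - {b} - {v}"
    using False b by auto
   then have "V - {b} - {v} \<noteq> V - {a', e'}" "V - {b} - {v} \<noteq> V - {a, e'}" "V - {b} - {v} \<noteq> V - {a, a'}"
    by metis+
   then show ?thesis
    by (simp add: s_def)
  qed
  moreover have c: "card (V - {b}) = Suc (Suc m)"
   using b V by simp
  moreover have "fc (V - {b}) v (W (V - {b})) = W (V - {b} - {v})" if "v \<in> V - {b}" for v
   using that c by (intro fam_Pow_fc[OF W]) auto
  moreover have "W (V - {b}) \<in> K (card (V - {b}) - 1)"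
  proof (rule fam_Pow_in[OF W])
   show "V - {b} \<noteq> {}"
    using c by (intro card_neqD) simp
  qed blast
  ultimately show ?thesis
   unfolding fill_def by (intro bexI[of _ "W (V - {b})"] ballI) (simp_all only:)
 qed
qed

end

section \<open>Translations of fillers and their commutation\<close>

context kan begin

text \<open>Translation by the \<open>D\<close>s takes \<open>z\<close> to \<open>w\<close> and
  \<open>y\<close> to \<open>y2\<close>; translation by the \<open>E\<close>s takes \<open>z\<close>
  to \<open>y\<close>, and it is to be shown that it takes \<open>w\<close> to \<open>y2\<close>.
  Everything is placed in a simplex on \<open>A\<close> with the two new vertices \<open>a'\<close>
  and \<open>e'\<close>. Then \<open>square\<close> is applied once around \<open>D1\<close> and
  once around \<open>D2\<close>, and both applications share the wall \<open>R\<close> opposite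
  \<open>a\<close>.\<close>

lemma comm_lab:
 assumes A: "finite A" "card A = Suc m" "1 \<le> m"
  and lab: "a \<in> A" "e \<in> A" "a \<noteq> e" "a' \<notin> A" "e' \<notin> A" "a' \<noteq> e'"
  and P_def: "P = insert a' A" and Q_def: "Q = insert e' A"
  and D: "D1 \<in> K (Suc m)" "D2 \<in> K (Suc m)" "D3 \<in> K (Suc m)" "D4 \<in> K (Suc m)"
  and E: "E1 \<in> K (Suc m)" "E2 \<in> K (Suc m)"
  and D1: "fc P a' D1 = z" and D2: "fc P a' D2 = w" "fc P a D1 = fc P a D2"
  and E1: "fc Q e' E1 = z" and E2: "fc Q e' E2 = y"
  and E12: "\<And>b. b \<in> A ==> b \<noteq> a ==> fc Q b E1 = fc Q b E2"
  and D3: "fc P a' D3 = y" "\<And>b. b \<in> A ==> b \<noteq> a ==> fc P b D3 = fc P b D1"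
  and D4: "fc P a' D4 = y2" "fc P a D4 = fc P a D3" "\<And>b. b \<in> A ==> b \<noteq> a ==> fc P b D4 = fc P b D2"
  and par: "par m y z" "par m w z"
 shows "\<exists>F1\<in>K (Suc m). \<exists>F2\<in>K (Suc m). fc Q e' F1 = w \<and> fc Q e' F2 = y2 \<and> fc Q e F1 = fc Q e F2 \<and>
   (\<forall>b\<in>A. b \<noteq> e --> fc Q b F1 = fc Q b E1 \<and> fc Q b F2 = fc Q b E2)"
proof -
 define V where "V = P \<union> Q"
 define R where "R = V - {a}"
 have P: "finite P" "card P = Suc (Suc m)" and Q: "finite Q" "card Q = Suc (Suc m)"
  using A lab by (auto simp: P_def Q_def)
 have Veq: "V = insert a' (insert e' A)"
  by (auto simp: V_def P_def Q_def)
 have V: "finite V" "card V = Suc (Suc (Suc m))"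
  using A lab by (auto simp: Veq)
 have Vd: "V - {a', e'} = A" "V - {a, e'} = P - {a}" "V - {a, a'} = Q - {a}" "V - {e'} = P" "V - {a'} = Q"
  using lab by (auto simp: Veq P_def Q_def)
 have PA: "P - {a'} = A" and QA: "Q - {e'} = A"
  using lab by (auto simp: P_def Q_def)
 have inV: "a \<in> V" "a' \<in> V" "e' \<in> V" "distinct [a, a', e']"
  using lab by (auto simp: Veq)
 have R: "finite R" "card R = Suc (Suc m)" "R \<subseteq> V"
  using V inV by (auto simp: R_def)
 have inPQ: "a \<in> P" "a' \<in> P" "e' \<in> Q" "a \<in> Q" "e \<in> Q" "e \<in> P" "e \<in> R" "P \<subseteq> V" "Q \<subseteq> V"
  using lab by (auto simp: P_def Q_def R_def V_def)
 \<comment> \<open>\<open>F1\<close> is \<open>E1\<close> with \<open>z\<close> exchanged for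
   \<open>w\<close>; its face opposite \<open>e\<close> absorbs the change.\<close>
 have "\<exists>F1\<in>K (Suc m). fc Q e' F1 = w \<and> (\<forall>b\<in>Q. b \<noteq> e' --> b \<noteq> e --> fc Q b F1 = fc Q b E1)"
  using A lab E par E1 inPQ by (intro move[OF Q]) auto
 then obtain F1 where F1: "F1 \<in> K (Suc m)" "fc Q e' F1 = w"
  "\<And>b. b \<in> A ==> b \<noteq> e ==> fc Q b F1 = fc Q b E1"
  using lab by (force simp: Q_def)
 have PQ: "P \<inter> Q = A"
  using lab by (auto simp: P_def Q_def)
 have subP: "sub P X A = fc P a' X" "sub P X (P - {a}) = fc P a X" if "X \<in> K (Suc m)" for X
  using sub_Diff[of P a' X] sub_Diff[of P a X] P inPQ that by (simp_all add: PA)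
 have subQ: "sub Q X A = fc Q e' X" "sub Q X (Q - {a}) = fc Q a X" if "X \<in> K (Suc m)" for X
  using sub_Diff[of Q e' X] sub_Diff[of Q a X] Q inPQ that by (simp_all add: QA)
 have "\<exists>s. fam (Pow (P \<union> Q) - {{}}) s \<and> s P = D1 \<and> s Q = E1"
  by (rule glue2[where b = a], unfold PQ) (use P Q D E inPQ subP subQ D1 E1 in auto)
 then obtain W1 where W1: "fam (Pow V - {{}}) W1" "W1 P = D1" "W1 Q = E1"
  by (auto simp: V_def)
 have W1P: "W1 (P - {b}) = fc P b D1" if "b \<in> P" for b
  using fam_Pow_fc[OF W1(1), of P b] P that W1(2) inPQ by simp
 have W1Q: "W1 (Q - {b}) = fc Q b E1" if "b \<in> Q" for b
  using fam_Pow_fc[OF W1(1), of Q b] Q that W1(3) inPQ by simp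
 have W1R: "W1 R \<in> K (Suc m)"
  using fam_Pow_in[OF W1(1), of R] R inPQ by auto
 have W1R': "sub R (W1 R) B = W1 B" if "B \<subseteq> R" "B \<noteq> {}" for B
 proof -
  have "R \<in> Pow V - {{}}"
   using R(3) inPQ(7) by blast
  then show ?thesis
   using fam_eq_sub[OF W1(1) _ that] by simp
 qed
 have nP: "P - {a} \<subseteq> R" "P - {a} \<noteq> {}" "Q - {a} \<subseteq> R" "Q - {a} \<noteq> {}"
  using lab by (auto simp: R_def V_def P_def Q_def)
 \<comment> \<open>The second configuration is built around the same wall \<open>W1 R\<close> as the
   first one, now with \<open>D2\<close> and \<open>F1\<close> in place of \<open>D1\<close> and
   \<open>E1\<close>.\<close>
 have "\<exists>s. fam (Pow (P \<union> Q \<union> R) - {{}}) s \<and> s P = D2 \<and> s Q = F1 \<and> s R = W1 R"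
 proof (rule glue3[where b = e])
  have PR: "P \<inter> R = P - {a}" and QR: "Q \<inter> R = Q - {a}"
   by (auto simp: R_def V_def)
  show "sub P D2 (P \<inter> Q) = sub Q F1 (P \<inter> Q)"
   unfolding PQ using subP subQ D F1 D2 by simp
  show "sub P D2 (P \<inter> R) = sub R (W1 R) (P \<inter> R)"
   unfolding PR using subP D D2 W1R' nP W1P[of a] inPQ by simp
  show "sub Q F1 (Q \<inter> R) = sub R (W1 R) (Q \<inter> R)"
   unfolding QR using subQ F1 lab W1R' nP W1Q[of a] inPQ by simp
 qed (use P Q R D F1 W1R inPQ in auto)
 moreover have "P \<union> Q \<union> R = V"
  by (auto simp: V_def R_def)
 ultimately obtain W2 where W2: "fam (Pow V - {{}}) W2" "W2 P = D2" "W2 Q = F1" "W2 R = W1 R"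
  by auto
 have W2P: "W2 (P - {b}) = fc P b D2" if "b \<in> P" for b
  using fam_Pow_fc[OF W2(1), of P b] P that W2(2) inPQ by simp
 have W2Q: "W2 (Q - {b}) = fc Q b F1" if "b \<in> Q" for b
  using fam_Pow_fc[OF W2(1), of Q b] Q that W2(3) inPQ by simp
 have W2R: "W2 (R - {b}) = W1 (R - {b})" if "b \<in> R" for b
  using fam_Pow_fc[OF W2(1), of R b] fam_Pow_fc[OF W1(1), of R b] R that W2(4) by simp
 define u2 where "u2 = fc P a D3"
 define w2 where "w2 = fc Q a E2"
 have paru: "par m u2 (fc P a D1)"
  unfolding u2_def by (rule par_face[OF P A(3), of a' a]) (use lab D D1 D3 par in \<open>auto simp: P_def\<close>)
 have parw: "par m w2 (fc Q a E1)"
  unfolding w2_def by (rule par_face[OF Q A(3), of e' a]) (use lab E E1 E2 E12 par in \<open>auto simp: Q_def\<close>)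
 have pary: "par m y2 w"
 proof -
  have "par m (fc P a' D4) (fc P a' D2)"
   by (rule par_face[OF P A(3), of a a']) (use lab D D2 D4 paru in \<open>auto simp: P_def u2_def\<close>)
  then show ?thesis using D2 D4 by simp
 qed
 have nin: "a' \<notin> A" "a \<notin> P - {a}" "a' \<in> P - {a}" "e' \<notin> P" "e' \<in> Q - {a}" "a \<in> A" "a' \<notin> Q" "e' \<notin> A"
  using lab by (auto simp: P_def Q_def)
 have ne: "P - {a} \<noteq> A" "Q - {a} \<noteq> A" "Q - {a} \<noteq> P - {a}"
  using lab by (auto simp: P_def Q_def)
 have neP: "P - {b} \<noteq> A" "P - {b} \<noteq> P - {a}" "P - {b} \<noteq> Q - {a}" if "b \<in> A" "b \<noteq> a" for b
  using that lab by (auto simp: P_def Q_def)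
 have neQ: "Q - {b} \<noteq> A" "Q - {b} \<noteq> P - {a}" "Q - {b} \<noteq> Q - {a}" if "b \<in> A" "b \<noteq> a" for b
  using that lab by (auto simp: P_def Q_def)
 have neR: "R - {b} \<noteq> A" "R - {b} \<noteq> P - {a}" "R - {b} \<noteq> Q - {a}" if "b \<in> A" "b \<noteq> a" for b
  using that lab by (auto simp: P_def Q_def R_def V_def)
 have RR: "R - {a'} = Q - {a}" "R - {e'} = P - {a}" "R = insert a' (insert e' (A - {a}))"
  using lab by (auto simp: P_def Q_def R_def V_def)
 define s1 where "s1 = W1(A := y, P - {a} := u2, Q - {a} := w2)"
 have "fill s1 (V - {a})"
 proof (rule square[OF V A(3) inV W1(1), of y u2 w2 _ a'])
  show "par m y (W1 (V - {a', e'}))"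
   unfolding Vd using W1P[of a'] inPQ par D1 by (simp add: PA)
  show "par m u2 (W1 (V - {a, e'}))"
   unfolding Vd using W1P[of a] inPQ paru by simp
  show "par m w2 (W1 (V - {a, a'}))"
   unfolding Vd using W1Q[of a] inPQ parw by simp
  show "s1 = W1(V - {a', e'} := y, V - {a, e'} := u2, V - {a, a'} := w2)"
   unfolding Vd s1_def ..
  show "{a', a} = {a, a'}" by auto
  show "fill s1 (V - {e'})"
   unfolding Vd fill_def
  proof (intro bexI[of _ D3] ballI)
   fix v assume "v \<in> P"
   then consider "v = a'" | "v = a" | "v \<in> A" "v \<noteq> a"
    by (auto simp: P_def)
   then show "fc P v D3 = s1 (P - {v})"
   proof cases
    case 1 then show ?thesis using D3 ne by (simp add: PA s1_def)
   next
    case 2 then show ?thesis using ne by (simp add: s1_def u2_def)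
   next
    case 3 then show ?thesis using neP[OF 3] W1P[of v] D3(2)[OF 3] \<open>v \<in> P\<close> by (simp add: s1_def)
   qed
  qed (use D P in simp)
  show "fill s1 (V - {a'})"
   unfolding Vd fill_def
  proof (intro bexI[of _ E2] ballI)
   fix v assume "v \<in> Q"
   then consider "v = e'" | "v = a" | "v \<in> A" "v \<noteq> a"
    by (auto simp: Q_def)
   then show "fc Q v E2 = s1 (Q - {v})"
   proof cases
    case 1 then show ?thesis using E2 ne by (simp add: QA s1_def)
   next
    case 2 then show ?thesis using ne by (simp add: s1_def w2_def)
   next
    case 3 then show ?thesis using neQ[OF 3] W1Q[of v] E12[OF 3] \<open>v \<in> Q\<close> by (simp add: s1_def)
   qed
  qed (use E Q in simp)
 qed
 \<comment> \<open>\<open>G\<close> fills the wall \<open>R\<close> after its faces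
   \<open>P - {a}\<close> and \<open>Q - {a}\<close> have been changed. As \<open>a\<close> belongs
   to \<open>A\<close> but not to \<open>R\<close>, the value on \<open>A\<close> plays no part in
   it, and \<open>G\<close> can be reused in the second configuration.\<close>
 then obtain G where G: "G \<in> K (Suc m)" "\<And>v. v \<in> R ==> fc R v G = s1 (R - {v})"
  using R unfolding fill_def R_def by auto
 define s2 where "s2 = W2(A := y2, P - {a} := u2, Q - {a} := w2)"
 have "fill s2 (V - {a'})"
 proof (rule square[OF V A(3) inV W2(1), of y2 u2 w2 _ a])
  show "par m y2 (W2 (V - {a', e'}))"
   unfolding Vd using W2P[of a'] inPQ pary D2 by (simp add: PA)
  show "par m u2 (W2 (V - {a, e'}))"
   unfolding Vd using W2P[of a] inPQ paru D2 by simp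
  show "par m w2 (W2 (V - {a, a'}))"
   unfolding Vd using W2Q[of a] inPQ parw F1(3)[of a] lab by simp
  show "s2 = W2(V - {a', e'} := y2, V - {a, e'} := u2, V - {a, a'} := w2)"
   unfolding Vd s2_def ..
  show "{a, a'} = {a, a'}" by auto
  show "fill s2 (V - {e'})"
   unfolding Vd fill_def
  proof (intro bexI[of _ D4] ballI)
   fix v assume "v \<in> P"
   then consider "v = a'" | "v = a" | "v \<in> A" "v \<noteq> a"
    by (auto simp: P_def)
   then show "fc P v D4 = s2 (P - {v})"
   proof cases
    case 1 then show ?thesis using D4 ne by (simp add: PA s2_def)
   next
    case 2 then show ?thesis using ne D4 by (simp add: s2_def u2_def)
   next
    case 3 then show ?thesis using neP[OF 3] W2P[of v] D4(3)[OF 3] \<open>v \<in> P\<close> by (simp add: s2_def)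
   qed
  qed (use D P in simp)
  show "fill s2 (V - {a})"
   unfolding fill_def R_def[symmetric]
  proof (intro bexI[of _ G] ballI)
   fix v assume v: "v \<in> R"
   have "s1 (R - {v}) = s2 (R - {v})"
   proof -
    consider "v = a'" | "v = e'" | "v \<in> A" "v \<noteq> a"
     using v RR by auto
    then show ?thesis
    proof cases
     case 1 then show ?thesis using ne by (simp add: RR(1,2) s1_def s2_def)
    next
     case 2 then show ?thesis using ne by (simp add: RR(1,2) s1_def s2_def)
    next
     case 3 then show ?thesis using neR[OF 3] W2R[OF v] by (simp add: s1_def s2_def)
    qed
   qed
   then show "fc R v G = s2 (R - {v})"
    using G(2)[OF v] by simp
  qed (use G R in simp)
 qed
 then obtain F2 where F2: "F2 \<in> K (Suc m)" "\<And>v. v \<in> Q ==> fc Q v F2 = s2 (Q - {v})"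
  using Q unfolding fill_def Vd by auto
 have "fc Q e' F2 = y2"
  using F2(2)[of e'] inPQ ne by (simp add: QA s2_def)
 moreover have "fc Q e F1 = fc Q e F2"
  using F2(2)[of e] W2Q[of e] neQ[of e] inPQ lab by (simp add: s2_def)
 moreover have "fc Q b F2 = fc Q b E2" if "b \<in> A" "b \<noteq> e" for b
 proof (cases "b = a")
  case True
  then show ?thesis using F2(2)[of a] inPQ ne by (simp add: s2_def w2_def)
 next
  case False
  have "b \<in> Q"
   using that by (simp add: Q_def)
  then show ?thesis
   using F2(2)[of b] W2Q[of b] neQ[OF that(1) False] F1(3)[OF that] E12[OF that(1) False]
   by (simp add: s2_def)
 qed
 ultimately show ?thesis
  using F1 F2(1) by (intro bexI[of _ F1] bexI[of _ F2]) auto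
qed


definition agree :: "nat => nat => 's => 's => bool" where
 "agree m i D D' \<longleftrightarrow> (\<forall>k\<le>Suc m. k \<noteq> i --> k \<noteq> Suc i --> d (Suc m) k D' = d (Suc m) k D)"

text \<open>The filler \<open>z\<close> is carried from face \<open>i + 1\<close> to face
  \<open>i\<close> through a variant of \<open>D1\<close>, and back to face \<open>i + 1\<close>
  through a variant of \<open>D2\<close>. Up to homotopy this is the action on fillers of the
  homotopy class given by the difference of \<open>D1\<close> and \<open>D2\<close>.\<close>

definition lamrel :: "nat => nat => 's => 's => 's => 's => bool" where
 "lamrel m i D1 D2 z w \<longleftrightarrow> (\<exists>D1'\<in>K (Suc m). \<exists>D2'\<in>K (Suc m). agree m i D1 D1' \<and> agree m i D2 D2' \<and>
   d (Suc m) (Suc i) D1' = z \<and> d (Suc m) (Suc i) D2' = w \<and> d (Suc m) i D1' = d (Suc m) i D2')"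

definition ldata :: "nat => 's => nat => 's => 's => bool" where
 "ldata m x i D1 D2 \<longleftrightarrow> i \<le> m \<and> D1 \<in> K (Suc m) \<and> D2 \<in> K (Suc m) \<and>
   par m (d (Suc m) (Suc i) D1) x \<and> par m (d (Suc m) (Suc i) D2) x \<and>
   par m (d (Suc m) i D1) (d (Suc m) i D2)"

text \<open>The position of the vertex \<open>k\<close> of a simplex after a new vertex has been
  inserted directly behind the vertex \<open>i\<close>.\<close>

definition ix :: "nat => nat => nat" where
 "ix i k = (if k \<le> i then k else Suc k)"

text \<open>Apart from the faces \<open>e\<close> and \<open>e + 1\<close>, the two simplices may
  differ only opposite the vertex \<open>a\<close> of the translated simplex. One free face is
  enough for transitivity, and it leaves enough in common for commutation with translations along
  \<open>a\<close>.\<close>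

definition pdata :: "nat => 's => nat => nat => 's => 's => bool" where
 "pdata m x e a E1 E2 \<longleftrightarrow> ldata m x e E1 E2 \<and> a \<le> m \<and> a \<noteq> e \<and>
   (\<forall>k\<le>Suc m. k \<noteq> e --> k \<noteq> Suc e --> k \<noteq> ix e a --> d (Suc m) k E1 = d (Suc m) k E2)"

lemma pos_atMost: "i \<le> m ==> pos {..m} i = i"
proof -
 assume "i \<le> m"
 then have "{b \<in> {..m}. b < i} = {..<i}"
  by auto
 then show ?thesis by (simp add: pos_def)
qed

lemma fc_atMost: "i \<le> m ==> fc {..m} i x = d m i x"
 by (simp add: fc_def pos_atMost)

text \<open>Even labels leave room for a new vertex \<open>Suc (2 * i)\<close> immediately after the
  vertex \<open>2 * i\<close>, without renumbering the others.\<close>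

definition evs :: "nat => nat set" where
 "evs m = (\<lambda>i. 2 * i) ` {..m}"

lemma evs: "finite (evs m)" "card (evs m) = Suc m" "Suc (2 * i) \<notin> evs m" "2 * i \<in> evs m \<longleftrightarrow> i \<le> m"
 by (auto simp: evs_def card_image inj_on_def; presburger)+

lemma fc_evs:
 assumes "i \<le> m"
 shows "fc (insert (Suc (2 * i)) (evs m)) (Suc (2 * i)) x = d (Suc m) (Suc i) x"
  "k \<le> m ==> fc (insert (Suc (2 * i)) (evs m)) (2 * k) x = d (Suc m) (ix i k) x"
proof -
 let ?P = "insert (Suc (2 * i)) (evs m)"
 have c: "card ?P = Suc (Suc m)"
  by (simp add: evs)
 have "{b \<in> ?P. b < Suc (2 * i)} = (\<lambda>j. 2 * j) ` {..i}"
  using assms by (auto simp: evs_def)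
 then have "pos ?P (Suc (2 * i)) = Suc i"
  by (simp add: pos_def card_image inj_on_def)
 then show "fc ?P (Suc (2 * i)) x = d (Suc m) (Suc i) x"
  by (simp add: fc_def c)
 assume k: "k \<le> m"
 have "pos ?P (2 * k) = ix i k"
 proof (cases "k \<le> i")
  case True
  then have "{b \<in> ?P. b < 2 * k} = (\<lambda>j. 2 * j) ` {..<k}"
   using k by (auto simp: evs_def)
  then show ?thesis
   using True by (simp add: pos_def card_image inj_on_def ix_def)
 next
  case False
  then have "{b \<in> ?P. b < 2 * k} = insert (Suc (2 * i)) ((\<lambda>j. 2 * j) ` {..<k})"
   using k by (auto simp: evs_def)
  moreover have "Suc (2 * i) \<notin> (\<lambda>j. 2 * j) ` {..<k}"
   by (auto; presburger)
  ultimately show ?thesis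
   using False by (simp add: pos_def card_image inj_on_def ix_def)
 qed
 then show "fc ?P (2 * k) x = d (Suc m) (ix i k) x"
  by (simp add: fc_def c)
qed

lemma ix_self [simp]: "ix i i = i"
 by (simp add: ix_def)

lemma agree_evs:
 assumes "i \<le> m"
 shows "agree m i D D' \<longleftrightarrow> (\<forall>b\<in>evs m. b \<noteq> 2 * i -->
  fc (insert (Suc (2 * i)) (evs m)) b D' = fc (insert (Suc (2 * i)) (evs m)) b D)"
proof -
 have "(\<forall>k\<le>Suc m. k \<noteq> i --> k \<noteq> Suc i --> F k) \<longleftrightarrow> (\<forall>k\<le>m. k \<noteq> i --> F (ix i k))" for F
 proof safe
  fix k assume *: "\<forall>k\<le>m. k \<noteq> i --> F (ix i k)" "k \<le> Suc m" "k \<noteq> i" "k \<noteq> Suc i"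
  show "F k"
  proof (cases "k < i")
   case True then show ?thesis using *(1)[rule_format, of k] assms by (simp add: ix_def)
  next
   case False
   then have "F (ix i (k - 1))"
    using *(2-4) by (intro *(1)[rule_format]) auto
   then show ?thesis using False *(2-4) by (auto simp: ix_def split: if_splits)
  qed
 qed (auto simp: ix_def)
 then show ?thesis
  using assms by (simp add: agree_def evs_def fc_evs[unfolded evs_def]; blast)
qed

lemma comm_rel:
 assumes m: "1 \<le> m" and l: "ldata m x a D1 D2" and p: "pdata m x e a E1 E2"
  and zw: "lamrel m a D1 D2 z w" and zy: "lamrel m e E1 E2 z y" and yy: "lamrel m a D1 D2 y y2"
  and par: "par m y z" "par m w z"
 shows "lamrel m e E1 E2 w y2"
proof -
 have ae: "a \<le> m" "e \<le> m" "a \<noteq> e"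
  using l p by (auto simp: ldata_def pdata_def)
 let ?A = "evs m" and ?a = "2 * a" and ?a' = "Suc (2 * a)" and ?e = "2 * e" and ?e' = "Suc (2 * e)"
 let ?P = "insert ?a' ?A" and ?Q = "insert ?e' ?A"
 obtain D1' D2' where D: "D1' \<in> K (Suc m)" "D2' \<in> K (Suc m)" "agree m a D1 D1'" "agree m a D2 D2'"
  "d (Suc m) (Suc a) D1' = z" "d (Suc m) (Suc a) D2' = w" "d (Suc m) a D1' = d (Suc m) a D2'"
  using zw unfolding lamrel_def by blast
 obtain D3 D4 where D': "D3 \<in> K (Suc m)" "D4 \<in> K (Suc m)" "agree m a D1 D3" "agree m a D2 D4"
  "d (Suc m) (Suc a) D3 = y" "d (Suc m) (Suc a) D4 = y2" "d (Suc m) a D3 = d (Suc m) a D4"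
  using yy unfolding lamrel_def by blast
 obtain E1' E2' where E: "E1' \<in> K (Suc m)" "E2' \<in> K (Suc m)" "agree m e E1 E1'" "agree m e E2 E2'"
  "d (Suc m) (Suc e) E1' = z" "d (Suc m) (Suc e) E2' = y" "d (Suc m) e E1' = d (Suc m) e E2'"
  using zy unfolding lamrel_def by blast
 have "\<exists>F1\<in>K (Suc m). \<exists>F2\<in>K (Suc m). fc ?Q ?e' F1 = w \<and> fc ?Q ?e' F2 = y2 \<and> fc ?Q ?e F1 = fc ?Q ?e F2 \<and>
   (\<forall>b\<in>?A. b \<noteq> ?e --> fc ?Q b F1 = fc ?Q b E1' \<and> fc ?Q b F2 = fc ?Q b E2')"
 proof (rule comm_lab[of ?A m ?a ?e ?a' ?e' ?P ?Q D1' D2' D3 D4 E1' E2' z w y y2])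
  show "?a' \<notin> ?A" "?e' \<notin> ?A"
   by (simp_all add: evs)
  show "fc ?Q b E1' = fc ?Q b E2'" if b: "b \<in> ?A" "b \<noteq> ?a" for b
  proof -
   obtain k where k: "b = 2 * k" "k \<le> m"
    using b by (auto simp: evs_def)
   show ?thesis
   proof (cases "k = e")
    case True
    then show ?thesis using E k ae by (simp add: fc_evs)
   next
    case False
    have "ix e k \<le> Suc m" "ix e k \<noteq> e" "ix e k \<noteq> Suc e" "ix e k \<noteq> ix e a"
     using False k b by (auto simp: ix_def)
    then show ?thesis
     using E(3,4) p k ae by (simp add: fc_evs agree_def pdata_def)
   qed
  qed
  show "fc ?P b D3 = fc ?P b D1'" if "b \<in> ?A" "b \<noteq> ?a" for b
   using D(3) D'(3) that ae by (simp add: agree_evs)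
  show "fc ?P b D4 = fc ?P b D2'" if "b \<in> ?A" "b \<noteq> ?a" for b
   using D(4) D'(4) that ae by (simp add: agree_evs)
 qed (use D D' E ae m par in \<open>simp_all add: fc_evs evs\<close>)
 then obtain F1 F2 where F: "F1\<in>K (Suc m)" "F2\<in>K (Suc m)" "fc ?Q ?e' F1 = w" "fc ?Q ?e' F2 = y2"
  "fc ?Q ?e F1 = fc ?Q ?e F2" "\<And>b. b\<in>?A ==> b \<noteq> ?e ==> fc ?Q b F1 = fc ?Q b E1' \<and> fc ?Q b F2 = fc ?Q b E2'"
  by blast
 have "agree m e E1 F1" "agree m e E2 F2"
  using E(3,4) F(6) ae by (simp_all add: agree_evs)
 moreover have "d (Suc m) (Suc e) F1 = w" "d (Suc m) (Suc e) F2 = y2" "d (Suc m) e F1 = d (Suc m) e F2"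
  using F(3-5) ae by (simp_all add: fc_evs)
 ultimately show ?thesis
  unfolding lamrel_def using F(1,2) by blast
qed


lemma move_index:
 assumes "1 \<le> m" "p \<le> Suc m" "q \<le> Suc m" "p \<noteq> q" "E \<in> K (Suc m)" "par m w (d (Suc m) p E)"
 shows "\<exists>F\<in>K (Suc m). d (Suc m) p F = w \<and> (\<forall>k\<le>Suc m. k \<noteq> p --> k \<noteq> q --> d (Suc m) k F = d (Suc m) k E)"
 using move[of "{..Suc m}" m p q E w] assms by (auto simp: fc_atMost)

lemma par_face_index:
 assumes "1 \<le> m" "p \<le> Suc m" "q \<le> Suc m" "p \<noteq> q" "D \<in> K (Suc m)" "D' \<in> K (Suc m)"
  "\<And>k. k \<le> Suc m ==> k \<noteq> p ==> k \<noteq> q ==> d (Suc m) k D = d (Suc m) k D'"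
  "par m (d (Suc m) p D) (d (Suc m) p D')"
 shows "par m (d (Suc m) q D) (d (Suc m) q D')"
 using par_face[of "{..Suc m}" m p q D D'] assms by (auto simp: fc_atMost)

lemma lamrel_par:
 assumes m: "1 \<le> m" and l: "ldata m x i D1 D2" and z: "par m z x" and r: "lamrel m i D1 D2 z w"
 shows "par m w x"
proof -
 obtain D1' D2' where D: "D1' \<in> K (Suc m)" "D2' \<in> K (Suc m)" "agree m i D1 D1'" "agree m i D2 D2'"
  "d (Suc m) (Suc i) D1' = z" "d (Suc m) (Suc i) D2' = w" "d (Suc m) i D1' = d (Suc m) i D2'"
  using r unfolding lamrel_def by blast
 have l': "i \<le> m" "D1 \<in> K (Suc m)" "D2 \<in> K (Suc m)" "par m (d (Suc m) (Suc i) D1) x"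
  "par m (d (Suc m) (Suc i) D2) x" "par m (d (Suc m) i D1) (d (Suc m) i D2)"
  using l by (auto simp: ldata_def)
 have p: "par m (d (Suc m) (Suc i) D1') (d (Suc m) (Suc i) D1)"
  using par_trans[OF z par_sym[OF l'(4)]] D(5) by simp
 have "par m (d (Suc m) i D1') (d (Suc m) i D1)"
  by (rule par_face_index[of m "Suc i"]) (use m l'(1-3) D(1-4) p in \<open>auto simp: agree_def\<close>)
 then have p2: "par m (d (Suc m) i D2') (d (Suc m) i D2)"
  using par_trans[OF _ l'(6)] D(7) by simp
 have "par m (d (Suc m) (Suc i) D2') (d (Suc m) (Suc i) D2)"
  by (rule par_face_index[of m i]) (use m l'(1-3) D(1-4) p2 in \<open>auto simp: agree_def\<close>)
 then show ?thesis
  using par_trans[OF _ l'(5)] D(6) by simp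
qed

text \<open>Put \<open>z\<close> into \<open>D1\<close> and let face \<open>i\<close> absorb the
  change; then put the new face \<open>i\<close> into \<open>D2\<close> and let face
  \<open>i + 1\<close> absorb it.\<close>

lemma lamrel_total:
 assumes m: "1 \<le> m" and l: "ldata m x i D1 D2" and z: "par m z x"
 shows "\<exists>w. lamrel m i D1 D2 z w"
proof -
 have l': "i \<le> m" "D1 \<in> K (Suc m)" "D2 \<in> K (Suc m)" "par m (d (Suc m) (Suc i) D1) x"
  "par m (d (Suc m) (Suc i) D2) x" "par m (d (Suc m) i D1) (d (Suc m) i D2)"
  using l by (auto simp: ldata_def)
 have pz: "par m z (d (Suc m) (Suc i) D1)"
  using par_trans[OF z par_sym[OF l'(4)]] .
 then obtain D1' where D1': "D1' \<in> K (Suc m)" "d (Suc m) (Suc i) D1' = z" "agree m i D1 D1'"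
  using move_index[of m "Suc i" i D1 z] m l' by (auto simp: agree_def)
 have "par m (d (Suc m) i D1') (d (Suc m) i D1)"
  by (rule par_face_index[of m "Suc i"]) (use m l'(1-3) D1' pz in \<open>auto simp: agree_def\<close>)
 then have "par m (d (Suc m) i D1') (d (Suc m) i D2)"
  using par_trans[OF _ l'(6)] by blast
 then obtain D2' where "D2' \<in> K (Suc m)" "d (Suc m) i D2' = d (Suc m) i D1'" "agree m i D2 D2'"
  using move_index[of m i "Suc i" D2] m l' by (auto simp: agree_def)
 then have "lamrel m i D1 D2 z (d (Suc m) (Suc i) D2')"
  unfolding lamrel_def using D1' by (intro bexI[of _ D1'] bexI[of _ D2']) auto
 then show ?thesis
  by blast
qed

lemma hom_index:
 assumes "t \<in> K (Suc m)" "t' \<in> K (Suc m)" "j \<le> Suc m"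
  "\<And>k. k \<le> Suc m ==> k \<noteq> j ==> d (Suc m) k t = d (Suc m) k t'"
 shows "hom m (d (Suc m) j t) (d (Suc m) j t')"
 unfolding hom_def using assms by blast

text \<open>Two passages of \<open>z\<close> through variants of \<open>D1\<close> end in homotopic
  faces \<open>i\<close>. After replacing one of these by the other in the variant of
  \<open>D2\<close>, the two results complete the same horn.\<close>

lemma lamrel_unique:
 assumes m: "1 \<le> m" "i \<le> m" and r: "lamrel m i D1 D2 z w" "lamrel m i D1 D2 z w'"
 shows "hom m w w'"
proof -
 obtain A1 A2 where A: "A1 \<in> K (Suc m)" "A2 \<in> K (Suc m)" "agree m i D1 A1" "agree m i D2 A2"
  "d (Suc m) (Suc i) A1 = z" "d (Suc m) (Suc i) A2 = w" "d (Suc m) i A1 = d (Suc m) i A2"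
  using r(1) unfolding lamrel_def by blast
 obtain B1 B2 where B: "B1 \<in> K (Suc m)" "B2 \<in> K (Suc m)" "agree m i D1 B1" "agree m i D2 B2"
  "d (Suc m) (Suc i) B1 = z" "d (Suc m) (Suc i) B2 = w'" "d (Suc m) i B1 = d (Suc m) i B2"
  using r(2) unfolding lamrel_def by blast
 have "hom m (d (Suc m) i B1) (d (Suc m) i A1)"
 proof (rule hom_index)
  show "d (Suc m) k B1 = d (Suc m) k A1" if "k \<le> Suc m" "k \<noteq> i" for k
   using that A(3,5) B(3,5) by (cases "k = Suc i") (simp_all add: agree_def)
 qed (use m A B in auto)
 then have h: "hom m (d (Suc m) i B2) (d (Suc m) i A1)"
  by (simp only: B(7))
 have i: "i \<le> Suc m"
  using m by simp
 obtain B3 where B3: "B3 \<in> K (Suc m)" "d (Suc m) i B3 = d (Suc m) i A1"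
  "\<And>k. k \<le> Suc m ==> k \<noteq> i ==> d (Suc m) k B3 = d (Suc m) k B2"
  using hom_replace_index[OF m(1) h B(2) i refl] by blast
 have "hom m (d (Suc m) (Suc i) A2) (d (Suc m) (Suc i) B3)"
 proof (rule hom_index)
  show "d (Suc m) k A2 = d (Suc m) k B3" if "k \<le> Suc m" "k \<noteq> Suc i" for k
   using that A(4,7) B(4) B3(2,3) by (cases "k = i") (simp_all add: agree_def)
 qed (use m A B3 in auto)
 then show ?thesis
  using A(6) B(6) B3(3)[of "Suc i"] m by simp
qed

lemma lamrel_hom:
 assumes m: "1 \<le> m" "i \<le> m" and r: "lamrel m i D1 D2 z w" "hom m w w'"
 shows "lamrel m i D1 D2 z w'"
proof -
 obtain A1 A2 where A: "A1 \<in> K (Suc m)" "A2 \<in> K (Suc m)" "agree m i D1 A1" "agree m i D2 A2"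
  "d (Suc m) (Suc i) A1 = z" "d (Suc m) (Suc i) A2 = w" "d (Suc m) i A1 = d (Suc m) i A2"
  using r(1) unfolding lamrel_def by blast
 obtain B where B: "B \<in> K (Suc m)" "d (Suc m) (Suc i) B = w'"
  "\<And>k. k \<le> Suc m ==> k \<noteq> Suc i ==> d (Suc m) k B = d (Suc m) k A2"
  using hom_replace_index[of m w w' A2 "Suc i"] A m r(2) by auto
 have "agree m i D2 B" "d (Suc m) i A1 = d (Suc m) i B"
  using A B(3) m by (auto simp: agree_def)
 then show ?thesis
  unfolding lamrel_def using A B by blast
qed

text \<open>One simplex for each homotopy class of fillers of the boundary of \<open>x\<close>;
  classically a torsor under the m-th homotopy group.\<close>

definition reps :: "nat => 's => 's set" where
 "reps m x = rep m ` {z. par m z x}"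

lemma repsD:
 assumes "z \<in> reps m x" "1 \<le> m"
 shows "par m z x" "rep m z = z" "z \<in> K m"
proof -
 obtain y where y: "z = rep m y" "par m y x"
  using assms by (auto simp: reps_def)
 then have yK: "y \<in> K m"
  by (auto simp: par_def)
 show "par m z x" "rep m z = z"
  using par_trans[OF par_sym[OF rep_par[OF yK assms(2)]] y(2)] rep_rep[OF yK assms(2)] y(1) by simp_all
 then show "z \<in> K m"
  by (simp add: par_def)
qed

lemma repsI: "par m z x ==> rep m z \<in> reps m x"
 by (auto simp: reps_def)

lemma reps_cong:
 assumes "par m x y"
 shows "reps m x = reps m y"
proof -
 have "par m z x \<longleftrightarrow> par m z y" for z
  using par_trans[OF _ assms] par_trans[OF _ par_sym[OF assms]] by blast
 then show ?thesis
  by (simp add: reps_def)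
qed

lemma reps_eq:
 assumes "z \<in> reps m x" "w \<in> reps m y" "hom m z w" "1 \<le> m"
 shows "z = w"
 using rep_eq[OF assms(3,4)] repsD(2)[OF assms(1,4)] repsD(2)[OF assms(2,4)] by simp

text \<open>Translations along the vertex \<open>i\<close>, realised as functions on canonical
  fillers. By \<open>lamrel_unique\<close> the data \<open>D1\<close>, \<open>D2\<close> determine
  the function on \<open>reps m x\<close>.\<close>

definition Lf :: "nat => 's => nat => ('s => 's) set" where
 "Lf m x i = {f. \<exists>D1 D2. ldata m x i D1 D2 \<and> (\<forall>z\<in>reps m x. f z \<in> reps m x \<and> lamrel m i D1 D2 z (f z))}"

definition Pf :: "nat => 's => nat => nat => ('s => 's) set" where
 "Pf m x e a = {f. \<exists>D1 D2. pdata m x e a D1 D2 \<and> (\<forall>z\<in>reps m x. f z \<in> reps m x \<and> lamrel m e D1 D2 z (f z))}"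

lemma Pf_subset_Lf: "Pf m x e a \<subseteq> Lf m x e"
 by (auto simp: Pf_def Lf_def pdata_def)

lemma lam_function:
 assumes "1 \<le> m" "ldata m x i D1 D2"
 shows "\<exists>f. \<forall>z\<in>reps m x. f z \<in> reps m x \<and> lamrel m i D1 D2 z (f z)"
proof -
 have i: "i \<le> m"
  using assms by (simp add: ldata_def)
 have "\<exists>w. w \<in> reps m x \<and> lamrel m i D1 D2 z w" if z: "z \<in> reps m x" for z
 proof -
  have zx: "par m z x"
   using repsD(1)[OF z assms(1)] .
  obtain w where w: "lamrel m i D1 D2 z w"
   using lamrel_total[OF assms zx] by blast
  then have px: "par m w x"
   using lamrel_par[OF assms zx] by blast
  then have "w \<in> K m"
   by (simp add: par_def)
  then have "lamrel m i D1 D2 z (rep m w)"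
   using lamrel_hom[OF assms(1) i w hom_rep] assms(1) by blast
  then show ?thesis
   using repsI[OF px] by blast
 qed
 then show ?thesis
  by metis
qed

lemma Lf_closed: "f \<in> Lf m x i ==> z \<in> reps m x ==> f z \<in> reps m x"
 by (auto simp: Lf_def)

lemma Lf_Pf_commute:
 assumes m: "1 \<le> m" and f: "f \<in> Lf m x a" and g: "g \<in> Pf m x e a" and z: "z \<in> reps m x"
 shows "f (g z) = g (f z)"
proof -
 obtain D1 D2 where D: "ldata m x a D1 D2" "\<And>z. z \<in> reps m x ==> f z \<in> reps m x \<and> lamrel m a D1 D2 z (f z)"
  using f by (auto simp: Lf_def)
 obtain E1 E2 where E: "pdata m x e a E1 E2" "\<And>z. z \<in> reps m x ==> g z \<in> reps m x \<and> lamrel m e E1 E2 z (g z)"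
  using g by (auto simp: Pf_def)
 have par: "par m (g z) z" "par m (f z) z"
  using par_trans[OF repsD(1)[OF _ m] par_sym[OF repsD(1)[OF z m]]] D(2)[OF z] E(2)[OF z] by blast+
 have fz: "f z \<in> reps m x" and gz: "g z \<in> reps m x"
  using D(2)[OF z] E(2)[OF z] by blast+
 have "lamrel m e E1 E2 (f z) (f (g z))"
  using comm_rel[OF m D(1) E(1), of z "f z" "g z" "f (g z)"] D(2)[OF z] E(2)[OF z] D(2)[OF gz] par by blast
 moreover have "e \<le> m"
  using E(1) by (simp add: pdata_def ldata_def)
 ultimately have "hom m (f (g z)) (g (f z))"
  using lamrel_unique[OF m] E(2)[OF fz] by blast
 then show ?thesis
  using reps_eq[OF _ _ _ m] D(2)[OF gz] E(2)[OF fz] by blast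
qed

text \<open>The filler \<open>z\<close> is a face of some \<open>E1\<close>. Exchanging it for
  \<open>y\<close>, with the change absorbed by the face opposite \<open>a\<close>, gives an
  \<open>E2\<close> such that the pair translates \<open>z\<close> to \<open>y\<close>.\<close>

lemma Pf_trans:
 assumes m: "1 \<le> m" and ae: "e \<le> m" "a \<le> m" "e \<noteq> a" and z: "z \<in> reps m x" and y: "y \<in> reps m x"
 shows "\<exists>g\<in>Pf m x e a. g z = y"
proof -
 have "insert (Suc e) ({..Suc m} - {Suc e}) = {..Suc m}"
  using ae by auto
 then obtain E1 where E1: "E1 \<in> K (Suc m)" "d (Suc m) (Suc e) E1 = z"
  using extend_simplex[of "{..Suc m} - {Suc e}" m z "Suc e"] repsD(3)[OF z m] m ae by (auto simp: fc_atMost)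
 have px: "par m z x" "par m y x"
  using repsD(1)[OF _ m] z y by blast+
 have ix: "ix e a \<le> Suc m" "Suc e \<noteq> ix e a" "e \<noteq> ix e a"
  using ae by (auto simp: ix_def)
 have "par m y (d (Suc m) (Suc e) E1)"
  using par_trans[OF px(2) par_sym[OF px(1)]] E1(2) by simp
 then obtain E2 where E2: "E2 \<in> K (Suc m)" "d (Suc m) (Suc e) E2 = y"
  "\<And>k. k \<le> Suc m ==> k \<noteq> Suc e ==> k \<noteq> ix e a ==> d (Suc m) k E2 = d (Suc m) k E1"
  using move_index[of m "Suc e" "ix e a" E1 y] m ae ix E1 by auto
 have e: "d (Suc m) e E2 = d (Suc m) e E1"
  using E2(3)[of e] ae ix by simp
 have p: "pdata m x e a E1 E2"
  using E1 E2 px ae e face_in[of E1 m e] by (auto simp: pdata_def ldata_def intro: par_refl)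
 then obtain g where g: "\<forall>z\<in>reps m x. g z \<in> reps m x \<and> lamrel m e E1 E2 z (g z)"
  using lam_function[OF m, of x e E1 E2] by (auto simp: pdata_def)
 have "lamrel m e E1 E2 z y"
  unfolding lamrel_def using E1 E2(1,2) e by (intro bexI[of _ E1] bexI[of _ E2]) (auto simp: agree_def)
 then have "hom m (g z) y"
  using lamrel_unique[OF m ae(1)] g z by blast
 then have "g z = y"
  using reps_eq[OF _ y _ m] g z by blast
 then show ?thesis
  using p g by (auto simp: Pf_def)
qed

text \<open>Translations along three different vertices commute pairwise and each kind acts transitively,
 so the three kinds coincide and form an abelian group (Eckmann--Hilton).\<close>

lemma Lf_commute:
 assumes m: "2 \<le> m" and f: "f \<in> Lf m x 1" "f' \<in> Lf m x 1" and z: "z \<in> reps m x"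
 shows "f (f' z) = f' (f z)"
proof -
 have m1: "1 \<le> m" and m0: "0 \<le> m"
  using m by simp_all
 note PL = subsetD[OF Pf_subset_Lf]
 have c: "g (h y) = h (g y)" if g: "g \<in> Pf m x 0 1" and h: "h \<in> Pf m x 0 1" and y: "y \<in> reps m x" for g h y
 proof -
  obtain k where k: "k \<in> Pf m x 1 2" "k y = g y"
   using Pf_trans[OF m1 m1 m _ y Lf_closed[OF PL[OF g] y]] by auto
  \<comment> \<open>\<open>g\<close> and \<open>k\<close> agree at \<open>y\<close>, and both
    commute with the translations \<open>l\<close> along a third vertex, which reach every filler
    from \<open>y\<close>. This is where three vertices, hence dimension at least two, are
    used.\<close>
  have eq: "g u = k u" if u: "u \<in> reps m x" for u
  proof -
   obtain l where l: "l \<in> Pf m x 2 0" "l y = u"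
    using Pf_trans[OF m1 m m0 _ y u] by auto
   have "g u = l (g y)"
    using Lf_Pf_commute[OF m1 PL[OF g] l(1) y] l(2) by simp
   also have "\<dots> = k (l y)"
    using Lf_Pf_commute[OF m1 PL[OF l(1)] k(1) y] k(2) by simp
   finally show ?thesis
    using l(2) by simp
  qed
  have "k (h y) = h (k y)"
   using Lf_Pf_commute[OF m1 PL[OF k(1)] h y] .
  then show ?thesis
   using eq[OF Lf_closed[OF PL[OF h] y]] eq[OF y] by simp
 qed
 have ex: "\<exists>g\<in>Pf m x 0 1. \<forall>u\<in>reps m x. f u = g u" if f: "f \<in> Lf m x 1" for f
 proof -
  obtain g where g: "g \<in> Pf m x 0 1" "g z = f z"
   using Pf_trans[OF m1 m0 m1 _ z Lf_closed[OF f z]] by auto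
  have "f u = g u" if u: "u \<in> reps m x" for u
  proof -
   obtain l where l: "l \<in> Pf m x 0 1" "l z = u"
    using Pf_trans[OF m1 m0 m1 _ z u] by auto
   have "f u = l (f z)"
    using Lf_Pf_commute[OF m1 f l(1) z] l(2) by simp
   also have "\<dots> = g u"
    using c[OF g(1) l(1) z] g(2) l(2) by simp
   finally show ?thesis .
  qed
  then show ?thesis
   using g(1) by blast
 qed
 obtain g where g: "g \<in> Pf m x 0 1" "\<forall>u\<in>reps m x. f u = g u"
  using ex[OF f(1)] by blast
 obtain g' where g': "g' \<in> Pf m x 0 1" "\<forall>u\<in>reps m x. f' u = g' u"
  using ex[OF f(2)] by blast
 have "g z \<in> reps m x" "g' z \<in> reps m x"
  using Lf_closed[OF PL[OF g(1)] z] Lf_closed[OF PL[OF g'(1)] z] by blast+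
 then show ?thesis
  using c[OF g(1) g'(1) z] g(2) g'(2) z by simp
qed

end

section \<open>Means\<close>

text \<open>Boundedness on the whole type, so that sums, products with scalars and compositions need
  no side conditions; the set carrying a mean enters only through \<open>mean\<close>.\<close>

definition bfun :: "('x => real) => bool" where
 "bfun f \<longleftrightarrow> (\<exists>B. \<forall>x. \<bar>f x\<bar> \<le> B)"

lemma bfunI: "(\<And>x. \<bar>f x\<bar> \<le> B) ==> bfun f"
 by (auto simp: bfun_def)

lemma bfun_add: "bfun f ==> bfun g ==> bfun (\<lambda>x. f x + g x)"
proof -
 assume "bfun f" "bfun g"
 then obtain A B where "\<And>x. \<bar>f x\<bar> \<le> A" "\<And>x. \<bar>g x\<bar> \<le> B"
  by (auto simp: bfun_def)
 then have "\<bar>f x + g x\<bar> \<le> A + B" for x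
  by (meson abs_triangle_ineq add_mono order_trans)
 then show ?thesis by (rule bfunI)
qed

lemma bfun_scale: "bfun f ==> bfun (\<lambda>x. c * f x)"
proof -
 assume "bfun f"
 then obtain A where "\<And>x. \<bar>f x\<bar> \<le> A"
  by (auto simp: bfun_def)
 then have "\<bar>c * f x\<bar> \<le> \<bar>c\<bar> * A" for x
  by (simp add: abs_mult mult_left_mono)
 then show ?thesis by (rule bfunI)
qed

lemma bfun_const [simp]: "bfun (\<lambda>x. c)"
 by (auto simp: bfun_def)

lemma bfun_minus: "bfun f ==> bfun (\<lambda>x. - f x)"
 by (simp add: bfun_def)

lemma bfun_diff: "bfun f ==> bfun g ==> bfun (\<lambda>x. f x - g x)"
 using bfun_add[OF _ bfun_minus, of f g] by simp

lemma bfun_compose: "bfun f ==> bfun (\<lambda>x. f (h x))"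
 by (auto simp: bfun_def)

lemma bfun_sum: "(\<And>i. i \<in> I ==> bfun (f i)) ==> bfun (\<lambda>x. \<Sum>i\<in>I. f i x)"
 by (induction I rule: infinite_finite_induct) (auto intro: bfun_add)

section \<open>The Hahn-Banach theorem\<close>

definition linear_closed :: "('x => real) set => bool" where
 "linear_closed V \<longleftrightarrow> (\<lambda>_. 0) \<in> V \<and> (\<forall>f\<in>V. \<forall>g\<in>V. (\<lambda>x. f x + g x) \<in> V) \<and> (\<forall>c. \<forall>f\<in>V. (\<lambda>x. c * f x) \<in> V)"

definition sublinear :: "('x => real) set => (('x => real) => real) => bool" where
 "sublinear V q \<longleftrightarrow> (\<forall>f\<in>V. \<forall>g\<in>V. q (\<lambda>x. f x + g x) \<le> q f + q g) \<and>
   (\<forall>c>0. \<forall>f\<in>V. q (\<lambda>x. c * f x) \<le> c * q f)"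

lemma sublinear_add:
 "sublinear V q ==> f \<in> V ==> g \<in> V ==> q (\<lambda>x. f x + g x) \<le> q f + q g"
 by (simp add: sublinear_def)

lemma sublinear_scale:
 assumes "linear_closed V" "sublinear V q" "f \<in> V" "0 < c"
 shows "q (\<lambda>x. c * f x) = c * q f"
proof (rule antisym)
 show "q (\<lambda>x. c * f x) \<le> c * q f"
  using assms by (auto simp: sublinear_def)
 have "(\<lambda>x. c * f x) \<in> V"
  using assms by (auto simp: linear_closed_def)
 then have "q (\<lambda>x. (1 / c) * (c * f x)) \<le> (1 / c) * q (\<lambda>x. c * f x)"
  using assms unfolding sublinear_def by (metis zero_less_divide_1_iff)
 then show "c * q f \<le> q (\<lambda>x. c * f x)"
  using assms(4) by (simp add: field_simps)
qed

lemma sublinear_zero: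
 assumes "linear_closed V" "sublinear V q"
 shows "q (\<lambda>_. 0) = 0"
 using sublinear_scale[OF assms, of "\<lambda>_. 0" 2] assms(1) by (simp add: linear_closed_def)

lemma sublinear_lower:
 assumes "linear_closed V" "sublinear V q" "f \<in> V"
 shows "- q (\<lambda>x. - 1 * f x) \<le> q f"
proof -
 have "(\<lambda>x. - 1 * f x) \<in> V"
  using assms unfolding linear_closed_def by blast
 then have "q (\<lambda>x. f x + - 1 * f x) \<le> q f + q (\<lambda>x. - 1 * f x)"
  by (rule sublinear_add[OF assms(2,3)])
 then show ?thesis
  using sublinear_zero[OF assms(1,2)] by simp
qed

text \<open>The auxiliary functional of the Hahn-Banach argument. It lies below \<open>q\<close>
  (take t = 0), and its value at \<open>- y\<close> is at most \<open>- q y\<close> (take t = 1), so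
  that whatever is linear and below it takes at least the value \<open>q y\<close> at
  \<open>y\<close>.\<close>

definition shift :: "(('x => real) => real) => ('x => real) => ('x => real) => real" where
 "shift q y f = (INF t\<in>{0..}. q (\<lambda>x. f x + t * y x) - t * q y)"

lemma
 assumes V: "linear_closed V" and q: "sublinear V q" and y: "y \<in> V"
 shows shift_le: "f \<in> V ==> 0 \<le> t ==> shift q y f \<le> q (\<lambda>x. f x + t * y x) - t * q y"
  and shift_sublinear: "sublinear V (shift q y)"
proof -
 have add: "(\<lambda>x. f x + g x) \<in> V" if "f \<in> V" "g \<in> V" for f g
  using V that by (auto simp: linear_closed_def)
 have sc: "(\<lambda>x. c * f x) \<in> V" if "f \<in> V" for f and c :: real
  using V that by (auto simp: linear_closed_def)
 have q_add: "q (\<lambda>x. f x + g x) \<le> q f + q g" if "f \<in> V" "g \<in> V" for f g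
  using q that by (auto simp: sublinear_def)
 have q_sc: "q (\<lambda>x. c * f x) = c * q f" if "f \<in> V" "0 \<le> c" for f c
  using sublinear_scale[OF V q that(1), of c] sublinear_zero[OF V q] that(2) by (cases "c = 0") auto
 have lower: "- q (\<lambda>x. - 1 * f x) \<le> q (\<lambda>x. f x + t * y x) - t * q y" if f: "f \<in> V" and t: "0 \<le> t" for f t
 proof -
  have "q (\<lambda>x. (f x + t * y x) + - 1 * f x) \<le> q (\<lambda>x. f x + t * y x) + q (\<lambda>x. - 1 * f x)"
   using f y by (intro q_add add sc)
  moreover have "q (\<lambda>x. (f x + t * y x) + - 1 * f x) = t * q y"
   using q_sc[OF y t] by (simp add: algebra_simps)
  ultimately show ?thesis
   by simp
 qed
 have bdd: "bdd_below ((\<lambda>t. q (\<lambda>x. f x + t * y x) - t * q y) ` {0..})" if "f \<in> V" for f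
  using lower[OF that] by (intro bdd_belowI2) auto
 show le: "shift q y f \<le> q (\<lambda>x. f x + t * y x) - t * q y" if "f \<in> V" "0 \<le> t" for f t
  unfolding shift_def using that by (intro cINF_lower[OF bdd]) auto
 have app: "\<exists>t\<ge>0. q (\<lambda>x. f x + t * y x) - t * q y < r" if "f \<in> V" "shift q y f < r" for f r
  using that(2) unfolding shift_def by (subst (asm) cINF_less_iff[OF _ bdd[OF that(1)]]) auto
 show "sublinear V (shift q y)"
  unfolding sublinear_def
 proof safe
  fix f g assume f: "f \<in> V" and g: "g \<in> V"
  show "shift q y (\<lambda>x. f x + g x) \<le> shift q y f + shift q y g"
  proof (rule field_le_epsilon)
   fix e :: real assume "0 < e"
   obtain s where s: "0 \<le> s" "q (\<lambda>x. f x + s * y x) - s * q y < shift q y f + e / 2"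
    using app[OF f, of "shift q y f + e / 2"] \<open>0 < e\<close> by auto
   obtain t where t: "0 \<le> t" "q (\<lambda>x. g x + t * y x) - t * q y < shift q y g + e / 2"
    using app[OF g, of "shift q y g + e / 2"] \<open>0 < e\<close> by auto
   have "shift q y (\<lambda>x. f x + g x) \<le> q (\<lambda>x. (f x + g x) + (s + t) * y x) - (s + t) * q y"
    using s t f g by (intro le add) auto
   moreover have "q (\<lambda>x. (f x + s * y x) + (g x + t * y x)) \<le> q (\<lambda>x. f x + s * y x) + q (\<lambda>x. g x + t * y x)"
    using f g y by (intro q_add add sc)
   moreover have "(\<lambda>x. (f x + g x) + (s + t) * y x) = (\<lambda>x. (f x + s * y x) + (g x + t * y x))"
    by (auto simp: algebra_simps)
   ultimately show "shift q y (\<lambda>x. f x + g x) \<le> shift q y f + shift q y g + e"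
    using s t by (simp add: algebra_simps)
  qed
 next
  fix c :: real and f assume c: "0 < c" and f: "f \<in> V"
  show "shift q y (\<lambda>x. c * f x) \<le> c * shift q y f"
  proof (rule field_le_epsilon)
   fix e :: real assume "0 < e"
   obtain s where s: "0 \<le> s" "q (\<lambda>x. f x + s * y x) - s * q y < shift q y f + e / c"
    using app[OF f, of "shift q y f + e / c"] \<open>0 < e\<close> c by auto
   have "shift q y (\<lambda>x. c * f x) \<le> q (\<lambda>x. c * f x + (c * s) * y x) - (c * s) * q y"
    using s c f by (intro le sc) auto
   also have "q (\<lambda>x. c * f x + (c * s) * y x) = q (\<lambda>x. c * (f x + s * y x))"
    by (simp add: algebra_simps)
   also have "\<dots> = c * q (\<lambda>x. f x + s * y x)"
    using f y c by (intro q_sc add sc) auto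
   finally have "shift q y (\<lambda>x. c * f x) \<le> c * (q (\<lambda>x. f x + s * y x) - s * q y)"
    by (simp add: algebra_simps)
   also have "\<dots> \<le> c * (shift q y f + e / c)"
    using s c by (intro mult_left_mono) auto
   finally show "shift q y (\<lambda>x. c * f x) \<le> c * shift q y f + e"
    using c by (simp add: algebra_simps)
  qed
 qed
qed

text \<open>A minimal sublinear functional is linear, since by minimality it equals each of its
  shifts. Starting Zorn's lemma from \<open>shift p z\<close> instead of \<open>p\<close> forces the
  value at \<open>z\<close> up to \<open>p z\<close>.\<close>

lemma hahn_banach:
 assumes V: "linear_closed V" and p: "sublinear V p" and z: "z \<in> V"
 shows "\<exists>L. (\<forall>f\<in>V. \<forall>g\<in>V. L (\<lambda>x. f x + g x) = L f + L g) \<and>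
  (\<forall>c. \<forall>f\<in>V. L (\<lambda>x. c * f x) = c * L f) \<and> (\<forall>f\<in>V. L f \<le> p f) \<and> p z \<le> L z"
proof -
 have sc: "(\<lambda>x. c * f x) \<in> V" if "f \<in> V" for f and c :: real
  using V that by (auto simp: linear_closed_def)
 have add: "(\<lambda>x. f x + g x) \<in> V" if "f \<in> V" "g \<in> V" for f g
  using V that by (auto simp: linear_closed_def)
 define p' where "p' = shift p z"
 \<comment> \<open>The functionals are set to 0 off \<open>V\<close>, so that comparing values on
   \<open>V\<close> gives an antisymmetric order on total functions.\<close>
 define S where "S = {q. sublinear V q \<and> (\<forall>f\<in>V. q f \<le> p' f) \<and> (\<forall>f. f \<notin> V --> q f = 0)}"
 define ge :: "(('a => real) => real) => (('a => real) => real) => bool" where "ge q r \<longleftrightarrow> r \<le> q" for q r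
 have p': "sublinear V p'"
  unfolding p'_def by (rule shift_sublinear[OF V p z])
 define p0 where "p0 f = (if f \<in> V then p' f else 0)" for f
 have p0: "p0 \<in> S"
  using p' add sc by (auto simp: S_def p0_def sublinear_def)
 have "\<exists>m\<in>S. \<forall>a\<in>S. ge m a --> a = m"
 proof (rule predicate_Zorn)
  show "partial_order_on S (relation_of ge S)"
   by (rule partial_order_on_relation_ofI) (auto simp: ge_def)
  fix C assume C: "C \<in> Chains (relation_of ge S)"
  show "\<exists>u\<in>S. \<forall>a\<in>C. ge a u"
  proof (cases "C = {}")
   case True
   then show ?thesis using p0 by blast
  next
   case False
   have CS: "C \<subseteq> S" and ch: "\<And>q r. q \<in> C ==> r \<in> C ==> q \<le> r \<or> r \<le> q"
    using C by (auto simp: Chains_def relation_of_def ge_def)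
   define u where "u f = (INF q\<in>C. q f)" for f
   have bdd: "bdd_below ((\<lambda>q. q f) ` C)" for f
   proof (cases "f \<in> V")
    case True
    have "- p' (\<lambda>x. - 1 * f x) \<le> q f" if "q \<in> C" for q
    proof -
     have "q (\<lambda>x. - 1 * f x) \<le> p' (\<lambda>x. - 1 * f x)"
      using that CS sc[OF True, of "-1"] by (auto simp: S_def)
     moreover have "- q (\<lambda>x. - 1 * f x) \<le> q f"
      using that CS V True by (intro sublinear_lower) (auto simp: S_def)
     ultimately show ?thesis by simp
    qed
    then show ?thesis by (intro bdd_belowI2) auto
   next
    case False
    then have "0 \<le> q f" if "q \<in> C" for q
     using that CS by (auto simp: S_def)
    then show ?thesis by (intro bdd_belowI2) auto
   qed
   have le: "u f \<le> q f" if "q \<in> C" for q f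
    unfolding u_def using that by (intro cINF_lower bdd)
   have app: "\<exists>q\<in>C. q f < r" if "u f < r" for f r
    using that unfolding u_def by (subst (asm) cINF_less_iff[OF False bdd]) auto
   have "sublinear V u"
    unfolding sublinear_def
   proof safe
    fix f g assume f: "f \<in> V" and g: "g \<in> V"
    show "u (\<lambda>x. f x + g x) \<le> u f + u g"
    proof (rule field_le_epsilon)
     fix e :: real assume "0 < e"
     obtain q r where q: "q \<in> C" "q f < u f + e / 2" and r: "r \<in> C" "r g < u g + e / 2"
      using app[of f "u f + e / 2"] app[of g "u g + e / 2"] \<open>0 < e\<close> by auto
     obtain s where s: "s \<in> C" "s f \<le> q f" "s g \<le> r g"
      using ch[OF q(1) r(1)] q(1) r(1) by (metis le_fun_def order_refl)
     have "u (\<lambda>x. f x + g x) \<le> s (\<lambda>x. f x + g x)"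
      using le s by blast
     also have "\<dots> \<le> s f + s g"
      using s CS f g by (auto simp: S_def sublinear_def)
     finally show "u (\<lambda>x. f x + g x) \<le> u f + u g + e"
      using s q r by simp
    qed
   next
    fix c :: real and f assume c: "0 < c" and f: "f \<in> V"
    show "u (\<lambda>x. c * f x) \<le> c * u f"
    proof (rule field_le_epsilon)
     fix e :: real assume "0 < e"
     then obtain q where q: "q \<in> C" "q f < u f + e / c"
      using app[of f "u f + e / c"] c by auto
     have "u (\<lambda>x. c * f x) \<le> q (\<lambda>x. c * f x)"
      using le q by blast
     also have "\<dots> \<le> c * q f"
      using q CS f c by (auto simp: S_def sublinear_def)
     also have "\<dots> \<le> c * (u f + e / c)"
      using q c by (intro mult_left_mono) auto
     finally show "u (\<lambda>x. c * f x) \<le> c * u f + e"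
      using c by (simp add: algebra_simps)
    qed
   qed
   moreover have "u f \<le> p' f" if "f \<in> V" for f
   proof -
    obtain q where "q \<in> C"
     using False by blast
    then have "u f \<le> q f" "q f \<le> p' f"
     using le CS that by (auto simp: S_def)
    then show ?thesis by simp
   qed
   moreover have "u f = 0" if "f \<notin> V" for f
   proof -
    have "q f = 0" if "q \<in> C" for q
     using that CS \<open>f \<notin> V\<close> by (auto simp: S_def)
    then have "(\<lambda>q. q f) ` C = {0}"
     using False by force
    then show ?thesis by (simp add: u_def)
   qed
   ultimately have "u \<in> S"
    by (auto simp: S_def)
   then show ?thesis
    using le by (auto simp: ge_def le_fun_def)
  qed
 qed
 then obtain m where m: "m \<in> S" and min: "\<And>a. a \<in> S ==> a \<le> m ==> a = m"
  by (auto simp: ge_def)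
 have ms: "sublinear V m" and mp: "\<And>f. f \<in> V ==> m f \<le> p' f"
  using m by (auto simp: S_def)
 have m_add: "m (\<lambda>x. f x + y x) = m f + m y" if f: "f \<in> V" and y: "y \<in> V" for f y
 proof (rule antisym)
  show "m (\<lambda>x. f x + y x) \<le> m f + m y"
   using ms f y by (auto simp: sublinear_def)
  \<comment> \<open>\<open>r\<close> is a member of \<open>S\<close> below the minimal
    \<open>m\<close>, hence equal to it; the term t = 1 of the infimum is then the missing half of
    additivity.\<close>
  define r where "r f = (if f \<in> V then shift m y f else 0)" for f
  have rm: "r f \<le> m f" for f
   using shift_le[OF V ms y, of f 0] m by (auto simp: r_def S_def)
  have "sublinear V r"
   using shift_sublinear[OF V ms y] add sc by (auto simp: r_def sublinear_def)
  then have "r \<in> S"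
   using order_trans[OF rm mp] by (auto simp: S_def) (simp add: r_def)
  then have "r = m"
   using min rm by (auto simp: le_fun_def)
  then have "m f \<le> m (\<lambda>x. f x + 1 * y x) - 1 * m y"
  proof -
   have "m f = shift m y f"
    using fun_cong[OF \<open>r = m\<close>, of f] f by (simp add: r_def)
   then show ?thesis
    using shift_le[OF V ms y f, of 1] by simp
  qed
  then show "m f + m y \<le> m (\<lambda>x. f x + y x)"
   by simp
 qed
 have m0: "m (\<lambda>_. 0) = 0"
  by (rule sublinear_zero[OF V ms])
 have m_neg: "m (\<lambda>x. - 1 * f x) = - m f" if "f \<in> V" for f
  using m_add[OF that sc[OF that, of "-1"]] m0 by simp
 have m_sc: "m (\<lambda>x. c * f x) = c * m f" if f: "f \<in> V" for c f
 proof (cases "c > 0 \<or> c = 0")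
  case True
  then show ?thesis
   using sublinear_scale[OF V ms f, of c] m0 by auto
 next
  case False
  then have "m (\<lambda>x. (- c) * (- 1 * f x)) = (- c) * m (\<lambda>x. - 1 * f x)"
   by (intro sublinear_scale[OF V ms sc[OF f]]) auto
  then show ?thesis
   using m_neg[OF f] by simp
 qed
 have "m f \<le> p f" if "f \<in> V" for f
  using mp[OF that] shift_le[OF V p z that, of 0] by (simp add: p'_def)
 moreover have "p z \<le> m z"
 proof -
  have "m (\<lambda>x. - 1 * z x) \<le> p (\<lambda>x. - 1 * z x + 1 * z x) - 1 * p z"
   using mp[OF sc[OF z, of "-1"]] shift_le[OF V p z sc[OF z, of "-1"], of 1] by (simp add: p'_def)
  then show ?thesis
   using m_neg[OF z] sublinear_zero[OF V p] by simp
 qed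
 ultimately show ?thesis
  using m_add m_sc by (intro exI[of _ m]) blast
qed

section \<open>Means on bounded functions\<close>

definition mean :: "'x set => (('x => real) => real) => bool" where
 "mean R m \<longleftrightarrow> (\<forall>f g. bfun f --> bfun g --> m (\<lambda>x. f x + g x) = m f + m g) \<and>
   (\<forall>c f. bfun f --> m (\<lambda>x. c * f x) = c * m f) \<and>
   (\<forall>f. bfun f --> (\<forall>x\<in>R. 0 \<le> f x) --> 0 \<le> m f) \<and> m (\<lambda>x. 1) = 1"

lemma
 assumes "mean R m"
 shows mean_add: "bfun f ==> bfun g ==> m (\<lambda>x. f x + g x) = m f + m g"
  and mean_scale: "bfun f ==> m (\<lambda>x. c * f x) = c * m f"
  and mean_nonneg: "bfun f ==> (\<And>x. x \<in> R ==> 0 \<le> f x) ==> 0 \<le> m f"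
  and mean_one: "m (\<lambda>x. 1) = 1"
 using assms by (auto simp: mean_def)

lemma mean_diff: "mean R m ==> bfun f ==> bfun g ==> m (\<lambda>x. f x - g x) = m f - m g"
 using mean_add[of R m f "\<lambda>x. - 1 * g x"] mean_scale[of R m g "-1"] bfun_scale[of g "-1"] by simp

lemma mean_mono: "mean R m ==> bfun f ==> bfun g ==> (\<And>x. x \<in> R ==> f x \<le> g x) ==> m f \<le> m g"
 using mean_nonneg[of R m "\<lambda>x. g x - f x"] mean_diff[of R m g f] bfun_diff[of g f] by simp

text \<open>Positivity is demanded on \<open>R\<close> alone, and this makes a mean blind to the
  values off \<open>R\<close>, although its arguments are total functions.\<close>

lemma mean_cong: "mean R m ==> bfun f ==> bfun g ==> (\<And>x. x \<in> R ==> f x = g x) ==> m f = m g"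
 using mean_mono[of R m f g] mean_mono[of R m g f] by (simp add: order_antisym)

lemma mean_const: "mean R m ==> m (\<lambda>x. c) = c"
 using mean_scale[of R m "\<lambda>x. 1" c] mean_one[of R m] by simp

lemma mean_bound:
 assumes "mean R m" "bfun f" "\<And>x. x \<in> R ==> \<bar>f x\<bar> \<le> B"
 shows "\<bar>m f\<bar> \<le> B"
proof -
 have "m f \<le> m (\<lambda>x. B)" "m (\<lambda>x. - B) \<le> m f"
  using assms(3) by (intro mean_mono[OF assms(1)]; auto simp: assms(2) abs_le_iff; fastforce)+
 then show ?thesis
  using mean_const[OF assms(1)] by (auto simp: abs_le_iff)
qed

lemma mean_sum:
 assumes "mean R m" "\<And>i. i \<in> I ==> bfun (f i)"
 shows "m (\<lambda>x. \<Sum>i\<in>I. f i x) = (\<Sum>i\<in>I. m (f i))"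
 using assms(2)
proof (induction I rule: infinite_finite_induct)
 case (insert i I)
 then have "m (\<lambda>x. f i x + (\<Sum>i\<in>I. f i x)) = m (f i) + m (\<lambda>x. \<Sum>i\<in>I. f i x)"
  by (intro mean_add[OF assms(1)] bfun_sum) auto
 then show ?case
  using insert by simp
qed (use mean_const[OF assms(1), of 0] in auto)

lemma mean_map:
 assumes "mean R m" "\<And>x. x \<in> R ==> h x \<in> R'"
 shows "mean R' (\<lambda>f. m (\<lambda>x. f (h x)))"
 using assms(2) mean_add[OF assms(1)] mean_scale[OF assms(1)] mean_nonneg[OF assms(1)] mean_one[OF assms(1)]
 by (auto simp: mean_def bfun_compose)

subsection \<open>Invariant means\<close>

definition avg :: "('x => 'x) => nat => ('x => real) => 'x => real" where
 "avg h n f x = (\<Sum>k\<le>n. f ((h ^^ k) x)) / Suc n"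

inductive_set avgs :: "('x => 'x) set => (('x => real) => 'x => real) set" for H where
 avgs_id: "(\<lambda>f. f) \<in> avgs H"
| avgs_step: "A \<in> avgs H ==> h \<in> H ==> (\<lambda>f. avg h n (A f)) \<in> avgs H"

text \<open>A Markov-Kakutani argument. \<open>p\<close> is the best upper bound of \<open>f\<close>
  after any composition of Cesaro averages, and it is subadditive because such averages commute. A
  linear functional below \<open>p\<close> is a mean; it is invariant because the average over n + 1
  steps of the difference of \<open>f\<close> and its translate telescopes to at most 2B/(n + 1).
  The maps commute only on \<open>R\<close>, hence the pointwise form of the auxiliary
  facts.\<close>

lemma invariant_mean_exists:
 fixes R :: "'x set" and H :: "('x => 'x) set"
 assumes ne: "R \<noteq> {}" and maps: "\<And>h x. h \<in> H ==> x \<in> R ==> h x \<in> R"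
  and comm: "\<And>h g x. h \<in> H ==> g \<in> H ==> x \<in> R ==> h (g x) = g (h x)"
 obtains m where "mean R m" "\<And>h f. h \<in> H ==> bfun f ==> m (\<lambda>x. f (h x)) = m f"
proof -
 have powR: "(h ^^ k) x \<in> R" if "h \<in> H" "x \<in> R" for h x k
  using that by (induction k) (auto intro: maps)
 have pow1: "(h ^^ k) (g x) = g ((h ^^ k) x)" if "h \<in> H" "g \<in> H" "x \<in> R" for h g x k
  using that by (induction k) (auto simp: comm powR)
 have powpow: "(h ^^ k) ((g ^^ l) x) = (g ^^ l) ((h ^^ k) x)" if "h \<in> H" "g \<in> H" "x \<in> R" for h g x k l
  using that by (induction l) (auto simp: pow1 powR)
 have add: "A (\<lambda>x. f x + g x) = (\<lambda>x. A f x + A g x)" if "A \<in> avgs H" for A f g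
  using that by (induction) (auto simp: avg_def sum.distrib add_divide_distrib)
 have scale: "A (\<lambda>x. c * f x) = (\<lambda>x. c * A f x)" if "A \<in> avgs H" for A f c
  using that by (induction) (auto simp: avg_def sum_distrib_left)
 have bound: "A f x \<le> B" if "A \<in> avgs H" "\<And>x. x \<in> R ==> f x \<le> B" "x \<in> R" for A f x and B :: real
  using that(1,3)
 proof (induction arbitrary: x)
  case (avgs_step A h n)
  have "(\<Sum>k\<le>n. A f ((h ^^ k) x)) \<le> (\<Sum>k\<le>n. B)"
   using avgs_step by (intro sum_mono) (auto intro: powR)
  then show ?case
   by (simp add: avg_def divide_le_eq mult.commute)
 qed (use that in auto)
 have loc: "A f x = A g x" if "A \<in> avgs H" "\<And>x. x \<in> R ==> f x = g x" "x \<in> R" for A f g x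
  using that(1,3) by (induction arbitrary: x) (auto simp: avg_def that(2) powR)
 have comp: "(\<lambda>f. A (B f)) \<in> avgs H" if "A \<in> avgs H" "B \<in> avgs H" for A B
  using that(1) by induction (auto intro: that(2) avgs.intros)
 have single: "avg h n (B f) x = B (avg h n f) x" if "B \<in> avgs H" "h \<in> H" "x \<in> R" for B h n f x
  using that(1,3)
 proof (induction arbitrary: x)
  case (avgs_step B g l)
  have "avg h n (avg g l (B f)) x = (\<Sum>k\<le>n. \<Sum>j\<le>l. B f ((g ^^ j) ((h ^^ k) x))) / (Suc n * Suc l)"
   by (simp add: avg_def sum_divide_distrib algebra_simps)
  also have "\<dots> = (\<Sum>j\<le>l. \<Sum>k\<le>n. B f ((h ^^ k) ((g ^^ j) x))) / (Suc n * Suc l)"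
   using avgs_step that(2) by (subst sum.swap) (simp add: powpow)
  also have "\<dots> = avg g l (avg h n (B f)) x"
   by (simp add: avg_def sum_divide_distrib algebra_simps)
  also have "\<dots> = avg g l (B (avg h n f)) x"
   using avgs_step powR by (simp add: avg_def[of g])
  finally show ?case .
 qed simp
 have AB: "A (B f) x = B (A f) x" if "A \<in> avgs H" "B \<in> avgs H" "x \<in> R" for A B f x
  using that(1,3)
 proof (induction arbitrary: x)
  case (avgs_step A h n)
  have "avg h n (A (B f)) x = avg h n (B (A f)) x"
   using avgs_step powR by (simp add: avg_def)
  then show ?case
   using single[OF that(2) avgs_step(2,4)] by simp
 qed simp
 define V :: "('x => real) set" where "V = {f. bfun f}"
 have V: "linear_closed V"
  by (auto simp: V_def linear_closed_def bfun_add bfun_scale)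
 define p where "p f = (INF A\<in>avgs H. SUP x\<in>R. A f x)" for f
 have bA: "bdd_above ((\<lambda>x. A f x) ` R)" if "A \<in> avgs H" "bfun f" for A f
 proof -
  obtain B where B: "\<And>x. f x \<le> B"
   using \<open>bfun f\<close> unfolding bfun_def by (meson abs_le_D1)
  show ?thesis
   by (rule bdd_aboveI2[where M = B]) (use bound[OF that(1) B] in simp)
 qed
 have bB: "bdd_below ((\<lambda>A. SUP x\<in>R. A f x) ` avgs H)" if "bfun f" for f
 proof -
  obtain B where B: "\<And>x. - 1 * f x \<le> B"
   using \<open>bfun f\<close> unfolding bfun_def by (metis abs_le_D2 mult_minus1)
  obtain x where x: "x \<in> R"
   using ne by blast
  have "- B \<le> (SUP x\<in>R. A f x)" if A: "A \<in> avgs H" for A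
  proof -
   have "- A f x \<le> B"
    using bound[OF A, of "\<lambda>x. - 1 * f x" B x] B x scale[OF A, of "-1" f] by simp
   moreover have "A f x \<le> (SUP x\<in>R. A f x)"
    using x by (intro cSUP_upper bA A \<open>bfun f\<close>)
   ultimately show ?thesis by simp
  qed
  then show ?thesis by (intro bdd_belowI2) auto
 qed
 have p_le: "p f \<le> B" if "A \<in> avgs H" "\<And>x. x \<in> R ==> A f x \<le> B" "bfun f" for A f and B :: real
 proof -
  have "p f \<le> (SUP x\<in>R. A f x)"
   unfolding p_def using that by (intro cINF_lower bB)
  also have "\<dots> \<le> B"
   using ne that by (intro cSUP_least) auto
  finally show ?thesis .
 qed
 have p_app: "\<exists>A\<in>avgs H. \<forall>x\<in>R. A f x < r" if pf: "p f < r" "bfun f" for f r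
 proof -
  obtain A where A: "A \<in> avgs H" "(SUP x\<in>R. A f x) < r"
   using pf(1) avgs_id[of H] unfolding p_def by (subst (asm) cINF_less_iff[OF _ bB[OF pf(2)]]) auto
  have "A f x < r" if "x \<in> R" for x
   using cSUP_upper[OF that bA[OF A(1) \<open>bfun f\<close>]] A(2) by simp
  then show ?thesis using A by blast
 qed
 have sub: "sublinear V p"
  unfolding sublinear_def V_def
 proof safe
  fix f g :: "'x => real" assume f: "bfun f" and g: "bfun g"
  show "p (\<lambda>x. f x + g x) \<le> p f + p g"
  proof (rule field_le_epsilon)
   fix e :: real assume "0 < e"
   obtain A where A: "A \<in> avgs H" "\<And>x. x \<in> R ==> A f x < p f + e / 2"
    using p_app[OF _ f, of "p f + e / 2"] \<open>0 < e\<close> by auto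
   obtain B where B: "B \<in> avgs H" "\<And>x. x \<in> R ==> B g x < p g + e / 2"
    using p_app[OF _ g, of "p g + e / 2"] \<open>0 < e\<close> by auto
   \<comment> \<open>The composition of \<open>A\<close>, good for \<open>f\<close>, with
     \<open>B\<close>, good for \<open>g\<close>, is good for both: since they commute, either of
     them may be applied first.\<close>
   show "p (\<lambda>x. f x + g x) \<le> p f + p g + e"
   proof (rule p_le[OF comp[OF A(1) B(1)]])
    fix x assume x: "x \<in> R"
    have "A (B (\<lambda>x. f x + g x)) x = B (A f) x + A (B g) x"
     using AB[OF A(1) B(1) x, of f] by (simp add: add[OF A(1)] add[OF B(1)])
    moreover have "B (A f) x \<le> p f + e / 2"
     using A(2) by (intro bound[OF B(1) _ x]) (auto intro: less_imp_le)
    moreover have "A (B g) x \<le> p g + e / 2"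
     using B(2) by (intro bound[OF A(1) _ x]) (auto intro: less_imp_le)
    ultimately show "A (B (\<lambda>x. f x + g x)) x \<le> p f + p g + e"
     by simp
   qed (use f g in \<open>rule bfun_add\<close>)
  qed
 next
  fix c :: real and f :: "'x => real" assume c: "0 < c" and f: "bfun f"
  show "p (\<lambda>x. c * f x) \<le> c * p f"
  proof (rule field_le_epsilon)
   fix e :: real assume "0 < e"
   then obtain A where A: "A \<in> avgs H" "\<And>x. x \<in> R ==> A f x < p f + e / c"
    using p_app[OF _ f, of "p f + e / c"] c by auto
   show "p (\<lambda>x. c * f x) \<le> c * p f + e"
   proof (rule p_le[OF A(1)])
    fix x assume "x \<in> R"
    then have "c * A f x \<le> c * (p f + e / c)"
     using A(2) c by (intro mult_left_mono) (auto intro: less_imp_le)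
    then show "A (\<lambda>x. c * f x) x \<le> c * p f + e"
     using c by (simp add: scale[OF A(1)] algebra_simps)
   qed (use f in \<open>rule bfun_scale\<close>)
  qed
 qed
 have z0: "(\<lambda>_. 0) \<in> V"
  by (simp add: V_def)
 obtain L where L0: "(\<forall>f\<in>V. \<forall>g\<in>V. L (\<lambda>x. f x + g x) = L f + L g) \<and>
  (\<forall>c. \<forall>f\<in>V. L (\<lambda>x. c * f x) = c * L f) \<and> (\<forall>f\<in>V. L f \<le> p f) \<and> p (\<lambda>_. 0) \<le> L (\<lambda>_. 0)"
  using hahn_banach[OF V sub z0] ..
 have L: "\<And>f g. f \<in> V ==> g \<in> V ==> L (\<lambda>x. f x + g x) = L f + L g"
  "\<And>c f. f \<in> V ==> L (\<lambda>x. c * f x) = c * L f" "\<And>f. f \<in> V ==> L f \<le> p f"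
  using L0 by simp_all
 have L_le: "L f \<le> B" if "bfun f" "\<And>x. x \<in> R ==> f x \<le> B" for f and B :: real
  using L(3)[of f] p_le[OF avgs_id, of f B] that by (simp add: V_def)
 have L_neg: "L (\<lambda>x. - 1 * f x) = - L f" if "bfun f" for f
  using L(2)[of f "-1"] that by (simp add: V_def)
 have "mean R L"
  unfolding mean_def
 proof (intro conjI allI impI)
  fix f :: "'x => real" assume f: "bfun f" "\<forall>x\<in>R. 0 \<le> f x"
  then show "0 \<le> L f"
   using L_le[of "\<lambda>x. - 1 * f x" 0] L_neg[OF f(1)] bfun_scale[OF f(1), of "-1"] by simp
 next
  have "L (\<lambda>x. 1) \<le> 1"
   by (rule L_le) auto
  moreover have "- L (\<lambda>x. 1) \<le> - 1"
   using L_le[of "\<lambda>x. - 1" "-1"] L_neg[of "\<lambda>x. 1"] by simp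
  ultimately show "L (\<lambda>x. 1) = 1"
   by simp
 qed (use L in \<open>auto simp: V_def\<close>)
 moreover have "L (\<lambda>x. f (h x)) = L f" if h: "h \<in> H" and f: "bfun f" for h f
 proof -
  obtain B where B: "\<And>x. \<bar>f x\<bar> \<le> B"
   using f by (auto simp: bfun_def)
  have B0: "0 \<le> B"
   using B[of undefined] by linarith
  have fh: "bfun (\<lambda>x. f (h x))"
   using f by (rule bfun_compose)
  have tele: "avg h n (\<lambda>x. f x - f (h x)) x = (f x - f ((h ^^ Suc n) x)) / Suc n" for n x
  proof -
   have "(\<Sum>k\<le>n. f ((h ^^ k) x) - f ((h ^^ Suc k) x)) = f ((h ^^ 0) x) - f ((h ^^ Suc n) x)"
    using sum_telescope[of "\<lambda>k. f ((h ^^ k) x)" n] by simp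
   then show ?thesis
    by (simp add: avg_def)
  qed
  have avg1: "avg h n \<in> avgs H" for n
   using avgs_step[OF avgs_id h, of n] by simp
  have small: "L (\<lambda>x. s * (f x - f (h x))) \<le> 0" if s: "s \<in> {1, -1}" for s :: real
  proof (rule field_le_epsilon)
   fix e :: real assume e: "0 < e"
   obtain n :: nat where n: "2 * B / e < n"
    using reals_Archimedean2 by blast
   have bs: "bfun (\<lambda>x. s * (f x - f (h x)))"
    using f fh by (intro bfun_scale bfun_diff)
   have "p (\<lambda>x. s * (f x - f (h x))) \<le> e"
   proof (rule p_le[OF avg1[of n] _ bs])
    fix x
    have "avg h n (\<lambda>x. s * (f x - f (h x))) x = s * ((f x - f ((h ^^ Suc n) x)) / Suc n)"
     using scale[OF avg1[of n], of s "\<lambda>x. f x - f (h x)"] tele by (simp add: fun_eq_iff)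
    also have "\<dots> \<le> \<bar>f x - f ((h ^^ Suc n) x)\<bar> / Suc n"
     using s by (auto simp: divide_right_mono abs_le_iff intro!: divide_right_mono)
    also have "\<dots> \<le> 2 * B / Suc n"
     using B[of x] B[of "(h ^^ Suc n) x"] by (intro divide_right_mono) auto
    also have "\<dots> \<le> e"
    proof -
     have "2 * B < e * n"
      using n e by (simp add: field_simps)
     then have "2 * B \<le> e * Suc n"
      using e by (simp add: algebra_simps)
     then show ?thesis by (simp add: divide_le_eq mult.commute)
    qed
    finally show "avg h n (\<lambda>x. s * (f x - f (h x))) x \<le> e" .
   qed
   then show "L (\<lambda>x. s * (f x - f (h x))) \<le> 0 + e"
    using L(3)[of "\<lambda>x. s * (f x - f (h x))"] bs by (simp add: V_def)
  qed
  have eqn: "L (\<lambda>x. s * (f x - f (h x))) = s * (L f - L (\<lambda>x. f (h x)))" for s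
   using mean_diff[OF \<open>mean R L\<close> f fh] mean_scale[OF \<open>mean R L\<close> bfun_diff[OF f fh]] by simp
  have "1 * (L f - L (\<lambda>x. f (h x))) \<le> 0" "- 1 * (L f - L (\<lambda>x. f (h x))) \<le> 0"
   using small[of 1] small[of "-1"] unfolding eqn by simp_all
  then show ?thesis
   by simp
 qed
 ultimately show ?thesis
  using that by blast
qed

lemma fa_measure_sum:
 fixes \<mu> :: "'x set => real"
 assumes add: "\<And>A B. A \<subseteq> G ==> B \<subseteq> G ==> A \<inter> B = {} ==> \<mu> (A \<union> B) = \<mu> A + \<mu> B"
  and "finite T" "\<And>c. c \<in> T ==> A c \<subseteq> G" "\<And>c c'. c \<in> T ==> c' \<in> T ==> c \<noteq> c' ==> A c \<inter> A c' = {}"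
 shows "\<mu> (\<Union>c\<in>T. A c) = (\<Sum>c\<in>T. \<mu> (A c))"
 using assms(2-)
proof (induction T rule: finite_induct)
 case empty
 show ?case
  using add[of "{}" "{}"] by simp
next
 case (insert c T)
 have "\<mu> (A c \<union> (\<Union>c\<in>T. A c)) = \<mu> (A c) + \<mu> (\<Union>c\<in>T. A c)"
  using insert.prems insert.hyps(2) by (intro add) fastforce+
 then show ?case
  using insert by simp
qed

text \<open>Integration against a finitely additive probability measure: \<open>S\<close> integrates
  the functions with finitely many values, and bounded functions are uniform limits of
  these.\<close>

lemma mean_of_fa_measure:
 fixes \<mu> :: "'x set => real"
 assumes nn: "\<And>A. A \<subseteq> G ==> 0 \<le> \<mu> A" and one: "\<mu> G = 1"
  and add: "\<And>A B. A \<subseteq> G ==> B \<subseteq> G ==> A \<inter> B = {} ==> \<mu> (A \<union> B) = \<mu> A + \<mu> B"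
 obtains m where "mean G m"
  "\<And>h f. bij_betw h G G ==> (\<And>A. A \<subseteq> G ==> \<mu> (h ` A) = \<mu> A) ==> bfun f ==> m (\<lambda>x. f (h x)) = m f"
proof -
 define S where "S s = (\<Sum>a\<in>s ` G. a * \<mu> {x \<in> G. s x = a})" for s :: "'x => real"
 \<comment> \<open>Two functions with finitely many values are compared over the partition by their
   joint values, which is why \<open>k\<close> maps into pairs.\<close>
 have Sgen: "S (\<lambda>x. \<phi> (k x)) = (\<Sum>c\<in>k ` G. \<phi> c * \<mu> {x \<in> G. k x = c})"
  if fin: "finite (k ` G)" for k :: "'x => real \<times> real" and \<phi> :: "real \<times> real => real"
 proof -
  have "\<mu> {x \<in> G. \<phi> (k x) = a} = (\<Sum>c\<in>{c \<in> k ` G. \<phi> c = a}. \<mu> {x \<in> G. k x = c})" for a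
  proof -
   have "{x \<in> G. \<phi> (k x) = a} = (\<Union>c\<in>{c \<in> k ` G. \<phi> c = a}. {x \<in> G. k x = c})"
    by auto
   moreover have "\<mu> (\<Union>c\<in>{c \<in> k ` G. \<phi> c = a}. {x \<in> G. k x = c}) =
    (\<Sum>c\<in>{c \<in> k ` G. \<phi> c = a}. \<mu> {x \<in> G. k x = c})"
    by (rule fa_measure_sum[OF add]) (use fin in \<open>simp_all, blast+\<close>)
   ultimately show ?thesis by simp
  qed
  then have "S (\<lambda>x. \<phi> (k x)) = (\<Sum>a\<in>\<phi> ` k ` G. \<Sum>c\<in>{c \<in> k ` G. \<phi> c = a}. \<phi> c * \<mu> {x \<in> G. k x = c})"
   by (simp add: S_def image_image sum_distrib_left)
  also have "\<dots> = (\<Sum>c\<in>k ` G. \<phi> c * \<mu> {x \<in> G. k x = c})"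
   using fin by (intro sum.group) auto
  finally show ?thesis .
 qed
 have pair: "finite ((\<lambda>x. (s x, t x)) ` G)" if "finite (s ` G)" "finite (t ` G)" for s t :: "'x => real"
  by (rule finite_subset[of _ "s ` G \<times> t ` G"]) (use that in auto)
 have S_add: "S (\<lambda>x. s x + t x) = S s + S t" if f: "finite (s ` G)" "finite (t ` G)" for s t
  using Sgen[OF pair[OF f], of "\<lambda>(a,b). a + b"] Sgen[OF pair[OF f], of fst] Sgen[OF pair[OF f], of snd]
  by (simp add: case_prod_beta sum.distrib algebra_simps)
 have S_scale: "S (\<lambda>x. c * s x) = c * S s" if f: "finite (s ` G)" for s c
  using Sgen[OF pair[OF f f], of "\<lambda>p. c * fst p"] Sgen[OF pair[OF f f], of fst]
  by (simp add: sum_distrib_left algebra_simps)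
 have S_mono: "S s \<le> S t" if f: "finite (s ` G)" "finite (t ` G)" and le: "\<And>x. x \<in> G ==> s x \<le> t x" for s t
 proof -
  have "(\<Sum>c\<in>(\<lambda>x. (s x, t x)) ` G. fst c * \<mu> {x \<in> G. (s x, t x) = c}) \<le>
   (\<Sum>c\<in>(\<lambda>x. (s x, t x)) ` G. snd c * \<mu> {x \<in> G. (s x, t x) = c})"
   using le by (intro sum_mono mult_right_mono nn) auto
  then show ?thesis
   using Sgen[OF pair[OF f], of fst] Sgen[OF pair[OF f], of snd] by simp
 qed
 have Gne: "G \<noteq> {}"
  using add[of "{}" "{}"] one by auto
 have S_const: "S (\<lambda>x. c) = c" for c
  using one Gne by (simp add: S_def image_constant_conv)
 have S_near: "\<bar>S s - S t\<bar> \<le> e" if f: "finite (s ` G)" "finite (t ` G)"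
  and le: "\<And>x. x \<in> G ==> \<bar>s x - t x\<bar> \<le> e" for s t e
 proof -
  have fe: "finite ((\<lambda>x. t x + e) ` G)" "finite ((\<lambda>x. s x + e) ` G)" "finite ((\<lambda>x. e) ` G)"
   using f finite_imageI[of "t ` G" "\<lambda>a. a + e"] finite_imageI[of "s ` G" "\<lambda>a. a + e"]
   by (auto simp: image_image image_constant_conv)
  have "S s \<le> S (\<lambda>x. t x + e)" "S t \<le> S (\<lambda>x. s x + e)"
   using le f fe by (intro S_mono; fastforce simp: abs_le_iff)+
  then show ?thesis
   using S_add[OF f(1) fe(3)] S_add[OF f(2) fe(3)] S_const by (auto simp: abs_le_iff)
 qed
 define app where "app f s e \<longleftrightarrow> finite (s ` G) \<and> (\<forall>x\<in>G. \<bar>f x - s x\<bar> \<le> e)" for f s :: "'x => real" and e :: real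
 have app_ex: "\<exists>s. app f s e" if "bfun f" "0 < e" for f e
 proof -
  obtain B where B: "\<And>x. \<bar>f x\<bar> \<le> B"
   using \<open>bfun f\<close> by (auto simp: bfun_def)
  define s where "s x = e * of_int \<lfloor>f x / e\<rfloor>" for x
  have "s ` G \<subseteq> (\<lambda>j. e * of_int j) ` {\<lfloor>- B / e\<rfloor>..\<lfloor>B / e\<rfloor>}"
  proof
   fix y assume "y \<in> s ` G"
   then obtain x where x: "y = e * of_int \<lfloor>f x / e\<rfloor>" by (auto simp: s_def)
   have "- B \<le> f x" "f x \<le> B"
    using B[of x] by auto
   then have "- B / e \<le> f x / e" "f x / e \<le> B / e"
    using that(2) by (intro divide_right_mono; simp)+
   then have "\<lfloor>f x / e\<rfloor> \<in> {\<lfloor>- B / e\<rfloor>..\<lfloor>B / e\<rfloor>}"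
    by (simp add: floor_mono del: minus_divide_left)
   then show "y \<in> (\<lambda>j. e * of_int j) ` {\<lfloor>- B / e\<rfloor>..\<lfloor>B / e\<rfloor>}"
    using x by blast
  qed
  then have "finite (s ` G)"
   by (rule finite_subset) simp
  moreover have "\<bar>f x - s x\<bar> \<le> e" for x
  proof -
   define j :: real where "j = of_int \<lfloor>f x / e\<rfloor>"
   have "j \<le> f x / e" "f x / e \<le> j + 1"
    unfolding j_def by linarith+
   then have "e * j \<le> f x" "f x \<le> e * j + e"
    using that(2) by (simp_all add: field_simps)
   then have "e * of_int \<lfloor>f x / e\<rfloor> \<le> f x" "f x \<le> e * of_int \<lfloor>f x / e\<rfloor> + e"
    by (simp_all add: j_def)
   then show ?thesis
    by (simp add: s_def abs_le_iff)
  qed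
  ultimately show ?thesis
   by (auto simp: app_def)
 qed
 have app_near: "\<bar>S s - S t\<bar> \<le> e + e'" if "app f s e" "app f t e'" for f s t e e'
 proof (rule S_near)
  show "\<bar>s x - t x\<bar> \<le> e + e'" if "x \<in> G" for x
  proof -
   have "\<bar>f x - s x\<bar> \<le> e" "\<bar>f x - t x\<bar> \<le> e'"
    using \<open>app f s e\<close> \<open>app f t e'\<close> that by (auto simp: app_def)
   then show ?thesis by linarith
  qed
 qed (use that in \<open>auto simp: app_def\<close>)
 \<comment> \<open>By \<open>app_near\<close> the intervals around \<open>S s\<close> of radius
   \<open>e\<close> meet pairwise; the supremum of their lower ends lies in all of them.\<close>
 define m where "m f = Sup {S s - e | s e. app f s e}" for f
 have m: "\<bar>m f - S s\<bar> \<le> e" if f: "bfun f" and s: "app f s e" for f s e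
 proof -
  have up: "r \<le> S s + e" if "r \<in> {S s - e | s e. app f s e}" for r
   using that app_near[OF _ s] by (fastforce simp: abs_le_iff)
  have "S s - e \<le> m f"
   unfolding m_def using s up by (intro cSup_upper bdd_aboveI) auto
  moreover have "m f \<le> S s + e"
   unfolding m_def using s up by (intro cSup_least) auto
  ultimately show ?thesis
   by (auto simp: abs_le_iff)
 qed
 have "mean G m"
  unfolding mean_def
 proof (intro conjI allI impI)
  fix f g :: "'x => real" assume f: "bfun f" and g: "bfun g"
  have "\<bar>m (\<lambda>x. f x + g x) - (m f + m g)\<bar> \<le> 0 + e" if e0: "0 < e" for e
  proof -
   obtain s t where s: "app f s (e/4)" and t: "app g t (e/4)"
    using app_ex[OF f, of "e/4"] app_ex[OF g, of "e/4"] e0 by auto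
   have fin: "finite (s ` G)" "finite (t ` G)"
    using s t by (auto simp: app_def)
   have "finite ((\<lambda>x. s x + t x) ` G)"
    using finite_imageI[OF pair[OF fin], of "\<lambda>(a,b). a + b"] by (simp add: image_image)
   moreover have "\<bar>f x + g x - (s x + t x)\<bar> \<le> e / 4 + e / 4" if "x \<in> G" for x
   proof -
    have "\<bar>f x - s x\<bar> \<le> e / 4" "\<bar>g x - t x\<bar> \<le> e / 4"
     using s t that by (auto simp: app_def)
    then show ?thesis by linarith
   qed
   ultimately have ap: "app (\<lambda>x. f x + g x) (\<lambda>x. s x + t x) (e/4 + e/4)"
    by (simp add: app_def)
   show ?thesis
    using m[OF bfun_add[OF f g] ap] m[OF f s] m[OF g t] S_add[OF fin] by linarith
  qed
  then have "\<bar>m (\<lambda>x. f x + g x) - (m f + m g)\<bar> \<le> 0"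
   by (rule field_le_epsilon)
  then show "m (\<lambda>x. f x + g x) = m f + m g" by simp
 next
  fix c :: real and f :: "'x => real" assume f: "bfun f"
  have "\<bar>m (\<lambda>x. c * f x) - c * m f\<bar> \<le> 0 + e" if e0: "0 < e" for e
  proof -
   define k where "k = e / (2 * (\<bar>c\<bar> + 1))"
   have k: "0 < k" "\<bar>c\<bar> * k \<le> e / 2"
    using that by (auto simp: k_def field_simps)
   obtain s where s: "app f s k"
    using app_ex[OF f k(1)] by auto
   have fin: "finite (s ` G)"
    using s by (auto simp: app_def)
   have "finite ((\<lambda>x. c * s x) ` G)"
    using finite_imageI[OF fin, of "\<lambda>a. c * a"] by (simp add: image_image)
   moreover have "\<bar>c * f x - c * s x\<bar> \<le> \<bar>c\<bar> * k" if "x \<in> G" for x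
   proof -
    have "\<bar>f x - s x\<bar> \<le> k"
     using s that by (auto simp: app_def)
    then show ?thesis
     by (simp add: abs_mult mult_left_mono flip: right_diff_distrib)
   qed
   ultimately have ap: "app (\<lambda>x. c * f x) (\<lambda>x. c * s x) (\<bar>c\<bar> * k)"
    by (simp add: app_def)
   have "\<bar>m (\<lambda>x. c * f x) - c * S s\<bar> \<le> \<bar>c\<bar> * k"
    using m[OF bfun_scale[OF f] ap] S_scale[OF fin] by simp
   moreover have "\<bar>c * m f - c * S s\<bar> \<le> \<bar>c\<bar> * k"
    using m[OF f s] by (simp add: abs_mult mult_left_mono flip: right_diff_distrib)
   ultimately show ?thesis
    using k by linarith
  qed
  then have "\<bar>m (\<lambda>x. c * f x) - c * m f\<bar> \<le> 0"
   by (rule field_le_epsilon)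
  then show "m (\<lambda>x. c * f x) = c * m f" by simp
 next
  fix f :: "'x => real" assume f: "bfun f" "\<forall>x\<in>G. 0 \<le> f x"
  have "- m f \<le> 0 + e" if e0: "0 < e" for e
  proof -
   obtain s where s: "app f s (e/2)"
    using app_ex[OF f(1), of "e/2"] e0 by auto
   have "S (\<lambda>x. - e / 2) \<le> S s"
   proof (rule S_mono)
    show "- e / 2 \<le> s x" if "x \<in> G" for x
    proof -
     have "\<bar>f x - s x\<bar> \<le> e / 2" "0 \<le> f x"
      using s f that by (auto simp: app_def)
     then show ?thesis by linarith
    qed
   qed (use s in \<open>auto simp: app_def image_constant_conv\<close>)
   then show ?thesis
    using m[OF f(1) s] S_const[of "- e / 2"] by linarith
  qed
  then have "- m f \<le> 0"
   by (rule field_le_epsilon)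
  then show "0 \<le> m f" by simp
 next
  have ap: "app (\<lambda>x. 1) (\<lambda>x. 1) 0"
   by (auto simp: app_def image_constant_conv)
  show "m (\<lambda>x. 1) = 1"
   using m[OF bfun_const ap] S_const[of 1] by simp
 qed
 moreover have "m (\<lambda>x. f (h x)) = m f"
  if h: "bij_betw h G G" and inv: "\<And>A. A \<subseteq> G ==> \<mu> (h ` A) = \<mu> A" and f: "bfun f" for h f
 proof -
  have hG: "h ` G = G" "\<And>x. x \<in> G ==> h x \<in> G"
   using h by (auto simp: bij_betw_def)
  have "\<bar>m (\<lambda>x. f (h x)) - m f\<bar> \<le> 0 + e" if e0: "0 < e" for e
  proof -
   obtain s where s: "app f s (e/2)"
    using app_ex[OF f, of "e/2"] e0 by auto
   have im: "(\<lambda>x. s (h x)) ` G = s ` G"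
    using hG(1) by (metis image_image)
   have ap: "app (\<lambda>x. f (h x)) (\<lambda>x. s (h x)) (e/2)"
    using s hG(2) by (auto simp: app_def im)
   have "S (\<lambda>x. s (h x)) = S s"
   proof -
    have "\<mu> {x \<in> G. s (h x) = a} = \<mu> {x \<in> G. s x = a}" for a
    proof -
     have "h ` {x \<in> G. s (h x) = a} = {x \<in> G. s x = a}"
      using hG by force
     then show ?thesis
      using inv[of "{x \<in> G. s (h x) = a}"] by auto
    qed
    then show ?thesis
     by (simp add: S_def im)
   qed
   then show ?thesis
    using m[OF bfun_compose[OF f] ap] m[OF f s] by linarith
  qed
  then have "\<bar>m (\<lambda>x. f (h x)) - m f\<bar> \<le> 0"
   by (rule field_le_epsilon)
  then show ?thesis by simp
 qed
 ultimately show ?thesis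
  using that by blast
qed

subsection \<open>Iterated products of means\<close>

text \<open>The variables form a list, outermost first, because finitely additive means obey no
  Fubini theorem and the order matters. Arguments are \<open>undefined\<close> off the list, in
  accordance with \<open>PiE\<close>.\<close>

primrec prodmean :: "'g list => ('g => ('x => real) => real) => (('g => 'x) => real) => real" where
 "prodmean [] \<mu> f = f (\<lambda>_. undefined)"
| "prodmean (g # gs) \<mu> f = \<mu> g (\<lambda>x. prodmean gs \<mu> (\<lambda>c. f (c(g := x))))"

lemma prodmean_bound:
 assumes "\<And>g. g \<in> set gs ==> mean (R g) (\<mu> g)" "\<And>c. \<bar>f c\<bar> \<le> B"
 shows "\<bar>prodmean gs \<mu> f\<bar> \<le> B"
 using assms
proof (induction gs arbitrary: f)
 case (Cons g gs)
 have b: "\<bar>prodmean gs \<mu> (\<lambda>c. f (c(g := x)))\<bar> \<le> B" for x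
  using Cons.prems by (intro Cons.IH) auto
 then have "bfun (\<lambda>x. prodmean gs \<mu> (\<lambda>c. f (c(g := x))))"
  by (rule bfunI)
 then show ?case
  using mean_bound[of "R g" "\<mu> g" "\<lambda>x. prodmean gs \<mu> (\<lambda>c. f (c(g := x)))" B] Cons.prems(1) b by simp
qed auto

lemma bfun_prodmean:
 assumes "\<And>g. g \<in> set gs ==> mean (R g) (\<mu> g)" "bfun f"
 shows "bfun (\<lambda>x. prodmean gs \<mu> (\<lambda>c. f (h x c)))"
proof -
 obtain B where "\<And>c. \<bar>f c\<bar> \<le> B"
  using assms(2) by (auto simp: bfun_def)
 then show ?thesis
  using assms(1) by (intro bfunI[of _ B] prodmean_bound) auto
qed

lemma prodmean_cong:
 assumes "\<And>g. g \<in> set gs ==> mean (R g) (\<mu> g)" "bfun f" "bfun f'" "distinct gs"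
  "\<And>c. c \<in> Pi\<^sub>E (set gs) R ==> f c = f' c"
 shows "prodmean gs \<mu> f = prodmean gs \<mu> f'"
 using assms
proof (induction gs arbitrary: f f')
 case (Cons g gs)
 have "prodmean gs \<mu> (\<lambda>c. f (c(g := x))) = prodmean gs \<mu> (\<lambda>c. f' (c(g := x)))" if x: "x \<in> R g" for x
 proof (rule Cons.IH)
  show "f (c(g := x)) = f' (c(g := x))" if "c \<in> Pi\<^sub>E (set gs) R" for c
   using that x Cons.prems(4) by (intro Cons.prems(5)) (auto simp: PiE_def extensional_def)
  show "bfun (\<lambda>c. f (c(g := x)))" "bfun (\<lambda>c. f' (c(g := x)))"
   using bfun_compose[of f "\<lambda>c. c(g := x)"] bfun_compose[of f' "\<lambda>c. c(g := x)"] Cons.prems by blast+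
 qed (use Cons.prems in auto)
 then show ?case
  using Cons.prems(1)[of g] bfun_prodmean[of gs R \<mu> f "\<lambda>x c. c(g := x)"]
   bfun_prodmean[of gs R \<mu> f' "\<lambda>x c. c(g := x)"] Cons.prems
  by (auto intro!: mean_cong[of "R g" "\<mu> g"])
qed (auto simp: PiE_def extensional_def)

text \<open>Separates outer from inner variables, so that the inner ones can be transformed in a way
  that depends on the outer ones.\<close>

lemma prodmean_append:
 assumes "\<And>g. g \<in> set (xs @ ys) ==> mean (R g) (\<mu> g)" "bfun f" "distinct (xs @ ys)"
 shows "prodmean (xs @ ys) \<mu> f =
  prodmean xs \<mu> (\<lambda>c. prodmean ys \<mu> (\<lambda>c'. f (\<lambda>g. if g \<in> set ys then c' g else c g)))"
 using assms
proof (induction xs arbitrary: f)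
 case Nil
 have "prodmean ys \<mu> f = prodmean ys \<mu> (\<lambda>c'. f (\<lambda>g. if g \<in> set ys then c' g else undefined))"
 proof (rule prodmean_cong)
  show "f c = f (\<lambda>g. if g \<in> set ys then c g else undefined)" if "c \<in> Pi\<^sub>E (set ys) R" for c
  proof -
   have "c = (\<lambda>g. if g \<in> set ys then c g else undefined)"
    using that by (auto simp: PiE_def extensional_def)
   then show ?thesis by simp
  qed
 qed (use Nil bfun_compose[of f "\<lambda>c g. if g \<in> set ys then c g else undefined"] in auto)
 then show ?case by simp
next
 case (Cons x xs)
 have "prodmean (xs @ ys) \<mu> (\<lambda>c. f (c(x := v))) = prodmean xs \<mu> (\<lambda>c. prodmean ys \<mu>
  (\<lambda>c'. f (\<lambda>g. if g \<in> set ys then c' g else (c(x := v)) g)))" for v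
 proof -
  have "(\<lambda>g. if g \<in> set ys then c' g else c g)(x := v) = (\<lambda>g. if g \<in> set ys then c' g else (c(x := v)) g)" for c c'
   using Cons.prems(3) by auto
  then show ?thesis
   using Cons.IH[of "\<lambda>c. f (c(x := v))"] Cons.prems bfun_compose[of f "\<lambda>c. c(x := v)"] by simp
 qed
 then show ?case by simp
qed

text \<open>Variables on which the integrand does not depend drop out because means are normalised.
  The remaining ones keep their order, hence the equation between lists.\<close>

lemma prodmean_reindex:
 assumes "\<And>g. g \<in> set gs ==> mean (R g) (\<mu> g)" "bfun F" "distinct gs" "map j hs = filter Q gs"
 shows "prodmean gs \<mu> (\<lambda>c. F (\<lambda>h. if h \<in> set hs then c (j h) else undefined)) = prodmean hs (\<lambda>h. \<mu> (j h)) F"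
 using assms
proof (induction gs arbitrary: hs F)
 case (Cons g gs)
 have notin: "g \<notin> j ` set hs'" if "map j hs' = filter Q gs" for hs'
 proof -
  have "j ` set hs' = set (filter Q gs)"
   using that by (metis list.set_map)
  then show ?thesis
   using Cons.prems(3) by auto
 qed
 show ?case
 proof (cases "Q g")
  case True
  then obtain h hs' where hs: "hs = h # hs'" "j h = g" "map j hs' = filter Q gs"
   using Cons.prems(4) by (cases hs) auto
  have hh: "h \<notin> set hs'"
   using notin[OF hs(3)] hs(2) by auto
  have "prodmean gs \<mu> (\<lambda>c. F (\<lambda>h. if h \<in> set hs then (c(g := x)) (j h) else undefined)) =
   prodmean hs' (\<lambda>h. \<mu> (j h)) (\<lambda>c. F (c(h := x)))" for x
  proof -
   have "(\<lambda>k. if k \<in> set hs then (c(g := x)) (j k) else undefined) =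
    (\<lambda>k. if k \<in> set hs' then c (j k) else undefined)(h := x)" for c
   proof
    fix k
    show "(if k \<in> set hs then (c(g := x)) (j k) else undefined) =
     ((\<lambda>k. if k \<in> set hs' then c (j k) else undefined)(h := x)) k"
    proof (cases "k = h")
     case False
     have "j k \<noteq> g" if "k \<in> set hs'"
      using notin[OF hs(3)] that by blast
     then show ?thesis
      using False hs(1) by simp
    qed (use hs in simp)
   qed
   then show ?thesis
    using Cons.IH[of "\<lambda>c. F (c(h := x))" hs'] Cons.prems hs(3) bfun_compose[of F "\<lambda>c. c(h := x)"] by simp
  qed
  then show ?thesis
   using hs by simp
 next
  case False
  then have eq: "map j hs = filter Q gs"
   using Cons.prems(4) by simp
  have ee: "(\<lambda>k. if k \<in> set hs then (c(g := x)) (j k) else undefined) =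
   (\<lambda>k. if k \<in> set hs then c (j k) else undefined)" for c x
   using notin[OF eq] by (auto simp: fun_eq_iff)
  have "(\<lambda>c. F (\<lambda>k. if k \<in> set hs then (c(g := x)) (j k) else undefined)) =
   (\<lambda>c. F (\<lambda>k. if k \<in> set hs then c (j k) else undefined))" for x
   by (rule ext, rule arg_cong[of _ _ F], rule ee)
  moreover have "prodmean gs \<mu> (\<lambda>c. F (\<lambda>k. if k \<in> set hs then c (j k) else undefined)) =
   prodmean hs (\<lambda>h. \<mu> (j h)) F"
   using Cons.prems by (intro Cons.IH[OF _ Cons.prems(2) _ eq]) auto
  ultimately have "prodmean gs \<mu> (\<lambda>c. F (\<lambda>k. if k \<in> set hs then (c(g := x)) (j k) else undefined)) =
   prodmean hs (\<lambda>h. \<mu> (j h)) F" for x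
   by (simp only:)
  then show ?thesis
   using mean_const[OF Cons.prems(1)[of g]] by simp
 qed
qed simp

lemma prodmean_transport:
 assumes "\<And>h. h \<in> set hs ==> mean (R h) (\<mu> h)" "\<And>h. h \<in> set hs ==> mean (R' h) (\<mu>' h)"
  "bfun F" "distinct hs" "\<And>h f. h \<in> set hs ==> bfun f ==> \<mu>' h f = \<mu> h (\<lambda>x. f (t h x))"
 shows "prodmean hs \<mu> (\<lambda>c. F (\<lambda>h. if h \<in> set hs then t h (c h) else undefined)) = prodmean hs \<mu>' F"
 using assms
proof (induction hs arbitrary: F)
 case (Cons g hs)
 have "prodmean hs \<mu> (\<lambda>c. F (\<lambda>h. if h \<in> set (g # hs) then t h ((c(g := x)) h) else undefined)) =
  prodmean hs \<mu>' (\<lambda>c. F (c(g := t g x)))" for x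
 proof -
  have "(\<lambda>h. if h \<in> set (g # hs) then t h ((c(g := x)) h) else undefined) =
   (\<lambda>h. if h \<in> set hs then t h (c h) else undefined)(g := t g x)" for c
   using Cons.prems(4) by (auto simp: fun_eq_iff)
  then show ?thesis
   using Cons.IH[of "\<lambda>c. F (c(g := t g x))"] Cons.prems bfun_compose[of F "\<lambda>c. c(g := t g x)"] by simp
 qed
 moreover have "\<mu>' g (\<lambda>y. prodmean hs \<mu>' (\<lambda>c. F (c(g := y)))) = \<mu> g (\<lambda>x. prodmean hs \<mu>' (\<lambda>c. F (c(g := t g x))))"
  using Cons.prems(5)[of g "\<lambda>y. prodmean hs \<mu>' (\<lambda>c. F (c(g := y)))"]
   bfun_prodmean[of hs R' \<mu>' F "\<lambda>y c. c(g := y)"] Cons.prems by simp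
 ultimately show ?case by simp
qed simp

section \<open>Random cones\<close>

context kan begin

text \<open>Passage of a filler from face 2 to face 1 through a variant of \<open>D\<close>: one
  half of a translation along the vertex 1. These two faces are the ones related when the vertex 1
  of a cone gives way to the vertex 2.\<close>

definition tr :: "nat => 's => 's => 's" where
 "tr m D z = rep m (SOME u. \<exists>D'\<in>K (Suc m). agree m 1 D D' \<and> d (Suc m) 2 D' = z \<and> d (Suc m) 1 D' = u)"

text \<open>Two variants of \<open>D\<close> with the same face 2 fill the same horn, so their faces
  1 are homotopic and have one representative.\<close>

lemma tr_eq:
 assumes "1 \<le> m" "D' \<in> K (Suc m)" "agree m 1 D D'"
 shows "tr m D (d (Suc m) 2 D') = rep m (d (Suc m) 1 D')"
proof -
 let ?P = "\<lambda>u. \<exists>D''\<in>K (Suc m). agree m 1 D D'' \<and> d (Suc m) 2 D'' = d (Suc m) 2 D' \<and> d (Suc m) 1 D'' = u"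
 have "?P (d (Suc m) 1 D')"
  using assms by blast
 then have "?P (SOME u. ?P u)"
  by (rule someI)
 then obtain D'' where D'': "D''\<in>K (Suc m)" "agree m 1 D D''" "d (Suc m) 2 D'' = d (Suc m) 2 D'"
  "d (Suc m) 1 D'' = (SOME u. ?P u)"
  by blast
 have "hom m (d (Suc m) 1 D'') (d (Suc m) 1 D')"
 proof (rule hom_index)
  show "d (Suc m) k D'' = d (Suc m) k D'" if "k \<le> Suc m" "k \<noteq> 1" for k
   using that D''(2,3) assms(3) by (cases "k = 2") (simp_all add: agree_def numeral_2_eq_2)
 qed (use D'' assms in auto)
 then show ?thesis
  unfolding tr_def using rep_eq[OF _ assms(1)] D''(4) by simp
qed

lemma fc_image:
 assumes "strict_mono f" "v \<in> B"
 shows "fc (f ` B) (f v) t = fc B v t"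
proof -
 have "inj_on f B" "strict_mono_on B f"
  using assms(1) by (auto simp: strict_mono_eq inj_on_def strict_mono_on_def strict_mono_def)
 then show ?thesis
  using pos_image[of B f v] assms(2) by (simp add: fc_def card_image)
qed

lemma image_Diff_singleton: "strict_mono (f :: nat => nat) ==> f ` (B - {v}) = f ` B - {f v}"
 by (auto simp: strict_mono_eq)

lemma fam_image:
 assumes f: "strict_mono f" and s: "fam F' s" and F: "\<And>B. B \<in> F ==> f ` B \<in> F'"
  and down: "\<And>B v. B \<in> F ==> v \<in> B ==> 2 \<le> card B ==> B - {v} \<in> F"
 shows "fam F (\<lambda>B. s (f ` B))"
 unfolding fam_def
proof (intro ballI conjI impI)
 fix B assume B: "B \<in> F"
 have inj: "inj_on f B"
  using f by (auto simp: strict_mono_eq inj_on_def)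
 note fB = famD[OF s F[OF B]]
 show "finite B" "B \<noteq> {}"
  using fB(1,2) inj finite_imageD by auto
 show "s (f ` B) \<in> K (card B - 1)"
  using fB(3) inj by (simp add: card_image)
 fix v assume v: "2 \<le> card B" "v \<in> B"
 show "B - {v} \<in> F"
  using down B v by blast
 show "fc B v (s (f ` B)) = s (f ` (B - {v}))"
  using fB(5)[of "f v"] v inj f by (simp add: card_image fc_image image_Diff_singleton)
qed

lemma fill_image:
 assumes "strict_mono f" "fill s (f ` B)"
 shows "fill (\<lambda>B. s (f ` B)) B"
proof -
 have "inj_on f B"
  using assms(1) by (auto simp: strict_mono_eq inj_on_def)
 then show ?thesis
  using assms unfolding fill_def by (auto simp: card_image fc_image image_Diff_singleton)
qed

lemma fill_cong: "fill s A ==> (\<And>v. v \<in> A ==> s' (A - {v}) = s (A - {v})) ==> fill s' A"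
 unfolding fill_def by auto

end

section \<open>Lists of the subsets of a given size, in a fixed order\<close>

primrec Ls :: "nat => nat list => nat set list" where
 "Ls r [] = (if r = 0 then [{}] else [])"
| "Ls r (x # xs) = (if r = 0 then [{}] else map (insert x) (Ls (r - 1) xs) @ Ls r xs)"

lemma Ls_0 [simp]: "Ls 0 xs = [{}]"
 by (cases xs) auto

lemma set_Ls: "distinct xs ==> set (Ls r xs) = {H. H \<subseteq> set xs \<and> card H = r}"
proof (induction xs arbitrary: r)
 case Nil
 then show ?case by auto
next
 case (Cons x xs)
 show ?case
 proof (cases r)
  case 0
  have "H = {}" if "H \<subseteq> set (x # xs)" "card H = 0" for H
   using that finite_subset[of H "set (x # xs)"] by auto
  then show ?thesis
   using 0 by auto
 next
  case (Suc q)
  have "{H. H \<subseteq> set (x # xs) \<and> card H = Suc q} =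
   insert x ` {H. H \<subseteq> set xs \<and> card H = q} \<union> {H. H \<subseteq> set xs \<and> card H = Suc q}" (is "?L = ?R")
  proof
   show "?L \<subseteq> ?R"
   proof
    fix H assume H: "H \<in> ?L"
    have fin: "finite H"
     using H finite_subset[of H "set (x # xs)"] by auto
    show "H \<in> ?R"
    proof (cases "x \<in> H")
     case True
     then have "H = insert x (H - {x})" "H - {x} \<subseteq> set xs" "card (H - {x}) = q"
      using H fin by auto
     then show ?thesis by blast
    next
     case False
     then show ?thesis using H by auto
    qed
   qed
   show "?R \<subseteq> ?L"
   proof
    fix H assume "H \<in> ?R"
    then consider J where "J \<subseteq> set xs" "card J = q" "H = insert x J" | "H \<subseteq> set xs" "card H = Suc q"
     by auto
    then show "H \<in> ?L"
    proof cases
     case 1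
     then have "finite J" "x \<notin> J"
      using Cons.prems finite_subset[of J "set xs"] by auto
     then show ?thesis using 1 by auto
    qed auto
   qed
  qed
  then show ?thesis
   using Cons Suc by simp
 qed
qed

lemma distinct_Ls: "distinct xs ==> distinct (Ls r xs)"
proof (induction xs arbitrary: r)
 case (Cons x xs)
 show ?case
 proof (cases r)
  case (Suc q)
  have "inj_on (insert x) (set (Ls q xs))"
   using Cons.prems by (auto simp: inj_on_def set_Ls)
  moreover have "insert x ` set (Ls q xs) \<inter> set (Ls (Suc q) xs) = {}"
   using Cons.prems by (auto simp: set_Ls)
  ultimately show ?thesis
   using Cons Suc by (simp add: distinct_map)
 qed simp
qed simp

text \<open>An equation between lists and not merely between sets: the order of integration has to
  survive relabelling, and in \<open>filter_Ls\<close> also the deletion of a vertex.\<close>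

lemma map_Ls: "map ((`) f) (Ls r xs) = Ls r (map f xs)"
proof (induction xs arbitrary: r)
 case (Cons x xs)
 have "map ((`) f) (map (insert x) (Ls q xs)) = map (insert (f x)) (map ((`) f) (Ls q xs))" for q
  by simp
 then show ?case
  using Cons by simp
qed simp

lemma filter_Ls: "filter (\<lambda>H. v \<notin> H) (Ls r xs) = Ls r (filter (\<lambda>x. x \<noteq> v) xs)"
proof (induction xs arbitrary: r)
 case (Cons x xs)
 show ?case
 proof (cases "x = v")
  case True
  then have "filter (\<lambda>H. v \<notin> H) (map (insert x) (Ls q xs)) = []" for q
   by (auto simp: filter_empty_conv)
  then show ?thesis
   using Cons True by simp
 next
  case False
  then have "filter (\<lambda>H. v \<notin> H) (map (insert x) (Ls q xs)) = map (insert x) (filter (\<lambda>H. v \<notin> H) (Ls q xs))" for q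
   by (simp add: filter_map o_def)
  then show ?thesis
   using Cons False by simp
 qed
qed simp

lemma prodmean_mu_cong: "(\<And>g. g \<in> set gs ==> \<mu> g = \<mu>' g) ==> prodmean gs \<mu> f = prodmean gs \<mu>' f"
 by (induction gs arbitrary: f) auto

lemma prodmean_const:
 "(\<And>g. g \<in> set gs ==> mean (R g) (\<mu> g)) ==> prodmean gs \<mu> (\<lambda>c. k) = k"
proof (induction gs)
 case (Cons g gs)
 then show ?case
  using mean_const[of "R g" "\<mu> g" k] by simp
qed simp

section \<open>Partial cones and deletion of a vertex\<close>

definition skip :: "nat => nat => nat" where
 "skip v x = (if x < v then x else Suc x)"

lemma strict_mono_skip: "strict_mono (skip v)"
 by (auto simp: strict_mono_def skip_def)

lemma skip_image_atLeastAtMost: "1 \<le> v ==> v \<le> Suc N ==> skip v ` {1..N} = {1..Suc N} - {v}"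
proof -
 assume v: "1 \<le> v" "v \<le> Suc N"
 have "x \<in> skip v ` {1..N}" if "x \<in> {1..Suc N} - {v}" for x
 proof (cases "x < v")
  case True
  then show ?thesis
   using that v by (intro image_eqI[of _ _ x]) (auto simp: skip_def)
 next
  case False
  then show ?thesis
   using that v by (intro image_eqI[of _ _ "x - 1"]) (auto simp: skip_def)
 qed
 moreover have "skip v ` {1..N} \<subseteq> {1..Suc N} - {v}"
  using v by (auto simp: skip_def)
 ultimately show ?thesis
  by blast
qed

text \<open>The full simplex on \<open>{1..N}\<close>, together with the cone with apex 0 over its
  faces of dimension less than \<open>r\<close>; faces through the apex thus have dimension at most
  \<open>r\<close>.\<close>

definition Asets :: "nat => nat => nat set set" where
 "Asets r N = {B. B \<subseteq> {0..N} \<and> B \<noteq> {} \<and> (0 \<in> B --> card B \<le> Suc r)}"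

lemma Asets_finite: "B \<in> Asets r N ==> finite B"
 by (auto simp: Asets_def intro: finite_subset)

lemma Asets_down: "B \<in> Asets r N ==> 2 \<le> card B ==> B - {v} \<in> Asets r N"
 using Diff_singleton_nonempty[of B v] card_Diff1_le[of B v] by (auto simp: Asets_def)

lemma Asets_mono: "r \<le> r' ==> Asets r N \<subseteq> Asets r' N"
 by (auto simp: Asets_def)

lemma Asets_skip:
 assumes "1 \<le> v" "v \<le> Suc N"
 shows "skip v ` B \<in> Asets r (Suc N) \<longleftrightarrow> B \<in> Asets r N"
proof -
 have inj: "inj_on (skip v) B"
  using strict_mono_skip by (auto simp: strict_mono_eq inj_on_def)
 have "0 \<in> skip v ` B \<longleftrightarrow> 0 \<in> B"
  using assms by (force simp: skip_def split: if_splits)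
 moreover have "skip v ` B \<subseteq> {0..Suc N} \<longleftrightarrow> B \<subseteq> {0..N}"
  using assms by (auto simp: skip_def split: if_splits; fastforce)
 ultimately show ?thesis
  using inj by (auto simp: Asets_def card_image)
qed

text \<open>Restriction to the face opposite the vertex \<open>v\<close>, renumbered without a
  gap.\<close>

definition pull :: "nat => (nat set => 's) => nat set => 's" where
 "pull v y B = y (skip v ` B)"

text \<open>The input of the averaging: a base vertex for every component, joined to each of its
  vertices by an edge, and a mean on the fillers of every boundary that is preserved by transport.
  In dimension one only edges starting at a base vertex carry a mean.\<close>

locale kan_mean = kan K d for K :: "nat => 's set" and d :: "nat => nat => 's => 's" +
 fixes base :: "'s => 's" and mu :: "nat => 's => ('s => real) => real"
 assumes base_edge: "x \<in> K 0 ==> \<exists>e\<in>K 1. d 1 1 e = base x \<and> d 1 0 e = x"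
  and base_const: "e \<in> K 1 ==> base (d 1 1 e) = base (d 1 0 e)"
  and mu_mean: "1 \<le> m ==> x \<in> K m ==> (m = 1 ==> base (d 1 1 x) = d 1 1 x) ==> mean (reps m x) (mu m x)"
  and mu_par: "1 \<le> m ==> par m x x' ==> mu m x = mu m x'"
  and mu_tr: "1 \<le> m ==> D \<in> K (Suc m) ==> (m = 1 ==> base (d 1 1 (d 2 2 D)) = d 1 1 (d 2 2 D)) ==>
   bfun f ==> mu m (d (Suc m) 1 D) f = mu m (d (Suc m) 2 D) (\<lambda>z. f (tr m D z))"
begin

text \<open>The states after stage \<open>r\<close>: the cone has been chosen up to dimension
  \<open>r\<close>. The last clause is the invariant that leaves the next stage unobstructed, as it
  provides fillers for the boundaries through \<open>{0, 1}\<close>. The value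
  \<open>undefined\<close> elsewhere makes states equal as soon as their faces are.\<close>

definition E :: "nat => nat => (nat set => 's) => bool" where
 "E r N y \<longleftrightarrow> fam (Asets r N) y \<and> (\<forall>B. B \<notin> Asets r N --> y B = undefined) \<and> base (y {1}) = y {0} \<and>
   (\<forall>G. G \<subseteq> {2..N} --> card G \<le> r --> fill y (insert 0 (insert 1 G)))"

lemma ED:
 assumes "E r N y"
 shows "fam (Asets r N) y" "B \<notin> Asets r N ==> y B = undefined" "base (y {1}) = y {0}"
  "G \<subseteq> {2..N} ==> card G \<le> r ==> fill y (insert 0 (insert 1 G))"
 using assms by (auto simp: E_def)

lemma E_K: "E r N y ==> B \<in> Asets r N ==> y B \<in> K (card B - 1)"
 using famD(3)[OF ED(1)] .

lemma E_fc: "E r N y ==> B \<in> Asets r N ==> 2 \<le> card B ==> v \<in> B ==> fc B v (y B) = y (B - {v})"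
 using famD(5)[OF ED(1)] .

text \<open>Some filler of the boundary on \<open>insert 0 (insert 1 H)\<close>. It merely names
  this boundary as an argument of \<open>reps\<close> and \<open>mu\<close>.\<close>

definition xf :: "nat => (nat set => 's) => nat set => 's" where
 "xf r y H = (SOME t. t \<in> K (Suc r) \<and> (\<forall>v\<in>insert 0 (insert 1 H).
   fc (insert 0 (insert 1 H)) v t = y (insert 0 (insert 1 H) - {v})))"

lemma card01:
 fixes H :: "nat set"
 shows "H \<subseteq> {2..N} ==> card (insert 0 (insert 1 H)) = Suc (Suc (card H))"
proof -
 assume H: "H \<subseteq> {2..N}"
 then have "finite H" "0 \<notin> insert 1 H" "1 \<notin> H"
  using finite_subset[of H "{2..N}"] by auto
 then show ?thesis by simp
qed

lemma xf:
 assumes "E r N y" "H \<subseteq> {2..N}" "card H = r"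
 shows "xf r y H \<in> K (Suc r)"
  "\<And>v. v \<in> insert 0 (insert 1 H) ==> fc (insert 0 (insert 1 H)) v (xf r y H) = y (insert 0 (insert 1 H) - {v})"
proof -
 have "fill y (insert 0 (insert 1 H))"
  using ED(4)[OF assms(1,2)] assms(3) by simp
 then have "\<exists>t. t \<in> K (Suc r) \<and> (\<forall>v\<in>insert 0 (insert 1 H).
   fc (insert 0 (insert 1 H)) v t = y (insert 0 (insert 1 H) - {v}))"
  using card01[OF assms(2)] assms(3) unfolding fill_def by auto
 from someI_ex[OF this] show "xf r y H \<in> K (Suc r)"
  "\<And>v. v \<in> insert 0 (insert 1 H) ==> fc (insert 0 (insert 1 H)) v (xf r y H) = y (insert 0 (insert 1 H) - {v})"
  unfolding xf_def by blast+
qed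

lemma par_fill:
 assumes "E r N y" "H \<subseteq> {2..N}" "card H = r" "t \<in> K (Suc r)"
  "\<And>v. v \<in> insert 0 (insert 1 H) ==> fc (insert 0 (insert 1 H)) v t = y (insert 0 (insert 1 H) - {v})"
 shows "par (Suc r) t (xf r y H)"
proof -
 have f: "finite (insert 0 (insert 1 H))"
  using assms(2) finite_subset by auto
 show ?thesis
  using xf[OF assms(1-3)] assms(4,5) unfolding par_fc[OF f card01[OF assms(2), unfolded assms(3)]] by simp
qed

lemma reps_fc:
 assumes "E r N y" "H \<subseteq> {2..N}" "card H = r" "c \<in> reps (Suc r) (xf r y H)"
 shows "c \<in> K (Suc r)" "rep (Suc r) c = c"
  "\<And>v. v \<in> insert 0 (insert 1 H) ==> fc (insert 0 (insert 1 H)) v c = y (insert 0 (insert 1 H) - {v})"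
proof -
 have f: "finite (insert 0 (insert 1 H))"
  using assms(2) finite_subset by auto
 show "c \<in> K (Suc r)" "rep (Suc r) c = c"
  using repsD[OF assms(4)] by auto
 have "par (Suc r) c (xf r y H)"
  using repsD[OF assms(4)] by auto
 then have "\<forall>v\<in>insert 0 (insert 1 H). fc (insert 0 (insert 1 H)) v c = fc (insert 0 (insert 1 H)) v (xf r y H)"
  unfolding par_fc[OF f card01[OF assms(2), unfolded assms(3)]] by blast
 then show "\<And>v. v \<in> insert 0 (insert 1 H) ==> fc (insert 0 (insert 1 H)) v c = y (insert 0 (insert 1 H) - {v})"
  using xf(2)[OF assms(1-3)] by metis
qed

text \<open>\<open>t\<close> fills the horn on \<open>insert 1 B\<close> that is open opposite 1.
  The face opposite 0 belongs to the state already; all other faces contain \<open>{0, 1}\<close>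
  and are given by the variables \<open>c\<close>.\<close>

definition hf :: "(nat set => 's) => (nat set => 's) => nat set => 's => bool" where
 "hf y c B t \<longleftrightarrow> t \<in> K (card B) \<and>
   (\<forall>b\<in>B. fc (insert 1 B) b t = (if b = 0 then y (insert 1 (B - {0})) else c (B - {0, b})))"

text \<open>Of the new faces only those through \<open>{0, 1}\<close> are free, with one variable
  \<open>c H\<close> for every \<open>H\<close> of size \<open>r\<close>. A new face through 0 that
  avoids 1 is forced: it closes the horn of \<open>hf\<close>, and \<open>rep\<close> makes it
  independent of the filler.\<close>

definition asm :: "nat => nat => (nat set => 's) => (nat set => 's) => nat set => 's" where
 "asm r N y c B = (if B \<in> Asets r N then y B else if B \<in> Asets (Suc r) N then
   (if 1 \<in> B then c (B - {0, 1}) else rep (Suc r) (fc (insert 1 B) 1 (SOME t. hf y c B t))) else undefined)"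

definition adm :: "nat => nat => (nat set => 's) => (nat set => 's) => bool" where
 "adm r N y c \<longleftrightarrow> (\<forall>H. H \<subseteq> {2..N} --> card H = r --> c H \<in> reps (Suc r) (xf r y H))"

lemma new_set:
 assumes "B \<in> Asets (Suc r) N" "B \<notin> Asets r N"
 shows "0 \<in> B" "card B = Suc (Suc r)" "finite B" "B \<subseteq> {0..N}"
 using assms by (auto simp: Asets_def intro: finite_subset)

text \<open>Any two faces of the horn meet in a set of size \<open>r + 1\<close>, which belongs to
  the old state, and each of them restricts to the old value there; so the horn is
  compatible.\<close>

lemma hf_ex:
 assumes E: "E r N y" and N: "1 \<le> N" and adm: "adm r N y c"
  and B: "B \<in> Asets (Suc r) N" "B \<notin> Asets r N" "1 \<notin> B"
 shows "\<exists>t. hf y c B t"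
proof -
 note nB = new_set[OF B(1,2)]
 define A where "A = insert 1 B"
 have A: "finite A" "card A = Suc (Suc (Suc r))" "1 \<in> A" "0 \<in> A"
  using nB B(3) by (auto simp: A_def)
 have H: "B - {0, b} \<subseteq> {2..N}" "card (B - {0, b}) = r" if "b \<in> B" "b \<noteq> 0" for b
 proof -
  have "x \<in> {2..N}" if x: "x \<in> B - {0,b}" for x
  proof -
   have "x \<noteq> 0" "x \<noteq> 1" "x \<le> N"
    using x nB(4) B(3) by auto
   then show ?thesis by auto
  qed
  then show "B - {0, b} \<subseteq> {2..N}" by blast
  show "card (B - {0, b}) = r"
   using that nB by (simp add: card_Diff_subset)
 qed
 have ins: "insert 0 (insert 1 (B - {0, b})) = A - {b}" if "b \<in> B" "b \<noteq> 0" for b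
  using that nB(1) B(3) by (auto simp: A_def)
 have G: "insert 1 (B - {0}) \<in> Asets r N" "insert 1 (B - {0}) = A - {0}"
  using nB B(3) N by (auto simp: Asets_def A_def)
 define x where "x b = (if b = 0 then y (insert 1 (B - {0})) else c (B - {0, b}))" for b
 have cfc: "c (B - {0, b}) \<in> K (Suc r)" "\<And>v. v \<in> A - {b} ==> fc (A - {b}) v (c (B - {0, b})) = y (A - {b} - {v})"
  if b: "b \<in> B" "b \<noteq> 0" for b
 proof -
  have cr: "c (B - {0, b}) \<in> reps (Suc r) (xf r y (B - {0, b}))"
   using adm H[OF b] by (simp add: adm_def)
  show "c (B - {0, b}) \<in> K (Suc r)"
   using reps_fc(1)[OF E H[OF b] cr] .
  show "\<And>v. v \<in> A - {b} ==> fc (A - {b}) v (c (B - {0, b})) = y (A - {b} - {v})"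
   using reps_fc(3)[OF E H[OF b] cr, unfolded ins[OF b]] .
 qed
 have cG: "card (A - {0}) = Suc (Suc r)"
  using A by simp
 have yfc: "fc (A - {0}) v (x 0) = y (A - {0} - {v})" if "v \<in> A - {0}" for v
  using E_fc[OF E G(1), of v, unfolded G(2)] that cG by (simp add: x_def G(2)[unfolded One_nat_def])
 have xfc: "fc (A - {b}) v (x b) = y (A - {b} - {v})" if "b \<in> B" "v \<in> A - {b}" for b v
  using yfc cfc(2)[of b v] that by (cases "b = 0") (auto simp: x_def)
 have "\<exists>t\<in>K (card A - 1). \<forall>b\<in>A. b \<noteq> 1 --> fc A b t = x b"
 proof (rule horn_lab)
  show "finite A" "3 \<le> card A" "1 \<in> A"
   using A by auto
  show "x b \<in> K (card A - 2)" if "b \<in> A" "b \<noteq> 1" for b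
  proof (cases "b = 0")
   case True
   then show ?thesis
    using E_K[OF E G(1)] G(2) cG A by (simp add: x_def)
  next
   case False
   then show ?thesis
    using cfc(1)[of b] that A by (auto simp: x_def A_def)
  qed
  show "fc (A - {b}) v (x b) = fc (A - {v}) b (x v)"
   if "b \<in> A" "v \<in> A" "b \<noteq> 1" "v \<noteq> 1" "b \<noteq> v" for b v
  proof -
   have "A - {b} - {v} = A - {v} - {b}" by auto
   moreover have "b \<in> B" "v \<in> B"
    using that by (auto simp: A_def)
   ultimately show ?thesis
    using xfc[of b v] xfc[of v b] that by simp
  qed
 qed
 then obtain t where "t \<in> K (card A - 1)" "\<forall>b\<in>A. b \<noteq> 1 --> fc A b t = x b"
  by blast
 then have "hf y c B t"
  unfolding hf_def using A nB B(3) by (auto simp: A_def x_def)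
 then show ?thesis
  by blast
qed

lemma hf_unique:
 assumes B: "B \<in> Asets (Suc r) N" "B \<notin> Asets r N" "1 \<notin> B" and t: "hf y c B t" "hf y c B t'"
 shows "rep (Suc r) (fc (insert 1 B) 1 t) = rep (Suc r) (fc (insert 1 B) 1 t')"
proof -
 note nB = new_set[OF B(1,2)]
 have "hom (Suc r) (fc (insert 1 B) 1 t) (fc (insert 1 B) 1 t')"
 proof (rule homI)
  show "fc (insert 1 B) w t = fc (insert 1 B) w t'" if "w \<in> insert 1 B" "w \<noteq> 1" for w
   using t that by (auto simp: hf_def)
 qed (use t nB B in \<open>auto simp: hf_def\<close>)
 then show ?thesis
  by (intro rep_eq) auto
qed

lemma asm_new:
 assumes E: "E r N y" and adm: "adm r N y c" and B: "B \<in> Asets (Suc r) N" "B \<notin> Asets r N" "1 \<notin> B"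
  and t: "hf y c B t"
 shows "asm r N y c B = rep (Suc r) (fc (insert 1 B) 1 t)"
proof -
 have "hf y c B (SOME t. hf y c B t)"
  using t by (rule someI)
 then show ?thesis
  using hf_unique[OF B _ t] B by (simp add: asm_def)
qed

lemma asm_old: "B \<in> Asets r N ==> asm r N y c B = y B"
 by (simp add: asm_def)

lemma asm_coord:
 assumes "H \<subseteq> {2..N}" "card H = r" "1 \<le> N"
 shows "insert 0 (insert 1 H) \<in> Asets (Suc r) N" "insert 0 (insert 1 H) \<notin> Asets r N"
  "asm r N y c (insert 0 (insert 1 H)) = c H"
proof -
 have c: "card (insert 0 (insert 1 H)) = Suc (Suc r)"
  using card01[OF assms(1)] assms(2) by simp
 show 1: "insert 0 (insert 1 H) \<in> Asets (Suc r) N"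
  using assms c by (auto simp: Asets_def)
 show 2: "insert 0 (insert 1 H) \<notin> Asets r N"
  using c by (auto simp: Asets_def)
 have "insert 0 (insert 1 H) - {0, 1} = H"
  using assms(1) by auto
 then show "asm r N y c (insert 0 (insert 1 H)) = c H"
  using 1 2 by (simp add: asm_def)
qed

text \<open>The missing face of the horn is homotopic to its representative, so it has the
  prescribed boundary, and by \<open>hom_replace\<close> the filler can be altered to have the
  representative itself as its face. The altered filler yields the last claim, which is the
  invariant for the next stage.\<close>

lemma asm_props:
 assumes E: "E r N y" and N: "1 \<le> N" and adm: "adm r N y c" and B: "B \<in> Asets (Suc r) N" "B \<notin> Asets r N"
 shows "asm r N y c B \<in> K (Suc r)" "rep (Suc r) (asm r N y c B) = asm r N y c B"
  "\<And>v. v \<in> B ==> fc B v (asm r N y c B) = y (B - {v})"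
  "1 \<notin> B ==> fill (asm r N y c) (insert 1 B)"
proof -
 note nB = new_set[OF B]
 have "asm r N y c B \<in> K (Suc r) \<and> rep (Suc r) (asm r N y c B) = asm r N y c B \<and>
  (\<forall>v\<in>B. fc B v (asm r N y c B) = y (B - {v})) \<and> (1 \<notin> B --> fill (asm r N y c) (insert 1 B))"
 proof (cases "1 \<in> B")
  case True
  define H where "H = B - {0, 1}"
  have "x \<in> {2..N}" if "x \<in> H" for x
  proof -
   have "x \<noteq> 0" "x \<noteq> 1" "x \<le> N"
    using that nB(4) by (auto simp: H_def)
   then show ?thesis by auto
  qed
  then have H: "H \<subseteq> {2..N}" "card H = r" "B = insert 0 (insert 1 H)"
   using nB True by (auto simp: H_def card_Diff_subset)
  have "c H \<in> reps (Suc r) (xf r y H)"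
   using adm H by (auto simp: adm_def)
  then show ?thesis
   using reps_fc[OF E H(1,2)] asm_coord(3)[OF H(1,2) N, of y c] H(3) by simp
 next
  case False
  obtain t where t: "hf y c B t"
   using hf_ex[OF E N adm B False] by blast
  define A where "A = insert 1 B"
  have A: "finite A" "card A = Suc (Suc (Suc r))" "1 \<in> A" "0 \<in> A" "A - {1} = B"
   using nB False by (auto simp: A_def)
  define u where "u = fc A 1 t"
  have tK: "t \<in> K (Suc (Suc r))"
   using t nB by (simp add: hf_def)
  have uK: "u \<in> K (Suc r)"
   using fc_in[of A 1 t] A nB tK by (simp add: u_def)
  have asmB: "asm r N y c B = rep (Suc r) u"
   using asm_new[OF E adm B False t] by (simp add: u_def A_def)
  have ht: "hom (Suc r) u (rep (Suc r) u)"
   using uK by (intro hom_rep) auto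
  then have par: "par (Suc r) u (rep (Suc r) u)"
   by (rule hom_par) simp
  have H: "B - {0, b} \<subseteq> {2..N}" "card (B - {0, b}) = r" if "b \<in> B" "b \<noteq> 0" for b
  proof -
   have "x \<in> {2..N}" if x: "x \<in> B - {0,b}" for x
   proof -
    have "x \<noteq> 0" "x \<noteq> 1" "x \<le> N"
     using x nB(4) False by auto
    then show ?thesis by auto
   qed
   then show "B - {0, b} \<subseteq> {2..N}" by blast
   show "card (B - {0, b}) = r"
    using that nB by (simp add: card_Diff_subset)
  qed
  have ins: "insert 0 (insert 1 (B - {0, b})) = A - {b}" if "b \<in> B" "b \<noteq> 0" for b
   using that nB(1) False by (auto simp: A_def)
  have G: "insert 1 (B - {0}) \<in> Asets r N" "insert 1 (B - {0}) = A - {0}"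
   using nB False N by (auto simp: Asets_def A_def)
  have cA: "card (A - {b}) = Suc (Suc r)" if "b \<in> A" for b
   using A that by simp
  have tA: "fc A b t = asm r N y c (A - {b})" if b: "b \<in> B" for b
  proof (cases "b = 0")
   case True
   then show ?thesis
    using t b G asm_old[OF G(1)] by (auto simp: hf_def A_def)
  next
   case b0: False
   have "asm r N y c (A - {b}) = c (B - {0, b})"
    using asm_coord(3)[OF H[OF b b0] N] ins[OF b b0] by simp
   then show ?thesis
    using t b b0 by (auto simp: hf_def A_def)
  qed
  have face: "fc (A - {b}) 1 (fc A b t) = y (A - {b} - {1})" if b: "b \<in> B" for b
  proof (cases "b = 0")
   case True
   then have "fc A b t = y (A - {0})"
    using t b G by (auto simp: hf_def A_def)
   then show ?thesis
    using E_fc[OF E G(1), of 1, unfolded G(2)] True cA[of 0] A(3,4) by simp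
  next
   case b0: False
   have "fc A b t = c (B - {0, b})"
    using t b b0 by (auto simp: hf_def A_def)
   moreover have "c (B - {0, b}) \<in> reps (Suc r) (xf r y (B - {0, b}))"
    using adm H[OF b b0] by (auto simp: adm_def)
   ultimately show ?thesis
    using reps_fc(3)[OF E H[OF b b0], of "c (B - {0, b})" 1] ins[OF b b0] by simp
  qed
  have "fc B v (rep (Suc r) u) = y (B - {v})" if v: "v \<in> B" for v
  proof -
   have "fc B v (rep (Suc r) u) = fc B v u"
    using par par_fc[of B "Suc r" u "rep (Suc r) u"] nB v by auto
   also have "\<dots> = fc (A - {1}) v (fc A 1 t)"
    using A by (simp add: u_def)
   also have "\<dots> = fc (A - {v}) 1 (fc A v t)"
    using A v tK False by (intro fc_comm) (auto simp: A_def)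
   also have "\<dots> = y (A - {v} - {1})"
    using face[OF v] .
   also have "A - {v} - {1} = B - {v}"
    using A(5) by auto
   finally show ?thesis .
  qed
  moreover have "fill (asm r N y c) A"
  proof -
   obtain t' where t': "t' \<in> K (Suc (Suc r))" "fc A 1 t' = rep (Suc r) u" "\<And>w. w \<in> A ==> w \<noteq> 1 ==> fc A w t' = fc A w t"
    using hom_replace[OF A(1,2,3) _ ht tK] by (auto simp: u_def)
   have "fc A v t' = asm r N y c (A - {v})" if v: "v \<in> A" for v
   proof (cases "v = 1")
    case True
    then show ?thesis
     using t'(2) asmB A(5) by simp
   next
    case False
    then show ?thesis
     using t'(3)[OF v False] tA[of v] v by (simp add: A_def)
   qed
   then show ?thesis
    unfolding fill_def using t'(1) A(2) by auto
  qed
  moreover have "rep (Suc r) u \<in> K (Suc r)"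
   using par by (simp add: par_def)
  ultimately show ?thesis
   using asmB rep_rep[OF uK] by (simp add: A_def)
 qed
 then show "asm r N y c B \<in> K (Suc r)" "rep (Suc r) (asm r N y c B) = asm r N y c B"
  "\<And>v. v \<in> B ==> fc B v (asm r N y c B) = y (B - {v})"
  "1 \<notin> B ==> fill (asm r N y c) (insert 1 B)"
  by blast+
qed

end

context kan_mean begin

lemma bd_Asets:
 assumes "G \<subseteq> {2..N}" "card G \<le> r" "1 \<le> N" "v \<in> insert 0 (insert 1 G)"
 shows "insert 0 (insert 1 G) - {v} \<in> Asets r N"
proof -
 let ?B = "insert 0 (insert 1 G)"
 have c: "card ?B = Suc (Suc (card G))"
  using card01[OF assms(1)] .
 have "card (?B - {v}) = Suc (card G)"
  using assms(4) c by (simp only: card_Diff_singleton)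
 moreover have "?B - {v} \<noteq> {}"
  using Diff_singleton_nonempty[of ?B v] c by simp
 moreover have "?B - {v} \<subseteq> {0..N}"
 proof -
  have "0 \<in> {0..N}" "1 \<in> {0..N}" "G \<subseteq> {0..N}"
   using assms(1,3) by auto
  then show ?thesis by blast
 qed
 ultimately show ?thesis
  using assms(2) by (simp only: Asets_def mem_Collect_eq Suc_le_mono simp_thms)
qed

lemma asm_E:
 assumes E: "E r N y" and N: "1 \<le> N" and adm: "adm r N y c"
 shows "E (Suc r) N (asm r N y c)"
 unfolding E_def
proof (intro conjI allI impI)
 let ?y = "asm r N y c"
 have down: "B - {v} \<in> Asets r N" if "B \<in> Asets (Suc r) N" "v \<in> B" "2 \<le> card B" "B \<notin> Asets r N" for B v
 proof -
  note nB = new_set[OF that(1,4)]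
  have "card (B - {v}) = Suc r" "B - {v} \<subseteq> {0..N}"
   using nB(2,4) that(2) by (auto simp: card_Diff_singleton)
  then show ?thesis
   using Diff_singleton_nonempty[OF that(3), of v] by (simp only: Asets_def mem_Collect_eq order_refl simp_thms)
 qed
 show "fam (Asets (Suc r) N) ?y"
  unfolding fam_def
 proof (intro ballI conjI impI)
  fix B assume B: "B \<in> Asets (Suc r) N"
  show "finite B" "B \<noteq> {}"
   using B Asets_finite[OF B] by (simp_all add: Asets_def)
  show "?y B \<in> K (card B - 1)"
   using E_K[OF E, of B] asm_props(1)[OF E N adm B] new_set[OF B] by (cases "B \<in> Asets r N") (auto simp: asm_old)
  fix v assume v: "2 \<le> card B" "v \<in> B"
  show "B - {v} \<in> Asets (Suc r) N"
   using Asets_down[OF B v(1)] .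
  show "fc B v (?y B) = ?y (B - {v})"
  proof (cases "B \<in> Asets r N")
   case True
   then show ?thesis
    using E_fc[OF E True v] Asets_down[OF True v(1)] by (simp add: asm_old)
  next
   case False
   then show ?thesis
    using asm_props(3)[OF E N adm B False v(2)] down[OF B v(2,1) False] by (simp add: asm_old)
  qed
 qed
 show "?y B = undefined" if "B \<notin> Asets (Suc r) N" for B
  using that Asets_mono[of r "Suc r" N] by (auto simp: asm_def)
 have "{1} \<in> Asets r N" "{0} \<in> Asets r N"
  using N by (auto simp: Asets_def)
 then show "base (?y {1}) = ?y {0}"
  using ED(3)[OF E] by (simp add: asm_old)
 show "fill ?y (insert 0 (insert 1 G))" if G: "G \<subseteq> {2..N}" "card G \<le> Suc r" for G
 proof (cases "card G \<le> r")
  case True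
  show ?thesis
  proof (rule fill_cong[OF ED(4)[OF E G(1) True]])
   fix v assume v: "v \<in> insert 0 (insert 1 G)"
   have "insert 0 (insert 1 G) - {v} \<in> Asets r N"
    using bd_Asets[OF G(1) True N v] .
   then show "?y (insert 0 (insert 1 G) - {v}) = y (insert 0 (insert 1 G) - {v})"
    by (rule asm_old)
  qed
 next
  case False
  then have cG: "card G = Suc r"
   using G by simp
  have fG: "finite G" "0 \<notin> G" "1 \<notin> G"
   using G(1) finite_subset by auto
  then have "insert 0 G \<in> Asets (Suc r) N" "insert 0 G \<notin> Asets r N" "1 \<notin> insert 0 G"
   using G cG by (auto simp: Asets_def)
  then have "fill ?y (insert 1 (insert 0 G))"
   by (rule asm_props(4)[OF E N adm])
  then show ?thesis
   by (simp add: insert_commute)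
 qed
qed

text \<open>By its last clause the state \<open>y'\<close> has fillers of the boundaries
  \<open>insert 1 B\<close>, and these are fillers in the sense of \<open>hf\<close>; so
  \<open>y'\<close> with canonical new faces is recovered from its faces through
  \<open>{0, 1}\<close>. This serves to recognise a restricted state as an assembled one.\<close>

lemma asm_unique:
 assumes E: "E r N y" and N: "1 \<le> N" and E': "E (Suc r) N y'"
  and eq: "\<And>B. B \<in> Asets r N ==> y' B = y B"
  and rep: "\<And>B. B \<in> Asets (Suc r) N ==> B \<notin> Asets r N ==> rep (Suc r) (y' B) = y' B"
  and c: "\<And>H. H \<subseteq> {2..N} ==> card H = r ==> c H = y' (insert 0 (insert 1 H))"
 shows "adm r N y c" "asm r N y c = y'"
proof -
 show adm: "adm r N y c"
  unfolding adm_def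
 proof (intro allI impI)
  fix H assume H: "H \<subseteq> {2..N}" "card H = r"
  let ?B = "insert 0 (insert 1 H)"
  note B = asm_coord(1,2)[OF H N]
  have cB: "card ?B = Suc (Suc r)"
   using card01[OF H(1)] H(2) by simp
  have "par (Suc r) (y' ?B) (xf r y H)"
  proof (rule par_fill[OF E H])
   show "y' ?B \<in> K (Suc r)"
    using E_K[OF E' B(1)] cB by simp
   fix v assume v: "v \<in> ?B"
   have "?B - {v} \<in> Asets r N"
    using bd_Asets[OF H(1) _ N v] H(2) by simp
   then show "fc ?B v (y' ?B) = y (?B - {v})"
    using E_fc[OF E' B(1) _ v] cB eq by simp
  qed
  then show "c H \<in> reps (Suc r) (xf r y H)"
   using repsI[of "Suc r" "y' ?B"] rep[OF B] c[OF H] by simp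
 qed
 show "asm r N y c = y'"
 proof
  fix B
  consider "B \<in> Asets r N" | "B \<in> Asets (Suc r) N" "B \<notin> Asets r N" "1 \<in> B"
   | "B \<in> Asets (Suc r) N" "B \<notin> Asets r N" "1 \<notin> B" | "B \<notin> Asets (Suc r) N"
   by blast
  then show "asm r N y c B = y' B"
  proof cases
   case 1
   then show ?thesis using eq asm_old by simp
  next
   case 2
   note nB = new_set[OF 2(1,2)]
   define H where "H = B - {0, 1}"
   have "x \<in> {2..N}" if "x \<in> H" for x
   proof -
    have "x \<noteq> 0" "x \<noteq> 1" "x \<le> N"
     using that nB(4) by (auto simp: H_def)
    then show ?thesis by auto
   qed
   then have H: "H \<subseteq> {2..N}" "card H = r" "B = insert 0 (insert 1 H)"
    using nB 2(3) by (auto simp: H_def card_Diff_subset)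
   then show ?thesis
    using asm_coord(3)[OF H(1,2) N, of y c] c[OF H(1,2)] by simp
  next
   case 3
   note nB = new_set[OF 3(1,2)]
   define G where "G = B - {0}"
   have "x \<in> {2..N}" if "x \<in> G" for x
   proof -
    have "x \<noteq> 0" "x \<noteq> 1" "x \<le> N"
     using that nB(4) 3(3) by (auto simp: G_def)
    then show ?thesis by auto
   qed
   then have G: "G \<subseteq> {2..N}"
    by blast
   have G': "card G = Suc r" "insert 0 (insert 1 G) = insert 1 B"
    using nB(1-3) by (auto simp: G_def)
   have "fill y' (insert 1 B)"
    using ED(4)[OF E' G] by (simp only: G')
   then obtain t where t: "t \<in> K (card (insert 1 B) - 1)" "\<And>v. v \<in> insert 1 B ==> fc (insert 1 B) v t = y' (insert 1 B - {v})"
    unfolding fill_def by blast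
   have "hf y c B t"
    unfolding hf_def
   proof (intro conjI ballI)
    show "t \<in> K (card B)"
     using t(1) nB 3(3) by simp
    fix b assume b: "b \<in> B"
    show "fc (insert 1 B) b t = (if b = 0 then y (insert 1 (B - {0})) else c (B - {0, b}))"
    proof (cases "b = 0")
     case True
     have e: "insert 1 B - {0} = insert 1 (B - {0})"
      by auto
     have "insert 1 (B - {0}) \<in> Asets r N"
      using nB N by (auto simp: Asets_def)
     then show ?thesis
      using t(2)[of b] b True eq e by simp
    next
     case False
     have H: "B - {0, b} \<subseteq> {2..N}" "card (B - {0, b}) = r"
      using G nB(1-3) b False by (auto simp: G_def card_Diff_subset)
     have "insert 1 B - {b} = insert 0 (insert 1 (B - {0, b}))"
      using nB(1) b False 3(3) by auto
     then show ?thesis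
      using t(2)[of b] b False c[OF H] by simp
    qed
   qed
   then have "asm r N y c B = rep (Suc r) (fc (insert 1 B) 1 t)"
    by (rule asm_new[OF E adm 3])
   moreover have "insert 1 B - {1} = B"
    using 3(3) by auto
   ultimately show ?thesis
    using t(2)[of 1] rep[OF 3(1,2)] by simp
  next
   case 4
   then show ?thesis
    using Asets_mono[of r "Suc r" N] ED(2)[OF E' 4] by (auto simp: asm_def)
  qed
 qed
qed

lemma E_base: "E r N y ==> v \<in> {1..N} ==> base (y {v}) = y {0}"
proof -
 assume E: "E r N y" and v: "v \<in> {1..N}"
 show ?thesis
 proof (cases "v = 1")
  case True
  then show ?thesis using ED(3)[OF E] by simp
 next
  case False
  then have v2: "1 < v" using v by auto
  have A: "{1, v} \<in> Asets r N"
   using v by (auto simp: Asets_def)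
  have c: "card {1, v} = 2"
   using v2 by simp
  have p: "pos {1, v} v = 1" "pos {1, v} 1 = 0"
  proof -
   have "{b \<in> {1, v}. b < v} = {1}" "{b \<in> {1, v}. b < 1} = {}"
    using v2 by auto
   then show "pos {1, v} v = 1" "pos {1, v} 1 = 0"
    by (simp_all add: pos_def)
  qed
  have "fc {1, v} v (y {1, v}) = y ({1, v} - {v})" "fc {1, v} 1 (y {1, v}) = y ({1, v} - {1})"
   using E_fc[OF E A] c by auto
  moreover have "{1, v} - {v} = {1}" "{1, v} - {1} = {v}"
   using v2 by auto
  ultimately have "d 1 1 (y {1, v}) = y {1}" "d 1 0 (y {1, v}) = y {v}"
   using c p by (simp_all add: fc_def)
  moreover have "y {1, v} \<in> K 1"
   using E_K[OF E A] c by simp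
  ultimately show ?thesis
   using base_const[of "y {1, v}"] ED(3)[OF E] by simp
 qed
qed

text \<open>Only \<open>v = 1\<close> needs an argument, since 2 then becomes the distinguished
  vertex. In the simplex on \<open>{0, 1, 2}\<close> and \<open>G'\<close>, the facet opposite 0 is
  present, and the facets opposite other vertices than 0 and 1 contain \<open>{0, 1}\<close>, so
  their boundaries can be filled; by \<open>fill_last\<close> the same holds for the facet opposite
  1.\<close>

lemma E_pull:
 assumes E: "E r (Suc N) y" and N: "1 \<le> N" and v: "1 \<le> v" "v \<le> Suc N"
 shows "E r N (pull v y)"
 unfolding E_def
proof (intro conjI allI impI)
 show "fam (Asets r N) (pull v y)"
  unfolding pull_def
  by (rule fam_image[OF strict_mono_skip ED(1)[OF E]]) (auto simp: Asets_skip[OF v] Asets_down)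
 show "pull v y B = undefined" if "B \<notin> Asets r N" for B
  using that Asets_skip[OF v] ED(2)[OF E] by (simp add: pull_def)
 show "base (pull v y {1}) = pull v y {0}"
 proof -
  have "skip v 1 \<in> {1..Suc N}" "skip v 0 = 0"
   using N v by (auto simp: skip_def)
  then show ?thesis
   using E_base[OF E, of "skip v 1"] by (simp add: pull_def)
 qed
 fix G assume G: "G \<subseteq> {2..N}" "card G \<le> r"
 have fG: "finite G"
  using G(1) finite_subset by auto
 have inj: "inj_on (skip v) G"
  using strict_mono_skip by (auto simp: strict_mono_eq inj_on_def)
 define G' where "G' = skip v ` G"
 have cG': "card G' = card G" "finite G'"
  using inj fG by (auto simp: G'_def card_image)
 have "fill y (skip v ` insert 0 (insert 1 G))"
 proof (cases "v = 1")
  case False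
  then have "skip v ` insert 0 (insert 1 G) = insert 0 (insert 1 G')" "G' \<subseteq> {2..Suc N}"
   using v G(1) by (auto simp: skip_def G'_def)
  then show ?thesis
   using ED(4)[OF E] G(2) cG' by simp
 next
  case True
  have G'3: "G' \<subseteq> {3..Suc N}"
   using G(1) True by (auto simp: skip_def G'_def)
  define V where "V = insert 0 (insert 1 (insert 2 G'))"
  have V: "finite V" "card V = Suc (Suc (Suc (card G)))"
  proof -
   have "0 \<notin> insert 1 (insert 2 G')" "1 \<notin> insert 2 G'" "2 \<notin> G'"
    using G'3 by auto
   then show "finite V" "card V = Suc (Suc (Suc (card G)))"
    using cG' by (auto simp: V_def)
  qed
  have VN: "V \<subseteq> {0..Suc N}"
   using G'3 N by (auto simp: V_def)
  have "fill y (V - {1})"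
  proof (rule fill_last)
   show "finite V" "3 \<le> card V" "1 \<in> V"
    using V by (auto simp: V_def)
   show "fam {B. B \<subseteq> V \<and> B \<noteq> {} \<and> card B \<le> card V - 2} y"
   proof (rule fam_subset[OF ED(1)[OF E]])
    show "{B. B \<subseteq> V \<and> B \<noteq> {} \<and> card B \<le> card V - 2} \<subseteq> Asets r (Suc N)"
     using VN V G(2) by (auto simp: Asets_def)
    show "B - {w} \<in> {B. B \<subseteq> V \<and> B \<noteq> {} \<and> card B \<le> card V - 2}"
     if B: "B \<in> {B. B \<subseteq> V \<and> B \<noteq> {} \<and> card B \<le> card V - 2}" "w \<in> B" "2 \<le> card B" for B w
     using B Diff_singleton_nonempty[OF B(3), of w] card_Diff1_le[of B w] by auto
   qed
   show "fill y (V - {b})" if b: "b \<in> V" "b \<noteq> 1" for b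
   proof (cases "b = 0")
    case True
    have A: "V - {0} \<in> Asets r (Suc N)"
     using VN by (auto simp: Asets_def V_def)
    have "0 \<in> V"
     by (simp add: V_def)
    then have c: "card (V - {0}) = Suc (Suc (card G))"
     using V by simp
    show ?thesis
     unfolding True fill_def
     using E_K[OF E A] E_fc[OF E A] c by (intro bexI[of _ "y (V - {0})"]) auto
   next
    case False
    define G2 where "G2 = insert 2 G' - {b}"
    have "V - {b} = insert 0 (insert 1 G2)"
     using b False by (auto simp: V_def G2_def)
    moreover have "G2 \<subseteq> {2..Suc N}"
     using G'3 N by (auto simp: G2_def)
    moreover have "card G2 \<le> r"
    proof -
     have "b \<in> insert 2 G'"
      using b False by (auto simp: V_def)
     moreover have "2 \<notin> G'"
      using G'3 by auto
     ultimately show ?thesis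
      using cG' G(2) by (simp add: G2_def)
    qed
    ultimately show ?thesis
     using ED(4)[OF E] by simp
   qed
  qed
  moreover have "V - {1} = skip v ` insert 0 (insert 1 G)"
   using True G'3 by (auto simp: V_def G'_def skip_def)
  ultimately show ?thesis
   by simp
 qed
 then have "fill (\<lambda>B. y (skip v ` B)) (insert 0 (insert 1 G))"
  by (rule fill_image[OF strict_mono_skip])
 then show "fill (pull v y) (insert 0 (insert 1 G))"
  by (simp add: pull_def[abs_def])
qed

end

text \<open>Composition of a mean with a kernel. The kernel vanishes off \<open>R\<close>, which
  turns its values into a bounded function on the whole type.\<close>

lemma mean_bind:
 assumes m: "mean R m" and k: "\<And>y. y \<in> R ==> mean R' (k y)" and z: "\<And>y f. y \<notin> R ==> k y f = 0"
 shows "mean R' (\<lambda>f. m (\<lambda>y. k y f))"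
proof -
 have b: "bfun (\<lambda>y. k y f)" if f: "bfun f" for f
 proof -
  obtain B where B: "\<And>x. \<bar>f x\<bar> \<le> B"
   using f by (auto simp: bfun_def)
  have "0 \<le> B"
   using B[of undefined] by linarith
  then have "\<bar>k y f\<bar> \<le> B" for y
   using mean_bound[OF k f B] z by (cases "y \<in> R") auto
  then show ?thesis by (rule bfunI)
 qed
 show ?thesis
  unfolding mean_def
 proof (intro conjI allI impI)
  fix f g :: "'b => real" assume f: "bfun f" and g: "bfun g"
  have "m (\<lambda>y. k y (\<lambda>x. f x + g x)) = m (\<lambda>y. k y f + k y g)"
   using mean_add[OF k f g] by (intro mean_cong[OF m] b bfun_add f g)
  then show "m (\<lambda>y. k y (\<lambda>x. f x + g x)) = m (\<lambda>y. k y f) + m (\<lambda>y. k y g)"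
   using mean_add[OF m b[OF f] b[OF g]] by simp
 next
  fix c :: real and f :: "'b => real" assume f: "bfun f"
  have "m (\<lambda>y. k y (\<lambda>x. c * f x)) = m (\<lambda>y. c * k y f)"
   using mean_scale[OF k f] by (intro mean_cong[OF m] b bfun_scale f)
  then show "m (\<lambda>y. k y (\<lambda>x. c * f x)) = c * m (\<lambda>y. k y f)"
   using mean_scale[OF m b[OF f]] by simp
 next
  fix f :: "'b => real" assume f: "bfun f" "\<forall>x\<in>R'. 0 \<le> f x"
  then show "0 \<le> m (\<lambda>y. k y f)"
   using mean_nonneg[OF k f(1)] by (intro mean_nonneg[OF m] b) auto
 next
  have "m (\<lambda>y. k y (\<lambda>x. 1)) = m (\<lambda>y. 1)"
   using mean_one[OF k] by (intro mean_cong[OF m] b) auto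
  then show "m (\<lambda>y. k y (\<lambda>x. 1)) = 1"
   using mean_one[OF m] by simp
 qed
qed

lemma mean_eq:
 assumes m: "mean R m" and eq: "\<And>f. bfun f ==> m f = m' f"
 shows "mean R m'"
 unfolding mean_def
proof (intro conjI allI impI)
 show "m' (\<lambda>x. f x + g x) = m' f + m' g" if f: "bfun f" and g: "bfun g" for f g
  using mean_add[OF m f g] eq[OF bfun_add[OF f g]] eq[OF f] eq[OF g] by simp
 show "m' (\<lambda>x. c * f x) = c * m' f" if f: "bfun f" for c f
  using mean_scale[OF m f, of c] eq[OF bfun_scale[OF f, of c]] eq[OF f] by simp
 show "0 \<le> m' f" if f: "bfun f" "\<forall>x\<in>R. 0 \<le> f x" for f
  using mean_nonneg[OF m f(1)] f(2) eq[OF f(1)] by simp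
 show "m' (\<lambda>x. 1) = 1"
  using mean_one[OF m] eq[OF bfun_const] by simp
qed

lemma mean_prodmean:
 assumes "\<And>g. g \<in> set gs ==> mean (R g) (\<mu> g)" "distinct gs"
 shows "mean (Pi\<^sub>E (set gs) R) (prodmean gs \<mu>)"
 using assms
proof (induction gs)
 case Nil
 then show ?case by (auto simp: mean_def)
next
 case (Cons g gs)
 have IH: "mean (Pi\<^sub>E (set gs) R) (prodmean gs \<mu>)"
  using Cons by auto
 define k where "k x f = (if x \<in> R g then prodmean gs \<mu> (\<lambda>c. f (c(g := x))) else 0)" for x and f :: "('a => 'b) => real"
 have mg: "mean (R g) (\<mu> g)"
  using Cons.prems by simp
 have "mean (Pi\<^sub>E (set (g # gs)) R) (\<lambda>f. \<mu> g (\<lambda>x. k x f))"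
 proof (rule mean_bind[OF mg])
  fix x assume x: "x \<in> R g"
  have "mean (Pi\<^sub>E (set (g # gs)) R) (\<lambda>f. prodmean gs \<mu> (\<lambda>c. f (c(g := x))))"
   by (rule mean_map[OF IH]) (use x in \<open>auto simp: PiE_def extensional_def\<close>)
  then show "mean (Pi\<^sub>E (set (g # gs)) R) (k x)"
   using x by (simp add: k_def[abs_def])
 qed (simp add: k_def)
 moreover have "\<mu> g (\<lambda>x. k x f) = prodmean (g # gs) \<mu> f" if f: "bfun f" for f
 proof -
  have b: "bfun (\<lambda>x. prodmean gs \<mu> (\<lambda>c. f (c(g := x))))"
   using bfun_prodmean[of gs R \<mu> f "\<lambda>x c. c(g := x)"] Cons.prems f by simp
  then obtain B where B: "\<And>x. \<bar>prodmean gs \<mu> (\<lambda>c. f (c(g := x)))\<bar> \<le> B"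
   by (auto simp: bfun_def)
  have "0 \<le> B"
   using B[of undefined] by linarith
  then have "bfun (\<lambda>x. k x f)"
   using B by (intro bfunI[of _ B]) (simp add: k_def)
  then show ?thesis
   using mean_cong[OF mg _ b, of "\<lambda>x. k x f"] by (simp add: k_def)
 qed
 ultimately show ?case
  by (rule mean_eq)
qed

section \<open>One stage of the averaging\<close>

context kan_mean begin

text \<open>The kernel from states after stage \<open>r\<close> to states after stage
  \<open>r + 1\<close>: the free variables are averaged in the order of \<open>Ls\<close>, each over
  the fillers of its own boundary.\<close>

definition S :: "nat => nat => (nat set => 's) => ((nat set => 's) => real) => real" where
 "S r N y f = (if E r N y then prodmean (Ls r [2..<Suc N]) (\<lambda>H. mu (Suc r) (xf r y H)) (\<lambda>c. f (asm r N y c)) else 0)"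

lemma set_coords: "set (Ls r [2..<Suc N]) = {H. H \<subseteq> {2..N} \<and> card H = r}"
 by (simp add: set_Ls atLeastLessThanSuc_atLeastAtMost del: upt_Suc)

text \<open>The edge on \<open>{0, 1}\<close> starts at the apex, which is the base vertex of its
  component; this is the condition under which \<open>mu\<close> is a mean in dimension one.\<close>

lemma base_xf:
 assumes E: "E 0 N y" and x: "par 1 x (xf 0 y {})"
 shows "base (d 1 1 x) = d 1 1 x"
proof -
 have xf': "xf 0 y {} \<in> K 1" "\<And>v. v \<in> {0, 1} ==> fc {0, 1} v (xf 0 y {}) = y ({0, 1} - {v})"
  using xf[OF E, of "{}"] by auto
 have p: "pos {0, 1} 1 = 1" "pos {0, 1} 0 = 0" "card {0, 1 :: nat} = 2"
 proof -
  have "{b \<in> {0, 1}. b < 1} = {0 :: nat}" "{b \<in> {0, 1 :: nat}. b < 0} = {}"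
   by auto
  then show "pos {0, 1} 1 = 1" "pos {0, 1} 0 = 0" "card {0, 1 :: nat} = 2"
   by (simp_all add: pos_def)
 qed
 have s: "{0, 1} - {1} = {0 :: nat}" "{0, 1} - {0} = {1 :: nat}"
  by auto
 have "d 1 1 (xf 0 y {}) = y {0}"
  using xf'(2)[of 1, unfolded s fc_def p] by simp
 moreover have "d 1 0 (xf 0 y {}) = y {1}"
  using xf'(2)[of 0, unfolded s fc_def p] by simp
 ultimately have "base (y {0}) = y {0}"
  using base_const[OF xf'(1)] ED(3)[OF E] by simp
 moreover have "d 1 1 x = d 1 1 (xf 0 y {})"
  using x by (simp add: par_def)
 ultimately show ?thesis
  using \<open>d 1 1 (xf 0 y {}) = y {0}\<close> by simp
qed

lemma mean_xf:
 assumes "E r N y" "H \<in> set (Ls r [2..<Suc N])"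
 shows "mean (reps (Suc r) (xf r y H)) (mu (Suc r) (xf r y H))"
proof (rule mu_mean)
 have H: "H \<subseteq> {2..N}" "card H = r"
  using assms(2) by (simp_all add: set_coords del: upt_Suc)
 show K: "xf r y H \<in> K (Suc r)"
  using xf(1)[OF assms(1) H] .
 assume r: "Suc r = 1"
 have "finite H"
  using H(1) finite_subset by auto
 then have "H = {}"
  using H r by simp
 then show "base (d 1 1 (xf r y H)) = d 1 1 (xf r y H)"
  using base_xf[of N y "xf r y H"] assms(1) K r par_refl by simp
qed simp

lemma adm_PiE: "c \<in> Pi\<^sub>E (set (Ls r [2..<Suc N])) (\<lambda>H. reps (Suc r) (xf r y H)) ==> adm r N y c"
 by (auto simp: adm_def set_coords PiE_def simp del: upt_Suc)

lemma distinct_coords: "distinct (Ls r [2..<Suc N])"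
 by (simp add: distinct_Ls del: upt_Suc)

lemma mean_S:
 assumes E: "E r N y" and N: "1 \<le> N"
 shows "mean {y'. E (Suc r) N y' \<and> (\<forall>B\<in>Asets r N. y' B = y B)} (S r N y)"
proof -
 have "mean (Pi\<^sub>E (set (Ls r [2..<Suc N])) (\<lambda>H. reps (Suc r) (xf r y H)))
  (prodmean (Ls r [2..<Suc N]) (\<lambda>H. mu (Suc r) (xf r y H)))"
  using mean_xf[OF E] distinct_coords by (intro mean_prodmean)
 then have "mean {y'. E (Suc r) N y' \<and> (\<forall>B\<in>Asets r N. y' B = y B)}
  (\<lambda>f. prodmean (Ls r [2..<Suc N]) (\<lambda>H. mu (Suc r) (xf r y H)) (\<lambda>c. f (asm r N y c)))"
  by (rule mean_map) (use asm_E[OF E N adm_PiE] in \<open>auto simp: asm_old\<close>)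
 then show ?thesis
  using E by (simp add: S_def[abs_def])
qed

text \<open>Both sides are states with canonical new faces and the same faces through
  \<open>{0, 1}\<close>, so \<open>asm_unique\<close> identifies them.\<close>

lemma pull_asm:
 assumes E: "E r (Suc N) y" and N: "1 \<le> N" and v: "1 \<le> v" "v \<le> Suc N" and adm: "adm r (Suc N) y c"
  and c': "\<And>H. H \<in> set (Ls r [2..<Suc N]) ==> c' H = asm r (Suc N) y c (skip v ` insert 0 (insert 1 H))"
 shows "asm r N (pull v y) c' = pull v (asm r (Suc N) y c)"
proof (rule asm_unique(2)[OF E_pull[OF E N v] N])
 show "E (Suc r) N (pull v (asm r (Suc N) y c))"
  using asm_E[OF E _ adm] N v by (intro E_pull) auto
 show "pull v (asm r (Suc N) y c) B = pull v y B" if "B \<in> Asets r N" for B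
  using that Asets_skip[OF v] by (simp add: pull_def asm_old)
 show "rep (Suc r) (pull v (asm r (Suc N) y c) B) = pull v (asm r (Suc N) y c) B"
  if "B \<in> Asets (Suc r) N" "B \<notin> Asets r N" for B
  using asm_props(2)[OF E _ adm, of "skip v ` B"] that Asets_skip[OF v] by (simp add: pull_def)
 show "c' H = pull v (asm r (Suc N) y c) (insert 0 (insert 1 H))" if "H \<subseteq> {2..N}" "card H = r" for H
  using c'[of H] that by (simp add: set_coords pull_def del: upt_Suc)
qed

lemma par_pull:
 assumes E: "E r (Suc N) y" and N: "1 \<le> N" and v: "1 \<le> v" "v \<le> Suc N"
  and H: "H \<in> set (Ls r [2..<Suc N])" and t: "t \<in> K (Suc r)"
  and f: "\<And>b. b \<in> skip v ` insert 0 (insert 1 H) ==> fc (skip v ` insert 0 (insert 1 H)) b t = y (skip v ` insert 0 (insert 1 H) - {b})"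
 shows "par (Suc r) t (xf r (pull v y) H)"
proof (rule par_fill[OF E_pull[OF E N v]])
 show "H \<subseteq> {2..N}" "card H = r"
  using H by (simp_all add: set_coords del: upt_Suc)
 fix b assume b: "b \<in> insert 0 (insert 1 H)"
 have "fc (insert 0 (insert 1 H)) b t = fc (skip v ` insert 0 (insert 1 H)) (skip v b) t"
  using fc_image[OF strict_mono_skip b] by simp
 also have "\<dots> = y (skip v ` insert 0 (insert 1 H) - {skip v b})"
  using b by (intro f) blast
 also have "\<dots> = pull v y (insert 0 (insert 1 H) - {b})"
  by (simp only: pull_def image_Diff_singleton[OF strict_mono_skip])
 finally show "fc (insert 0 (insert 1 H)) b t = pull v y (insert 0 (insert 1 H) - {b})" .
qed (rule t)

lemma map_skip_upt:
 assumes "2 \<le> v" "v \<le> Suc N"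
 shows "map (skip v) [2..<Suc N] = filter (\<lambda>x. x \<noteq> v) [2..<Suc (Suc N)]"
proof -
 have "[2..<Suc N] = [2..<v] @ [v..<Suc N]"
  using upt_add_eq_append[of 2 v "Suc N - v"] assms by simp
 moreover have "[2..<Suc (Suc N)] = [2..<v] @ v # [Suc v..<Suc (Suc N)]"
  using upt_add_eq_append[of 2 v "Suc (Suc N) - v"] upt_conv_Cons[of v "Suc (Suc N)"] assms by simp
 moreover have "map (skip v) [2..<v] = [2..<v]"
  by (rule map_idI) (simp add: skip_def)
 moreover have "map (skip v) [v..<Suc N] = map Suc [v..<Suc N]"
  by (rule map_cong) (simp_all add: skip_def del: upt_Suc)
 moreover have "filter (\<lambda>x. x \<noteq> v) [2..<v] = [2..<v]" "filter (\<lambda>x. x \<noteq> v) [Suc v..<Suc (Suc N)] = [Suc v..<Suc (Suc N)]"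
  by (auto simp: filter_id_conv simp del: upt_Suc)
 ultimately show ?thesis
  by (simp add: map_Suc_upt del: upt_Suc)
qed

text \<open>As the edge \<open>{0, 1}\<close> survives, the variables of the face are the variables
  of the whole that avoid \<open>v\<close>, in the same order, and the others are integrated
  out.\<close>

lemma S_face_ge2:
 assumes E: "E r (Suc N) y" and N: "1 \<le> N" and v: "2 \<le> v" "v \<le> Suc N" and f: "bfun f"
 shows "S r (Suc N) y (\<lambda>y'. f (pull v y')) = S r N (pull v y) f"
proof -
 have v1: "1 \<le> v"
  using v by simp
 let ?gs = "Ls r [2..<Suc (Suc N)]" and ?hs = "Ls r [2..<Suc N]" and ?\<mu> = "\<lambda>H. mu (Suc r) (xf r y H)"
 define F where "F c' = f (asm r N (pull v y) c')" for c'
 have bF: "bfun F"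
  unfolding F_def[abs_def] using f by (rule bfun_compose)
 have sk: "skip v ` insert 0 (insert 1 H) = insert 0 (insert 1 (skip v ` H))" for H
  using v by (simp add: skip_def)
 have map: "map ((`) (skip v)) ?hs = filter (\<lambda>H. v \<notin> H) ?gs"
  unfolding map_Ls filter_Ls map_skip_upt[OF v] ..
 have hs_gs: "skip v ` H \<in> set ?gs" if "H \<in> set ?hs" for H
 proof -
  have "skip v ` H \<in> set (map ((`) (skip v)) ?hs)"
   using that by simp
  then show ?thesis
   unfolding map by simp
 qed
 have "S r (Suc N) y (\<lambda>y'. f (pull v y')) = prodmean ?gs ?\<mu> (\<lambda>c. f (pull v (asm r (Suc N) y c)))"
  using E by (simp add: S_def del: upt_Suc)
 also have "\<dots> = prodmean ?gs ?\<mu> (\<lambda>c. F (\<lambda>H. if H \<in> set ?hs then c (skip v ` H) else undefined))"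
 proof (rule prodmean_cong[where R = "\<lambda>H. reps (Suc r) (xf r y H)"])
  fix c assume c: "c \<in> Pi\<^sub>E (set ?gs) (\<lambda>H. reps (Suc r) (xf r y H))"
  have "asm r N (pull v y) (\<lambda>H. if H \<in> set ?hs then c (skip v ` H) else undefined) = pull v (asm r (Suc N) y c)"
  proof (rule pull_asm[OF E N v1 v(2) adm_PiE[OF c]])
   fix H assume H: "H \<in> set ?hs"
   have "skip v ` H \<subseteq> {2..Suc N}" "card (skip v ` H) = r"
    using hs_gs[OF H] by (simp_all add: set_coords del: upt_Suc)
   then show "(if H \<in> set ?hs then c (skip v ` H) else undefined) = asm r (Suc N) y c (skip v ` insert 0 (insert 1 H))"
    using asm_coord(3)[of "skip v ` H" "Suc N" r y c] H unfolding sk by simp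
  qed
  then show "f (pull v (asm r (Suc N) y c)) = F (\<lambda>H. if H \<in> set ?hs then c (skip v ` H) else undefined)"
   by (simp add: F_def)
 next
  show "bfun (\<lambda>c. f (pull v (asm r (Suc N) y c)))"
   using bfun_compose[OF f, of "\<lambda>c. pull v (asm r (Suc N) y c)"] .
  show "bfun (\<lambda>c. F (\<lambda>H. if H \<in> set ?hs then c (skip v ` H) else undefined))"
   using bfun_compose[OF bF, of "\<lambda>c H. if H \<in> set ?hs then c (skip v ` H) else undefined"] .
 qed (use mean_xf[OF E] distinct_coords in blast)+
 also have "\<dots> = prodmean ?hs (\<lambda>H. ?\<mu> (skip v ` H)) F"
  by (rule prodmean_reindex[OF mean_xf[OF E] bF distinct_coords map])
 also have "\<dots> = prodmean ?hs (\<lambda>H. mu (Suc r) (xf r (pull v y) H)) F"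
 proof (rule prodmean_mu_cong)
  fix H assume H: "H \<in> set ?hs"
  have H': "skip v ` H \<subseteq> {2..Suc N}" "card (skip v ` H) = r"
   using hs_gs[OF H] by (simp_all add: set_coords del: upt_Suc)
  have "par (Suc r) (xf r y (skip v ` H)) (xf r (pull v y) H)"
   using xf[OF E H'] unfolding sk[symmetric] by (intro par_pull[OF E N v1 v(2) H])
  then show "?\<mu> (skip v ` H) = mu (Suc r) (xf r (pull v y) H)"
   by (intro mu_par) auto
 qed
 also have "\<dots> = S r N (pull v y) f"
  using E_pull[OF E N v1 v(2)] by (simp add: S_def F_def[abs_def] del: upt_Suc)
 finally show ?thesis .
qed

end

context kan_mean begin

text \<open>After the deletion of 1 the distinguished edge is the former \<open>{0, 2}\<close>, and
  the faces through it are forced ones. The variables containing 2, \<open>XS1\<close>, come first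
  in the list. With these fixed, the forced face on \<open>{0, 2}\<close> and \<open>j H\<close> is
  the transport of the single variable \<open>c (j H)\<close>, through a simplex that depends on
  \<open>XS1\<close> only, and \<open>mu\<close> is invariant under transport. With another order of
  the variables this argument would fail.\<close>

lemma S_face_1:
 assumes E: "E r (Suc N) y" and N: "1 \<le> N" and f: "bfun f"
 shows "S r (Suc N) y (\<lambda>y'. f (pull 1 y')) = S r N (pull 1 y) f"
proof -
 have v1: "(1::nat) \<le> 1" "1 \<le> Suc N" and N1: "1 \<le> Suc N"
  by auto
 define gs where "gs = Ls r [2..<Suc (Suc N)]"
 define hs where "hs = Ls r [2..<Suc N]"
 define XS2 where "XS2 = Ls r [3..<Suc (Suc N)]"
 define XS1 where "XS1 = (if r = 0 then [] else map (insert 2) (Ls (r - 1) [3..<Suc (Suc N)]))"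
 define \<mu> where "\<mu> H = mu (Suc r) (xf r y H)" for H
 define R where "R H = reps (Suc r) (xf r y H)" for H
 define j where "j H = skip 1 ` H" for H
 define BB where "BB H = skip 1 ` insert 0 (insert 1 H)" for H
 have up: "[2..<Suc (Suc N)] = 2 # [3..<Suc (Suc N)]"
  using upt_conv_Cons[of 2 "Suc (Suc N)"] N by (simp del: upt_Suc add: numeral_3_eq_3 numeral_2_eq_2)
 have gs_eq: "gs = XS1 @ XS2"
  unfolding gs_def XS1_def XS2_def up by (cases r) simp_all
 have map_hs: "map j hs = filter (\<lambda>_. True) XS2"
 proof -
  have "map (skip 1) [2..<Suc N] = map Suc [2..<Suc N]"
   by (rule map_cong) (simp_all add: skip_def del: upt_Suc)
  then have "map (skip 1) [2..<Suc N] = [3..<Suc (Suc N)]"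
   by (simp add: map_Suc_upt del: upt_Suc add: numeral_3_eq_3 numeral_2_eq_2)
  then show ?thesis
   using map_Ls[of "skip 1" r "[2..<Suc N]"] by (simp add: hs_def XS2_def j_def[abs_def] del: upt_Suc)
 qed
 have set_gs: "set gs = {H. H \<subseteq> {2..Suc N} \<and> card H = r}"
  unfolding gs_def by (rule set_coords)
 have set_XS2: "set XS2 = {H. H \<subseteq> {3..Suc N} \<and> card H = r}"
  unfolding XS2_def by (simp add: set_Ls atLeastLessThanSuc_atLeastAtMost del: upt_Suc)
 have dist: "distinct gs" "distinct hs"
  unfolding gs_def hs_def by (rule distinct_coords)+
 have dist2: "distinct (XS1 @ XS2)"
  using dist(1) unfolding gs_eq .
 then have dist3: "distinct XS2" "distinct XS1"
  by auto
 have mgs: "mean (R H) (\<mu> H)" if "H \<in> set gs" for H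
  using mean_xf[OF E, of H] that by (simp add: R_def \<mu>_def gs_def)
 have jX: "j H \<in> set XS2" if "H \<in> set hs" for H
 proof -
  have "j H \<in> set (map j hs)"
   using that by simp
  then show ?thesis
   unfolding map_hs by simp
 qed
 have sk: "skip 1 0 = 0" "skip 1 1 = 2"
  by (simp_all add: skip_def)
 have BB: "BB H = insert 0 (insert 2 (j H))" for H
  unfolding BB_def j_def by (simp only: image_insert sk)
 have H: "H \<subseteq> {2..N}" "card H = r" if "H \<in> set hs" for H
  using that unfolding hs_def by (simp_all add: set_coords del: upt_Suc)
 have Bnew: "BB H \<in> Asets (Suc r) (Suc N)" "BB H \<notin> Asets r (Suc N)" "1 \<notin> BB H" if h: "H \<in> set hs" for H
 proof -
  show "BB H \<in> Asets (Suc r) (Suc N)" "BB H \<notin> Asets r (Suc N)"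
   unfolding BB_def Asets_skip[OF v1] using asm_coord(1,2)[OF H[OF h] N] by blast+
  have "1 \<notin> j H"
   using jX[OF h] by (auto simp: set_XS2)
  then show "1 \<notin> BB H"
   by (simp add: BB)
 qed
 define V where "V H = insert 1 (BB H)" for H
 have V: "finite (V H)" "card (V H) = Suc (Suc (Suc r))" "V H = insert 0 (insert 1 (insert 2 (j H)))"
  "pos (V H) 1 = 1" "pos (V H) 2 = 2" "1 \<in> V H" "2 \<in> V H" if h: "H \<in> set hs" for H
 proof -
  have G: "j H \<subseteq> {3..Suc N}" "card (j H) = r"
   using jX[OF h] by (simp_all add: set_XS2)
  show eq: "V H = insert 0 (insert 1 (insert 2 (j H)))"
   by (auto simp: V_def BB)
  have "finite (j H)"
   using G(1) finite_subset by auto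
  then show "finite (V H)"
   by (simp add: eq)
  show "card (V H) = Suc (Suc (Suc r))"
   using new_set(2,3)[OF Bnew(1,2)[OF h]] Bnew(3)[OF h] by (simp add: V_def)
  have "{b \<in> V H. b < 1} = {0}" "{b \<in> V H. b < 2} = {0, 1}"
   using G(1) by (auto simp: eq)
  then show "pos (V H) 1 = 1" "pos (V H) 2 = 2"
   by (simp_all add: pos_def)
  show "1 \<in> V H" "2 \<in> V H"
   by (auto simp: eq)
 qed
 have dV: "d (Suc (Suc r)) 1 t = fc (V H) 1 t" "d (Suc (Suc r)) 2 t = fc (V H) 2 t" if "H \<in> set hs" for H t
  using V[OF that] by (simp_all add: fc_def)
 \<comment> \<open>\<open>c1\<close> is completed by arbitrary values of the variables in
   \<open>XS2\<close>, only to obtain one simplex \<open>DD\<close> through which all transports for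
   this \<open>c1\<close> pass.\<close>
 define ext where "ext c1 = (\<lambda>g. if g \<in> set XS2 then rep (Suc r) (xf r y g) else c1 g)" for c1
 define DD where "DD c1 H = (SOME t. hf y (ext c1) (BB H) t)" for c1 H
 define tt where "tt c1 H z = tr (Suc r) (DD c1 H) z" for c1 H z
 have xfK: "xf r y g \<in> K (Suc r)" if "g \<in> set gs" for g
  using xf(1)[OF E, of g] that by (simp add: set_gs)
 have adm_ext: "adm r (Suc N) y (ext c1)" if c1: "\<And>g. g \<in> set XS1 ==> c1 g \<in> R g" for c1
  unfolding adm_def
 proof (intro allI impI)
  fix g assume g: "g \<subseteq> {2..Suc N}" "card g = r"
  then have gg: "g \<in> set gs"
   by (simp add: set_gs)
  show "ext c1 g \<in> reps (Suc r) (xf r y g)"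
  proof (cases "g \<in> set XS2")
   case True
   then show ?thesis
    using repsI[OF par_refl[OF xfK[OF gg]]] by (simp add: ext_def)
  next
   case False
   then show ?thesis
    using c1[of g] gg gs_eq by (auto simp: ext_def R_def)
  qed
 qed
 have hfD: "hf y (ext c1) (BB H) (DD c1 H)" if "\<And>g. g \<in> set XS1 ==> c1 g \<in> R g" "H \<in> set hs" for c1 H
  unfolding DD_def using hf_ex[OF E N1 adm_ext[OF that(1)] Bnew[OF that(2)]] by (rule someI_ex)
 \<comment> \<open>The face of \<open>V H\<close> opposite a vertex other than 0, 1, 2 contains 2
   and so is a variable of \<open>XS1\<close>, on which \<open>c\<close> and its completion
   coincide. Hence the filler for \<open>c\<close> is a variant of \<open>DD\<close>, and its faces
   opposite 2 and 1 are related by \<open>tr\<close>.\<close>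
 have key: "asm r (Suc N) y c (BB H) = tt c H (c (j H))" if c: "c \<in> Pi\<^sub>E (set gs) R" and h: "H \<in> set hs" for c H
 proof -
  have admc: "adm r (Suc N) y c"
   using adm_PiE[of c r "Suc N" y] c unfolding gs_def R_def[abs_def] .
  obtain t where t: "hf y c (BB H) t"
   using hf_ex[OF E N1 admc Bnew[OF h]] by blast
  have c1: "c g \<in> R g" if "g \<in> set XS1" for g
   using c that gs_eq by auto
  note D = hfD[OF c1 h]
  have cB: "card (BB H) = Suc (Suc r)"
   using new_set(2)[OF Bnew(1,2)[OF h]] .
  have tK: "t \<in> K (Suc (Suc r))"
   using t cB by (simp add: hf_def)
  have "agree (Suc r) 1 (DD c H) t"
   unfolding agree_def
  proof (intro allI impI)
   fix k assume k: "k \<le> Suc (Suc r)" "k \<noteq> 1" "k \<noteq> Suc 1"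
   obtain b where b: "b \<in> V H" "pos (V H) b = k"
    using pos_surj[OF V(1)[OF h], of k] V(2)[OF h] k(1) by auto
   then have b12: "b \<noteq> 1" "b \<noteq> 2"
    using V(4,5)[OF h] k by auto
   have bB: "b \<in> BB H"
    using b b12 by (auto simp: V_def)
   have "fc (V H) b t = fc (V H) b (DD c H)"
   proof (cases "b = 0")
    case True
    then show ?thesis
     using t D bB by (simp add: hf_def V_def)
   next
    case False
    have two: "2 \<in> BB H - {0, b}"
     using b12 by (simp add: BB)
    have "BB H - {0, b} \<notin> set XS2"
    proof
     assume "BB H - {0, b} \<in> set XS2"
     then have "BB H - {0, b} \<subseteq> {3..Suc N}"
      unfolding set_XS2 mem_Collect_eq by (rule conjunct1)
     from subsetD[OF this two] show False
      by simp
    qed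
    then have "ext c (BB H - {0, b}) = c (BB H - {0, b})"
     by (simp add: ext_def)
    then show ?thesis
     using t D bB False by (simp add: hf_def V_def)
   qed
   then show "d (Suc (Suc r)) k t = d (Suc (Suc r)) k (DD c H)"
    using b V(2)[OF h] by (simp add: fc_def)
  qed
  then have tr: "tr (Suc r) (DD c H) (d (Suc (Suc r)) 2 t) = rep (Suc r) (d (Suc (Suc r)) 1 t)"
   using tK by (intro tr_eq) auto
  have "BB H - {0, 2} = j H"
   using jX[OF h] by (auto simp: BB set_XS2)
  then have "d (Suc (Suc r)) 2 t = c (j H)"
   using t dV(2)[OF h] by (simp add: hf_def V_def BB)
  then show ?thesis
   using tr asm_new[OF E admc Bnew[OF h] t] dV(1)[OF h] by (simp add: tt_def V_def)
 qed
 have inv: "mu (Suc r) (xf r (pull 1 y) H) g = \<mu> (j H) (\<lambda>z. g (tt c1 H z))"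
  if c1: "\<And>g. g \<in> set XS1 ==> c1 g \<in> R g" and h: "H \<in> set hs" and g: "bfun g" for c1 H g
 proof -
  note D = hfD[OF c1 h] and admc = adm_ext[OF c1]
  have cB: "card (BB H) = Suc (Suc r)"
   using new_set(2)[OF Bnew(1,2)[OF h]] .
  have DK: "DD c1 H \<in> K (Suc (Suc r))"
   using D cB by (simp add: hf_def)
  have jg: "j H \<in> set gs"
   using jX[OF h] gs_eq by simp
  have "BB H - {0, 2} = j H"
   using jX[OF h] by (auto simp: BB set_XS2)
  then have d2: "d (Suc (Suc r)) 2 (DD c1 H) = rep (Suc r) (xf r y (j H))"
   using D dV(2)[OF h] jX[OF h] by (simp add: hf_def V_def BB ext_def)
  then have p2: "par (Suc r) (d (Suc (Suc r)) 2 (DD c1 H)) (xf r y (j H))"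
   using par_sym[OF rep_par[OF xfK[OF jg]]] by simp
  have u1: "d (Suc (Suc r)) 1 (DD c1 H) \<in> K (Suc r)"
   using face_in[OF DK, of 1] by simp
  let ?t = "asm r (Suc N) y (ext c1) (BB H)"
  have "?t = rep (Suc r) (d (Suc (Suc r)) 1 (DD c1 H))"
   using asm_new[OF E admc Bnew[OF h] D] dV(1)[OF h] by (simp add: V_def)
  then have "par (Suc r) (d (Suc (Suc r)) 1 (DD c1 H)) ?t"
   using rep_par[OF u1] by simp
  moreover have "par (Suc r) ?t (xf r (pull 1 y) H)"
  proof (rule par_pull[OF E N v1 h[unfolded hs_def]])
   show "?t \<in> K (Suc r)"
    by (rule asm_props(1)[OF E N1 admc Bnew(1,2)[OF h]])
   show "fc (skip 1 ` insert 0 (insert 1 H)) b ?t = y (skip 1 ` insert 0 (insert 1 H) - {b})"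
    if "b \<in> skip 1 ` insert 0 (insert 1 H)" for b
    using asm_props(3)[OF E N1 admc Bnew(1,2)[OF h]] that unfolding BB_def by blast
  qed
  ultimately have p1: "par (Suc r) (d (Suc (Suc r)) 1 (DD c1 H)) (xf r (pull 1 y) H)"
   by (rule par_trans)
  have "mu (Suc r) (d (Suc (Suc r)) 1 (DD c1 H)) g = mu (Suc r) (d (Suc (Suc r)) 2 (DD c1 H)) (\<lambda>z. g (tr (Suc r) (DD c1 H) z))"
  proof (rule mu_tr[OF _ DK _ g])
   assume "Suc r = 1"
   then have r0: "r = 0"
    by simp
   have "j H = {}"
    using jX[OF h] r0 finite_subset[of "j H" "{3..Suc N}"] by (auto simp: set_XS2)
   then have "par 1 (d 2 2 (DD c1 H)) (xf 0 y {})"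
    using p2 r0 by (simp add: numeral_2_eq_2)
   then show "base (d 1 1 (d 2 2 (DD c1 H))) = d 1 1 (d 2 2 (DD c1 H))"
    using base_xf[of "Suc N" y] E r0 by simp
  qed simp
  moreover have "mu (Suc r) (d (Suc (Suc r)) 1 (DD c1 H)) = mu (Suc r) (xf r (pull 1 y) H)"
   "mu (Suc r) (d (Suc (Suc r)) 2 (DD c1 H)) = mu (Suc r) (xf r y (j H))"
   using mu_par[OF _ p1] mu_par[OF _ p2] by simp_all
  ultimately show ?thesis
   by (simp add: \<mu>_def tt_def)
 qed
 define F where "F c' = f (asm r N (pull 1 y) c')" for c'
 have bF: "bfun F"
  unfolding F_def[abs_def] using f by (rule bfun_compose)
 define mg where "mg c1 c2 = (\<lambda>g. if g \<in> set XS2 then c2 g else c1 g)" for c1 c2 :: "nat set => 's"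
 define co where "co c = (\<lambda>H. if H \<in> set hs then tt c H (c (j H)) else undefined)" for c
 have E1: "E r N (pull 1 y)"
  by (rule E_pull[OF E N v1])
 have mX1: "\<And>g. g \<in> set XS1 ==> mean (R g) (\<mu> g)" and mX2: "\<And>g. g \<in> set XS2 ==> mean (R g) (\<mu> g)"
  and mX: "\<And>g. g \<in> set (XS1 @ XS2) ==> mean (R g) (\<mu> g)"
  using mgs gs_eq by auto
 have mh: "mean (reps (Suc r) (xf r (pull 1 y) H)) (mu (Suc r) (xf r (pull 1 y) H))" if "H \<in> set hs" for H
  using mean_xf[OF E1, of H] that by (simp add: hs_def)
 have mj: "mean (R (j H)) (\<mu> (j H))" if "H \<in> set hs" for H
  using mX2[OF jX[OF that]] .
 have "S r (Suc N) y (\<lambda>y'. f (pull 1 y')) = prodmean gs \<mu> (\<lambda>c. f (pull 1 (asm r (Suc N) y c)))"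
  using E by (simp add: S_def gs_def \<mu>_def[abs_def] del: upt_Suc)
 also have "\<dots> = prodmean gs \<mu> (\<lambda>c. F (co c))"
 proof (rule prodmean_cong[OF mgs])
  fix c assume c: "c \<in> Pi\<^sub>E (set gs) R"
  have admc: "adm r (Suc N) y c"
   using adm_PiE[of c r "Suc N" y] c unfolding gs_def R_def[abs_def] .
  have "asm r N (pull 1 y) (co c) = pull 1 (asm r (Suc N) y c)"
   by (rule pull_asm[OF E N v1 admc]) (use key[OF c] in \<open>simp add: co_def hs_def BB_def\<close>)
  then show "f (pull 1 (asm r (Suc N) y c)) = F (co c)"
   by (simp add: F_def)
 next
  show "bfun (\<lambda>c. f (pull 1 (asm r (Suc N) y c)))"
   using bfun_compose[OF f, of "\<lambda>c. pull 1 (asm r (Suc N) y c)"] .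
  show "bfun (\<lambda>c. F (co c))"
   using bfun_compose[OF bF, of co] .
 qed (use dist dist3 in auto)
 also have "\<dots> = prodmean XS1 \<mu> (\<lambda>c1. prodmean XS2 \<mu> (\<lambda>c2. F (co (mg c1 c2))))"
  unfolding gs_eq mg_def using mX bfun_compose[OF bF, of co] dist2 by (rule prodmean_append)
 \<comment> \<open>After the change of variables the inner mean no longer depends on
   \<open>c1\<close>, and the outer means become trivial.\<close>
 also have "\<dots> = prodmean XS1 \<mu> (\<lambda>c1. prodmean hs (\<lambda>H. mu (Suc r) (xf r (pull 1 y) H)) F)"
 proof (rule prodmean_cong[OF mX1])
  fix c1 assume c1': "c1 \<in> Pi\<^sub>E (set XS1) R"
  then have c1: "\<And>g. g \<in> set XS1 ==> c1 g \<in> R g"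
   by auto
  define F' where "F' c = F (\<lambda>H. if H \<in> set hs then tt c1 H (c H) else undefined)" for c
  have bF': "bfun F'"
   unfolding F'_def[abs_def] using bF by (rule bfun_compose)
  have "F (co (mg c1 c2)) = F' (\<lambda>H. if H \<in> set hs then c2 (j H) else undefined)" for c2
  proof -
   have "ext (mg c1 c2) = ext c1"
    by (auto simp: ext_def mg_def)
   then have "tt (mg c1 c2) = tt c1"
    by (simp add: tt_def[abs_def] DD_def)
   moreover have "mg c1 c2 (j H) = c2 (j H)" if "H \<in> set hs" for H
    using jX[OF that] by (simp add: mg_def)
   ultimately have "co (mg c1 c2) = (\<lambda>H. if H \<in> set hs then tt c1 H (if H \<in> set hs then c2 (j H) else undefined) else undefined)"
    by (auto simp: co_def)
   then show ?thesis
    by (simp add: F'_def)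
  qed
  then have "prodmean XS2 \<mu> (\<lambda>c2. F (co (mg c1 c2))) =
   prodmean XS2 \<mu> (\<lambda>c2. F' (\<lambda>H. if H \<in> set hs then c2 (j H) else undefined))"
   by (simp only:)
  also have "\<dots> = prodmean hs (\<lambda>H. \<mu> (j H)) F'"
   by (rule prodmean_reindex[OF mX2 bF' dist3(1) map_hs])
  also have "\<dots> = prodmean hs (\<lambda>H. mu (Suc r) (xf r (pull 1 y) H)) F"
   unfolding F'_def[abs_def]
   by (rule prodmean_transport[OF mj mh bF dist(2) inv[OF c1]])
  finally show "prodmean XS2 \<mu> (\<lambda>c2. F (co (mg c1 c2))) = prodmean hs (\<lambda>H. mu (Suc r) (xf r (pull 1 y) H)) F" .
 next
  show "bfun (\<lambda>c1. prodmean XS2 \<mu> (\<lambda>c2. F (co (mg c1 c2))))"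
   using bfun_prodmean[of XS2 R \<mu> F "\<lambda>c1 c2. co (mg c1 c2)"] mX2 bF by blast
 qed (use dist dist3 in auto)
 also have "\<dots> = prodmean hs (\<lambda>H. mu (Suc r) (xf r (pull 1 y) H)) F"
  by (rule prodmean_const[OF mX1])
 also have "\<dots> = S r N (pull 1 y) f"
  using E1 by (simp add: S_def F_def[abs_def] hs_def del: upt_Suc)
 finally show ?thesis .
qed

lemma S_face:
 assumes "E r (Suc N) y" "1 \<le> N" "1 \<le> v" "v \<le> Suc N" "bfun f"
 shows "S r (Suc N) y (\<lambda>y'. f (pull v y')) = S r N (pull v y) f"
proof (cases "v = 1")
 case True
 then show ?thesis using S_face_1[OF assms(1,2,5)] by simp
next
 case False
 then show ?thesis using assms by (intro S_face_ge2) auto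
qed

section \<open>Composition of the stages, and the mean on cones\<close>

primrec Q :: "nat => nat => (nat set => 's) => ((nat set => 's) => real) => real" where
 "Q 0 N y f = f y"
| "Q (Suc r) N y f = Q r N y (\<lambda>y'. S r N y' f)"

lemma mean_Q:
 assumes "E 0 N y" "1 \<le> N"
 shows "mean {y'. E r N y' \<and> (\<forall>B\<in>Asets 0 N. y' B = y B)} (Q r N y)"
proof (induction r)
 case 0
 then show ?case
  using assms by (auto simp: mean_def)
next
 case (Suc r)
 let ?R = "\<lambda>r. {y'. E r N y' \<and> (\<forall>B\<in>Asets 0 N. y' B = y B)}"
 define k where "k y' f = (if y' \<in> ?R r then S r N y' f else 0)" for y' f
 have "mean (?R (Suc r)) (\<lambda>f. Q r N y (\<lambda>y'. k y' f))"
 proof (rule mean_bind[OF Suc])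
  fix y' assume y': "y' \<in> ?R r"
  have "mean (?R (Suc r)) (\<lambda>f. S r N y' (\<lambda>x. f x))"
   by (rule mean_map[OF mean_S]) (use y' assms Asets_mono[of 0 r N] in \<open>auto simp: subset_iff\<close>)
  then show "mean (?R (Suc r)) (k y')"
   using y' by (simp add: k_def[abs_def])
 qed (auto simp: k_def)
 then show ?case
 proof (rule mean_eq)
  fix f :: "(nat set => 's) => real" assume f: "bfun f"
  obtain B where B: "\<And>x. \<bar>f x\<bar> \<le> B"
   using f by (auto simp: bfun_def)
  have "0 \<le> B"
   using B[of undefined] by linarith
  have SB: "\<bar>S r N y' f\<bar> \<le> B" for y'
  proof (cases "E r N y'")
   case True
   then show ?thesis
    using mean_bound[OF mean_S[OF True assms(2)] f B] by simp
  next
   case False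
   then show ?thesis
    using \<open>0 \<le> B\<close> by (simp add: S_def)
  qed
  have "\<bar>k y' f\<bar> \<le> B" for y'
   using SB \<open>0 \<le> B\<close> by (simp add: k_def)
  then have "Q r N y (\<lambda>y'. k y' f) = Q r N y (\<lambda>y'. S r N y' f)"
   using SB by (intro mean_cong[OF Suc] bfunI[of _ B]) (auto simp: k_def)
  then show "Q r N y (\<lambda>y'. k y' f) = Q (Suc r) N y f"
   by simp
 qed
qed

lemma bfun_S:
 assumes "1 \<le> N" "bfun f"
 shows "bfun (\<lambda>y'. S r N y' f)"
proof -
 obtain B where B: "\<And>x. \<bar>f x\<bar> \<le> B"
  using assms(2) by (auto simp: bfun_def)
 have "0 \<le> B"
  using B[of undefined] by linarith
 have "\<bar>S r N y' f\<bar> \<le> B" for y'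
 proof (cases "E r N y'")
  case True
  then show ?thesis
   using mean_bound[OF mean_S[OF True assms(1)] assms(2) B] by simp
 next
  case False
  then show ?thesis
   using \<open>0 \<le> B\<close> by (simp add: S_def)
 qed
 then show ?thesis by (rule bfunI)
qed

lemma Q_face:
 assumes "E 0 (Suc N) y" "1 \<le> N" "1 \<le> v" "v \<le> Suc N" "bfun f"
 shows "Q r (Suc N) y (\<lambda>y'. f (pull v y')) = Q r N (pull v y) f"
 using assms(5)
proof (induction r arbitrary: f)
 case (Suc r)
 have b: "bfun (\<lambda>y'. f (pull v y'))"
  using bfun_compose[OF Suc.prems, of "pull v"] .
 have bS: "bfun (\<lambda>y'. S r N y' f)"
  using bfun_S[OF assms(2) Suc.prems] .
 have "Q r (Suc N) y (\<lambda>y'. S r (Suc N) y' (\<lambda>y'. f (pull v y'))) = Q r (Suc N) y (\<lambda>y'. S r N (pull v y') f)"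
 proof (rule mean_cong[OF mean_Q[OF assms(1)]])
  show "bfun (\<lambda>y'. S r (Suc N) y' (\<lambda>y'. f (pull v y')))"
   using bfun_S[OF _ b] by simp
  show "bfun (\<lambda>y'. S r N (pull v y') f)"
   using bfun_compose[OF bS, of "pull v"] .
 qed (use S_face assms Suc.prems in auto)
 also have "\<dots> = Q r N (pull v y) (\<lambda>y'. S r N y' f)"
  using Suc.IH[OF bS] .
 finally show ?case
  by simp
qed simp

text \<open>Besides 0 and 1 there are only N - 1 vertices, so stage \<open>N\<close> has no
  variables and adds no face. The surplus stage left over after the deletion of a vertex therefore
  does nothing.\<close>

lemma Q_stop:
 assumes "E 0 N y" "1 \<le> N" "bfun f"
 shows "Q (Suc N) N y f = Q N N y f"
proof -
 have "Q N N y (\<lambda>y'. S N N y' f) = Q N N y f"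
 proof (rule mean_cong[OF mean_Q[OF assms(1,2)] bfun_S[OF assms(2,3)] assms(3)])
  fix y' assume "y' \<in> {y'. E N N y' \<and> (\<forall>B\<in>Asets 0 N. y' B = y B)}"
  then have y': "E N N y'" by simp
  have "H \<notin> set (Ls N [2..<Suc N])" for H
  proof
   assume "H \<in> set (Ls N [2..<Suc N])"
   then have H: "H \<subseteq> {2..N}" "card H = N"
    by (simp_all add: set_coords del: upt_Suc)
   then show False
    using card_mono[of "{2..N}" H] assms(2) by simp
  qed
  then have L: "Ls N [2..<Suc N] = []"
   by (metis last_in_set)
  have "card B \<le> Suc N" if "B \<subseteq> {0..N}" for B
   using card_mono[OF _ that] by simp
  then have A: "Asets (Suc N) N = Asets N N"
   by (auto simp: Asets_def le_SucI)
  have "asm N N y' c = y'" for c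
   using ED(2)[OF y'] by (auto simp: asm_def A)
  then show "S N N y' f = f y'"
   using y' L by (simp add: S_def del: upt_Suc)
 qed
 then show ?thesis by simp
qed

lemma E0_ex:
 assumes N: "1 \<le> N" and x: "x \<in> K (N - 1)"
 shows "\<exists>y. E 0 N y \<and> y {1..N} = x"
proof -
 define s where "s = sub {1..N} x"
 have fs: "fam (Pow {1..N} - {{}}) s"
  unfolding s_def using x by (intro fam_sub) auto
 have s1: "s {1} \<in> K 0"
  using fam_Pow_in[OF fs, of "{1}"] N by simp
 obtain e where e: "e \<in> K 1" "d 1 1 e = base (s {1})" "d 1 0 e = s {1}"
  using base_edge[OF s1] by blast
 have bK: "base (s {1}) \<in> K 0"
  using face_in[of e 0 1] e by simp
 define y where "y B = (if B = {0} then base (s {1}) else if B \<in> Pow {1..N} - {{}} then s B else undefined)" for B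
 have A: "B \<in> Asets 0 N \<longleftrightarrow> B = {0} \<or> B \<in> Pow {1..N} - {{}}" for B
 proof
  assume B: "B \<in> Asets 0 N"
  show "B = {0} \<or> B \<in> Pow {1..N} - {{}}"
  proof (cases "0 \<in> B")
   case True
   then have "card B \<le> 1" "finite B"
    using B Asets_finite[OF B] by (simp_all add: Asets_def)
   then have "B = {0}"
    using True card_le_Suc0_iff_eq[of B] by auto
   then show ?thesis by simp
  next
   case False
   have "b \<in> {1..N}" if "b \<in> B" for b
   proof -
    have "b \<noteq> 0" "b \<le> N"
     using B False that by (auto simp: Asets_def)
    then show ?thesis by auto
   qed
   then show ?thesis
    using B by (auto simp: Asets_def)
  qed
 qed (auto simp: Asets_def)
 have ys: "y B = s B" if "B \<in> Pow {1..N} - {{}}" for B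
  using that by (auto simp: y_def)
 have "E 0 N y"
  unfolding E_def
 proof (intro conjI allI impI)
  show "fam (Asets 0 N) y"
   unfolding fam_def
  proof
   fix B assume "B \<in> Asets 0 N"
   then consider "B = {0}" | "B \<in> Pow {1..N} - {{}}"
    using A by blast
   then show "finite B \<and> B \<noteq> {} \<and> y B \<in> K (card B - 1) \<and>
    (2 \<le> card B --> (\<forall>v\<in>B. B - {v} \<in> Asets 0 N \<and> fc B v (y B) = y (B - {v})))"
   proof cases
    case 1
    then show ?thesis using bK by (simp add: y_def)
   next
    case 2
    show ?thesis
    proof (intro conjI impI ballI)
     show "finite B" "B \<noteq> {}" "y B \<in> K (card B - 1)"
      using famD(1-3)[OF fs 2] ys[OF 2] by auto
     fix v assume v: "2 \<le> card B" "v \<in> B"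
     show "B - {v} \<in> Asets 0 N"
      using famD(4)[OF fs 2 v] A by blast
     show "fc B v (y B) = y (B - {v})"
      using famD(4,5)[OF fs 2 v] ys[OF 2] ys[of "B - {v}"] by simp
    qed
   qed
  qed
  show "y B = undefined" if "B \<notin> Asets 0 N" for B
   using that unfolding A y_def by auto
  show "base (y {1}) = y {0}"
   using N by (auto simp: y_def)
  fix G assume G: "G \<subseteq> {2..N}" "card G \<le> 0"
  then have "G = {}"
   using finite_subset[of G "{2..N}"] by auto
  moreover have "fill y {0, 1}"
  proof -
   have p: "pos {0, 1} 1 = 1" "pos {0, 1} 0 = 0" "card {0, 1 :: nat} = 2"
   proof -
    have "{b \<in> {0, 1}. b < 1} = {0 :: nat}" "{b \<in> {0, 1 :: nat}. b < 0} = {}"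
     by auto
    then show "pos {0, 1} 1 = 1" "pos {0, 1} 0 = 0" "card {0, 1 :: nat} = 2"
     by (simp_all add: pos_def)
   qed
   have s: "{0, 1} - {1} = {0 :: nat}" "{0, 1} - {0} = {1 :: nat}"
    by auto
   have "fc {0, 1} v e = y ({0, 1} - {v})" if "v \<in> {0, 1}" for v
   proof -
    consider "v = 0" | "v = 1"
     using \<open>v \<in> {0, 1}\<close> by auto
    then show ?thesis
    proof cases
     case 1
     show ?thesis unfolding 1 s fc_def p using e N by (simp add: y_def)
    next
     case 2
     show ?thesis unfolding 2 s fc_def p using e N by (simp add: y_def)
    qed
   qed
   then show ?thesis
    unfolding fill_def p using e(1) by (intro bexI[of _ e] ballI) (assumption | simp)+
  qed
  ultimately show "fill y (insert 0 (insert 1 G))"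
   by simp
 qed
 moreover have "y {1..N} = x"
  using N ys[of "{1..N}"] by (simp add: s_def)
 ultimately show ?thesis
  by blast
qed

text \<open>At stage 0 only the apex is added, and it is the base vertex of vertex 1. A starting
  state restricted to a face is thereby recognised as the starting state of that face.\<close>

lemma E0_unique:
 assumes N: "1 \<le> N" and y: "E 0 N y" "E 0 N y'" and eq: "y {1..N} = y' {1..N}"
 shows "y = y'"
proof
 fix B
 have A1: "{1..N} \<in> Asets 0 N"
  using N by (auto simp: Asets_def)
 have *: "y B = y' B" if "B \<subseteq> {1..N}" "B \<noteq> {}" for B
  using fam_fam_eq[OF ED(1)[OF y(1)] A1 ED(1)[OF y(2)] A1 eq that] .
 consider "B \<notin> Asets 0 N" | "B \<in> Asets 0 N" "0 \<in> B" | "B \<in> Asets 0 N" "0 \<notin> B"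
  by blast
 then show "y B = y' B"
 proof cases
  case 1
  then show ?thesis using ED(2)[OF y(1)] ED(2)[OF y(2)] by simp
 next
  case 2
  have "card B \<le> 1" "finite B"
   using 2 Asets_finite[OF 2(1)] by (simp_all add: Asets_def)
  then have "B = {0}"
   using 2(2) card_le_Suc0_iff_eq[of B] by auto
  then show ?thesis
   using ED(3)[OF y(1)] ED(3)[OF y(2)] *[of "{1}"] N by simp
 next
  case 3
  have "b \<in> {1..N}" if "b \<in> B" for b
  proof -
   have "b \<noteq> 0" "b \<le> N"
    using 3 that by (auto simp: Asets_def)
   then show ?thesis by auto
  qed
  then show ?thesis
   using 3 by (intro *) (auto simp: Asets_def)
 qed
qed

definition y0 :: "nat => 's => nat set => 's" where
 "y0 N x = (SOME y. E 0 N y \<and> y {1..N} = x)"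

text \<open>A mean on the cones over an n-simplex \<open>x\<close>. The vertices of \<open>x\<close>
  are labelled from 1 to n + 1 and the apex by 0, so \<open>x\<close> is the 0-th face of each
  cone.\<close>

definition T :: "nat => 's => ('s => real) => real" where
 "T n x f = Q (Suc n) (Suc n) (y0 (Suc n) x) (\<lambda>y. f (y {0..Suc n}))"

lemma y0:
 assumes "x \<in> K n"
 shows "E 0 (Suc n) (y0 (Suc n) x)" "y0 (Suc n) x {1..Suc n} = x"
 using someI_ex[OF E0_ex[of "Suc n" x]] assms by (auto simp: y0_def)

lemma pos_atLeastAtMost: "v \<le> N ==> pos {0..N} v = v" "1 \<le> v ==> v \<le> N ==> pos {1..N} v = v - 1"
proof -
 assume v: "v \<le> N"
 then have "{b \<in> {0..N}. b < v} = {..<v}"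
  by auto
 then show "pos {0..N} v = v"
  by (simp add: pos_def)
 assume "1 \<le> v"
 then have "{b \<in> {1..N}. b < v} = {1..<v}"
  using v by auto
 then show "pos {1..N} v = v - 1"
  by (simp add: pos_def)
qed

lemma mean_T:
 assumes "x \<in> K n"
 shows "mean {t \<in> K (Suc n). d (Suc n) 0 t = x} (T n x)"
proof -
 have "mean {t \<in> K (Suc n). d (Suc n) 0 t = x} (\<lambda>f. Q (Suc n) (Suc n) (y0 (Suc n) x) (\<lambda>y. f (y {0..Suc n})))"
 proof (rule mean_map[OF mean_Q[OF y0(1)[OF assms]]])
  fix y assume "y \<in> {y'. E (Suc n) (Suc n) y' \<and> (\<forall>B\<in>Asets 0 (Suc n). y' B = y0 (Suc n) x B)}"
  then have y: "E (Suc n) (Suc n) y" "\<forall>B\<in>Asets 0 (Suc n). y B = y0 (Suc n) x B"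
   by auto
  have A: "{0..Suc n} \<in> Asets (Suc n) (Suc n)" "{1..Suc n} \<in> Asets 0 (Suc n)"
   by (auto simp: Asets_def)
  have s: "{0..Suc n} - {0} = {1..Suc n}"
   by auto
  have "fc {0..Suc n} 0 (y {0..Suc n}) = y {1..Suc n}"
   using E_fc[OF y(1) A(1), of 0] unfolding s by simp
  then show "y {0..Suc n} \<in> {t \<in> K (Suc n). d (Suc n) 0 t = x}"
   using E_K[OF y(1) A(1)] y(2) A(2) y0(2)[OF assms] pos_atLeastAtMost(1)[of 0 "Suc n"] by (simp add: fc_def)
 qed simp
 then show ?thesis
  by (simp add: T_def[abs_def])
qed

text \<open>The vertex \<open>j\<close> of \<open>x\<close> carries the label \<open>Suc j\<close>.
  \<open>Q_face\<close> passes to the face, \<open>Q_stop\<close> removes the surplus stage, and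
  \<open>E0_unique\<close> identifies the starting states.\<close>

lemma T_face:
 assumes x: "x \<in> K (Suc n)" and j: "j \<le> Suc n" and f: "bfun f"
 shows "T (Suc n) x (\<lambda>t. f (d (Suc (Suc n)) (Suc j) t)) = T n (d (Suc n) j x) f"
proof -
 let ?M = "Suc n" and ?y = "y0 (Suc (Suc n)) x" and ?v = "Suc j"
 note y = y0[OF x]
 have v: "1 \<le> ?v" "?v \<le> Suc ?M" and M: "1 \<le> ?M"
  using j by auto
 have dx: "d (Suc n) j x \<in> K n"
  using face_in[OF x j] .
 define g where "g y' = f (y' {0..?M})" for y' :: "nat set => 's"
 have bg: "bfun g"
  unfolding g_def[abs_def] using f by (rule bfun_compose)
 have sk: "skip ?v ` {0..?M} = {0..Suc ?M} - {?v}"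
 proof -
  have eq: "{0..k} = insert 0 {1..k}" for k :: nat
   by auto
  have "skip ?v 0 = 0"
   by (simp add: skip_def)
  then have "skip ?v ` {0..?M} = insert 0 ({1..Suc ?M} - {?v})"
   using skip_image_atLeastAtMost[OF v] unfolding eq[of ?M] by simp
  also have "\<dots> = insert 0 {1..Suc ?M} - {?v}"
   by (subst insert_Diff_if) simp
  also have "insert 0 {1..Suc ?M} = {0..Suc ?M}"
   by (rule eq[symmetric])
  finally show ?thesis .
 qed
 have "T (Suc n) x (\<lambda>t. f (d (Suc (Suc n)) (Suc j) t)) = Q (Suc ?M) (Suc ?M) ?y (\<lambda>y'. f (d (Suc ?M) ?v (y' {0..Suc ?M})))"
  unfolding T_def by (rule refl)
 also have "\<dots> = Q (Suc ?M) (Suc ?M) ?y (\<lambda>y'. g (pull ?v y'))"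
 proof (rule mean_cong[OF mean_Q[OF y(1)]])
  fix y' assume "y' \<in> {y'. E (Suc ?M) (Suc ?M) y' \<and> (\<forall>B\<in>Asets 0 (Suc ?M). y' B = ?y B)}"
  then have y': "E (Suc ?M) (Suc ?M) y'"
   by simp
  have A: "{0..Suc ?M} \<in> Asets (Suc ?M) (Suc ?M)"
   by (auto simp: Asets_def)
  have "fc {0..Suc ?M} ?v (y' {0..Suc ?M}) = y' ({0..Suc ?M} - {?v})"
   using E_fc[OF y' A, of ?v] v by auto
  then show "f (d (Suc ?M) ?v (y' {0..Suc ?M})) = g (pull ?v y')"
   using pos_atLeastAtMost(1)[of ?v "Suc ?M"] v sk by (simp add: fc_def g_def pull_def)
 next
  show "bfun (\<lambda>y'. f (d (Suc ?M) ?v (y' {0..Suc ?M})))"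
   using bfun_compose[OF f, of "\<lambda>y'. d (Suc ?M) ?v (y' {0..Suc ?M})"] .
  show "bfun (\<lambda>y'. g (pull ?v y'))"
   using bfun_compose[OF bg, of "pull ?v"] .
 qed simp
 also have "\<dots> = Q (Suc ?M) ?M (pull ?v ?y) g"
  by (rule Q_face[OF y(1) M v bg])
 also have "\<dots> = Q ?M ?M (pull ?v ?y) g"
  by (rule Q_stop[OF E_pull[OF y(1) M v] M bg])
 also have "pull ?v ?y = y0 ?M (d (Suc n) j x)"
 proof (rule E0_unique[OF M E_pull[OF y(1) M v] y0(1)[OF dx]])
  have A: "{1..Suc ?M} \<in> Asets 0 (Suc ?M)"
   by (auto simp: Asets_def)
  have "pull ?v ?y {1..?M} = ?y ({1..Suc ?M} - {?v})"
   using skip_image_atLeastAtMost[OF v] by (simp add: pull_def)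
  also have "\<dots> = fc {1..Suc ?M} ?v (?y {1..Suc ?M})"
   using E_fc[OF y(1) A, of ?v] v by simp
  also have "\<dots> = d (Suc n) j x"
   using y(2) pos_atLeastAtMost(2)[OF v] by (simp add: fc_def)
  finally show "pull ?v ?y {1..?M} = y0 ?M (d (Suc n) j x) {1..?M}"
   using y0(2)[OF dx] by simp
 qed
 also have "Q ?M ?M (y0 ?M (d (Suc n) j x)) g = T n (d (Suc n) j x) f"
  unfolding T_def g_def[abs_def] by (rule refl)
 finally show ?thesis .
qed

end

section \<open>Composition of transports\<close>

context kan begin

lemma agree_sym: "agree m i D D' ==> agree m i D' D"
 by (simp add: agree_def)

lemma agree_trans: "agree m i D D' ==> agree m i D' D'' ==> agree m i D D''"
 by (simp add: agree_def)

lemma tr_agree: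
 assumes "agree m 1 D D0"
 shows "tr m D = tr m D0"
proof -
 have "agree m 1 D D' \<longleftrightarrow> agree m 1 D0 D'" for D'
  using agree_trans[OF assms] agree_trans[OF agree_sym[OF assms]] by blast
 then show ?thesis
  by (simp add: tr_def fun_eq_iff)
qed

lemma tr_ex:
 assumes m: "1 \<le> m" and D: "D \<in> K (Suc m)" and z: "par m z (d (Suc m) 2 D)"
 obtains D' where "D' \<in> K (Suc m)" "agree m 1 D D'" "d (Suc m) 2 D' = z" "tr m D z = rep m (d (Suc m) 1 D')"
  "par m (d (Suc m) 1 D') (d (Suc m) 1 D)"
proof -
 obtain D' where D': "D' \<in> K (Suc m)" "d (Suc m) 2 D' = z" "agree m 1 D D'"
  using move_index[of m 2 1 D z] m D z by (auto simp: agree_def numeral_2_eq_2)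
 have "par m (d (Suc m) 1 D') (d (Suc m) 1 D)"
  by (rule par_face_index[of m 2]) (use m D D' z in \<open>auto simp: agree_def numeral_2_eq_2\<close>)
 then show ?thesis
  using that[OF D'(1,3,2)] tr_eq[OF m D'(1,3)] D'(2) by simp
qed

lemma tr_reps:
 assumes m: "1 \<le> m" and D: "D \<in> K (Suc m)" and z: "par m z (d (Suc m) 2 D)"
 shows "tr m D z \<in> reps m (d (Suc m) 1 D)"
 using tr_ex[OF assms] repsI by metis

text \<open>After adjusting \<open>D1\<close> so that its face 1 is the face 2 of \<open>D\<close>
  itself, the two are glued as the facets opposite 3 and 1 of a simplex on
  \<open>{..Suc (Suc m)}\<close>. The facet opposite 2 is the composite; that it acts as the
  composite on every \<open>z\<close> is an instance of \<open>square\<close>.\<close>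

lemma tr_compose:
 assumes m: "1 \<le> m" and D: "D1 \<in> K (Suc m)" "D \<in> K (Suc m)" and p: "par m (d (Suc m) 1 D1) (d (Suc m) 2 D)"
 obtains D3 where "D3 \<in> K (Suc m)" "par m (d (Suc m) 2 D3) (d (Suc m) 2 D1)" "par m (d (Suc m) 1 D3) (d (Suc m) 1 D)"
  "\<And>z. par m z (d (Suc m) 2 D1) ==> tr m D3 z = tr m D (tr m D1 z)"
proof -
 obtain D1' where D1': "D1' \<in> K (Suc m)" "d (Suc m) 1 D1' = d (Suc m) 2 D" "agree m 1 D1 D1'"
  using move_index[of m 1 2 D1 "d (Suc m) 2 D"] m D par_sym[OF p] by (auto simp: agree_def numeral_2_eq_2)
 have p2: "par m (d (Suc m) 2 D1') (d (Suc m) 2 D1)"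
  by (rule par_face_index[of m 1]) (use m D D1' par_sym[OF p] in \<open>auto simp: agree_def numeral_2_eq_2\<close>)
 define V where "V = {..Suc (Suc m)}"
 have V: "finite V" "card V = Suc (Suc (Suc m))"
  by (auto simp: V_def)
 define P where "P = V - {3}"
 define Q where "Q = V - {1}"
 define R where "R = V - {2}"
 have inV: "1 \<in> V" "2 \<in> V" "3 \<in> V" "0 \<in> V"
  using m by (auto simp: V_def)
 have cc: "finite (V - {b})" "card (V - {b}) = Suc (Suc m)" if "b \<in> V" for b
  using that V by auto
 have ps: "pos (V - {b}) k = (if b < k then k - 1 else k)" if "b \<in> V" "k \<in> V" for b k
  using pos_Diff[of V b k] V that pos_atMost[of k "Suc (Suc m)"] by (simp add: V_def)
 have fP: "fc P 2 t = d (Suc m) 2 t" "fc P 1 t = d (Suc m) 1 t" for t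
  using cc[OF inV(3)] ps[OF inV(3)] inV by (simp_all add: fc_def P_def)
 have fQ: "fc Q 3 t = d (Suc m) 2 t" "fc Q 2 t = d (Suc m) 1 t" for t
  using cc[OF inV(1)] ps[OF inV(1)] inV by (simp_all add: fc_def Q_def)
 have fR: "fc R 3 t = d (Suc m) 2 t" "fc R 1 t = d (Suc m) 1 t" for t
  using cc[OF inV(2)] ps[OF inV(2)] inV by (simp_all add: fc_def R_def)
 have agr: "fc (V - {b}) k t = fc (V - {b}) k t'" if "agree m 1 t' t" "b \<in> {1,2,3}" "k \<in> V" "k \<notin> {1,2,3}" for t t' b k
 proof -
  have "b \<in> V" using that(2) inV by auto
  moreover have "pos (V - {b}) k \<le> Suc m"
   using ps[OF \<open>b \<in> V\<close> that(3)] pos_less_card[of "V - {b}" k] cc[OF \<open>b \<in> V\<close>] that by auto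
  moreover have "pos (V - {b}) k \<noteq> 1" "pos (V - {b}) k \<noteq> 2"
   using ps[OF \<open>b \<in> V\<close> that(3)] that(2,4) by (auto split: if_splits)
  ultimately show ?thesis
   using that(1) cc[of b] by (simp add: fc_def agree_def numeral_2_eq_2)
 qed
 have PQ: "P \<inter> Q = P - {1}" "P \<inter> Q = Q - {3}" "P \<union> Q = V"
  using inV by (auto simp: P_def Q_def)
 have "\<exists>s. fam (Pow (P \<union> Q) - {{}}) s \<and> s P = D1' \<and> s Q = D"
 proof (rule glue2[where b = 0])
  have "sub P D1' (P - {1}) = fc P 1 D1'"
   using cc[OF inV(3)] D1' inV by (intro sub_Diff) (auto simp: P_def)
  moreover have "sub Q D (Q - {3}) = fc Q 3 D"
   using cc[OF inV(1)] D inV by (intro sub_Diff) (auto simp: Q_def)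
  ultimately show "sub P D1' (P \<inter> Q) = sub Q D (P \<inter> Q)"
   using D1' fP fQ PQ by metis
 qed (use cc[OF inV(3)] cc[OF inV(1)] D1' D inV in \<open>auto simp: P_def Q_def\<close>)
 then obtain W where W: "fam (Pow V - {{}}) W" "W P = D1'" "W Q = D"
  using PQ(3) by auto
 define D3 where "D3 = W R"
 have Wf: "fc (V - {b}) k (W (V - {b})) = W (V - {b, k})" if "b \<in> V" "k \<in> V" "k \<noteq> b" for b k
 proof -
  have "fc (V - {b}) k (W (V - {b})) = W (V - {b} - {k})"
   using cc[OF that(1)] that by (intro fam_Pow_fc[OF W(1)]) auto
  moreover have "V - {b} - {k} = V - {b, k}" by auto
  ultimately show ?thesis by simp
 qed
 have D3K: "D3 \<in> K (Suc m)"
 proof -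
  have "0 \<in> R" "R \<subseteq> V"
   using inV by (auto simp: R_def)
  then show ?thesis
   using fam_Pow_in[OF W(1), of R] cc(2)[OF inV(2)] unfolding D3_def R_def by (fastforce)
 qed
 have W23: "W (V - {2, 3}) = d (Suc m) 2 D1'"
  using Wf[OF inV(3,2)] W(2) fP(1) by (simp add: P_def insert_commute)
 have W13: "W (V - {1, 3}) = d (Suc m) 2 D"
  using Wf[OF inV(1,3)] W(3) fQ(1) by (simp add: Q_def)
 have W12: "W (V - {1, 2}) = d (Suc m) 1 D"
  using Wf[OF inV(1,2)] W(3) fQ(2) by (simp add: Q_def)
 have d3: "d (Suc m) 2 D3 = d (Suc m) 2 D1'" "d (Suc m) 1 D3 = d (Suc m) 1 D"
  using Wf[OF inV(2,3)] Wf[OF inV(2,1)] fR W23 W12 by (simp_all add: D3_def R_def insert_commute)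
 have comp: "tr m D3 z = tr m D (tr m D1 z)" if z: "par m z (d (Suc m) 2 D1)" for z
 proof -
  have z': "par m z (d (Suc m) 2 D1')"
   using par_trans[OF z par_sym[OF p2]] .
  obtain A where A: "A \<in> K (Suc m)" "agree m 1 D1' A" "d (Suc m) 2 A = z" "tr m D1' z = rep m (d (Suc m) 1 A)"
   "par m (d (Suc m) 1 A) (d (Suc m) 1 D1')"
   using tr_ex[OF m D1'(1) z'] by blast
  define u where "u = d (Suc m) 1 A"
  have uK: "u \<in> K m"
   using A(5) by (simp add: u_def par_def)
  have "par m (rep m u) (d (Suc m) 2 D)"
   using par_trans[OF par_sym[OF rep_par[OF uK m]] A(5)[folded u_def]] D1'(2) by simp
  then obtain B where B: "B \<in> K (Suc m)" "agree m 1 D B" "d (Suc m) 2 B = rep m u"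
   "tr m D (rep m u) = rep m (d (Suc m) 1 B)" "par m (d (Suc m) 1 B) (d (Suc m) 1 D)"
   using tr_ex[OF m D(2)] by blast
  \<comment> \<open>Transports end in canonical representatives, whereas the configuration needs the
    simplex \<open>u\<close> itself; the variant of \<open>D\<close> is altered accordingly within
    the homotopy class.\<close>
  have "\<exists>B'\<in>K (Suc m). d (Suc m) 2 B' = u \<and> (\<forall>i\<le>Suc m. i \<noteq> 2 --> d (Suc m) i B' = d (Suc m) i B)"
   using hom_replace_index[OF m hom_sym[OF hom_rep[OF uK m]] B(1) _ B(3)] m by simp
  then obtain B' where B': "B' \<in> K (Suc m)" "d (Suc m) 2 B' = u" "\<And>i. i \<le> Suc m ==> i \<noteq> 2 ==> d (Suc m) i B' = d (Suc m) i B"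
   by blast
  define w where "w = d (Suc m) 1 B"
  have B'1: "d (Suc m) 1 B' = w"
   using B'(3)[of 1] by (simp add: w_def)
  have aB': "agree m 1 D B'"
   unfolding agree_def
  proof (intro allI impI)
   fix k assume k: "k \<le> Suc m" "k \<noteq> 1" "k \<noteq> Suc 1"
   then show "d (Suc m) k B' = d (Suc m) k D"
    using B(2)[unfolded agree_def, rule_format, OF k] B'(3)[of k] by (simp add: numeral_2_eq_2)
  qed
  define s where "s = W(V - {2, 3} := z, V - {1, 3} := u, V - {1, 2} := w)"
  have "2 \<in> V - {1, 3}" "2 \<notin> V - {2, 3}" "3 \<in> V - {1, 2}" "3 \<notin> V - {2, 3}" "3 \<notin> V - {1, 3}"
   using inV by simp_all
  then have dist: "V - {1, 3} \<noteq> V - {2, 3}" "V - {1, 2} \<noteq> V - {2, 3}" "V - {1, 2} \<noteq> V - {1, 3}"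
   by metis+
  have s_other: "s (V - {b, k}) = W (V - {b, k})" if "k \<notin> {1, 2, 3}" "k \<in> V" for b k
  proof -
   have "k \<notin> V - {b, k}" "k \<in> V - {2, 3}" "k \<in> V - {1, 3}" "k \<in> V - {1, 2}"
    using that by auto
   then have "V - {b, k} \<noteq> V - {2, 3}" "V - {b, k} \<noteq> V - {1, 3}" "V - {b, k} \<noteq> V - {1, 2}"
    by metis+
   then show ?thesis by (simp add: s_def)
  qed
  have fillI: "fill s (V - {b})" if "b \<in> {1,2,3}" "t \<in> K (Suc m)" "agree m 1 (W (V - {b})) t"
   "\<And>k. k \<in> {1,2,3} ==> k \<noteq> b ==> fc (V - {b}) k t = s (V - {b, k})" for b t
   unfolding fill_def
  proof (intro bexI[of _ t] ballI)
   have bV: "b \<in> V" using that(1) inV by auto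
   show "t \<in> K (card (V - {b}) - 1)"
    using that(2) cc[OF bV] by simp
   fix k assume k: "k \<in> V - {b}"
   have e: "V - {b} - {k} = V - {b, k}" by auto
   show "fc (V - {b}) k t = s (V - {b} - {k})"
   proof (cases "k \<in> {1,2,3}")
    case True
    then show ?thesis using that(4)[of k] k e by simp
   next
    case False
    then show ?thesis
     using agr[OF that(3,1), of k] k e s_other[OF False] Wf[OF bV, of k] by simp
   qed
  qed
  have "fill s (V - {2})"
  proof (rule square[OF V m inV(1,2,3) _ W(1), of z u w])
   show "distinct [1, 2, 3 :: nat]" by simp
   show "par m z (W (V - {2, 3}))" using z' W23 by simp
   show "par m u (W (V - {1, 3}))" using A(5) D1'(2) W13 by (simp add: u_def)
   show "par m w (W (V - {1, 2}))" using B(5) W12 by (simp add: w_def)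
   show "s = W(V - {2, 3} := z, V - {1, 3} := u, V - {1, 2} := w)" by (rule s_def)
   show "{1, 2} = {1, 2 :: nat}" by simp
   show "fill s (V - {3})"
   proof (rule fillI[where t = A])
    show "agree m 1 (W (V - {3})) A" using A(2) W(2) by (simp add: P_def)
    show "fc (V - {3}) k A = s (V - {3, k})" if kk: "k \<in> {1,2,3}" "k \<noteq> 3" for k
    proof -
     consider "k = 1" | "k = 2"
      using kk by auto
     then show ?thesis
     proof cases
      case 1
      have "V - {3, 1} = V - {1, 3}" by auto
      then show ?thesis
       using 1 fP(2)[of A] dist by (simp add: P_def s_def u_def del: One_nat_def)
     next
      case 2
      have "V - {3, 2} = V - {2, 3}" by auto
      then show ?thesis
       using 2 fP(1)[of A] A(3) dist by (simp add: P_def s_def del: One_nat_def)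
     qed
    qed
   qed (use A in auto)
   show "fill s (V - {1})"
   proof (rule fillI[where t = B'])
    show "agree m 1 (W (V - {1})) B'" using aB' W(3) by (simp add: Q_def)
    show "fc (V - {1}) k B' = s (V - {1, k})" if kk: "k \<in> {1,2,3}" "k \<noteq> 1" for k
    proof -
     consider "k = 3" | "k = 2"
      using kk by auto
     then show ?thesis
     proof cases
      case 1
      then show ?thesis
       using fQ(1)[of B'] B'(2) dist by (simp add: Q_def s_def del: One_nat_def)
     next
      case 2
      then show ?thesis
       using fQ(2)[of B'] B'1 dist by (simp add: Q_def s_def del: One_nat_def)
     qed
    qed
   qed (use B' in auto)
  qed
  then obtain t where t: "t \<in> K (Suc m)" "\<And>k. k \<in> V - {2} ==> fc (V - {2}) k t = s (V - {2} - {k})"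
   using cc[OF inV(2)] unfolding fill_def by auto
  have e2: "V - {2} - {k} = V - {2, k}" for k by auto
  have t2: "d (Suc m) 2 t = z"
   using t(2)[of 3] fR(1)[of t] inV e2[of 3] dist by (simp add: R_def s_def del: One_nat_def)
  have t1: "d (Suc m) 1 t = w"
  proof -
   have "V - {2, 1} = V - {1, 2}" by auto
   then show ?thesis
    using t(2)[of 1] fR(2)[of t] inV e2[of 1] dist by (simp add: R_def s_def del: One_nat_def)
  qed
  have "agree m 1 D3 t"
   unfolding agree_def
  proof (intro allI impI)
   fix i assume i: "i \<le> Suc m" "i \<noteq> 1" "i \<noteq> Suc 1"
   obtain k where k: "k \<in> V - {2}" "pos (V - {2}) k = i"
    using pos_surj[OF cc(1)[OF inV(2)], of i] cc(2)[OF inV(2)] i(1) by auto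
   have "k \<notin> {1,2,3}"
    using k i ps[OF inV(2), of k] inV by (auto simp: numeral_2_eq_2)
   then have "fc (V - {2}) k t = fc (V - {2}) k D3"
    using t(2)[OF k(1)] e2[of k] s_other[of k 2] Wf[OF inV(2), of k] k(1) by (simp add: D3_def R_def)
   then show "d (Suc m) i t = d (Suc m) i D3"
    using k(2) cc[OF inV(2)] by (simp add: fc_def)
  qed
  then have "tr m D3 z = rep m w"
   using tr_eq[OF m t(1), of D3] t1 t2 by simp
  moreover have "tr m D1 z = rep m u"
   using A(4) tr_agree[OF D1'(3)] by (simp add: u_def)
  ultimately show ?thesis
   using B(4) by (simp add: w_def)
 qed
 show ?thesis
  using that[OF D3K _ _ comp] d3 p2 face_in[OF D(2), of 1] by (simp add: par_refl)
qed

text \<open>The facets opposite 2 and 1 meet in the simplex opposite both, and this is the face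
  \<open>d m 1\<close> of either of them; so it suffices to glue along it.\<close>

lemma connect:
 assumes m: "1 \<le> m" and x: "x \<in> K m" "x' \<in> K m" "d m 1 x = d m 1 x'"
 shows "\<exists>D\<in>K (Suc m). d (Suc m) 2 D = x \<and> d (Suc m) 1 D = x'"
proof -
 define V where "V = {..Suc m}"
 define P where "P = V - {2}"
 define Q where "Q = V - {1}"
 have V: "finite V" "card V = Suc (Suc m)" "0 \<in> V" "1 \<in> V" "2 \<in> V"
  using m by (auto simp: V_def)
 have P: "finite P" "card P = Suc m" and Q: "finite Q" "card Q = Suc m"
  using V by (auto simp: P_def Q_def)
 have ps: "pos P 1 = 1" "pos Q 2 = 1"
  using pos_Diff[of V 2 1] pos_Diff[of V 1 2] V pos_atMost[of 1 "Suc m"] pos_atMost[of 2 "Suc m"] m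
  by (simp_all add: P_def Q_def V_def)
 have PQ: "P \<inter> Q = P - {1}" "P \<inter> Q = Q - {2}" "P \<union> Q = V"
  by (auto simp: P_def Q_def)
 have "\<exists>s. fam (Pow (P \<union> Q) - {{}}) s \<and> s P = x \<and> s Q = x'"
 proof (rule glue2[where b = 0])
  have "sub P x (P - {1}) = fc P 1 x"
   using P x V m by (intro sub_Diff) (auto simp: P_def)
  moreover have "sub Q x' (Q - {2}) = fc Q 2 x'"
   using Q x V m by (intro sub_Diff) (auto simp: Q_def)
  ultimately have "sub P x (P \<inter> Q) = fc P 1 x" "sub Q x' (P \<inter> Q) = fc Q 2 x'"
   using PQ(1,2) by metis+
  then show "sub P x (P \<inter> Q) = sub Q x' (P \<inter> Q)"
   using x(3) ps P Q by (simp add: fc_def)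
 qed (use P Q x V in \<open>auto simp: P_def Q_def\<close>)
 then obtain W where W: "fam (Pow V - {{}}) W" "W P = x" "W Q = x'"
  using PQ(3) by auto
 have "fc V 2 (W V) = x" "fc V 1 (W V) = x'"
  using fam_Pow_fc[OF W(1), of V 2] fam_Pow_fc[OF W(1), of V 1] W V by (simp_all add: P_def Q_def)
 moreover have "W V \<in> K (Suc m)"
  using fam_Pow_in[OF W(1), of V] V by auto
 ultimately show ?thesis
  using fc_atMost[of 2 "Suc m"] fc_atMost[of 1 "Suc m"] m unfolding V_def by auto
qed

end

text \<open>The means on fillers are transported from one chosen boundary for each fixed first face; for
 this to be consistent the chosen mean only has to be invariant under loops of transports.\<close>

locale kan_amenable = kan K d for K :: "nat => 's set" and d :: "nat => nat => 's => 's" +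
 fixes base :: "'s => 's"
 assumes base_edge: "x \<in> K 0 ==> \<exists>e\<in>K 1. d 1 1 e = base x \<and> d 1 0 e = x"
  and base_const: "e \<in> K 1 ==> base (d 1 1 e) = base (d 1 0 e)"
  and amen: "s \<in> K 0 ==> base s = s ==> \<exists>x\<in>K 1. d 1 1 x = s \<and>
   (\<exists>M. mean (reps 1 x) M \<and> (\<forall>h\<in>Lf 1 x 1. \<forall>g. bfun g --> M (\<lambda>z. g (h z)) = M g))"
begin

definition invm :: "nat => 's => 's \<times> (('s => real) => real) => bool" where
 "invm m s p \<longleftrightarrow> fst p \<in> K m \<and> d m 1 (fst p) = s \<and> mean (reps m (fst p)) (snd p) \<and>
   (\<forall>h\<in>Lf m (fst p) 1. \<forall>g. bfun g --> snd p (\<lambda>z. g (h z)) = snd p g)"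

definition XM :: "nat => 's => 's \<times> (('s => real) => real)" where
 "XM m s = (SOME p. invm m s p)"

definition ok :: "nat => 's => bool" where
 "ok m x \<longleftrightarrow> 1 \<le> m \<and> x \<in> K m \<and> (m = 1 --> base (d 1 1 x) = d 1 1 x)"

text \<open>In dimension one the invariant mean is assumed. In higher dimensions the translations
  commute by \<open>Lf_commute\<close>, and averaging produces it.\<close>

lemma XM:
 assumes "ok m x"
 shows "invm m (d m 1 x) (XM m (d m 1 x))"
proof -
 have "\<exists>p. invm m (d m 1 x) p"
 proof (cases "m = 1")
  case True
  then have "d 1 1 x \<in> K 0" "base (d 1 1 x) = d 1 1 x"
   using assms face_in[of x 0 1] by (auto simp: ok_def)
  then obtain y M where "y \<in> K 1" "d 1 1 y = d 1 1 x" "mean (reps 1 y) M"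
   "\<forall>h\<in>Lf 1 y 1. \<forall>g. bfun g --> M (\<lambda>z. g (h z)) = M g"
   using amen by blast
  then have "invm m (d m 1 x) (y, M)"
   using True by (simp add: invm_def)
  then show ?thesis ..
 next
  case False
  then have m: "2 \<le> m" and x: "x \<in> K m"
   using assms by (auto simp: ok_def)
  have "reps m x \<noteq> {}"
   using repsI[OF par_refl[OF x]] by blast
  then show ?thesis
  proof (rule invariant_mean_exists[where H = "Lf m x 1"])
   fix M assume "mean (reps m x) M" "\<And>h f. h \<in> Lf m x 1 ==> bfun f ==> M (\<lambda>x. f (h x)) = M f"
   then have "invm m (d m 1 x) (x, M)"
    using x by (simp add: invm_def)
   then show ?thesis ..
  qed (use Lf_closed Lf_commute[OF m] in blast)+
 qed
 then show ?thesis
  unfolding XM_def by (rule someI_ex)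
qed

text \<open>A simplex transporting the reference boundary to that of \<open>x\<close>. The
  conditions see \<open>x\<close> only up to equal boundary, so that \<open>Dx\<close>, and with it
  \<open>mu\<close>, is a function of the boundary.\<close>

definition Dx :: "nat => 's => 's" where
 "Dx m x = (SOME D. D \<in> K (Suc m) \<and> par m (d (Suc m) 2 D) (fst (XM m (d m 1 x))) \<and> par m (d (Suc m) 1 D) x)"

definition mu :: "nat => 's => ('s => real) => real" where
 "mu m x f = snd (XM m (d m 1 x)) (\<lambda>z. f (tr m (Dx m x) z))"

lemma Dx:
 assumes "ok m x"
 shows "Dx m x \<in> K (Suc m)" "par m (d (Suc m) 2 (Dx m x)) (fst (XM m (d m 1 x)))" "par m (d (Suc m) 1 (Dx m x)) x"
proof -
 have m: "1 \<le> m" and x: "x \<in> K m"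
  using assms by (auto simp: ok_def)
 let ?X = "fst (XM m (d m 1 x))"
 have X: "?X \<in> K m" "d m 1 ?X = d m 1 x"
  using XM[OF assms] by (auto simp: invm_def)
 obtain D where "D \<in> K (Suc m)" "d (Suc m) 2 D = ?X" "d (Suc m) 1 D = x"
  using connect[OF m X(1) x X(2)] by blast
 then have "\<exists>D. D \<in> K (Suc m) \<and> par m (d (Suc m) 2 D) ?X \<and> par m (d (Suc m) 1 D) x"
  using par_refl[OF X(1)] par_refl[OF x] by (intro exI[of _ D]) simp
 from someI_ex[OF this] show "Dx m x \<in> K (Suc m)" "par m (d (Suc m) 2 (Dx m x)) ?X" "par m (d (Suc m) 1 (Dx m x)) x"
  unfolding Dx_def by blast+
qed

lemma mean_mu:
 assumes "ok m x"
 shows "mean (reps m x) (mu m x)"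
proof -
 have m: "1 \<le> m"
  using assms by (auto simp: ok_def)
 let ?X = "fst (XM m (d m 1 x))"
 have "mean (reps m ?X) (snd (XM m (d m 1 x)))"
  using XM[OF assms] by (simp add: invm_def)
 then have "mean (reps m x) (\<lambda>f. snd (XM m (d m 1 x)) (\<lambda>z. f (tr m (Dx m x) z)))"
 proof (rule mean_map)
  fix z assume "z \<in> reps m ?X"
  then have "par m z (d (Suc m) 2 (Dx m x))"
   using par_trans[OF repsD(1)[OF _ m] par_sym[OF Dx(2)[OF assms]]] by blast
  then have "tr m (Dx m x) z \<in> reps m (d (Suc m) 1 (Dx m x))"
   by (rule tr_reps[OF m Dx(1)[OF assms]])
  then show "tr m (Dx m x) z \<in> reps m x"
   using reps_cong[OF Dx(3)[OF assms]] by simp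
 qed
 then show ?thesis
  by (simp add: mu_def[abs_def])
qed

lemma mu_par:
 assumes "1 \<le> m" "par m x x'"
 shows "mu m x = mu m x'"
proof -
 have s: "d m 1 x = d m 1 x'"
  using assms by (simp add: par_def)
 have "par m z x \<longleftrightarrow> par m z x'" for z
  using par_trans[OF _ assms(2)] par_trans[OF _ par_sym[OF assms(2)]] by blast
 then have "Dx m x = Dx m x'"
  unfolding Dx_def s by simp
 then show ?thesis
  unfolding mu_def[abs_def] s by simp
qed

text \<open>From the reference boundary one can go to \<open>?x\<close> and on through
  \<open>D\<close>, or directly to \<open>?x'\<close>. The two transports differ by a translation
  \<open>h\<close> of the reference fillers, under which the reference mean is invariant.\<close>

lemma mu_tr:
 assumes m: "1 \<le> m" and D: "D \<in> K (Suc m)" and b: "m = 1 ==> base (d 1 1 (d 2 2 D)) = d 1 1 (d 2 2 D)"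
  and f: "bfun f"
 shows "mu m (d (Suc m) 1 D) f = mu m (d (Suc m) 2 D) (\<lambda>z. f (tr m D z))"
proof -
 let ?x = "d (Suc m) 2 D" and ?x' = "d (Suc m) 1 D"
 have xK: "?x \<in> K m" "?x' \<in> K m"
  using face_in[OF D, of 2] face_in[OF D, of 1] m by auto
 have s: "d m 1 ?x = d m 1 ?x'"
 proof -
  obtain p where p: "m = Suc p"
   using m by (cases m) auto
  show ?thesis
   using face_face[of D p 1 2] D p by simp
 qed
 have okx: "ok m ?x"
  using b xK m by (auto simp: ok_def numeral_2_eq_2)
 have okx': "ok m ?x'"
  using b xK m s by (auto simp: ok_def numeral_2_eq_2)
 define X where "X = fst (XM m (d m 1 ?x))"
 define M where "M = snd (XM m (d m 1 ?x))"
 have inv: "mean (reps m X) M" "\<And>h g. h \<in> Lf m X 1 ==> bfun g ==> M (\<lambda>z. g (h z)) = M g"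
  using XM[OF okx] by (auto simp: invm_def X_def M_def)
 note D1 = Dx[OF okx, folded X_def] and D2 = Dx[OF okx', folded s, folded X_def]
 obtain D3 where D3: "D3 \<in> K (Suc m)" "par m (d (Suc m) 2 D3) (d (Suc m) 2 (Dx m ?x))" "par m (d (Suc m) 1 D3) ?x'"
  "\<And>z. par m z (d (Suc m) 2 (Dx m ?x)) ==> tr m D3 z = tr m D (tr m (Dx m ?x) z)"
  using tr_compose[OF m D1(1) D D1(3)] by blast
 have l: "ldata m X 1 D3 (Dx m ?x')"
  unfolding ldata_def
  using m D3(1) D2(1,2) par_trans[OF D3(2) D1(2)] par_trans[OF D3(3) par_sym[OF D2(3)]]
  by (auto simp: numeral_2_eq_2)
 obtain h where h: "\<And>z. z \<in> reps m X ==> h z \<in> reps m X \<and> lamrel m 1 D3 (Dx m ?x') z (h z)"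
  using lam_function[OF m l] by blast
 have hL: "h \<in> Lf m X 1"
  using l h by (auto simp: Lf_def)
 have eq: "tr m (Dx m ?x') (h z) = tr m D (tr m (Dx m ?x) z)" if z: "z \<in> reps m X" for z
 proof -
  obtain A B where AB: "A \<in> K (Suc m)" "B \<in> K (Suc m)" "agree m 1 D3 A" "agree m 1 (Dx m ?x') B"
   "d (Suc m) 2 A = z" "d (Suc m) 2 B = h z" "d (Suc m) 1 A = d (Suc m) 1 B"
   using h[OF z] unfolding lamrel_def by (auto simp: numeral_2_eq_2)
  have "tr m D3 z = tr m (Dx m ?x') (h z)"
   using tr_eq[OF m AB(1,3)] tr_eq[OF m AB(2,4)] AB(5-7) by simp
  moreover have "par m z (d (Suc m) 2 (Dx m ?x))"
   using par_trans[OF repsD(1)[OF z m] par_sym[OF D1(2)]] .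
  ultimately show ?thesis
   using D3(4) by simp
 qed
 have b1: "bfun (\<lambda>z. f (tr m (Dx m ?x') z))"
  using bfun_compose[OF f, of "tr m (Dx m ?x')"] .
 have "M (\<lambda>z. f (tr m (Dx m ?x') z)) = M (\<lambda>z. f (tr m (Dx m ?x') (h z)))"
  using inv(2)[OF hL b1] by simp
 also have "\<dots> = M (\<lambda>z. f (tr m D (tr m (Dx m ?x) z)))"
  using eq bfun_compose[OF f, of "\<lambda>z. tr m (Dx m ?x') (h z)"] bfun_compose[OF f, of "\<lambda>z. tr m D (tr m (Dx m ?x) z)"]
  by (intro mean_cong[OF inv(1)]) auto
 finally show ?thesis
  unfolding mu_def M_def s .
qed

sublocale kan_mean K d base mu
proof
 show "mean (reps m x) (mu m x)" if "1 \<le> m" "x \<in> K m" "m = 1 ==> base (d 1 1 x) = d 1 1 x" for m x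
  using that by (intro mean_mu) (auto simp: ok_def)
qed (use base_edge base_const mu_par mu_tr in auto)

end

section \<open>Chains of finite norm\<close>

definition l1 :: "('s => real) => bool" where
 "l1 c \<longleftrightarrow> (\<lambda>s. \<bar>c s\<bar>) summable_on UNIV"

definition nrm :: "('s => real) => real" where
 "nrm c = (\<Sum>\<^sub>\<infinity>s. \<bar>c s\<bar>)"

definition pairing :: "('s => real) => ('s => real) => real" where
 "pairing f c = (\<Sum>\<^sub>\<infinity>s. f s * c s)"

lemma nrm_nonneg: "0 \<le> nrm c"
 unfolding nrm_def by (rule infsum_nonneg) simp

lemma l1_mono: "l1 c ==> (\<And>s. \<bar>c' s\<bar> \<le> \<bar>c s\<bar>) ==> l1 c'"
 unfolding l1_def by (rule summable_on_comparison_test) auto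

lemma l1_subset: "l1 c ==> (\<lambda>s. \<bar>c s\<bar>) summable_on A" "l1 c ==> c summable_on A"
proof -
 assume "l1 c"
 then show 1: "(\<lambda>s. \<bar>c s\<bar>) summable_on A"
  unfolding l1_def using summable_on_subset_banach by blast
 then show "c summable_on A"
  using abs_summable_summable[of c A] by simp
qed

lemma l1_add: "l1 c ==> l1 c' ==> l1 (\<lambda>s. c s + c' s)"
 and nrm_add: "l1 c ==> l1 c' ==> nrm (\<lambda>s. c s + c' s) \<le> nrm c + nrm c'"
proof -
 assume c: "l1 c" "l1 c'"
 have s: "(\<lambda>s. \<bar>c s\<bar> + \<bar>c' s\<bar>) summable_on UNIV"
  using c unfolding l1_def by (rule summable_on_add)
 show l: "l1 (\<lambda>s. c s + c' s)"
  unfolding l1_def by (rule summable_on_comparison_test[OF s]) (auto intro: abs_triangle_ineq)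
 have "nrm (\<lambda>s. c s + c' s) \<le> (\<Sum>\<^sub>\<infinity>s. \<bar>c s\<bar> + \<bar>c' s\<bar>)"
  unfolding nrm_def using l s by (intro infsum_mono) (auto simp: l1_def intro: abs_triangle_ineq)
 also have "\<dots> = nrm c + nrm c'"
  unfolding nrm_def using c by (intro infsum_add) (auto simp: l1_def)
 finally show "nrm (\<lambda>s. c s + c' s) \<le> nrm c + nrm c'" .
qed

lemma l1_scale: "l1 c ==> l1 (\<lambda>s. k * c s)"
 and nrm_scale: "l1 c ==> nrm (\<lambda>s. k * c s) = \<bar>k\<bar> * nrm c"
proof -
 assume c: "l1 c"
 show "l1 (\<lambda>s. k * c s)"
  using summable_on_cmult_right[where f = "\<lambda>s. \<bar>c s\<bar>" and A = UNIV and c = "\<bar>k\<bar>"] c by (simp add: l1_def abs_mult)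
 show "nrm (\<lambda>s. k * c s) = \<bar>k\<bar> * nrm c"
  by (simp add: nrm_def abs_mult infsum_cmult_right')
qed

lemma l1_zero [simp]: "l1 (\<lambda>_. 0)" and nrm_zero [simp]: "nrm (\<lambda>_. 0) = 0"
 by (simp_all add: l1_def nrm_def)

lemma l1_diff: "l1 c ==> l1 c' ==> l1 (\<lambda>s. c s - c' s)"
 using l1_add[OF _ l1_scale[of c' "-1"], of c] by simp

lemma l1_finite: "finite {s. c s \<noteq> 0} ==> l1 c"
 unfolding l1_def by (rule finite_nonzero_values_imp_summable_on) simp

lemma abs_le_nrm:
 assumes "l1 c"
 shows "\<bar>c s\<bar> \<le> nrm c"
proof -
 have "(\<Sum>\<^sub>\<infinity>t\<in>{s}. \<bar>c t\<bar>) \<le> nrm c"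
  unfolding nrm_def using assms l1_subset(1)[OF assms, of "{s}"] by (intro infsum_mono_neutral) (auto simp: l1_def)
 then show ?thesis by simp
qed

lemma l1_mult:
 assumes "l1 c" "\<And>s. \<bar>f s\<bar> \<le> B"
 shows "l1 (\<lambda>s. f s * c s)" "nrm (\<lambda>s. f s * c s) \<le> B * nrm c"
proof -
 have B: "0 \<le> B"
  using assms(2)[of undefined] by linarith
 have le: "\<bar>f s * c s\<bar> \<le> \<bar>B * c s\<bar>" for s
  using assms(2)[of s] B by (simp add: abs_mult mult_right_mono)
 show l: "l1 (\<lambda>s. f s * c s)"
  by (rule l1_mono[OF l1_scale[OF assms(1), of B] le])
 have "nrm (\<lambda>s. f s * c s) \<le> nrm (\<lambda>s. B * c s)"
  unfolding nrm_def using l l1_scale[OF assms(1), of B] le by (intro infsum_mono) (auto simp: l1_def)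
 then show "nrm (\<lambda>s. f s * c s) \<le> B * nrm c"
  using nrm_scale[OF assms(1), of B] B by simp
qed

lemma pairing_bound:
 assumes "l1 c" "\<And>s. c s \<noteq> 0 ==> \<bar>f s\<bar> \<le> B" "0 \<le> B"
 shows "\<bar>pairing f c\<bar> \<le> B * nrm c"
proof -
 define g where "g s = (if c s \<noteq> 0 then f s else 0)" for s
 have eq: "(\<lambda>s. f s * c s) = (\<lambda>s. g s * c s)"
  by (auto simp: g_def)
 have "\<bar>g s\<bar> \<le> B" for s
  using assms by (simp add: g_def)
 note l = l1_mult[OF assms(1), of g B, OF this]
 have "\<bar>pairing f c\<bar> \<le> nrm (\<lambda>s. g s * c s)"
  unfolding pairing_def eq nrm_def using norm_infsum_bound[of "\<lambda>s. g s * c s" UNIV] l(1) by (simp add: l1_def)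
 then show ?thesis
  using l(2) by simp
qed

lemma pairing_summable: "l1 c ==> bfun f ==> (\<lambda>s. f s * c s) summable_on A"
 using l1_mult(1)[of c f] l1_subset(2) unfolding bfun_def by blast

lemma pairing_add: "l1 c ==> bfun f ==> bfun g ==> pairing (\<lambda>s. f s + g s) c = pairing f c + pairing g c"
 unfolding pairing_def by (simp add: distrib_right infsum_add pairing_summable)

lemma pairing_scale: "l1 c ==> bfun f ==> pairing (\<lambda>s. k * f s) c = k * pairing f c"
 unfolding pairing_def by (simp add: mult.assoc infsum_cmult_right pairing_summable)

lemma pairing_cong: "(\<And>s. c s \<noteq> 0 ==> f s = g s) ==> pairing f c = pairing g c"
 unfolding pairing_def by (intro infsum_cong) auto

lemma pairing_sum:
 assumes "l1 c" "\<And>i. i \<in> I ==> bfun (f i)" "finite I"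
 shows "pairing (\<lambda>s. \<Sum>i\<in>I. f i s) c = (\<Sum>i\<in>I. pairing (f i) c)"
 using assms(3,2)
proof (induction I rule: finite_induct)
 case empty
 then show ?case by (simp add: pairing_def)
next
 case (insert i I)
 then show ?case
  using pairing_add[OF assms(1), of "f i" "\<lambda>s. \<Sum>i\<in>I. f i s"] bfun_sum[of I f] by simp
qed

definition push :: "('s => 't) => ('s => real) => 't => real" where
 "push h c t = (\<Sum>\<^sub>\<infinity>s\<in>{s. h s = t}. c s)"

text \<open>Absolute summability allows summation fibre by fibre over \<open>h\<close>. Applied to
  the face maps, the last claim yields the duality of boundary and coboundary in
  \<open>pairing_bd\<close>.\<close>

lemma push:
 assumes c: "l1 c"
 shows l1_push: "l1 (push h c)" and nrm_push: "nrm (push h c) \<le> nrm c"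
  and pairing_push: "bfun f ==> pairing f (push h c) = pairing (\<lambda>s. f (h s)) c"
proof -
 let ?S = "Sigma UNIV (\<lambda>t. {s. h s = t})"
 have bij: "bij_betw snd ?S UNIV"
  by (rule bij_betw_byWitness[where f' = "\<lambda>s. (h s, s)"]) auto
 have sm: "(\<lambda>(t, s). g s) summable_on ?S" if "l1 g" for g
  using summable_on_reindex_bij_betw[OF bij, of g] l1_subset(2)[OF that] by (simp add: case_prod_unfold)
 have sig: "(\<Sum>\<^sub>\<infinity>t. \<Sum>\<^sub>\<infinity>s\<in>{s. h s = t}. g s) = (\<Sum>\<^sub>\<infinity>s. g s)"
  "(\<lambda>t. \<Sum>\<^sub>\<infinity>s\<in>{s. h s = t}. g s) summable_on UNIV" if "l1 g" for g
 proof -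
  show "(\<Sum>\<^sub>\<infinity>t. \<Sum>\<^sub>\<infinity>s\<in>{s. h s = t}. g s) = (\<Sum>\<^sub>\<infinity>s. g s)"
   using infsum_Sigma'_banach[OF sm[OF that]] infsum_reindex_bij_betw[OF bij, of g] by (simp add: case_prod_unfold)
  show "(\<lambda>t. \<Sum>\<^sub>\<infinity>s\<in>{s. h s = t}. g s) summable_on UNIV"
   using summable_on_Sigma_banach[OF sm[OF that]] by simp
 qed
 have la: "l1 (\<lambda>s. \<bar>c s\<bar>)"
  using c by (simp add: l1_def)
 have le: "\<bar>push h c t\<bar> \<le> (\<Sum>\<^sub>\<infinity>s\<in>{s. h s = t}. \<bar>c s\<bar>)" for t
  unfolding push_def using norm_infsum_bound[of c "{s. h s = t}"] l1_subset(1)[OF c] by simp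
 show l: "l1 (push h c)"
  unfolding l1_def by (rule summable_on_comparison_test[OF sig(2)[OF la]]) (use le in auto)
 have "nrm (push h c) \<le> (\<Sum>\<^sub>\<infinity>t. \<Sum>\<^sub>\<infinity>s\<in>{s. h s = t}. \<bar>c s\<bar>)"
  unfolding nrm_def using l le sig(2)[OF la] by (intro infsum_mono) (auto simp: l1_def)
 then show "nrm (push h c) \<le> nrm c"
  using sig(1)[OF la] by (simp add: nrm_def)
 assume f: "bfun f"
 then obtain B where B: "\<And>s. \<bar>f s\<bar> \<le> B"
  by (auto simp: bfun_def)
 have lf: "l1 (\<lambda>s. f (h s) * c s)"
  by (rule l1_mult(1)[OF c, of _ B]) (rule B)
 have "pairing f (push h c) = (\<Sum>\<^sub>\<infinity>t. \<Sum>\<^sub>\<infinity>s\<in>{s. h s = t}. f (h s) * c s)"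
  unfolding pairing_def push_def
 proof (rule infsum_cong)
  fix t
  have "f t * (\<Sum>\<^sub>\<infinity>s\<in>{s. h s = t}. c s) = (\<Sum>\<^sub>\<infinity>s\<in>{s. h s = t}. f t * c s)"
   by (simp add: infsum_cmult_right')
  also have "\<dots> = (\<Sum>\<^sub>\<infinity>s\<in>{s. h s = t}. f (h s) * c s)"
   by (rule infsum_cong) auto
  finally show "f t * (\<Sum>\<^sub>\<infinity>s\<in>{s. h s = t}. c s) = (\<Sum>\<^sub>\<infinity>s\<in>{s. h s = t}. f (h s) * c s)" .
 qed
 then show "pairing f (push h c) = pairing (\<lambda>s. f (h s)) c"
  using sig(1)[OF lf] by (simp add: pairing_def)
qed

lemma push_add: "l1 c ==> l1 c' ==> push h (\<lambda>s. c s + c' s) t = push h c t + push h c' t"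
 unfolding push_def by (intro infsum_add l1_subset)

lemma push_scale: "l1 c ==> push h (\<lambda>s. k * c s) t = k * push h c t"
 unfolding push_def by (intro infsum_cmult_right l1_subset)

lemma push_support:
 assumes "push h c t \<noteq> 0"
 obtains s where "h s = t" "c s \<noteq> 0"
proof (rule ccontr)
 assume "\<not> thesis"
 then have "c s = 0" if "h s = t" for s
  using that \<open>\<And>s. h s = t ==> c s \<noteq> 0 ==> thesis\<close> by blast
 then have "push h c t = 0"
  unfolding push_def by (intro infsum_0) auto
 then show False
  using assms by simp
qed

lemma infsum_sum:
 fixes f :: "'i => 's => real"
 assumes "\<And>i. i \<in> I ==> f i summable_on A" "finite I"
 shows "(\<Sum>\<^sub>\<infinity>s\<in>A. \<Sum>i\<in>I. f i s) = (\<Sum>i\<in>I. \<Sum>\<^sub>\<infinity>s\<in>A. f i s)"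
proof -
 have "(\<lambda>s. \<Sum>i\<in>I. f i s) summable_on A \<and> ?thesis"
  using assms(2,1)
  by (induction I rule: finite_induct) (auto simp: infsum_add intro: summable_on_add)
 then show ?thesis ..
qed

lemma bd_eq: "rchain_boundary (Suc p) c = (\<lambda>t. \<Sum>k\<le>Suc p. (-1) ^ k * push (singular_face (Suc p) k) c t)"
 by (simp add: rchain_boundary_def push_def)

lemma bd_add:
 "l1 c ==> l1 c' ==> rchain_boundary (Suc p) (\<lambda>s. c s + c' s) = (\<lambda>t. rchain_boundary (Suc p) c t + rchain_boundary (Suc p) c' t)"
 unfolding bd_eq by (simp add: push_add sum.distrib algebra_simps del: sum.atMost_Suc)

lemma bd_scale:
 "l1 c ==> rchain_boundary (Suc p) (\<lambda>s. k * c s) = (\<lambda>t. k * rchain_boundary (Suc p) c t)"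
 unfolding bd_eq by (simp add: push_scale sum_distrib_left algebra_simps del: sum.atMost_Suc)

lemma bd_diff:
 "l1 c ==> l1 c' ==> rchain_boundary (Suc p) (\<lambda>s. c s - c' s) = (\<lambda>t. rchain_boundary (Suc p) c t - rchain_boundary (Suc p) c' t)"
 using bd_add[OF _ l1_scale[of c' "-1"], of c p] bd_scale[of c' p "-1"] by simp

lemma bd_zero: "rchain_boundary p (\<lambda>_. 0) = (\<lambda>_. 0)"
 by (simp add: rchain_boundary_def fun_eq_iff)

lemma l1_sum: "(\<And>i. i \<in> I ==> l1 (f i)) ==> l1 (\<lambda>s. \<Sum>i\<in>I. f i s)"
 by (induction I rule: infinite_finite_induct) (auto intro: l1_add)

lemma bd_sum:
 "(\<And>i. i \<in> I ==> l1 (f i)) ==> rchain_boundary (Suc p) (\<lambda>s. \<Sum>i\<in>I. f i s) = (\<lambda>t. \<Sum>i\<in>I. rchain_boundary (Suc p) (f i) t)"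
 by (induction I rule: infinite_finite_induct) (auto simp: bd_zero bd_add l1_sum)

lemma l1_bd:
 assumes c: "l1 c"
 shows "l1 (rchain_boundary (Suc p) c)" "nrm (rchain_boundary (Suc p) c) \<le> real (Suc (Suc p)) * nrm c"
proof -
 have l: "l1 (\<lambda>t. (-1) ^ k * push (singular_face (Suc p) k) c t)" for k
  by (intro l1_scale l1_push c)
 show "l1 (rchain_boundary (Suc p) c)"
  unfolding bd_eq using l by (rule l1_sum)
 have "nrm (\<lambda>t. \<Sum>k\<in>I. (-1) ^ k * push (singular_face (Suc p) k) c t) \<le> real (card I) * nrm c" if "finite I" for I
  using that
 proof (induction I rule: finite_induct)
  case (insert k I)
  have "nrm (\<lambda>t. (-1) ^ k * push (singular_face (Suc p) k) c t + (\<Sum>k\<in>I. (-1) ^ k * push (singular_face (Suc p) k) c t))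
   \<le> nrm (\<lambda>t. (-1) ^ k * push (singular_face (Suc p) k) c t) + nrm (\<lambda>t. \<Sum>k\<in>I. (-1) ^ k * push (singular_face (Suc p) k) c t)"
   by (rule nrm_add[OF l l1_sum[OF l]])
  moreover have "nrm (\<lambda>t. (-1) ^ k * push (singular_face (Suc p) k) c t) \<le> nrm c"
   using nrm_scale[OF l1_push[OF c, of "singular_face (Suc p) k"], of "(-1) ^ k"] nrm_push[OF c, of "singular_face (Suc p) k"]
   by (simp add: power_abs)
  ultimately show ?case
   using insert by (simp add: algebra_simps)
 qed simp
 from this[of "{..Suc p}"] show "nrm (rchain_boundary (Suc p) c) \<le> real (Suc (Suc p)) * nrm c"
  unfolding bd_eq by simp
qed

lemma pairing_bd:
 assumes c: "l1 c" and f: "bfun f"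
 shows "pairing f (rchain_boundary (Suc p) c) = pairing (\<lambda>s. \<Sum>k\<le>Suc p. (-1) ^ k * f (singular_face (Suc p) k s)) c"
proof -
 have bf: "bfun (\<lambda>s. f (singular_face (Suc p) k s))" for k
  using bfun_compose[OF f] .
 have "pairing f (rchain_boundary (Suc p) c) = (\<Sum>k\<le>Suc p. (-1) ^ k * pairing f (push (singular_face (Suc p) k) c))"
 proof -
  have "pairing f (rchain_boundary (Suc p) c) = (\<Sum>\<^sub>\<infinity>s. \<Sum>k\<le>Suc p. (-1) ^ k * (f s * push (singular_face (Suc p) k) c s))"
   unfolding pairing_def bd_eq by (simp add: sum_distrib_left algebra_simps del: sum.atMost_Suc)
  also have "\<dots> = (\<Sum>k\<le>Suc p. \<Sum>\<^sub>\<infinity>s. (-1) ^ k * (f s * push (singular_face (Suc p) k) c s))"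
   by (rule infsum_sum) (auto intro!: summable_on_cmult_right pairing_summable l1_push c f)
  also have "\<dots> = (\<Sum>k\<le>Suc p. (-1) ^ k * pairing f (push (singular_face (Suc p) k) c))"
   unfolding pairing_def by (intro sum.cong refl infsum_cmult_right pairing_summable l1_push c f)
  finally show ?thesis .
 qed
 also have "\<dots> = (\<Sum>k\<le>Suc p. pairing (\<lambda>s. (-1) ^ k * f (singular_face (Suc p) k s)) c)"
  using pairing_push[OF c f] pairing_scale[OF c bf] by simp
 also have "\<dots> = pairing (\<lambda>s. \<Sum>k\<le>Suc p. (-1) ^ k * f (singular_face (Suc p) k s)) c"
  by (rule pairing_sum[OF c, symmetric]) (auto intro: bfun_scale bf)
 finally show ?thesis .
qed

lemma bfun_alternating: "bfun f ==> bfun (\<lambda>s. \<Sum>k\<in>A. (-1) ^ k * f (h k s))"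
 by (rule bfun_sum, rule bfun_scale, rule bfun_compose)

text \<open>Completeness of the space of chains, in the form of series that converge absolutely in
  norm. The sum is the pointwise one, its norm being controlled on finite sets of simplices.\<close>

lemma l1_series:
 assumes g: "\<And>i::nat. l1 (g i)" and s: "summable (\<lambda>i. nrm (g i))"
 shows "summable (\<lambda>i. g i s)" "l1 (\<lambda>s. suminf (\<lambda>i. g i s))" "nrm (\<lambda>s. suminf (\<lambda>i. g i s)) \<le> (suminf (\<lambda>i. nrm (g i)))"
proof -
 have sa: "summable (\<lambda>i. \<bar>g i s\<bar>)" for s
  by (rule summable_comparison_test[OF _ s]) (use abs_le_nrm[OF g] in auto)
 show "summable (\<lambda>i. g i s)"
  using summable_rabs_cancel[OF sa] .
 have fin: "(\<Sum>s\<in>F. \<bar>suminf (\<lambda>i. g i s)\<bar>) \<le> (suminf (\<lambda>i. nrm (g i)))" if "finite F" for F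
 proof -
  have "(\<Sum>s\<in>F. \<bar>suminf (\<lambda>i. g i s)\<bar>) \<le> (\<Sum>s\<in>F. suminf (\<lambda>i. \<bar>g i s\<bar>))"
   by (intro sum_mono summable_rabs sa)
  also have "\<dots> = (suminf (\<lambda>i. \<Sum>s\<in>F. \<bar>g i s\<bar>))"
   by (rule suminf_sum[symmetric]) (rule sa)
  also have "\<dots> \<le> (suminf (\<lambda>i. nrm (g i)))"
  proof (rule suminf_le[OF _ summable_sum[OF sa] s])
   fix i
   show "(\<Sum>s\<in>F. \<bar>g i s\<bar>) \<le> nrm (g i)"
    unfolding nrm_def by (rule finite_sum_le_infsum) (use g that in \<open>auto simp: l1_def\<close>)
  qed
  finally show ?thesis .
 qed
 show l: "l1 (\<lambda>s. suminf (\<lambda>i. g i s))"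
  unfolding l1_def
  by (rule nonneg_bdd_above_summable_on) (use fin in \<open>auto intro!: bdd_aboveI\<close>)
 show "nrm (\<lambda>s. suminf (\<lambda>i. g i s)) \<le> (suminf (\<lambda>i. nrm (g i)))"
  unfolding nrm_def[of "\<lambda>s. suminf (\<lambda>i. g i s)"]
  by (rule infsum_le_finite_sums) (use l fin in \<open>auto simp: l1_def\<close>)
qed

definition dl :: "'s => 's => real" where
 "dl s t = (if t = s then 1 else 0)"

lemma l1_dl: "l1 (dl s)" and nrm_dl: "nrm (dl s) = 1" and pairing_dl: "pairing f (dl s) = f s"
proof -
 show "l1 (dl s)"
  by (rule l1_finite) (rule finite_subset[of _ "{s}"], auto simp: dl_def split: if_splits)
 have "(\<Sum>\<^sub>\<infinity>t. \<bar>dl s t\<bar>) = (\<Sum>\<^sub>\<infinity>t\<in>{s}. \<bar>dl s t\<bar>)"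
  by (rule infsum_cong_neutral) (auto simp: dl_def)
 then show "nrm (dl s) = 1"
  by (simp add: nrm_def dl_def)
 have "(\<Sum>\<^sub>\<infinity>t. f t * dl s t) = (\<Sum>\<^sub>\<infinity>t\<in>{s}. f t * dl s t)"
  by (rule infsum_cong_neutral) (auto simp: dl_def)
 then show "pairing f (dl s) = f s"
  by (simp add: pairing_def dl_def)
qed

lemma nrm_eq_0: "l1 c ==> nrm c = 0 ==> c = (\<lambda>_. 0)"
 using abs_le_nrm[of c] by (auto simp: fun_eq_iff)

lemma l1_tail:
 assumes c: "l1 c" and e: "0 < e"
 obtains F where "finite F" "F \<subseteq> {s. c s \<noteq> 0}" "nrm (\<lambda>s. if s \<in> F then 0 else c s) < e"
proof -
 have "((\<lambda>s. \<bar>c s\<bar>) has_sum nrm c) UNIV"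
  using c unfolding nrm_def l1_def by (rule has_sum_infsum)
 then have "(sum (\<lambda>s. \<bar>c s\<bar>) \<longlongrightarrow> nrm c) (finite_subsets_at_top UNIV)"
  by (simp add: has_sum_def)
 from tendstoD[OF this e] obtain F where F: "finite F" "dist (sum (\<lambda>s. \<bar>c s\<bar>) F) (nrm c) < e"
  unfolding eventually_finite_subsets_at_top by blast
 let ?F = "F \<inter> {s. c s \<noteq> 0}"
 have l: "l1 (\<lambda>s. if s \<in> ?F then 0 else c s)"
  by (rule l1_mono[OF c]) auto
 have lf: "l1 (\<lambda>s. if s \<in> ?F then c s else 0)"
  by (rule l1_mono[OF c]) auto
 have "nrm c = (\<Sum>\<^sub>\<infinity>s. \<bar>if s \<in> ?F then 0 else c s\<bar> + \<bar>if s \<in> ?F then c s else 0\<bar>)"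
  unfolding nrm_def by (intro infsum_cong) auto
 also have "\<dots> = nrm (\<lambda>s. if s \<in> ?F then 0 else c s) + nrm (\<lambda>s. if s \<in> ?F then c s else 0)"
  using l lf unfolding nrm_def l1_def by (rule infsum_add)
 also have "nrm (\<lambda>s. if s \<in> ?F then c s else 0) = (\<Sum>\<^sub>\<infinity>s\<in>F. \<bar>c s\<bar>)"
  unfolding nrm_def by (rule infsum_cong_neutral) auto
 finally have "nrm (\<lambda>s. if s \<in> ?F then 0 else c s) < e"
  using F by (simp add: dist_real_def)
 then show thesis
  using that[of ?F] F(1) by blast
qed

text \<open>Duality of summable and bounded functions: both sides agree on finite combinations of
  the \<open>dl s\<close>, and what lies outside a large finite set is small in norm, hence
  negligible on either side.\<close>

lemma l1_functional:
 fixes L :: "('s => real) => real"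
 assumes add: "\<forall>f\<in>V. \<forall>g\<in>V. L (\<lambda>x. f x + g x) = L f + L g"
  and scale: "\<forall>c. \<forall>f\<in>V. L (\<lambda>x. c * f x) = c * L f"
  and V: "V = {w. l1 w \<and> (\<forall>s. w s \<noteq> 0 --> s \<in> K)}"
  and bound: "\<And>w. w \<in> V ==> \<bar>L w\<bar> \<le> C * nrm w" and w: "w \<in> V"
 shows "bfun (\<lambda>s. if s \<in> K then L (dl s) else 0)" "L w = pairing (\<lambda>s. if s \<in> K then L (dl s) else 0) w"
proof -
 let ?p = "\<lambda>s. if s \<in> K then L (dl s) else 0"
 have dlV: "dl s \<in> V" if "s \<in> K" for s
  using that by (auto simp: V l1_dl) (simp add: dl_def split: if_splits)
 have pb: "\<bar>?p s\<bar> \<le> \<bar>C\<bar>" for s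
  using bound[OF dlV, of s] by (auto simp: nrm_dl)
 then show bf: "bfun ?p"
  by (rule bfunI)
 have zero: "(\<lambda>_. 0) \<in> V"
  by (simp add: V)
 have L0: "L (\<lambda>_. 0) = 0"
  using scale[rule_format, OF zero, of 0] by simp
 have Vadd: "(\<lambda>s. f s + g s) \<in> V" if "f \<in> V" "g \<in> V" for f g
 proof -
  have "s \<in> K" if "f s + g s \<noteq> 0" for s
   using that \<open>f \<in> V\<close> \<open>g \<in> V\<close> by (cases "f s = 0") (auto simp: V)
  then show ?thesis
   using that l1_add[of f g] by (simp add: V)
 qed
 have Vscale: "(\<lambda>s. c * g s) \<in> V" if "g \<in> V" for g c
  using that l1_scale[of g c] by (auto simp: V)
 have fin: "(\<lambda>t. \<Sum>s\<in>F. w s * dl s t) \<in> V \<and> L (\<lambda>t. \<Sum>s\<in>F. w s * dl s t) = (\<Sum>s\<in>F. w s * ?p s)"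
  if "finite F" "F \<subseteq> K" for F
  using that
 proof (induction F rule: finite_induct)
  case (insert s F)
  have s: "(\<lambda>t. w s * dl s t) \<in> V" "L (\<lambda>t. w s * dl s t) = w s * ?p s"
   using scale dlV[of s] Vscale[OF dlV[of s]] insert by auto
  have F: "(\<lambda>t. \<Sum>s\<in>F. w s * dl s t) \<in> V" "L (\<lambda>t. \<Sum>s\<in>F. w s * dl s t) = (\<Sum>s\<in>F. w s * ?p s)"
   using insert by auto
  have "L (\<lambda>t. w s * dl s t + (\<Sum>s\<in>F. w s * dl s t)) = L (\<lambda>t. w s * dl s t) + L (\<lambda>t. \<Sum>s\<in>F. w s * dl s t)"
   using add[rule_format, OF s(1) F(1)] .
  then show ?case
   using Vadd[OF s(1) F(1)] s F by (simp only: sum.insert[OF insert(1,2)] simp_thms)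
 qed (simp add: zero L0)
 have lw: "l1 w" and wK: "\<And>s. w s \<noteq> 0 ==> s \<in> K"
  using w by (auto simp: V)
 have "\<bar>L w - pairing ?p w\<bar> \<le> (C + \<bar>C\<bar>) * e" if e: "0 < e" for e
 proof -
  obtain F where F: "finite F" "F \<subseteq> {s. w s \<noteq> 0}" "nrm (\<lambda>s. if s \<in> F then 0 else w s) < e"
   using l1_tail[OF lw e] .
  let ?r = "\<lambda>s. if s \<in> F then 0 else w s"
  have FK: "F \<subseteq> K"
   using F(2) wK by blast
  have rV: "?r \<in> V"
   using l1_mono[OF lw, of ?r] wK by (auto simp: V)
  have wF: "(\<Sum>s\<in>F. w s * dl s t) = (if t \<in> F then w t else 0)" for t
  proof -
   have "(\<Sum>s\<in>F. w s * dl s t) = (\<Sum>s\<in>F. if s = t then w t else 0)"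
    by (rule sum.cong) (auto simp: dl_def)
   then show ?thesis
    using F(1) by simp
  qed
  have weq: "w = (\<lambda>t. ?r t + (\<Sum>s\<in>F. w s * dl s t))"
   unfolding wF by (rule ext) simp
  have Lw: "L w = L ?r + (\<Sum>s\<in>F. w s * ?p s)"
  proof -
   have "L w = L (\<lambda>t. ?r t + (\<Sum>s\<in>F. w s * dl s t))"
    using weq by (rule arg_cong)
   also have "\<dots> = L ?r + L (\<lambda>t. \<Sum>s\<in>F. w s * dl s t)"
    using add[rule_format, OF rV conjunct1[OF fin[OF F(1) FK]]] .
   finally show ?thesis
    using fin[OF F(1) FK] by simp
  qed
  have "pairing ?p w = (\<Sum>\<^sub>\<infinity>s. ?p s * ?r s + ?p s * (if s \<in> F then w s else 0))"
   unfolding pairing_def by (intro infsum_cong) auto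
  also have "\<dots> = pairing ?p ?r + pairing ?p (\<lambda>s. if s \<in> F then w s else 0)"
   unfolding pairing_def using rV l1_mono[OF lw, of "\<lambda>s. if s \<in> F then w s else 0"]
   by (intro infsum_add pairing_summable bf) (auto simp: V)
  also have "pairing ?p (\<lambda>s. if s \<in> F then w s else 0) = (\<Sum>\<^sub>\<infinity>s\<in>F. w s * ?p s)"
   unfolding pairing_def by (rule infsum_cong_neutral) auto
  finally have "\<bar>L w - pairing ?p w\<bar> = \<bar>L ?r - pairing ?p ?r\<bar>"
   using Lw F(1) by simp
  also have "\<dots> \<le> \<bar>L ?r\<bar> + \<bar>pairing ?p ?r\<bar>"
   by (rule abs_triangle_ineq4)
  also have "\<dots> \<le> C * nrm ?r + \<bar>C\<bar> * nrm ?r"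
   using bound[OF rV] pairing_bound[of ?r ?p "\<bar>C\<bar>"] rV pb by (intro add_mono) (auto simp: V)
  also have "\<dots> = (C + \<bar>C\<bar>) * nrm ?r"
   by (simp add: algebra_simps)
  also have "\<dots> \<le> (C + \<bar>C\<bar>) * e"
   using F(3) by (intro mult_left_mono) auto
  finally show ?thesis .
 qed
 note eps = this
 show "L w = pairing ?p w"
 proof (rule ccontr)
  assume ne: "L w \<noteq> pairing ?p w"
  \<comment> \<open>Any number above the factor \<open>C + \<bar>C\<bar>\<close> would serve: the
    bound with e = x / q then gives x < x. The summand 1 makes it strictly larger.\<close>
  define q where "q = C + \<bar>C\<bar> + 1"
  have q: "0 < q" "C + \<bar>C\<bar> < q" "0 \<le> C + \<bar>C\<bar>"
   by (auto simp: q_def)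
  define x where "x = \<bar>L w - pairing ?p w\<bar>"
  have x: "0 < x"
   using ne by (simp add: x_def)
  have "x \<le> (C + \<bar>C\<bar>) * (x / q)"
   using eps[of "x / q"] x q by (simp add: x_def)
  also have "\<dots> < q * (x / q)"
   using x q by (intro mult_strict_right_mono) auto
  finally show False
   using q by simp
 qed
qed

section \<open>Supports, cycles and filling of cycles by duality\<close>

definition cyc :: "nat => 'a rchain => bool" where
 "cyc m z \<longleftrightarrow> rchain_boundary m z = (\<lambda>_. 0)"

definition supp :: "((nat => real) => 'a) set => 'a rchain set" where
 "supp K = {w. l1 w \<and> (\<forall>s. w s \<noteq> 0 --> s \<in> K)}"

lemma supp_zero: "(\<lambda>_. 0) \<in> supp K"
 and supp_add: "w \<in> supp K ==> w' \<in> supp K ==> (\<lambda>s. w s + w' s) \<in> supp K"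
 and supp_scale: "w \<in> supp K ==> (\<lambda>s. c * w s) \<in> supp K"
 and supp_l1: "w \<in> supp K ==> l1 w"
proof -
 show "(\<lambda>s. w s + w' s) \<in> supp K" if "w \<in> supp K" "w' \<in> supp K"
 proof -
  have "s \<in> K" if "w s + w' s \<noteq> 0" for s
   using that \<open>w \<in> supp K\<close> \<open>w' \<in> supp K\<close> by (cases "w s = 0") (auto simp: supp_def)
  then show ?thesis
   using that l1_add[of w w'] by (simp add: supp_def)
 qed
qed (use l1_scale[of w c] in \<open>auto simp: supp_def\<close>)

lemma supp_diff: "w \<in> supp K ==> w' \<in> supp K ==> (\<lambda>s. w s - w' s) \<in> supp K"
 using supp_add[OF _ supp_scale[of w' K "-1"], of w] by simp

lemma supp_sum: "(\<And>i. i \<in> I ==> f i \<in> supp K) ==> (\<lambda>s. \<Sum>i\<in>I. f i s) \<in> supp K"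
 by (induction I rule: infinite_finite_induct) (auto intro: supp_add supp_zero)

lemma supp_dl: "s \<in> K ==> dl s \<in> supp K"
 by (auto simp: supp_def l1_dl) (simp add: dl_def split: if_splits)

lemma supp_bd:
 assumes "c \<in> supp K'" "\<And>s k. s \<in> K' ==> k \<le> Suc m ==> singular_face (Suc m) k s \<in> K"
 shows "rchain_boundary (Suc m) c \<in> supp K"
proof -
 have "t \<in> K" if "rchain_boundary (Suc m) c t \<noteq> 0" for t
 proof -
  have "\<exists>k\<le>Suc m. push (singular_face (Suc m) k) c t \<noteq> 0"
  proof (rule ccontr)
   assume "\<not> (\<exists>k\<le>Suc m. push (singular_face (Suc m) k) c t \<noteq> 0)"
   then have "rchain_boundary (Suc m) c t = 0"
    unfolding bd_eq by (intro sum.neutral) auto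
   then show False
    using that by blast
  qed
  then show ?thesis
   using assms by (auto elim!: push_support simp: supp_def)
 qed
 then show ?thesis
  using l1_bd(1)[OF supp_l1[OF assms(1)]] by (simp add: supp_def)
qed

text \<open>The terms with i < k cancel against those with k \<le> i under the bijection that sends
  (k, i) to (i, k - 1), which changes the sign by one step.\<close>

lemma alternating_double_sum:
 fixes g :: "nat => nat => real"
 assumes g: "\<And>i k. i < k ==> k \<le> Suc n ==> g i k = g (k - 1) i"
 shows "(\<Sum>k\<le>Suc n. (-1) ^ k * (\<Sum>i\<le>n. (-1) ^ i * g i k)) = 0"
proof -
 let ?h = "\<lambda>(k, i). (-1) ^ k * ((-1) ^ i * g i k)"
 let ?A = "{(k, i). i < k \<and> k \<le> Suc n}" and ?B = "{(k, i). k \<le> i \<and> i \<le> n}"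
 have fin: "finite ?A" "finite ?B"
  by (rule finite_subset[of _ "{..Suc n} \<times> {..Suc n}"]; auto)+
 have "(\<Sum>k\<le>Suc n. (-1) ^ k * (\<Sum>i\<le>n. (-1) ^ i * g i k)) = sum ?h ({..Suc n} \<times> {..n})"
  by (simp add: sum_distrib_left sum.cartesian_product del: sum.atMost_Suc)
 also have "{..Suc n} \<times> {..n} = ?A \<union> ?B"
  by auto
 also have "sum ?h (?A \<union> ?B) = sum ?h ?A + sum ?h ?B"
  by (rule sum.union_disjoint[OF fin]) auto
 also have "sum ?h ?A = sum (\<lambda>p. - ?h p) ?B"
 proof (rule sum.reindex_bij_witness[where i = "\<lambda>(k, i). (Suc i, k)" and j = "\<lambda>(k, i). (i, k - 1)"])
  fix a assume "a \<in> ?A"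
  then obtain k i where a: "a = (Suc k, i)" "i \<le> k" "k \<le> n"
   by (cases a; cases "fst a") auto
  then show "- ?h (case a of (k, i) => (i, k - 1)) = ?h a"
   using g[of i "Suc k"] by simp
 qed auto
 finally show ?thesis
  by (simp add: sum_negf)
qed

text \<open>For infinite chains the cancellation takes place on the dual side: the value at
  \<open>t\<close> is the pairing with the bounded function \<open>dl t\<close>, and the double
  coboundary of that function vanishes on \<open>K\<close>.\<close>

lemma bd_bd:
 fixes c :: "'a rchain"
 assumes c: "c \<in> supp K"
  and ff: "\<And>s i k. s \<in> K ==> i < k ==> k \<le> Suc (Suc p) ==>
   singular_face (Suc p) i (singular_face (Suc (Suc p)) k s) = singular_face (Suc p) (k - 1) (singular_face (Suc (Suc p)) i s)"
 shows "rchain_boundary (Suc p) (rchain_boundary (Suc (Suc p)) c) = (\<lambda>_. 0)"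
proof
 fix t :: "(nat => real) => 'a"
 let ?b = "rchain_boundary (Suc p) (rchain_boundary (Suc (Suc p)) c)"
 have l: "l1 c" "l1 (rchain_boundary (Suc (Suc p)) c)"
  using supp_l1[OF c] l1_bd(1) by auto
 have bf: "bfun (dl t)"
  by (rule bfunI[of _ 1]) (simp add: dl_def)
 let ?d = "\<lambda>s. \<Sum>k\<le>Suc p. (-1) ^ k * dl t (singular_face (Suc p) k s)"
 have bd: "bfun ?d"
  by (rule bfun_alternating[OF bf])
 have "?b t = pairing (dl t) ?b"
 proof -
  have "pairing (dl t) ?b = pairing ?b (dl t)"
   by (simp add: pairing_def mult.commute)
  then show ?thesis
   by (simp add: pairing_dl)
 qed
 also have "\<dots> = pairing ?d (rchain_boundary (Suc (Suc p)) c)"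
  by (rule pairing_bd[OF l(2) bf])
 also have "\<dots> = pairing (\<lambda>s. \<Sum>k\<le>Suc (Suc p). (-1) ^ k * ?d (singular_face (Suc (Suc p)) k s)) c"
  by (rule pairing_bd[OF l(1) bd])
 also have "\<dots> = pairing (\<lambda>s. 0) c"
 proof (rule pairing_cong)
  fix s assume "c s \<noteq> 0"
  then have "s \<in> K"
   using c by (auto simp: supp_def)
  then show "(\<Sum>k\<le>Suc (Suc p). (-1) ^ k * ?d (singular_face (Suc (Suc p)) k s)) = 0"
   using ff by (intro alternating_double_sum) metis
 qed
 finally show "?b t = 0"
  by (simp add: pairing_def)
qed

text \<open>Hahn--Banach turns coercivity of the coboundary operator into an approximate solution of the boundary
 equation; iterating halves the error.\<close>

lemma half_step:
 fixes z :: "'a rchain"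
 assumes face: "\<And>s k. s \<in> K' ==> k \<le> Suc m ==> singular_face (Suc m) k s \<in> K"
  and z: "z \<in> supp K"
  and coer: "\<And>f. bfun f ==> (\<And>s. s \<in> K' ==> \<bar>\<Sum>k\<le>Suc m. (-1) ^ k * f (singular_face (Suc m) k s)\<bar> \<le> 1) ==> \<bar>pairing f z\<bar> \<le> nrm z"
 shows "\<exists>c\<in>supp K'. nrm c \<le> 2 * nrm z \<and> nrm (\<lambda>s. z s - rchain_boundary (Suc m) c s) \<le> nrm z / 2"
proof (cases "nrm z = 0")
 case True
 then show ?thesis
  using nrm_eq_0[OF supp_l1[OF z]] by (intro bexI[of _ "\<lambda>_. 0"]) (auto simp: bd_zero supp_zero)
next
 case False
 let ?D = "rchain_boundary (Suc m) :: 'a rchain => 'a rchain"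
 \<comment> \<open>The weight 4 fits the conclusion: \<open>F z c < 2 * nrm z\<close> gives
   \<open>nrm c\<close> at most \<open>2 * nrm z\<close> and an error of at most
   \<open>nrm z / 2\<close>.\<close>
 define F where "F w c = nrm c + 4 * nrm (\<lambda>s. w s - ?D c s)" for w c
 define q where "q w = (INF c\<in>supp K'. F w c)" for w
 have Dl: "l1 (?D c)" if "c \<in> supp K'" for c
  using supp_l1[OF that] by (rule l1_bd)
 have F0: "0 \<le> F w c" for w c
  using nrm_nonneg[of c] nrm_nonneg[of "\<lambda>s. w s - ?D c s"] by (simp add: F_def)
 have bdd: "bdd_below (F w ` supp K')" for w
  using F0 by (auto intro!: bdd_belowI)
 have ne: "supp K' \<noteq> {}"
  using supp_zero by blast
 have qle: "q w \<le> F w c" if "c \<in> supp K'" for w c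
  unfolding q_def by (rule cINF_lower[OF bdd that])
 have qge: "x \<le> q w" if "\<And>c. c \<in> supp K' ==> x \<le> F w c" for x w
  unfolding q_def by (rule cINF_greatest[OF ne that])
 have lin: "linear_closed (supp K)"
  by (auto simp: linear_closed_def supp_zero supp_add supp_scale)
 have sub: "sublinear (supp K) q"
  unfolding sublinear_def
 proof (intro conjI ballI allI impI)
  fix w w' assume w: "w \<in> supp K" "w' \<in> supp K"
  have 1: "q (\<lambda>s. w s + w' s) \<le> F w c + F w' c'" if c: "c \<in> supp K'" "c' \<in> supp K'" for c c'
  proof -
   have "(\<lambda>s. w s + w' s - ?D (\<lambda>s. c s + c' s) s) = (\<lambda>s. (w s - ?D c s) + (w' s - ?D c' s))"
    using bd_add[OF supp_l1[OF c(1)] supp_l1[OF c(2)]] by (auto simp: fun_eq_iff)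
   then have "F (\<lambda>s. w s + w' s) (\<lambda>s. c s + c' s) \<le> F w c + F w' c'"
    using nrm_add[OF supp_l1[OF c(1)] supp_l1[OF c(2)]]
     nrm_add[OF l1_diff[OF supp_l1[OF w(1)] Dl[OF c(1)]] l1_diff[OF supp_l1[OF w(2)] Dl[OF c(2)]]]
    by (simp add: F_def)
   then show ?thesis
    using qle[OF supp_add[OF c], of "\<lambda>s. w s + w' s"] by simp
  qed
  have "q (\<lambda>s. w s + w' s) - F w c \<le> q w'" if "c \<in> supp K'" for c
   using 1[OF that] by (intro qge) (simp add: algebra_simps)
  then have "q (\<lambda>s. w s + w' s) - q w' \<le> q w"
   by (intro qge) (simp add: algebra_simps)
  then show "q (\<lambda>s. w s + w' s) \<le> q w + q w'"
   by simp
 next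
  fix w and t :: real assume w: "w \<in> supp K" and t: "0 < t"
  have "q (\<lambda>s. t * w s) / t \<le> q w"
  proof (rule qge)
   fix c assume c: "c \<in> supp K'"
   have "(\<lambda>s. t * w s - ?D (\<lambda>s. t * c s) s) = (\<lambda>s. t * (w s - ?D c s))"
    using bd_scale[OF supp_l1[OF c]] by (auto simp: fun_eq_iff algebra_simps)
   then have "F (\<lambda>s. t * w s) (\<lambda>s. t * c s) = t * F w c"
    using nrm_scale[OF supp_l1[OF c], of t] nrm_scale[OF l1_diff[OF supp_l1[OF w] Dl[OF c]], of t] t
    by (simp add: F_def algebra_simps)
   then show "q (\<lambda>s. t * w s) / t \<le> F w c"
    using qle[OF supp_scale[OF c, of t], of "\<lambda>s. t * w s"] t by (simp add: field_simps)
  qed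
  then show "q (\<lambda>s. t * w s) \<le> t * q w"
   using t by (simp add: field_simps)
 qed
 obtain L where L: "\<forall>f\<in>supp K. \<forall>g\<in>supp K. L (\<lambda>x. f x + g x) = L f + L g"
  "\<forall>c. \<forall>f\<in>supp K. L (\<lambda>x. c * f x) = c * L f" "\<forall>f\<in>supp K. L f \<le> q f" "q z \<le> L z"
  using hahn_banach[OF lin sub z] by blast
 have q4: "q w \<le> 4 * nrm w" for w
  using qle[OF supp_zero, of w] by (simp add: F_def bd_zero)
 have qabs: "\<bar>L w\<bar> \<le> B" if "w \<in> supp K" "q w \<le> B" "q (\<lambda>s. -1 * w s) \<le> B" for w B
 proof -
  have "L (\<lambda>s. -1 * w s) = - L w"
   using L(2)[rule_format, OF that(1), of "-1"] by simp
  then show ?thesis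
   using L(3) that supp_scale[OF that(1), of "-1"] by (force simp: abs_le_iff)
 qed
 have L4: "\<bar>L w\<bar> \<le> 4 * nrm w" if "w \<in> supp K" for w
  using qabs[OF that q4] q4[of "\<lambda>s. -1 * w s"] nrm_scale[OF supp_l1[OF that], of "-1"] by simp
 define f where "f s = (if s \<in> K then L (dl s) else 0)" for s
 have f: "bfun f" and Lf: "\<And>w. w \<in> supp K ==> L w = pairing f w"
  using l1_functional[OF L(1,2) supp_def L4] z unfolding f_def[abs_def] by blast+
 \<comment> \<open>\<open>dl s\<close> is an exact solution of norm 1 for its own boundary, so
   \<open>q\<close> is at most 1 there; this bounds the coboundary of \<open>f\<close> by 1.\<close>
 have "\<bar>\<Sum>k\<le>Suc m. (-1) ^ k * f (singular_face (Suc m) k s)\<bar> \<le> 1" if s: "s \<in> K'" for s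
 proof -
  have dK: "?D (dl s) \<in> supp K"
   by (rule supp_bd[OF supp_dl[OF s] face])
  have "\<bar>L (?D (dl s))\<bar> \<le> 1"
  proof (rule qabs[OF dK])
   show "q (?D (dl s)) \<le> 1"
    using qle[OF supp_dl[OF s], of "?D (dl s)"] by (simp add: F_def nrm_dl)
   show "q (\<lambda>t. - 1 * ?D (dl s) t) \<le> 1"
    using qle[OF supp_scale[OF supp_dl[OF s], of "-1"], of "\<lambda>t. - 1 * ?D (dl s) t"]
     bd_scale[OF l1_dl[of s], of m "-1"] nrm_scale[OF l1_dl[of s], of "-1"] by (simp add: F_def nrm_dl)
  qed
  then show ?thesis
   using Lf[OF dK] pairing_bd[OF l1_dl f] by (simp add: pairing_dl del: sum.atMost_Suc)
 qed
 then have "\<bar>pairing f z\<bar> \<le> nrm z"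
  by (rule coer[OF f])
 then have "q z \<le> nrm z"
  using L(4) Lf[OF z] by simp
 then have "q z < 2 * nrm z"
  using False nrm_nonneg[of z] by linarith
 then obtain c where "c \<in> supp K'" "F z c < 2 * nrm z"
  unfolding q_def using cINF_less_iff[OF ne bdd] by blast
 then show ?thesis
  using nrm_nonneg[of c] nrm_nonneg[of "\<lambda>s. z s - ?D c s"] by (intro bexI[of _ c]) (auto simp: F_def)
qed

text \<open>Coercivity is available for cycles only, but every remainder of the iteration is again a
  cycle. The corrections decrease geometrically, so their sum is a chain of finite norm whose
  boundary is \<open>z\<close>.\<close>

lemma l1_acyclic:
 fixes z :: "'a rchain"
 assumes face: "\<And>s k. s \<in> K' ==> k \<le> Suc (Suc p) ==> singular_face (Suc (Suc p)) k s \<in> K"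
  and ff: "\<And>s i k. s \<in> K' ==> i < k ==> k \<le> Suc (Suc p) ==>
   singular_face (Suc p) i (singular_face (Suc (Suc p)) k s) = singular_face (Suc p) (k - 1) (singular_face (Suc (Suc p)) i s)"
  and coer: "\<And>f z. z \<in> supp K ==> cyc (Suc p) z ==> bfun f ==>
   (\<And>s. s \<in> K' ==> \<bar>\<Sum>k\<le>Suc (Suc p). (-1) ^ k * f (singular_face (Suc (Suc p)) k s)\<bar> \<le> 1) ==> \<bar>pairing f z\<bar> \<le> nrm z"
  and z: "z \<in> supp K" "cyc (Suc p) z"
 shows "\<exists>b\<in>supp K'. rchain_boundary (Suc (Suc p)) b = z"
proof -
 let ?D = "rchain_boundary (Suc (Suc p)) :: 'a rchain => 'a rchain"
 define ch where "ch z = (SOME c. c \<in> supp K' \<and> nrm c \<le> 2 * nrm z \<and> nrm (\<lambda>s. z s - ?D c s) \<le> nrm z / 2)" for z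
 have ch: "ch z \<in> supp K'" "nrm (ch z) \<le> 2 * nrm z" "nrm (\<lambda>s. z s - ?D (ch z) s) \<le> nrm z / 2"
  if "z \<in> supp K" "cyc (Suc p) z" for z
 proof -
  have "\<exists>c\<in>supp K'. nrm c \<le> 2 * nrm z \<and> nrm (\<lambda>s. z s - ?D c s) \<le> nrm z / 2"
   by (rule half_step[where K = K]) (use face coer that in auto)
  then have "\<exists>c. c \<in> supp K' \<and> nrm c \<le> 2 * nrm z \<and> nrm (\<lambda>s. z s - ?D c s) \<le> nrm z / 2"
   by blast
  from someI_ex[OF this] show "ch z \<in> supp K'" "nrm (ch z) \<le> 2 * nrm z" "nrm (\<lambda>s. z s - ?D (ch z) s) \<le> nrm z / 2"
   unfolding ch_def by blast+
 qed
 define zs where "zs i = ((\<lambda>z s. z s - ?D (ch z) s) ^^ i) z" for i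
 have zs0: "zs 0 = z" and zsS: "\<And>i. zs (Suc i) = (\<lambda>s. zs i s - ?D (ch (zs i)) s)"
  by (simp_all add: zs_def)
 have zs: "zs i \<in> supp K \<and> cyc (Suc p) (zs i) \<and> nrm (zs i) \<le> nrm z / 2 ^ i" for i
 proof (induction i)
  case (Suc i)
  then have i: "zs i \<in> supp K" "cyc (Suc p) (zs i)"
   by auto
  note c = ch[OF i]
  have D: "?D (ch (zs i)) \<in> supp K"
   by (rule supp_bd[OF c(1) face])
  have DD: "rchain_boundary (Suc p) (?D (ch (zs i))) = (\<lambda>_. 0)"
   by (rule bd_bd[OF c(1) ff])
  have "cyc (Suc p) (zs (Suc i))"
   unfolding cyc_def zsS bd_diff[OF supp_l1[OF i(1)] supp_l1[OF D]] DD using i(2) by (simp add: cyc_def)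
  moreover have "zs (Suc i) \<in> supp K"
   unfolding zsS by (rule supp_diff[OF i(1) D])
  moreover have "nrm (zs (Suc i)) \<le> nrm z / 2 ^ Suc i"
   using c(3) Suc by (simp add: zsS)
  ultimately show ?case
   by blast
 qed (use z in \<open>auto simp: zs0\<close>)
 define c where "c i = ch (zs i)" for i
 have c: "c i \<in> supp K'" "nrm (c i) \<le> 2 * nrm z * (1 / 2) ^ i" for i
  using ch[of "zs i"] zs[of i] by (auto simp: c_def power_one_over)
 have geo: "summable (\<lambda>i. 2 * nrm z * (1 / 2) ^ i)"
  by (intro summable_mult summable_geometric) simp
 have sm: "summable (\<lambda>i. nrm (c i))"
  by (rule summable_comparison_test[OF _ geo]) (intro exI[of _ 0] allI impI, unfold real_norm_def abs_of_nonneg[OF nrm_nonneg], rule c(2))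
 note cl = supp_l1[OF c(1)]
 define b where "b s = (suminf (\<lambda>i. c i s))" for s
 have bl: "l1 b"
  unfolding b_def[abs_def] by (rule l1_series(2)[OF cl sm])
 have "b s = 0" if "s \<notin> K'" for s
 proof -
  have "c i s = 0" for i
   using c(1)[of i] that by (auto simp: supp_def)
  then show ?thesis
   by (simp add: b_def)
 qed
 then have bs: "b \<in> supp K'"
  using bl by (auto simp: supp_def)
 have zN: "zs N = (\<lambda>s. z s - ?D (\<lambda>t. \<Sum>i<N. c i t) s)" for N
 proof (induction N)
  case (Suc N)
  have "?D (\<lambda>t. (\<Sum>i<N. c i t) + c N t) = (\<lambda>s. ?D (\<lambda>t. \<Sum>i<N. c i t) s + ?D (c N) s)"
   by (rule bd_add[OF l1_sum[OF cl] cl])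
  then show ?case
   using Suc by (simp add: zsS c_def[symmetric] fun_eq_iff)
 qed (simp add: zs0 bd_zero)
 let ?r = "\<lambda>N. nrm z / 2 ^ N + real (Suc (Suc (Suc p))) * (suminf (\<lambda>i. nrm (c (i + N))))"
 have le: "nrm (\<lambda>s. z s - ?D b s) \<le> ?r N" for N
 proof -
  let ?t = "\<lambda>s. suminf (\<lambda>i. c (i + N) s)"
  have smN: "summable (\<lambda>i. nrm (c (i + N)))"
   using summable_ignore_initial_segment[OF sm] .
  note t = l1_series(2,3)[OF cl smN]
  have "b s = (\<Sum>i<N. c i s) + ?t s" for s
   unfolding b_def using suminf_split_initial_segment[OF l1_series(1)[OF cl sm], of s N] by simp
  then have "b = (\<lambda>s. (\<Sum>i<N. c i s) + ?t s)"
   by blast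
  then have "?D b = (\<lambda>s. ?D (\<lambda>s. \<Sum>i<N. c i s) s + ?D ?t s)"
   using bd_add[OF l1_sum[OF cl] t(1)] by (fastforce)
  then have "(\<lambda>s. z s - ?D b s) = (\<lambda>s. zs N s + (-1) * ?D ?t s)"
   by (simp add: zN fun_eq_iff)
  then have "nrm (\<lambda>s. z s - ?D b s) \<le> nrm (zs N) + nrm (\<lambda>s. (-1) * ?D ?t s)"
   using nrm_add[OF supp_l1[of "zs N" K] l1_scale[OF l1_bd(1)[OF t(1)]], of "-1" "Suc p"] zs[of N] by simp
  also have "nrm (\<lambda>s. (-1) * ?D ?t s) \<le> real (Suc (Suc (Suc p))) * nrm ?t"
   using nrm_scale[OF l1_bd(1)[OF t(1)], of "-1" "Suc p"] l1_bd(2)[OF t(1), of "Suc p"] by simp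
  also have "\<dots> \<le> real (Suc (Suc (Suc p))) * (suminf (\<lambda>i. nrm (c (i + N))))"
   using t(2) by (intro mult_left_mono) auto
  finally show ?thesis
   using zs[of N] by linarith
 qed
 have "?r \<longlonglongrightarrow> 0 + real (Suc (Suc (Suc p))) * 0"
 proof (intro tendsto_add tendsto_mult tendsto_const)
  have "(\<lambda>N. nrm z * (1/2) ^ N) \<longlonglongrightarrow> nrm z * 0"
   by (intro tendsto_mult tendsto_const LIMSEQ_realpow_zero) auto
  then show "(\<lambda>N. nrm z / 2 ^ N) \<longlonglongrightarrow> 0"
   by (simp add: power_one_over)
  show "(\<lambda>N. suminf (\<lambda>i. nrm (c (i + N)))) \<longlonglongrightarrow> 0"
   using suminf_exist_split2[OF sm] .
 qed
 then have "nrm (\<lambda>s. z s - ?D b s) \<le> 0"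
  using LIMSEQ_le_const[of ?r 0 "nrm (\<lambda>s. z s - ?D b s)"] le by simp
 then have "(\<lambda>s. z s - ?D b s) = (\<lambda>_. 0)"
  using nrm_eq_0[OF l1_diff[OF supp_l1[OF z(1)] l1_bd(1)[OF bl]]] nrm_nonneg[of "\<lambda>s. z s - ?D b s"] by simp
 then have "?D b = z"
  by (simp add: fun_eq_iff)
 then show ?thesis
  using bs by blast
qed

lemma (in kan_mean) T_bound:
 assumes "x \<in> K n" "bfun f" "\<And>t. t \<in> K (Suc n) ==> \<bar>f t\<bar> \<le> B"
 shows "\<bar>T n x f\<bar> \<le> B"
 by (rule mean_bound[OF mean_T[OF assms(1)] assms(2)]) (use assms(3) in auto)

text \<open>The homotopy formula of the contraction: the 0-th face of a cone over \<open>x\<close>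
  is \<open>x\<close>, and its other faces are cones over the faces of \<open>x\<close>, where
  \<open>T_face\<close> applies.\<close>

lemma (in kan_mean) T_coboundary:
 assumes x: "x \<in> K (Suc p)" and f: "bfun f"
 shows "T (Suc p) x (\<lambda>t. \<Sum>k\<le>Suc (Suc p). (-1) ^ k * f (d (Suc (Suc p)) k t))
  = f x - (\<Sum>j\<le>Suc p. (-1) ^ j * T p (d (Suc p) j x) f)"
proof -
 let ?g = "\<lambda>k t. f (d (Suc (Suc p)) k t)"
 have bg: "bfun (?g k)" for k
  using bfun_compose[OF f] .
 note M = mean_T[OF x]
 have "T (Suc p) x (\<lambda>t. \<Sum>k\<le>Suc (Suc p). (-1) ^ k * ?g k t) = (\<Sum>k\<le>Suc (Suc p). T (Suc p) x (\<lambda>t. (-1) ^ k * ?g k t))"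
  by (rule mean_sum[OF M]) (intro bfun_scale bg)
 also have "\<dots> = (\<Sum>k\<le>Suc (Suc p). (-1) ^ k * T (Suc p) x (?g k))"
  by (intro sum.cong refl mean_scale[OF M] bg)
 also have "\<dots> = T (Suc p) x (?g 0) + (\<Sum>j\<le>Suc p. (-1) ^ Suc j * T (Suc p) x (?g (Suc j)))"
  by (subst sum.atMost_Suc_shift) simp
 also have "T (Suc p) x (?g 0) = f x"
 proof -
  have "T (Suc p) x (?g 0) = T (Suc p) x (\<lambda>t. f x)"
   by (rule mean_cong[OF M bg]) auto
  then show ?thesis
   using mean_const[OF M] by simp
 qed
 also have "(\<Sum>j\<le>Suc p. (-1) ^ Suc j * T (Suc p) x (?g (Suc j))) = (\<Sum>j\<le>Suc p. - ((-1) ^ j * T p (d (Suc p) j x) f))"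
  by (intro sum.cong refl) (use T_face[OF x _ f] in auto)
 finally show ?thesis
  by (simp only: sum_negf diff_conv_add_uminus)
qed

text \<open>On \<open>K (Suc p)\<close> the homotopy formula writes \<open>f\<close> as
  \<open>A\<close> plus the coboundary of the bounded function \<open>g\<close>. Here
  \<open>A\<close> averages the coboundary of \<open>f\<close> and is at most 1 in absolute value,
  while the coboundary of \<open>g\<close> pairs to 0 with a cycle; this is the coercivity of norm
  one.\<close>

lemma kan_mean_acyclic:
 fixes z :: "'a rchain"
 assumes km: "kan_mean K singular_face base mu"
  and z: "z \<in> supp (K (Suc p))" "cyc (Suc p) z"
 shows "\<exists>b\<in>supp (K (Suc (Suc p))). rchain_boundary (Suc (Suc p)) b = z"
proof -
 interpret kan_mean K singular_face base mu
  by (rule km)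
 show ?thesis
 proof (rule l1_acyclic[OF _ _ _ z])
  show "singular_face (Suc (Suc p)) k s \<in> K (Suc p)" if "s \<in> K (Suc (Suc p))" "k \<le> Suc (Suc p)" for s k
   using face_in[OF that] .
  show "singular_face (Suc p) i (singular_face (Suc (Suc p)) k s) = singular_face (Suc p) (k - 1) (singular_face (Suc (Suc p)) i s)"
   if "s \<in> K (Suc (Suc p))" "i < k" "k \<le> Suc (Suc p)" for s i k
   using face_face[OF that] .
  fix f z assume z: "z \<in> supp (K (Suc p))" "cyc (Suc p) z" and f: "bfun f"
   and le: "\<And>s. s \<in> K (Suc (Suc p)) ==> \<bar>\<Sum>k\<le>Suc (Suc p). (-1) ^ k * f (singular_face (Suc (Suc p)) k s)\<bar> \<le> 1"
  obtain B where B: "\<And>s. \<bar>f s\<bar> \<le> B"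
   using f by (auto simp: bfun_def)
  have B0: "0 \<le> B"
   using B[of undefined] by linarith
  let ?df = "\<lambda>t. \<Sum>k\<le>Suc (Suc p). (-1) ^ k * f (singular_face (Suc (Suc p)) k t)"
  define A where "A s = (if s \<in> K (Suc p) then T (Suc p) s ?df else 0)" for s
  define g where "g s = (if s \<in> K p then T p s f else 0)" for s
  let ?dg = "\<lambda>t. \<Sum>k\<le>Suc p. (-1) ^ k * g (singular_face (Suc p) k t)"
  have bdf: "bfun ?df"
   by (rule bfun_alternating[OF f])
  have A1: "\<bar>A s\<bar> \<le> 1" for s
   using T_bound[OF _ bdf le, of s] by (simp add: A_def del: sum.atMost_Suc)
  have bA: "bfun A"
   using bfunI[OF A1] .
  have "\<bar>g s\<bar> \<le> B" for s
   using T_bound[OF _ f, of s p B] B B0 by (auto simp: g_def)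
  then have bg: "bfun g"
   by (rule bfunI)
  have bdg: "bfun ?dg"
   by (rule bfun_alternating[OF bg])
  have lz: "l1 z"
   by (rule supp_l1[OF z(1)])
  have "pairing f z = pairing (\<lambda>s. A s + ?dg s) z"
  proof (rule pairing_cong)
   fix s assume "z s \<noteq> 0"
   then have s: "s \<in> K (Suc p)"
    using z(1) by (auto simp: supp_def)
   have "?dg s = (\<Sum>j\<le>Suc p. (-1) ^ j * T p (singular_face (Suc p) j s) f)"
    by (intro sum.cong refl) (use face_in[OF s] in \<open>auto simp: g_def\<close>)
   then show "f s = A s + ?dg s"
    using T_coboundary[OF s f] s by (simp add: A_def del: sum.atMost_Suc)
  qed
  also have "\<dots> = pairing A z + pairing ?dg z"
   by (rule pairing_add[OF lz bA bdg])
  also have "pairing ?dg z = pairing g (rchain_boundary (Suc p) z)"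
   by (rule pairing_bd[OF lz bg, symmetric])
  also have "\<dots> = 0"
   using z(2) by (simp add: cyc_def pairing_def)
  finally show "\<bar>pairing f z\<bar> \<le> nrm z"
   using pairing_bound[OF lz, of A 1] A1 by simp
 qed
qed

section \<open>Saturated subcomplexes\<close>

context kan begin

text \<open>Up to homotopy \<open>c\<close> is the path \<open>a\<close> followed by \<open>b\<close>; \<open>tetra\<close> is associativity.\<close>

definition tri :: "'s => 's => 's => bool" where
 "tri a b c \<longleftrightarrow> (\<exists>t\<in>K 2. d 2 2 t = a \<and> d 2 0 t = b \<and> d 2 1 t = c)"

lemma tri_edges:
 assumes "tri a b c"
 shows "a \<in> K 1" "b \<in> K 1" "c \<in> K 1" "d 1 1 a = d 1 1 c" "d 1 0 a = d 1 1 b" "d 1 0 b = d 1 0 c"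
proof -
 obtain t where t: "t \<in> K 2" "d 2 2 t = a" "d 2 0 t = b" "d 2 1 t = c"
  using assms by (auto simp: tri_def)
 have t': "t \<in> K (Suc (Suc 0))"
  using t(1) by (simp add: numeral_2_eq_2)
 show "a \<in> K 1" "b \<in> K 1" "c \<in> K 1"
  using face_in[OF t', of 2] face_in[OF t', of 0] face_in[OF t', of 1] t by (auto simp: numeral_2_eq_2)
 show "d 1 1 a = d 1 1 c" "d 1 0 a = d 1 1 b" "d 1 0 b = d 1 0 c"
  using face_face[OF t', of 1 2] face_face[OF t', of 0 2] face_face[OF t', of 0 1] t by (auto simp: numeral_2_eq_2)
qed

lemma tri_horn:
 fixes j :: nat
 assumes "j \<le> 2" "j \<noteq> 2 ==> a \<in> K 1" "j \<noteq> 0 ==> b \<in> K 1" "j \<noteq> 1 ==> c \<in> K 1"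
  "j = 0 ==> d 1 1 a = d 1 1 c" "j = 1 ==> d 1 0 a = d 1 1 b" "j = 2 ==> d 1 0 b = d 1 0 c"
 obtains a' b' c' where "tri a' b' c'" "j \<noteq> 2 ==> a' = a" "j \<noteq> 0 ==> b' = b" "j \<noteq> 1 ==> c' = c"
proof -
 have "\<exists>t\<in>K (Suc (Suc 0)). \<forall>i\<le>Suc (Suc 0). i \<noteq> j --> d (Suc (Suc 0)) i t = (if i = 0 then b else if i = 1 then c else a)"
 proof (rule horn)
  show "j \<le> Suc (Suc 0)"
   using assms(1) by simp
  show "(if i = 0 then b else if i = 1 then c else a) \<in> K (Suc 0)" if "i \<le> Suc (Suc 0)" "i \<noteq> j" for i
   using that assms(2-4) by (auto simp: le_Suc_eq)
  show "d (Suc 0) i (if k = 0 then b else if k = 1 then c else a) =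
   d (Suc 0) (k - 1) (if i = 0 then b else if i = 1 then c else a)"
   if "i < k" "k \<le> Suc (Suc 0)" "i \<noteq> j" "k \<noteq> j" for i k
  proof -
   have "i = 0 \<and> k = 1 \<and> j = 2 \<or> i = 0 \<and> k = 2 \<and> j = 1 \<or> i = 1 \<and> k = 2 \<and> j = 0"
    using that assms(1) by linarith
   then show ?thesis
    using assms(5-7) by auto
  qed
 qed
 then obtain t where t: "t \<in> K 2" "\<And>i. i \<le> 2 ==> i \<noteq> j ==> d 2 i t = (if i = 0 then b else if i = 1 then c else a)"
  unfolding numeral_2_eq_2 by blast
 have "tri (d 2 2 t) (d 2 0 t) (d 2 1 t)"
  using t(1) by (auto simp: tri_def)
 then show thesis
  by (rule that) (use t(2) in auto)
qed

lemma tri_ab: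
 assumes "a \<in> K 1" "b \<in> K 1" "d 1 0 a = d 1 1 b"
 shows "\<exists>c. tri a b c"
 by (rule tri_horn[of 1 a b undefined]) (use assms in auto)

lemma tri_bc:
 assumes "b \<in> K 1" "c \<in> K 1" "d 1 0 b = d 1 0 c"
 shows "\<exists>a. tri a b c"
 by (rule tri_horn[of 2 undefined b c]) (use assms in auto)

lemma tri_ac:
 assumes "a \<in> K 1" "c \<in> K 1" "d 1 1 a = d 1 1 c"
 shows "\<exists>b. tri a b c"
 by (rule tri_horn[of 0 a undefined c]) (use assms in auto)

lemma tetra:
 fixes j :: nat
 assumes j: "j \<le> 3" and F: "j \<noteq> 0 ==> tri e12 e23 e13" "j \<noteq> 1 ==> tri e02 e23 e03" "j \<noteq> 2 ==> tri e01 e13 e03" "j \<noteq> 3 ==> tri e01 e12 e02"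
 shows "tri e12 e23 e13 \<and> tri e02 e23 e03 \<and> tri e01 e13 e03 \<and> tri e01 e12 e02"
proof -
 obtain t0 where t0: "j \<noteq> 0 ==> t0 \<in> K 2 \<and> d 2 2 t0 = e12 \<and> d 2 0 t0 = e23 \<and> d 2 1 t0 = e13"
  using F(1) unfolding tri_def by blast
 obtain t1 where t1: "j \<noteq> 1 ==> t1 \<in> K 2 \<and> d 2 2 t1 = e02 \<and> d 2 0 t1 = e23 \<and> d 2 1 t1 = e03"
  using F(2) unfolding tri_def by blast
 obtain t2 where t2: "j \<noteq> 2 ==> t2 \<in> K 2 \<and> d 2 2 t2 = e01 \<and> d 2 0 t2 = e13 \<and> d 2 1 t2 = e03"
  using F(3) unfolding tri_def by blast
 obtain t3 where t3: "j \<noteq> 3 ==> t3 \<in> K 2 \<and> d 2 2 t3 = e01 \<and> d 2 0 t3 = e12 \<and> d 2 1 t3 = e02"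
  using F(4) unfolding tri_def by blast
 let ?x = "\<lambda>i. if i = 0 then t0 else if i = 1 then t1 else if i = 2 then t2 else t3"
 have "\<exists>t\<in>K (Suc (Suc (Suc 0))). \<forall>i\<le>Suc (Suc (Suc 0)). i \<noteq> j --> d (Suc (Suc (Suc 0))) i t = ?x i"
 proof (rule horn)
  show "j \<le> Suc (Suc (Suc 0))"
   using j by simp
  show "?x i \<in> K (Suc (Suc 0))" if "i \<le> Suc (Suc (Suc 0))" "i \<noteq> j" for i
  proof -
   have "i = 0 \<or> i = 1 \<or> i = 2 \<or> i = 3"
    using that by linarith
   then show ?thesis
    using that t0 t1 t2 t3 unfolding numeral_2_eq_2[symmetric] by auto
  qed
  show "d (Suc (Suc 0)) i (?x k) = d (Suc (Suc 0)) (k - 1) (?x i)"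
   if "i < k" "k \<le> Suc (Suc (Suc 0))" "i \<noteq> j" "k \<noteq> j" for i k
  proof -
   have "i = 0 \<and> k = 1 \<or> i = 0 \<and> k = 2 \<or> i = 0 \<and> k = 3 \<or> i = 1 \<and> k = 2 \<or> i = 1 \<and> k = 3 \<or> i = 2 \<and> k = 3"
    using that by (force)
   then show ?thesis
    using that(3,4) t0 t1 t2 t3 unfolding numeral_2_eq_2[symmetric] by (elim disjE) auto
  qed
 qed
 then obtain t where t: "t \<in> K 3" "\<And>i. i \<le> 3 ==> i \<noteq> j ==> d 3 i t = ?x i"
  unfolding numeral_3_eq_3 by blast
 have t': "t \<in> K (Suc (Suc (Suc 0)))"
  using t(1) by (simp add: numeral_3_eq_3)
 have inK: "d 3 i t \<in> K 2" if "i \<le> 3" for i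
  using face_in[OF t', of i] that by (simp add: numeral_3_eq_3 numeral_2_eq_2)
 have ff: "d 2 i (d 3 k t) = d 2 (k - 1) (d 3 i t)" if "i < k" "k \<le> 3" for i k
  using face_face[OF t', of i k] that by (simp add: numeral_3_eq_3 numeral_2_eq_2)
 note ff6 = ff[of 0 1, simplified] ff[of 0 2, simplified] ff[of 0 3, simplified] ff[of 1 2, simplified] ff[of 1 3, simplified] ff[of 2 3, simplified]
 have T: "tri (d 2 2 (d 3 i t)) (d 2 0 (d 3 i t)) (d 2 1 (d 3 i t))" if "i \<le> 3" for i
  using inK[OF that] by (auto simp: tri_def)
 consider "j = 0" | "j = 1" | "j = 2" | "j = 3"
  using j by linarith
 then show ?thesis
 proof cases
  case 1
  then have "d 3 1 t = t1" "d 3 2 t = t2" "d 3 3 t = t3"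
   using t(2)[of 1] t(2)[of 2] t(2)[of 3] by auto
  then show ?thesis
   using T[of 0] ff6 t1 t2 t3 F 1 by simp
 next
  case 2
  then have "d 3 0 t = t0" "d 3 2 t = t2" "d 3 3 t = t3"
   using t(2)[of 0] t(2)[of 2] t(2)[of 3] by auto
  then show ?thesis
   using T[of 1] ff6 t0 t2 t3 F 2 by simp
 next
  case 3
  then have "d 3 0 t = t0" "d 3 1 t = t1" "d 3 3 t = t3"
   using t(2)[of 0] t(2)[of 1] t(2)[of 3] by auto
  then show ?thesis
   using T[of 2] ff6 t0 t1 t3 F 3 by simp
 next
  case 4
  then have "d 3 0 t = t0" "d 3 1 t = t1" "d 3 2 t = t2"
   using t(2)[of 0] t(2)[of 1] t(2)[of 2] by auto
  then show ?thesis
   using T[of 3] ff6 t0 t1 t2 F 4 by simp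
 qed
qed

lemma tri_hom:
 shows tri_hom_a: "tri a b c ==> hom 1 a a' ==> tri a' b c"
  and tri_hom_b: "tri a b c ==> hom 1 b b' ==> tri a b' c"
  and tri_hom_c: "tri a b c ==> hom 1 c c' ==> tri a b c'"
proof -
 have *: "\<exists>r'\<in>K 2. d 2 l r' = y \<and> (\<forall>i\<le>2. i \<noteq> l --> d 2 i r' = d 2 i r)"
  if "hom 1 x y" "r \<in> K 2" "l \<le> 2" "d 2 l r = x" for x y l r
  using hom_replace_index[of 1 x y r l] that by (simp add: numeral_2_eq_2)
 assume "tri a b c"
 then obtain t where t: "t \<in> K 2" "d 2 2 t = a" "d 2 0 t = b" "d 2 1 t = c"
  unfolding tri_def by blast
 show "tri a' b c" if hh: "hom 1 a a'"
 proof -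
  obtain r where "r \<in> K 2" "d 2 2 r = a'" "\<And>i. i \<le> 2 ==> i \<noteq> 2 ==> d 2 i r = d 2 i t"
   using *[OF hh t(1) _ t(2)] by auto
  then show ?thesis
   using t(3,4) unfolding tri_def by (intro bexI[of _ r]) auto
 qed
 show "tri a b' c" if hh: "hom 1 b b'"
 proof -
  obtain r where "r \<in> K 2" "d 2 0 r = b'" "\<And>i. i \<le> 2 ==> i \<noteq> 0 ==> d 2 i r = d 2 i t"
   using *[OF hh t(1) _ t(3)] by auto
  then show ?thesis
   using t(2,4) unfolding tri_def by (intro bexI[of _ r]) auto
 qed
 show "tri a b c'" if hh: "hom 1 c c'"
 proof -
  obtain r where "r \<in> K 2" "d 2 1 r = c'" "\<And>i. i \<le> 2 ==> i \<noteq> 1 ==> d 2 i r = d 2 i t"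
   using *[OF hh t(1) _ t(4)] by auto
  then show ?thesis
   using t(2,3) unfolding tri_def by (intro bexI[of _ r]) auto
 qed
qed

lemma tri_unique:
 shows tri_unique_b: "tri a b c ==> tri a b' c ==> hom 1 b b'"
  and tri_unique_c: "tri a b c ==> tri a b c' ==> hom 1 c c'"
proof -
 have *: "hom 1 (d 2 l t) (d 2 l t')" if "t \<in> K 2" "t' \<in> K 2" "l \<le> 2" "\<And>k. k \<le> 2 ==> k \<noteq> l ==> d 2 k t = d 2 k t'" for t t' l
  using hom_index[of t 1 t' l] that by (simp add: numeral_2_eq_2)
 have three: "k = 0 \<or> k = 1 \<or> k = 2" if "k \<le> (2::nat)" for k
  using that by linarith
 show "hom 1 b b'" if h: "tri a b c" "tri a b' c"
 proof -
  obtain t t' where t: "t \<in> K 2" "d 2 2 t = a" "d 2 0 t = b" "d 2 1 t = c" "t' \<in> K 2" "d 2 2 t' = a" "d 2 0 t' = b'" "d 2 1 t' = c"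
   using h unfolding tri_def by blast
  show ?thesis
  proof -
   have "d 2 k t = d 2 k t'" if "k \<le> 2" "k \<noteq> 0" for k
    using three[OF that(1)] that t by auto
   then show ?thesis
    using *[OF t(1,5), of 0] t by simp
  qed
 qed
 show "hom 1 c c'" if h: "tri a b c" "tri a b c'"
 proof -
  obtain t t' where t: "t \<in> K 2" "d 2 2 t = a" "d 2 0 t = b" "d 2 1 t = c" "t' \<in> K 2" "d 2 2 t' = a" "d 2 0 t' = b" "d 2 1 t' = c'"
   using h unfolding tri_def by blast
  show ?thesis
  proof -
   have "d 2 k t = d 2 k t'" if "k \<le> 2" "k \<noteq> 1" for k
    using three[OF that(1)] that t by auto
   then show ?thesis
    using *[OF t(1,5), of 1] t by simp
  qed
 qed
qed

end

text \<open>From degree two on, membership is a condition on the edges only.\<close>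

primrec sat :: "(nat => 's set) => (nat => nat => 's => 's) => (nat => 's set) => nat => 's set" where
 "sat S d V 0 = V 0"
| "sat S d V (Suc m) = (if m = 0 then {x. \<exists>q\<in>V 1. kan.hom S d 1 x q} else {x\<in>S (Suc m). \<forall>k\<le>Suc m. d (Suc m) k x \<in> sat S d V m})"

lemma sat_mono:
 assumes "\<And>n. V n \<subseteq> V' n"
 shows "sat S d V n \<subseteq> sat S d V' n"
proof (induction n)
 case 0
 then show ?case
  using assms by simp
next
 case (Suc n)
 then show ?case
  using assms[of 1] by auto
qed

text \<open>\<open>V\<close> is a subcomplex that is itself Kan. The loops in \<open>const\<close>
  take the place of degenerate edges.\<close>

locale kan_pair = S: kan S d + V: kan V d
 for S V :: "nat => 's set" and d :: "nat => nat => 's => 's" +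
 assumes VS: "V n \<subseteq> S n"
  and const: "x \<in> V 0 ==> \<exists>e\<in>V 1. d 1 0 e = x \<and> d 1 1 e = x"
begin

abbreviation KV :: "nat => 's set" where
 "KV \<equiv> sat S d V"

lemma KV_1: "x \<in> KV 1 \<longleftrightarrow> (\<exists>q\<in>V 1. S.hom 1 x q)"
 by simp

lemma KV_S: "KV n \<subseteq> S n"
proof -
 consider "n = 0" | "n = 1" | m where "n = Suc (Suc m)"
  by (cases n; cases "n - 1") auto
 then show ?thesis
 proof cases
  case 2
  then show ?thesis
   using S.hom_in[of 1] by auto
 qed (use VS in auto)
qed

lemma hom_faces:
 assumes "S.hom 1 x q" "k \<le> 1"
 shows "d 1 k x = d 1 k q"
 using S.hom_par[OF assms(1)] assms(2) by (simp add: S.par_def)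

lemma V_KV: "V n \<subseteq> KV n"
proof (induction n)
 case (Suc n)
 show ?case
 proof (cases "n = 0")
  case True
  then show ?thesis
   using VS[of 1] S.hom_refl[of _ 1] by auto
 next
  case False
  then show ?thesis
   using VS[of "Suc n"] Suc V.face_in[of _ n] by auto
 qed
qed simp

lemma KV_face:
 assumes "x \<in> KV (Suc p)" "k \<le> Suc p"
 shows "d (Suc p) k x \<in> KV p"
proof (cases "p = 0")
 case True
 then obtain q where q: "q \<in> V 1" "S.hom 1 x q"
  using assms by auto
 have "d 1 k x = d 1 k q"
  by (rule hom_faces[OF q(2)]) (use assms True in auto)
 then show ?thesis
  using True V.face_in[of q 0 k] q(1) assms by auto
qed (use assms in auto)

text \<open>The two given edges are exchanged, one after the other, for homotopic edges of
  \<open>V\<close>. These form a horn, which is filled in \<open>V\<close>, and the third edge of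
  the filler is homotopic to the third edge of \<open>t\<close>.\<close>

lemma KV_triangle:
 assumes t: "t \<in> S 2" and a: "a \<le> 2" "b \<le> 2" "j \<le> 2" "a \<noteq> b" "a \<noteq> j" "b \<noteq> j"
  and K: "d 2 a t \<in> KV 1" "d 2 b t \<in> KV 1"
 shows "d 2 j t \<in> KV 1"
proof -
 obtain qa qb where q: "qa \<in> V 1" "S.hom 1 (d 2 a t) qa" "qb \<in> V 1" "S.hom 1 (d 2 b t) qb"
  using K unfolding KV_1 by blast
 have t2: "t \<in> S (Suc 1)"
  using t by (simp add: numeral_2_eq_2)
 have two: "Suc 1 = (2::nat)"
  by simp
 obtain t1 where t1: "t1 \<in> S 2" "d 2 a t1 = qa" "\<And>i. i \<le> 2 ==> i \<noteq> a ==> d 2 i t1 = d 2 i t"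
  using S.hom_replace_index[of 1 "d 2 a t" qa t a] q t a unfolding two by auto
 obtain t2 where t2: "t2 \<in> S 2" "d 2 b t2 = qb" "\<And>i. i \<le> 2 ==> i \<noteq> b ==> d 2 i t2 = d 2 i t1"
  using S.hom_replace_index[of 1 "d 2 b t" qb t1 b] q t1 a unfolding two by auto
 have t2q: "d 2 a t2 = qa" "d 2 j t2 = d 2 j t"
  using t2(3)[of a] t2(3)[of j] t1 a by auto
 have three: "k = a \<or> k = b \<or> k = j" if "k \<le> 2" for k
  using that a by linarith
 have "\<exists>u\<in>V (Suc (Suc 0)). \<forall>i\<le>Suc (Suc 0). i \<noteq> j --> d (Suc (Suc 0)) i u = (if i = a then qa else qb)"
 proof (rule V.horn)
  show "j \<le> Suc (Suc 0)"
   using a by simp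
  show "(if i = a then qa else qb) \<in> V (Suc 0)" if "i \<le> Suc (Suc 0)" "i \<noteq> j" for i
   using q by auto
  fix i k assume ik: "i < k" "k \<le> Suc (Suc 0)" "i \<noteq> j" "k \<noteq> j"
  have eq: "(if l = a then qa else qb) = d 2 l t2" if "l \<le> 2" "l \<noteq> j" for l
   using three[of l] that t2(2) t2q by auto
  show "d (Suc 0) i (if k = a then qa else qb) = d (Suc 0) (k - 1) (if i = a then qa else qb)"
   unfolding eq[of k, OF ik(2)[folded numeral_2_eq_2] ik(4)] eq[of i, OF less_imp_le[OF less_le_trans[OF ik(1) ik(2)[folded numeral_2_eq_2]]] ik(3)]
   using S.face_face[of t2 0 i k] t2(1) ik by (simp add: numeral_2_eq_2)
 qed
 then obtain u where u: "u \<in> V 2" "\<And>i. i \<le> 2 ==> i \<noteq> j ==> d 2 i u = (if i = a then qa else qb)"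
  unfolding numeral_2_eq_2 by blast
 have "S.hom 1 (d 2 j t2) (d 2 j u)"
 proof -
  have "d 2 k t2 = d 2 k u" if "k \<le> 2" "k \<noteq> j" for k
   using three[OF that(1)] u(2)[OF that] t2q t2(2) that by auto
  then show ?thesis
   using S.hom_index[of t2 1 u j] t2(1) u(1) VS[of 2] a unfolding two by auto
 qed
 moreover have "d 2 j u \<in> V 1"
  using V.face_in[of u 1 j] u(1) a unfolding two by auto
 ultimately show ?thesis
  unfolding KV_1 t2q by blast
qed

sublocale K: kan KV d
proof
 show "d (Suc p) k x \<in> KV p" if "x \<in> KV (Suc p)" "k \<le> Suc p" for p k x
  using KV_face[OF that] .
 show "d (Suc p) i (d (Suc (Suc p)) k x) = d (Suc p) (k - 1) (d (Suc (Suc p)) i x)"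
  if "x \<in> KV (Suc (Suc p))" "i < k" "k \<le> Suc (Suc p)" for p i k x
  using S.face_face[OF _ that(2,3)] that(1) KV_S[of "Suc (Suc p)"] by blast
 fix p j x
 assume j: "j \<le> Suc (Suc p)" and x: "\<And>i. i \<le> Suc (Suc p) ==> i \<noteq> j ==> x i \<in> KV (Suc p)"
  and c: "\<And>i k. i < k ==> k \<le> Suc (Suc p) ==> i \<noteq> j ==> k \<noteq> j ==> d (Suc p) i (x k) = d (Suc p) (k - 1) (x i)"
 have "\<exists>t\<in>S (Suc (Suc p)). \<forall>i\<le>Suc (Suc p). i \<noteq> j --> d (Suc (Suc p)) i t = x i"
  by (rule S.horn[OF j _ c]) (use x KV_S[of "Suc p"] in blast)
 then obtain t where t: "t \<in> S (Suc (Suc p))" "\<And>i. i \<le> Suc (Suc p) ==> i \<noteq> j ==> d (Suc (Suc p)) i t = x i"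
  by blast
 have "d (Suc (Suc p)) j t \<in> KV (Suc p)"
 proof (cases "p = 0")
  case True
  define a where "a = (if j = 0 then 1 else 0::nat)"
  define b where "b = (if j = 2 then 1 else 2::nat)"
  have ab: "a \<le> 2" "b \<le> 2" "j \<le> 2" "a \<noteq> b" "a \<noteq> j" "b \<noteq> j"
   using j True by (auto simp: a_def b_def)
  have "d 2 a t \<in> KV 1" "d 2 b t \<in> KV 1"
   using t(2)[of a] t(2)[of b] x[of a] x[of b] ab unfolding True numeral_2_eq_2[symmetric] One_nat_def by auto
  then have "d 2 j t \<in> KV 1"
   using t(1) ab unfolding True numeral_2_eq_2[symmetric] by (intro KV_triangle[of t a b j]) auto
  then show ?thesis
   unfolding True numeral_2_eq_2 One_nat_def .
 next
  case False
  \<comment> \<open>From dimension three on, every facet of the missing face is also a facet of one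
    of the given simplices, so it lies in the saturation.\<close>
  have "d (Suc p) k (d (Suc (Suc p)) j t) \<in> KV p" if k: "k \<le> Suc p" for k
  proof (cases "k < j")
   case True
   have "d (Suc p) k (d (Suc (Suc p)) j t) = d (Suc p) (j - 1) (x k)"
    using S.face_face[OF t(1) True j] t(2)[of k] True j by simp
   then show ?thesis
    using KV_face[OF x, of k "j - 1"] True j k by auto
  next
   case False
   have "d (Suc p) k (d (Suc (Suc p)) j t) = d (Suc p) j (x (Suc k))"
    using S.face_face[OF t(1), of j "Suc k"] t(2)[of "Suc k"] False k by simp
   then show ?thesis
    using KV_face[OF x, of "Suc k" j] False k by auto
  qed
  then show ?thesis
   using False S.face_in[OF t(1) j] by simp
 qed
 then have "d (Suc (Suc p)) i t \<in> KV (Suc p)" if "i \<le> Suc (Suc p)" for i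
  using that t(2)[of i] x[of i] by (cases "i = j") auto
 then have "t \<in> KV (Suc (Suc p))"
  using t(1) by simp
 then show "\<exists>t\<in>KV (Suc (Suc p)). \<forall>i\<le>Suc (Suc p). i \<noteq> j --> d (Suc (Suc p)) i t = x i"
  using t(2) by blast
qed

lemma KV_2I: "t \<in> S 2 ==> d 2 0 t \<in> KV 1 ==> d 2 1 t \<in> KV 1 ==> d 2 2 t \<in> KV 1 ==> t \<in> KV 2"
proof -
 assume t: "t \<in> S 2" "d 2 0 t \<in> KV 1" "d 2 1 t \<in> KV 1" "d 2 2 t \<in> KV 1"
 have "d 2 k t \<in> KV 1" if "k \<le> 2" for k
 proof -
  have "k = 0 \<or> k = 1 \<or> k = 2"
   using that by linarith
  then show ?thesis
   using t by blast
 qed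
 then show ?thesis
  using t(1) unfolding numeral_2_eq_2 One_nat_def by simp
qed

lemma tri_KV:
 assumes "S.tri a b c" "a \<in> KV 1" "b \<in> KV 1" "c \<in> KV 1"
 shows "K.tri a b c"
 using assms KV_2I unfolding S.tri_def K.tri_def by metis

lemma tri_S: "K.tri a b c ==> S.tri a b c"
 using KV_S[of 2] unfolding S.tri_def K.tri_def by blast

definition conn :: "'s => 's => bool" where
 "conn x y \<longleftrightarrow> (\<exists>e\<in>KV 1. d 1 1 e = x \<and> d 1 0 e = y)"

definition base :: "'s => 's" where
 "base x = (SOME y. conn y x)"

lemma conn_refl: "x \<in> KV 0 ==> conn x x"
 using const[of x] V_KV[of 1] unfolding conn_def sat.simps(1) by blast

lemma conn_trans: "conn x y ==> conn y z ==> conn x z"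
proof -
 assume "conn x y" "conn y z"
 then obtain a b where "a \<in> KV 1" "b \<in> KV 1" "d 1 1 a = x" "d 1 0 a = y" "d 1 1 b = y" "d 1 0 b = z"
  unfolding conn_def by blast
 moreover then obtain c where "K.tri a b c"
  using K.tri_ab[of a b] by auto
 ultimately show ?thesis
  using K.tri_edges[of a b c] unfolding conn_def by metis
qed

lemma conn_sym: "conn x y ==> conn y x"
proof -
 assume "conn x y"
 then obtain a where a: "a \<in> KV 1" "d 1 1 a = x" "d 1 0 a = y"
  unfolding conn_def by blast
 have "x \<in> KV 0"
  using K.face_in[of a 0 1] a by auto
 then obtain c where c: "c \<in> KV 1" "d 1 1 c = x" "d 1 0 c = x"
  using conn_refl unfolding conn_def by blast
 obtain b where "K.tri a b c"
  using K.tri_ac[of a c] a c by auto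
 then show ?thesis
  using K.tri_edges[of a b c] a c unfolding conn_def by metis
qed

lemma base_edge: "x \<in> KV 0 ==> \<exists>e\<in>KV 1. d 1 1 e = base x \<and> d 1 0 e = x"
 using someI[of "\<lambda>y. conn y x", OF conn_refl] unfolding base_def conn_def by blast

lemma base_const: "e \<in> KV 1 ==> base (d 1 1 e) = base (d 1 0 e)"
proof -
 assume "e \<in> KV 1"
 then have "conn (d 1 1 e) (d 1 0 e)"
  unfolding conn_def by blast
 then have "conn y (d 1 1 e) \<longleftrightarrow> conn y (d 1 0 e)" for y
  using conn_trans conn_sym by blast
 then show ?thesis
  unfolding base_def by simp
qed

end

text \<open>In the application \<open>W\<close> consists of the simplices of a member of the cover,
  \<open>V\<close> of those of a smaller set and \<open>S\<close> of all simplices. The mean on the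
  loops of \<open>W\<close> is invariant under right multiplication by a loop \<open>g\<close>,
  tested on functions that see loops up to homotopy in \<open>S\<close>; \<open>R\<close> is any
  choice of products with \<open>g\<close>.\<close>

locale kan_triple = kan_pair S V d + W: kan W d
 for S V W :: "nat => 's set" and d :: "nat => nat => 's => 's" +
 assumes VW: "V n \<subseteq> W n" and WS: "W n \<subseteq> S n"
  and wmean: "s \<in> V 0 ==> \<exists>M. mean {q\<in>W 1. d 1 0 q = s \<and> d 1 1 q = s} M \<and>
   (\<forall>g\<in>W 1. \<forall>R f. d 1 0 g = s --> d 1 1 g = s --> bfun f --> (\<forall>q q'. S.hom 1 q q' --> f q = f q') -->
    (\<forall>q. q \<in> W 1 --> d 1 0 q = s --> d 1 1 q = s --> R q \<in> W 1 \<and> S.tri q g (R q)) --> M (\<lambda>q. f (R q)) = M f)"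
begin

lemma tri_W: "W.tri a b c ==> S.tri a b c"
 using WS[of 2] unfolding S.tri_def W.tri_def by blast

definition kl :: "'s => 's set" where
 "kl s = {h\<in>KV 1. d 1 0 h = s \<and> d 1 1 h = s}"

text \<open>A right invariant mean on the loops of \<open>W\<close> is pushed to the loops of the saturation by sending a loop to
 its coordinate with respect to a chosen representative of its coset; this replaces the inheritance of
 amenability by subgroups.\<close>

definition orb :: "'s => 's => 's set" where
 "orb s z = {c. c \<in> W 1 \<and> (\<exists>h\<in>kl s. S.tri c h z)}"

definition ch :: "'s => 's => 's" where
 "ch s z = (SOME h. h \<in> kl s \<and> S.tri (SOME c. c \<in> orb s z) h z)"

lemma orb_nonempty:
 assumes "x \<in> V 1" "d 1 0 x = s" "d 1 1 x = s" "z \<in> W 1" "d 1 0 z = s"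
 shows "\<exists>c. c \<in> orb s z"
proof -
 have "x \<in> W 1" "x \<in> kl s"
  using assms VW[of 1] V_KV[of 1] by (auto simp: kl_def)
 moreover obtain c where "W.tri c x z"
  using W.tri_bc[of x z] assms calculation by auto
 ultimately show ?thesis
  using W.tri_edges(1) tri_W unfolding orb_def by blast
qed

lemma ch:
 assumes "\<exists>c. c \<in> orb s z"
 shows "ch s z \<in> kl s" "S.tri (SOME c. c \<in> orb s z) (ch s z) z"
proof -
 have "(SOME c. c \<in> orb s z) \<in> orb s z"
  using assms by (rule someI_ex)
 then have "\<exists>h. h \<in> kl s \<and> S.tri (SOME c. c \<in> orb s z) h z"
  unfolding orb_def by blast
 from someI_ex[OF this] show "ch s z \<in> kl s" "S.tri (SOME c. c \<in> orb s z) (ch s z) z"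
  unfolding ch_def by blast+
qed

text \<open>\<open>orb s z\<close> is the part in \<open>W\<close> of the coset of \<open>z\<close>
  modulo the loops of the saturation, and right multiplication by such a loop stays in the
  coset.\<close>

lemma orb_act:
 assumes g: "g \<in> kl s" and t: "S.tri z g z'"
 shows "orb s z = orb s z'"
proof (rule Set.set_eqI, rule iffI)
 fix c
 {
  assume "c \<in> orb s z"
  then obtain h where h: "c \<in> W 1" "h \<in> kl s" "S.tri c h z"
   unfolding orb_def by blast
  then obtain k where k: "K.tri h g k"
   using K.tri_ab[of h g] g by (auto simp: kl_def)
  have "S.tri c k z'"
   using S.tetra[of 2 h g k z z' c] tri_S[OF k] h t by auto
  moreover have "k \<in> kl s"
   using K.tri_edges[OF k] g h by (auto simp: kl_def)
  ultimately show "c \<in> orb s z'"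
   using h unfolding orb_def by blast
 next
  assume "c \<in> orb s z'"
  then obtain h where h: "c \<in> W 1" "h \<in> kl s" "S.tri c h z'"
   unfolding orb_def by blast
  then obtain k where k: "K.tri k g h"
   using K.tri_bc[of g h] g by (auto simp: kl_def)
  have "S.tri c k z"
   using S.tetra[of 3 k g h z z' c] tri_S[OF k] h t by auto
  moreover have "k \<in> kl s"
   using K.tri_edges[OF k] g h by (auto simp: kl_def)
  ultimately show "c \<in> orb s z"
   using h unfolding orb_def by blast
 }
qed

lemma orb_hom: "S.hom 1 z z' ==> orb s z = orb s z'"
 using S.tri_hom_c S.hom_sym unfolding orb_def by blast

text \<open>With r the representative of the coset, z = r h implies z g = r (h g): the coordinate of
  a loop is multiplied by \<open>g\<close> along with the loop.\<close>

lemma ch_act: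
 assumes g: "g \<in> kl s" and t: "S.tri z g z'" and ne: "\<exists>c. c \<in> orb s z"
 shows "K.tri (ch s z) g (ch s z')"
proof -
 note o = orb_act[OF g t]
 have c: "S.tri (SOME c. c \<in> orb s z) (ch s z) z" "S.tri (SOME c. c \<in> orb s z) (ch s z') z'"
  "ch s z \<in> kl s" "ch s z' \<in> kl s"
  using ch[OF ne] ch[of s z'] ne unfolding o by auto
 have "S.tri (ch s z) g (ch s z')"
  using S.tetra[of 0 "ch s z" g "ch s z'" z z' "SOME c. c \<in> orb s z"] c t by auto
 then show ?thesis
  using c g by (intro tri_KV) (auto simp: kl_def)
qed

lemma ch_hom:
 assumes h: "S.hom 1 z z'"
 shows "ch s z = ch s z'"
proof -
 have "S.tri a b z \<longleftrightarrow> S.tri a b z'" for a b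
  using S.tri_hom_c[OF _ h] S.tri_hom_c[OF _ S.hom_sym[OF h]] by blast
 then show ?thesis
  unfolding ch_def orb_hom[OF h] by simp
qed

lemma V_loop:
 assumes "g \<in> kl s"
 obtains q where "q \<in> V 1" "d 1 0 q = s" "d 1 1 q = s" "S.hom 1 g q"
proof -
 obtain q where q: "q \<in> V 1" "S.hom 1 g q"
  using assms by (auto simp: kl_def)
 have "d 1 0 g = d 1 0 q" "d 1 1 g = d 1 1 q"
  using hom_faces[OF q(2), of 0] hom_faces[OF q(2), of 1] by auto
 then show thesis
  using that[of q] q assms by (simp add: kl_def)
qed

text \<open>Written as products, z followed by \<open>d 2 0 D1\<close> and h z followed by
  \<open>d 2 0 D2\<close> are the same edge. Hence \<open>h\<close> is right multiplication by the
  loop \<open>g\<close> for which \<open>g\<close> followed by \<open>d 2 0 D2\<close> is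
  \<open>d 2 0 D1\<close>.\<close>

lemma Lf_act:
 assumes h: "h \<in> K.Lf 1 x 1" and x: "x \<in> kl s"
 obtains g where "g \<in> kl s" "\<And>z. z \<in> K.reps 1 x ==> K.tri z g (h z)"
proof -
 have two: "Suc 1 = (2::nat)"
  by simp
 obtain D1 D2 where D: "K.ldata 1 x 1 D1 D2" and hz: "\<And>z. z \<in> K.reps 1 x ==> K.lamrel 1 1 D1 D2 z (h z)"
  using h unfolding K.Lf_def by blast
 have D': "D1 \<in> KV 2" "D2 \<in> KV 2" "K.par 1 (d 2 2 D1) x" "K.par 1 (d 2 2 D2) x" "K.par 1 (d 2 1 D1) (d 2 1 D2)"
  using D unfolding K.ldata_def two by auto
 have T: "K.tri (d 2 2 D1) (d 2 0 D1) (d 2 1 D1)" "K.tri (d 2 2 D2) (d 2 0 D2) (d 2 1 D2)"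
  using D'(1,2) unfolding K.tri_def by blast+
 note E1 = K.tri_edges[OF T(1)] and E2 = K.tri_edges[OF T(2)]
 have s: "d 1 1 (d 2 0 D1) = s" "d 1 1 (d 2 0 D2) = s" "d 1 0 (d 2 0 D1) = d 1 0 (d 2 0 D2)"
  using E1 E2 D'(3-5) x unfolding K.par_def kl_def by auto
 obtain g where g: "K.tri g (d 2 0 D2) (d 2 0 D1)"
  using K.tri_bc[OF E2(2) E1(2)] s by auto
 have gs: "g \<in> kl s"
  using K.tri_edges[OF g] s by (auto simp: kl_def)
 moreover have "K.tri z g (h z)" if z: "z \<in> K.reps 1 x" for z
 proof -
  obtain A B where AB: "A \<in> KV 2" "B \<in> KV 2" "K.agree 1 1 D1 A" "K.agree 1 1 D2 B" "d 2 2 A = z" "d 2 2 B = h z" "d 2 1 A = d 2 1 B"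
   using hz[OF z] unfolding K.lamrel_def two by blast
  have "d 2 0 A = d 2 0 D1" "d 2 0 B = d 2 0 D2"
   using AB(3,4) unfolding K.agree_def two by auto
  then have "K.tri z (d 2 0 D1) (d 2 1 A)" "K.tri (h z) (d 2 0 D2) (d 2 1 A)"
   using AB unfolding K.tri_def by (metis, metis)
  then show ?thesis
   using K.tetra[of 3 g "d 2 0 D2" "d 2 0 D1" "h z" "d 2 1 A" z] g by auto
 qed
 ultimately show thesis
  by (rule that)
qed

sublocale kan_amenable KV d base
proof
 fix s assume s: "s \<in> KV 0" "base s = s"
 then have sV: "s \<in> V 0"
  by simp
 obtain x where x: "x \<in> V 1" "d 1 0 x = s" "d 1 1 x = s"
  using const[OF sV] by blast
 have xk: "x \<in> kl s"
  using x V_KV[of 1] by (auto simp: kl_def)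
 let ?L = "{q\<in>W 1. d 1 0 q = s \<and> d 1 1 q = s}"
 obtain M where M: "mean ?L M"
  "\<And>g R f. g \<in> W 1 ==> d 1 0 g = s ==> d 1 1 g = s ==> bfun f ==> (\<And>q q'. S.hom 1 q q' ==> f q = f q') ==>
    (\<And>q. q \<in> W 1 ==> d 1 0 q = s ==> d 1 1 q = s ==> R q \<in> W 1 \<and> S.tri q g (R q)) ==> M (\<lambda>q. f (R q)) = M f"
  using wmean[OF sV] by blast
 have ne: "\<exists>c. c \<in> orb s z" if "z \<in> ?L" for z
  using orb_nonempty[OF x] that by auto
 define r where "r z = K.rep 1 (ch s z)" for z
 have par: "K.par 1 h x" if "h \<in> kl s" for h
 proof -
  have "d 1 i h = d 1 i x" if "i \<le> 1" for i
  proof -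
   have "i = 0 \<or> i = 1"
    using that by linarith
   then show ?thesis
    using \<open>h \<in> kl s\<close> xk by (auto simp: kl_def)
  qed
  then show ?thesis
   using that xk unfolding K.par_def kl_def by blast
 qed
 have r: "r z \<in> K.reps 1 x" if "z \<in> ?L" for z
  unfolding r_def by (rule K.repsI[OF par[OF ch(1)[OF ne[OF that]]]])
 have mean: "mean (K.reps 1 x) (\<lambda>f. M (\<lambda>z. f (r z)))"
  by (rule mean_map[OF M(1) r])
 have inv: "M (\<lambda>z. f (h (r z))) = M (\<lambda>z. f (r z))" if h: "h \<in> K.Lf 1 x 1" and f: "bfun f" for h f
 proof -
  obtain g where g: "g \<in> kl s" "\<And>z. z \<in> K.reps 1 x ==> K.tri z g (h z)"
   using Lf_act[OF h xk] by blast
  \<comment> \<open>The loop \<open>g\<close> belongs to the saturation only; a homotopic loop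
    \<open>q\<close> of \<open>V\<close> can be multiplied with loops inside
    \<open>W\<close>.\<close>
  obtain q where q: "q \<in> V 1" "d 1 0 q = s" "d 1 1 q = s" "S.hom 1 g q"
   using V_loop[OF g(1)] .
  have qW: "q \<in> W 1"
   using q(1) VW by blast
  define R where "R z = (SOME c. W.tri z q c)" for z
  have R: "W.tri z q (R z)" if "z \<in> ?L" for z
   unfolding R_def by (rule someI_ex[OF W.tri_ab]) (use that q qW in auto)
  have RL: "R z \<in> ?L" if "z \<in> ?L" for z
   using W.tri_edges[OF R[OF that]] that q by auto
  have eq: "r (R z) = h (r z)" if z: "z \<in> ?L" for z
  proof -
   have "S.tri z g (R z)"
    by (rule S.tri_hom_b[OF tri_W[OF R[OF z]] S.hom_sym[OF q(4)]])
   then have "K.tri (ch s z) g (ch s (R z))"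
    by (rule ch_act[OF g(1) _ ne[OF z]])
   moreover have "K.hom 1 (ch s z) (r z)" "K.hom 1 (ch s (R z)) (r (R z))"
    unfolding r_def using ch(1)[OF ne[OF z]] ch(1)[OF ne[OF RL[OF z]]] by (auto simp: kl_def intro!: K.hom_rep)
   ultimately have "K.tri (r z) g (r (R z))"
    using K.tri_hom_a K.tri_hom_c by blast
   then have "K.hom 1 (r (R z)) (h (r z))"
    by (rule K.tri_unique_c[OF _ g(2)[OF r[OF z]]])
   then show ?thesis
    by (rule K.reps_eq[OF r[OF RL[OF z]] K.Lf_closed[OF h r[OF z]]]) simp
  qed
  have "M (\<lambda>z. f (h (r z))) = M (\<lambda>z. f (r (R z)))"
   by (rule mean_cong[OF M(1) bfun_compose[OF f, of "\<lambda>z. h (r z)"] bfun_compose[OF f, of "\<lambda>z. r (R z)"]]) (simp add: eq)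
  also have "\<dots> = M (\<lambda>z. f (r z))"
  proof (rule M(2)[OF qW q(2,3), of "\<lambda>z. f (r z)" R])
   show "bfun (\<lambda>z. f (r z))"
    using bfun_compose[OF f] .
   show "f (r a) = f (r b)" if "S.hom 1 a b" for a b
    unfolding r_def ch_hom[OF that] ..
   show "R a \<in> W 1 \<and> S.tri a q (R a)" if "a \<in> W 1" "d 1 0 a = s" "d 1 1 a = s" for a
    using RL[of a] tri_W[OF R[of a]] that by auto
  qed
  finally show ?thesis .
 qed
 show "\<exists>x\<in>KV 1. d 1 1 x = s \<and> (\<exists>M. mean (K.reps 1 x) M \<and> (\<forall>h\<in>K.Lf 1 x 1. \<forall>g. bfun g --> M (\<lambda>z. g (h z)) = M g))"
  using xk mean inv unfolding kl_def by (intro bexI[of _ x]) auto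
qed (use base_edge base_const in auto)

end

section \<open>Singular simplices and loops\<close>

text \<open>Deletes the coordinate \<open>i\<close>; inverse to \<open>simplical_face i\<close> on
  the points where this coordinate vanishes.\<close>

definition unface :: "nat => (nat => real) => nat => real" where
 "unface i x = (\<lambda>k. if k < i then x k else x (Suc k))"

lemma face_unface: "x i = 0 ==> simplical_face i (unface i x) = x"
 by (auto simp: simplical_face_def unface_def fun_eq_iff)

lemma unface_face: "unface i (simplical_face i x) = x"
 by (auto simp: simplical_face_def unface_def fun_eq_iff)

lemma standard_simplexI:
 assumes "\<And>k. 0 \<le> x k" "\<And>k. p < k ==> x k = 0" "(\<Sum>k\<le>p. x k) = 1"
 shows "x \<in> standard_simplex p"
proof -
 have "x k \<le> 1" for k
 proof (cases "k \<le> p")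
  case True
  then have "x k \<le> (\<Sum>k\<le>p. x k)"
   using assms(1) by (intro member_le_sum) auto
  then show ?thesis
   using assms(3) by simp
 qed (use assms(2) in auto)
 then show ?thesis
  using assms by (simp add: standard_simplex_def)
qed

lemma unface_in:
 assumes x: "x \<in> standard_simplex (Suc p)" and i: "i \<le> Suc p" "x i = 0"
 shows "unface i x \<in> standard_simplex p"
proof (rule standard_simplexI)
 show "0 \<le> unface i x k" for k
  using x by (simp add: unface_def standard_simplex_def)
 show "unface i x k = 0" if "p < k" for k
  using x i that by (simp add: unface_def standard_simplex_def)
 have "bij_betw (\<lambda>k. if k < i then k else Suc k) {..p} ({..Suc p} - {i})"
  by (rule bij_betw_byWitness[where f' = "\<lambda>k. if k < i then k else k - 1"]) (use i in auto)
 then have "(\<Sum>k\<le>p. x (if k < i then k else Suc k)) = sum x ({..Suc p} - {i})"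
  by (rule sum.reindex_bij_betw)
 also have "\<dots> = sum x {..Suc p}"
  using i by (simp add: sum_diff1 del: sum.atMost_Suc)
 also have "\<dots> = 1"
  using x by (simp add: standard_simplex_def del: sum.atMost_Suc)
 finally show "(\<Sum>k\<le>p. unface i x k) = 1"
  by (simp add: unface_def if_distrib)
qed

lemma face_comm: "i < k ==> simplical_face k (simplical_face i x) = simplical_face i (simplical_face (k - 1) x)"
 by (auto simp: simplical_face_def fun_eq_iff)

lemma face_in_simplex: "k \<le> Suc p ==> x \<in> standard_simplex p ==> simplical_face k x \<in> standard_simplex (Suc p)"
 using simplical_face_in_standard_simplex[of "Suc p" k x] by simp

lemma singular_face_comm:
 assumes "i < k" "k \<le> Suc (Suc p)"
 shows "singular_face (Suc p) i (singular_face (Suc (Suc p)) k s) = singular_face (Suc p) (k - 1) (singular_face (Suc (Suc p)) i s)"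
proof
 fix x
 show "singular_face (Suc p) i (singular_face (Suc (Suc p)) k s) x = singular_face (Suc p) (k - 1) (singular_face (Suc (Suc p)) i s) x"
 proof (cases "x \<in> standard_simplex p")
  case True
  have "simplical_face i x \<in> standard_simplex (Suc p)" "simplical_face (k - 1) x \<in> standard_simplex (Suc p)"
   using True assms by (auto intro!: face_in_simplex)
  then show ?thesis
   using True face_comm[OF assms(1), of x] by (simp add: singular_face_def)
 qed (simp add: singular_face_def)
qed

abbreviation Sing :: "'a topology => nat => ((nat => real) => 'a) set" where
 "Sing X n \<equiv> singular_simplex_set n X"

abbreviation Dt :: "nat => (nat => real) topology" where
 "Dt n \<equiv> subtopology (powertop_real UNIV) (standard_simplex n)"

lemma coord_cont: "continuous_map (powertop_real UNIV) euclideanreal (\<lambda>x. x k)"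
 by (rule continuous_map_product_projection) simp

text \<open>What is taken away from the \<open>N\<close> coordinates other than \<open>j\<close> is
  handed to the coordinate \<open>j\<close>, so the sum remains 1; minimality of \<open>x i\<close>
  keeps the coordinates nonnegative.\<close>

lemma horn_rho_in:
 assumes x: "x \<in> standard_simplex N" and j: "j \<le> N" and i: "i \<le> N" "i \<noteq> j"
  and min: "\<And>k. k \<le> N ==> k \<noteq> j ==> x i \<le> x k"
 shows "(\<lambda>k. if N < k then 0 else if k = j then x j + real N * x i else x k - x i) \<in> standard_simplex N"
proof (rule standard_simplexI)
 have x0: "0 \<le> x k" for k
  using x by (simp add: standard_simplex_def)
 show "0 \<le> (if N < k then 0 else if k = j then x j + real N * x i else x k - x i)" for k
  using min[of k] x0[of j] x0[of i] by auto
 have "(\<Sum>k\<le>N. if N < k then 0 else if k = j then x j + real N * x i else x k - x i)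
  = (x j + real N * x i) + (\<Sum>k\<in>{..N} - {j}. x k - x i)"
  using j by (subst sum.remove[of _ j]) (auto intro!: sum.cong)
 also have "(\<Sum>k\<in>{..N} - {j}. x k - x i) = (\<Sum>k\<in>{..N} - {j}. x k) - real N * x i"
  using j by (simp add: sum_subtractf)
 also have "(\<Sum>k\<in>{..N} - {j}. x k) = (\<Sum>k\<le>N. x k) - x j"
  using j by (simp add: sum_diff1)
 also have "(\<Sum>k\<le>N. x k) = 1"
  using x by (simp add: standard_simplex_def)
 finally show "(\<Sum>k\<le>N. if N < k then 0 else if k = j then x j + real N * x i else x k - x i) = 1"
  by simp
qed simp

text \<open>On the region \<open>T i\<close> where the coordinate \<open>i\<close> is minimal, subtracting that coordinate retracts the simplex
 onto the \<open>i\<close>-th face of the horn.\<close>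

lemma Sing_horn:
 assumes j: "j \<le> Suc (Suc p)"
  and y: "\<And>i. i \<le> Suc (Suc p) ==> i \<noteq> j ==> singular_simplex (Suc p) X (y i)"
  and c: "\<And>i k. i < k ==> k \<le> Suc (Suc p) ==> i \<noteq> j ==> k \<noteq> j ==>
     singular_face (Suc p) i (y k) = singular_face (Suc p) (k - 1) (y i)"
 shows "\<exists>t. singular_simplex (Suc (Suc p)) X t \<and> (\<forall>i\<le>Suc (Suc p). i \<noteq> j --> singular_face (Suc (Suc p)) i t = y i)"
proof -
 define N where "N = Suc (Suc p)"
 define A where "A = {..N} - {j}"
 define T where "T i = {x \<in> standard_simplex N. \<forall>k\<in>A. x i \<le> x k}" for i
 define rho where "rho i x = (\<lambda>k. if N < k then 0 else if k = j then x j + real N * x i else x k - x i)" for i and x :: "nat => real"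
 define f where "f i x = y i (unface i (rho i x))" for i x
 have A: "finite A" "A \<noteq> {}"
 proof -
  show "A \<noteq> {}"
   by (cases "j = 0") (auto simp: A_def N_def)
 qed (simp add: A_def)
 have rin: "rho i x \<in> standard_simplex N" "rho i x i = 0" if "i \<in> A" "x \<in> T i" for i x
 proof -
  show "rho i x \<in> standard_simplex N"
   unfolding rho_def by (rule horn_rho_in) (use that j in \<open>auto simp: A_def T_def N_def\<close>)
  show "rho i x i = 0"
   using that by (auto simp: rho_def A_def)
 qed
 have top: "topspace (Dt N) = standard_simplex N"
  by simp
 obtain g where g: "continuous_map (Dt N) X g" "\<And>x i. i \<in> A ==> x \<in> topspace (Dt N) \<inter> T i ==> g x = f i x"
 proof (rule pasting_lemma_exists_closed[of A "Dt N" T X f])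
  show "finite A"
   by (rule A)
  show "topspace (Dt N) \<subseteq> \<Union> (T ` A)"
  proof
   fix x assume "x \<in> topspace (Dt N)"
   then have x: "x \<in> standard_simplex N"
    by simp
   have "arg_min_on x A \<in> A" "\<And>k. k \<in> A ==> x (arg_min_on x A) \<le> x k"
    using arg_min_if_finite[OF A, of x] by (auto simp: not_less)
   then show "x \<in> \<Union> (T ` A)"
    using x by (auto simp: T_def)
  qed
  show "closedin (Dt N) (T i)" if "i \<in> A" for i
  proof -
   have "T i = (\<Inter>k\<in>A. {x \<in> topspace (Dt N). x k - x i \<in> {0..}})"
    using A(2) by (auto simp: T_def)
   moreover have "closedin (Dt N) {x \<in> topspace (Dt N). x k - x i \<in> {0..}}" for k
   proof (rule closedin_continuous_map_preimage)
    show "continuous_map (Dt N) euclideanreal (\<lambda>x. x k - x i)"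
     by (intro continuous_map_from_subtopology continuous_map_diff coord_cont)
   qed auto
   ultimately show ?thesis
    using A(2) by (simp only:) (intro closedin_INT, auto)
  qed
  show "continuous_map (subtopology (Dt N) (T i)) X (f i)" if i: "i \<in> A" for i
  proof -
   have "continuous_map (subtopology (Dt N) (T i)) (Dt (Suc p)) (\<lambda>x. unface i (rho i x))"
    unfolding continuous_map_in_subtopology continuous_map_componentwise_UNIV
   proof (intro conjI allI)
    fix k
    have "continuous_map (powertop_real UNIV) euclideanreal (\<lambda>x. unface i (rho i x) k)"
     unfolding unface_def rho_def
     by (auto intro!: continuous_map_diff continuous_map_add continuous_map_real_mult coord_cont)
    then show "continuous_map (subtopology (Dt N) (T i)) euclideanreal (\<lambda>x. unface i (rho i x) k)"
     by (intro continuous_map_from_subtopology)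
   next
    show "(\<lambda>x. unface i (rho i x)) \<in> topspace (subtopology (Dt N) (T i)) \<rightarrow> standard_simplex (Suc p)"
    proof
     fix x assume "x \<in> topspace (subtopology (Dt N) (T i))"
     then have "x \<in> T i"
      by simp
     then show "unface i (rho i x) \<in> standard_simplex (Suc p)"
      using rin[OF i] i by (intro unface_in) (auto simp: N_def A_def)
    qed
   qed
   moreover have "continuous_map (Dt (Suc p)) X (y i)"
    using y[of i] i by (auto simp: singular_simplex_def A_def N_def)
   ultimately have "continuous_map (subtopology (Dt N) (T i)) X (y i \<circ> (\<lambda>x. unface i (rho i x)))"
    by (rule continuous_map_compose)
   then show ?thesis
    by (simp add: f_def[abs_def] o_def)
  qed
  \<comment> \<open>On an overlap the two minimal coordinates are equal, so both retractions lead to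
    the same point; it lies in the intersection of the faces \<open>i\<close> and \<open>k\<close>,
    where the horn is compatible.\<close>
  have ov: "f i x = f k x" if ik: "i < k" "i \<in> A" "k \<in> A" "x \<in> T i" "x \<in> T k" for i k x
  proof -
   have xik: "x k = x i"
    using ik by (auto simp: T_def intro!: antisym)
   then have rho: "rho k x = rho i x"
    unfolding rho_def by (intro ext) simp
   define z where "z = rho i x"
   have z: "z \<in> standard_simplex N" "z i = 0" "z k = 0"
    using rin[OF ik(2,4)] rin[OF ik(3,5)] rho by (auto simp: z_def)
   let ?w = "unface i (unface k z)"
   have kz: "unface k z \<in> standard_simplex (Suc p)"
    using z ik by (intro unface_in) (auto simp: N_def A_def)
   have w: "?w \<in> standard_simplex p"
    using kz ik z by (intro unface_in) (auto simp: N_def A_def unface_def)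
   have 1: "simplical_face i ?w = unface k z"
    using z ik by (intro face_unface) (auto simp: unface_def)
   have w2: "?w = unface (k - 1) (unface i z)"
    using ik(1) by (auto simp: unface_def fun_eq_iff)
   have 2: "simplical_face (k - 1) ?w = unface i z"
    unfolding w2 using z ik by (intro face_unface) (auto simp: unface_def)
   have "singular_face (Suc p) i (y k) ?w = singular_face (Suc p) (k - 1) (y i) ?w"
    using c[of i k] ik by (auto simp: A_def N_def)
   then have "y k (unface k z) = y i (unface i z)"
    using w 1 2 by (simp add: singular_face_def)
   then show ?thesis
    using rho by (simp add: f_def z_def)
  qed
  show "f i x = f k x" if "i \<in> A" "k \<in> A" "x \<in> topspace (Dt N) \<inter> T i \<inter> T k" for i k x
  proof (cases i k rule: linorder_cases)
   case less
   show ?thesis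
    by (rule ov[OF less]) (use that in blast)+
  next
   case greater
   show ?thesis
    by (rule ov[OF greater, symmetric]) (use that in blast)+
  qed simp
  fix g assume "continuous_map (Dt N) X g" "\<And>x i. i \<in> A ==> x \<in> topspace (Dt N) \<inter> T i ==> g x = f i x"
  then show thesis
   by (rule that)
 qed
 let ?t = "restrict g (standard_simplex N)"
 have "singular_simplex N X ?t"
  using continuous_map_eq[OF g(1), of ?t] by (auto simp: singular_simplex_def)
 moreover have "singular_face N i ?t = y i" if i: "i \<le> N" "i \<noteq> j" for i
 proof
  fix x
  have ext: "y i \<in> extensional (standard_simplex (Suc p))"
   using y[of i] i by (auto simp: singular_simplex_def N_def)
  have iA: "i \<in> A"
   using i by (simp add: A_def)
  show "singular_face N i ?t x = y i x"
  proof (cases "x \<in> standard_simplex (Suc p)")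
   case True
   let ?z = "simplical_face i x"
   have z: "?z \<in> standard_simplex N"
    using face_in_simplex[OF _ True, of i] i by (simp add: N_def)
   have z0: "?z i = 0"
    by (simp add: simplical_face_def)
   have zT: "?z \<in> T i"
    using z z0 by (auto simp: T_def standard_simplex_def)
   have "rho i ?z = ?z"
    using z z0 by (auto simp: rho_def standard_simplex_def fun_eq_iff)
   then have "g ?z = y i x"
    using g(2)[OF iA, of ?z] z zT by (simp add: f_def unface_face)
   then show ?thesis
    using True z by (simp add: singular_face_def N_def)
  next
   case False
   then show ?thesis
    using ext by (simp add: singular_face_def N_def extensional_def)
  qed
 qed
 ultimately show ?thesis
  unfolding N_def by blast
qed

lemma kan_Sing: "kan (Sing X) singular_face"
proof
 show "singular_face (Suc p) k x \<in> Sing X p" if "x \<in> Sing X (Suc p)" "k \<le> Suc p" for p k x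
  using singular_simplex_singular_face[of "Suc p" X x k] that by simp
 show "singular_face (Suc p) i (singular_face (Suc (Suc p)) k x) = singular_face (Suc p) (k - 1) (singular_face (Suc (Suc p)) i x)"
  if "i < k" "k \<le> Suc (Suc p)" for p i k x
  by (rule singular_face_comm[OF that])
 show "\<exists>t\<in>Sing X (Suc (Suc p)). \<forall>i\<le>Suc (Suc p). i \<noteq> j --> singular_face (Suc (Suc p)) i t = x i"
  if "j \<le> Suc (Suc p)" "\<And>i. i \<le> Suc (Suc p) ==> i \<noteq> j ==> x i \<in> Sing X (Suc p)"
   "\<And>i k. i < k ==> k \<le> Suc (Suc p) ==> i \<noteq> j ==> k \<noteq> j ==> singular_face (Suc p) i (x k) = singular_face (Suc p) (k - 1) (x i)"
  for p j x
  using Sing_horn[of j p X x] that by auto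
qed

section \<open>Paths and loops as edges\<close>

definition pt :: "real => nat => real" where
 "pt \<tau> = (\<lambda>k. if k = 0 then 1 - \<tau> else if k = 1 then \<tau> else 0)"

text \<open>The edge runs from \<open>p 0\<close> to \<open>p 1\<close>; accordingly its face 1 is
  the start and its face 0 the end.\<close>

definition ed :: "(real => 'a) => (nat => real) => 'a" where
 "ed p = restrict (\<lambda>x. p (x 1)) (standard_simplex 1)"

definition vx :: "'a => (nat => real) => 'a" where
 "vx a = restrict (\<lambda>x. a) (standard_simplex 0)"

abbreviation II :: "real topology" where
 "II \<equiv> top_of_set {0..1}"

lemma pt_in: "\<tau> \<in> {0..1} ==> pt \<tau> \<in> standard_simplex 1"
 by (auto simp: pt_def standard_simplex_def)

lemma pt_eq: "x \<in> standard_simplex 1 ==> pt (x 1) = x"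
 by (auto simp: pt_def standard_simplex_def fun_eq_iff)

lemma simplex_coord: "x \<in> standard_simplex n ==> x k \<in> {0..1}"
 by (auto simp: standard_simplex_def)

lemma coord_II: "continuous_map (Dt n) II (\<lambda>x. x k)"
 unfolding continuous_map_in_subtopology
 using simplex_coord[of _ n k]
 by (auto simp del: atLeastAtMost_iff intro!: continuous_map_from_subtopology coord_cont)

lemma ed_in:
 assumes "continuous_map II Y p"
 shows "singular_simplex 1 Y (ed p)"
proof -
 have "continuous_map (Dt 1) Y (p \<circ> (\<lambda>x. x 1))"
  by (rule continuous_map_compose[OF coord_II assms])
 then have "continuous_map (Dt 1) Y (ed p)"
  by (rule continuous_map_eq) (simp add: ed_def)
 then show ?thesis
  by (simp add: singular_simplex_def ed_def)
qed

lemma path_cont: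
 assumes "singular_simplex 1 Y e"
 shows "continuous_map II Y (\<lambda>\<tau>. e (pt \<tau>))"
proof -
 have "continuous_map II (Dt 1) pt"
  unfolding continuous_map_in_subtopology continuous_map_componentwise_UNIV
 proof (intro conjI allI)
  show "continuous_map II euclideanreal (\<lambda>\<tau>. pt \<tau> k)" for k
   unfolding pt_def by (cases "k = 0"; cases "k = 1") (auto intro!: continuous_intros)
 qed (use pt_in in auto)
 then have "continuous_map II Y (e \<circ> pt)"
  by (rule continuous_map_compose) (use assms in \<open>simp add: singular_simplex_def\<close>)
 then show ?thesis
  by (simp add: o_def)
qed

lemma ed_path: "singular_simplex 1 Y e ==> ed (\<lambda>\<tau>. e (pt \<tau>)) = e"
proof
 fix x assume "singular_simplex 1 Y e"
 then show "ed (\<lambda>\<tau>. e (pt \<tau>)) x = e x"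
  using pt_eq[of x] by (cases "x \<in> standard_simplex 1") (auto simp: ed_def singular_simplex_def extensional_def)
qed

lemma path_ed: "\<tau> \<in> {0..1} ==> ed p (pt \<tau>) = p \<tau>"
 using pt_in[of \<tau>] by (simp add: ed_def) (simp add: pt_def)

lemma ed_cong: "(\<And>\<tau>. \<tau> \<in> {0..1} ==> p \<tau> = q \<tau>) ==> ed p = ed q"
 unfolding ed_def by (rule restrict_ext) (use simplex_coord in blast)

lemma simplex_0: "x \<in> standard_simplex 0 ==> x = (\<lambda>j. if j = 0 then 1 else 0)"
 by (simp add: standard_simplex_0)

lemma face_ed: "singular_face 1 0 (ed p) = vx (p 1)" "singular_face 1 1 (ed p) = vx (p 0)"
proof -
 have "ed p (simplical_face k x) = p (if k = 0 then 1 else 0)" if "x \<in> standard_simplex 0" "k \<le> 1" for k x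
 proof -
  have "simplical_face k x \<in> standard_simplex 1"
   using face_in_simplex[of k 0 x] that by simp
  moreover have "simplical_face k x 1 = (if k = 0 then 1 else 0)"
   using simplex_0[OF that(1)] that(2) by (auto simp: simplical_face_def)
  ultimately show ?thesis
   by (simp add: ed_def)
 qed
 then show "singular_face 1 0 (ed p) = vx (p 1)" "singular_face 1 1 (ed p) = vx (p 0)"
  by (auto simp: singular_face_def vx_def fun_eq_iff)
qed

lemma vx_inj: "vx a = vx b \<longleftrightarrow> a = b"
proof
 assume "vx a = vx b"
 then have "vx a (\<lambda>j. if j = 0 then 1 else 0) = vx b (\<lambda>j. if j = 0 then 1 else 0)"
  by simp
 then show "a = b"
  by (simp add: vx_def standard_simplex_0)
qed simp

lemma vertex_vx:
 assumes "singular_simplex 0 Y s"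
 obtains a where "a \<in> topspace Y" "s = vx a"
proof -
 let ?v = "\<lambda>j. if j = 0 then 1 else 0 :: real"
 have "s = vx (s ?v)"
 proof
  fix x
  show "s x = vx (s ?v) x"
   using assms simplex_0[of x] by (cases "x \<in> standard_simplex 0") (auto simp: vx_def singular_simplex_def extensional_def)
 qed
 moreover have "s ?v \<in> topspace Y"
  using assms continuous_map_image_subset_topspace[of "Dt 0" Y s] by (auto simp: singular_simplex_def standard_simplex_0)
 ultimately show thesis
  using that by blast
qed

lemma const_edge:
 assumes "singular_simplex 0 Y s"
 shows "\<exists>e\<in>Sing Y 1. singular_face 1 0 e = s \<and> singular_face 1 1 e = s"
proof -
 obtain a where a: "a \<in> topspace Y" "s = vx a"
  using vertex_vx[OF assms] .
 have "singular_simplex 1 Y (ed (\<lambda>_. a))"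
  by (rule ed_in) (use a in auto)
 then show ?thesis
  using face_ed[of "\<lambda>_. a"] a(2) by blast
qed

lemma edge_loop:
 assumes e: "singular_simplex 1 Y e" and s: "singular_face 1 0 e = vx a" "singular_face 1 1 e = vx a"
 shows "(\<lambda>\<tau>. e (pt \<tau>)) \<in> loops Y a"
proof -
 have "vx (e (pt 1)) = vx a" "vx (e (pt 0)) = vx a"
  using face_ed[of "\<lambda>\<tau>. e (pt \<tau>)"] s unfolding ed_path[OF e] by auto
 then show ?thesis
  using path_cont[OF e] unfolding loops_def vx_inj by blast
qed

lemma loop_edge:
 assumes "p \<in> loops Y a"
 shows "singular_simplex 1 Y (ed p)" "singular_face 1 0 (ed p) = vx a" "singular_face 1 1 (ed p) = vx a"
 using assms ed_in[of Y p] face_ed[of p] by (auto simp: loops_def)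

lemma face_2: "singular_face 2 k (restrict F (standard_simplex 2)) = ed (\<lambda>\<tau>. F (simplical_face k (pt \<tau>)))" if "k \<le> 2"
proof
 fix x
 show "singular_face 2 k (restrict F (standard_simplex 2)) x = ed (\<lambda>\<tau>. F (simplical_face k (pt \<tau>))) x"
 proof (cases "x \<in> standard_simplex 1")
  case True
  then have "simplical_face k x \<in> standard_simplex 2"
   using face_in_simplex[of k 1 x] that by (simp add: numeral_2_eq_2)
  then show ?thesis
   using True pt_eq[OF True] by (simp add: singular_face_def ed_def)
 qed (simp add: singular_face_def ed_def)
qed

lemma tri_map:
 assumes "continuous_map (Dt 2) X F"
 shows "kan.tri (Sing X) singular_face (ed (\<lambda>\<tau>. F (simplical_face 2 (pt \<tau>)))) (ed (\<lambda>\<tau>. F (simplical_face 0 (pt \<tau>))))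
  (ed (\<lambda>\<tau>. F (simplical_face 1 (pt \<tau>))))"
proof -
 let ?t = "restrict F (standard_simplex 2)"
 have "singular_simplex 2 X ?t"
  using continuous_map_eq[OF assms, of ?t] by (auto simp: singular_simplex_def)
 then show ?thesis
  unfolding kan.tri_def[OF kan_Sing]
  by (intro bexI[of _ ?t] conjI face_2) simp_all
qed

lemma tri_maps:
 assumes F: "continuous_map (Dt 2) X F"
  and abc: "\<And>\<tau>. \<tau> \<in> {0..1} ==> F (simplical_face 2 (pt \<tau>)) = a \<tau>"
   "\<And>\<tau>. \<tau> \<in> {0..1} ==> F (simplical_face 0 (pt \<tau>)) = b \<tau>"
   "\<And>\<tau>. \<tau> \<in> {0..1} ==> F (simplical_face 1 (pt \<tau>)) = c \<tau>"
 shows "kan.tri (Sing X) singular_face (ed a) (ed b) (ed c)"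
proof -
 have "ed (\<lambda>\<tau>. F (simplical_face 2 (pt \<tau>))) = ed a" "ed (\<lambda>\<tau>. F (simplical_face 0 (pt \<tau>))) = ed b"
  "ed (\<lambda>\<tau>. F (simplical_face 1 (pt \<tau>))) = ed c"
  using abc by (auto intro!: ed_cong)
 then show ?thesis
  using tri_map[OF F] by simp
qed

lemma sum_coord_II: "continuous_map (Dt 2) II (\<lambda>x. x 1 + x 2)"
proof -
 have "x 1 + x 2 \<in> {0..1}" if "x \<in> standard_simplex 2" for x :: "nat => real"
 proof -
  have "(\<Sum>k\<le>2. x k) = x 0 + x 1 + x 2"
   by (simp add: numeral_2_eq_2)
  moreover have "0 \<le> x 0" "0 \<le> x 1" "0 \<le> x 2" "(\<Sum>k\<le>2. x k) = 1"
   using that by (simp_all add: standard_simplex_def)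
  ultimately show ?thesis
   by simp
 qed
 then show ?thesis
  unfolding continuous_map_in_subtopology
  by (auto simp del: atLeastAtMost_iff intro!: continuous_map_from_subtopology continuous_map_add coord_cont)
qed

text \<open>The square of the homotopy is cut along its diagonal \<open>e\<close>.\<close>

lemma hom_of_loop_homotopic:
 assumes "loop_homotopic X x0 p p'"
 shows "kan.hom (Sing X) singular_face 1 (ed p) (ed p')"
proof -
 interpret S: kan "Sing X" singular_face
  by (rule kan_Sing)
 obtain h where h: "continuous_map (prod_topology II II) X h" "\<And>x. h (0, x) = p x" "\<And>x. h (1, x) = p' x"
  "\<And>t. t \<in> {0..1} ==> h (t, 0) = x0 \<and> h (t, 1) = x0"
  using assms unfolding loop_homotopic_def homotopic_with_def by auto
 have pc: "continuous_map II X p" "continuous_map II X p'"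
  using homotopic_with_imp_continuous_maps[OF assms[unfolded loop_homotopic_def]] by auto
 have p0: "p 0 = x0" "p 1 = x0" "p' 0 = x0" "p' 1 = x0"
  using h(2)[of 0] h(2)[of 1] h(3)[of 0] h(3)[of 1] h(4)[of 0] h(4)[of 1] by auto
 define c where "c = ed (\<lambda>_::real. x0)"
 define e where "e = ed (\<lambda>\<tau>. h (\<tau>, \<tau>))"
 have hc: "continuous_map (Dt 2) X (\<lambda>x. h (f x, g x))" if "continuous_map (Dt 2) II f" "continuous_map (Dt 2) II g" for f g
  using continuous_map_compose[OF continuous_map_pairedI[OF that] h(1)] by (simp add: o_def)
 \<comment> \<open>With the constant loop \<open>c\<close>, the four triangles read p c = e, p c =
   p, c p' = e and c p' = p'. Uniqueness of products up to homotopy then links p to e and e to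
   p'.\<close>
 have t1: "S.tri (ed p) c e"
  unfolding c_def e_def
  by (rule tri_maps[OF hc[OF coord_II[of 2 2] sum_coord_II]]) (use h in \<open>auto simp: simplical_face_def pt_def\<close>)
 have t2: "S.tri (ed p) c (ed p)"
  unfolding c_def
  by (rule tri_maps[OF continuous_map_compose[OF sum_coord_II pc(1)]]) (use p0 in \<open>auto simp: simplical_face_def pt_def\<close>)
 have t3: "S.tri c (ed p') e"
  unfolding c_def e_def
  by (rule tri_maps[OF hc[OF sum_coord_II coord_II[of 2 2]]]) (use h in \<open>auto simp: simplical_face_def pt_def\<close>)
 have t4: "S.tri c (ed p') (ed p')"
  unfolding c_def
  by (rule tri_maps[OF continuous_map_compose[OF coord_II[of 2 2] pc(2)]]) (use p0 in \<open>auto simp: simplical_face_def pt_def\<close>)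
 show ?thesis
  using S.hom_trans[OF S.tri_unique_c[OF t2 t1] S.tri_unique_c[OF t3 t4]] by simp
qed

text \<open>The triangle is convex: the path along its first two edges is moved along straight lines
  to the third edge.\<close>

lemma loop_homotopic_of_tri:
 assumes t: "kan.tri (Sing X) singular_face a b c"
  and s: "singular_face 1 0 a = vx x0" "singular_face 1 1 a = vx x0" "singular_face 1 0 b = vx x0"
 shows "loop_homotopic X x0 (loop_concat (\<lambda>\<tau>. a (pt \<tau>)) (\<lambda>\<tau>. b (pt \<tau>))) (\<lambda>\<tau>. c (pt \<tau>))"
proof -
 interpret S: kan "Sing X" singular_face
  by (rule kan_Sing)
 obtain F where F: "singular_simplex 2 X F" "singular_face 2 2 F = a" "singular_face 2 0 F = b" "singular_face 2 1 F = c"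
  using t unfolding S.tri_def by auto
 note E = S.tri_edges[OF t]
 have Fc: "continuous_map (Dt 2) X F"
  using F(1) by (simp add: singular_simplex_def)
 \<comment> \<open>In barycentric coordinates, the first bracket runs through the edges 01 and 12 at
   double speed, the second one through the edge 02; \<open>fst z\<close> interpolates between
   them.\<close>
 define ga :: "real \<times> real => nat => real" where
  "ga z = (\<lambda>k. (1 - fst z) * (if k = 0 then max 0 (1 - 2 * snd z) else if k = 1 then 1 - \<bar>1 - 2 * snd z\<bar> else if k = 2 then max 0 (2 * snd z - 1) else 0)
    + fst z * (if k = 0 then 1 - snd z else if k = 2 then snd z else 0))" for z
 have face: "F (simplical_face k (pt \<tau>)) = singular_face 2 k F (pt \<tau>)" if "\<tau> \<in> {0..1}" for k \<tau>
  using pt_in[OF that] by (simp add: singular_face_def)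
 have gin: "ga z \<in> standard_simplex 2" if "z \<in> {0..1} \<times> {0..1}" for z
 proof (rule standard_simplexI)
  have z: "0 \<le> fst z" "fst z \<le> 1" "0 \<le> snd z" "snd z \<le> 1"
   using that by auto
  have "\<bar>1 - 2 * snd z\<bar> \<le> 1"
   using z by auto
  then show "0 \<le> ga z k" for k
   using z by (auto simp: ga_def)
  have "max 0 (1 - 2 * snd z) + (1 - \<bar>1 - 2 * snd z\<bar>) + max 0 (2 * snd z - 1) = 1"
   by (auto simp: max_def abs_if)
  then have "(1 - fst z) * (max 0 (1 - 2 * snd z) + (1 - \<bar>1 - 2 * snd z\<bar>) + max 0 (2 * snd z - 1)) = 1 - fst z"
   by simp
  then show "(\<Sum>k\<le>2. ga z k) = 1"
   by (simp add: ga_def numeral_2_eq_2 algebra_simps)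
 qed (auto simp: ga_def)
 have "continuous_map (prod_topology II II) (Dt 2) ga"
  unfolding continuous_map_in_subtopology continuous_map_componentwise_UNIV
 proof (intro conjI allI)
  have f: "continuous_map (prod_topology II II) euclideanreal fst" "continuous_map (prod_topology II II) euclideanreal snd"
   using continuous_map_fst[of II II] continuous_map_snd[of II II] unfolding continuous_map_in_subtopology by blast+
  show "continuous_map (prod_topology II II) euclideanreal (\<lambda>z. ga z k)" for k
   unfolding ga_def
   by (cases "k = 0"; cases "k = 1"; cases "k = 2"; (simp only: if_True if_False)?)
    (auto intro!: continuous_map_diff continuous_map_add continuous_map_real_mult continuous_map_real_max continuous_map_real_abs f continuous_intros)
 qed (use gin in auto)
 then have cont: "continuous_map (prod_topology II II) X (F \<circ> ga)"
  by (rule continuous_map_compose[OF _ Fc])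
 show ?thesis
  unfolding loop_homotopic_def
 proof (subst homotopic_with, simp, intro exI conjI ballI)
  show "continuous_map (prod_topology II II) X (F \<circ> ga)"
   by (rule cont)
  fix \<tau> :: real assume "\<tau> \<in> topspace II"
  then have tau: "\<tau> \<in> {0..1}"
   by simp
  show "(F \<circ> ga) (0, \<tau>) = loop_concat (\<lambda>\<tau>. a (pt \<tau>)) (\<lambda>\<tau>. b (pt \<tau>)) \<tau>"
  proof (cases "\<tau> \<le> 1 / 2")
   case True
   have "ga (0, \<tau>) = simplical_face 2 (pt (2 * \<tau>))"
    using True tau by (auto simp: ga_def simplical_face_def pt_def fun_eq_iff)
   then show ?thesis
    using True tau face[of "2 * \<tau>" 2] F(2) by (simp add: loop_concat_def)
  next
   case False
   have "ga (0, \<tau>) = simplical_face 0 (pt (2 * \<tau> - 1))"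
    using False tau by (auto simp: ga_def simplical_face_def pt_def fun_eq_iff)
   then show ?thesis
    using False tau face[of "2 * \<tau> - 1" 0] F(3) by (simp add: loop_concat_def)
  qed
  have "ga (1, \<tau>) = simplical_face 1 (pt \<tau>)"
   by (auto simp: ga_def simplical_face_def pt_def fun_eq_iff)
  then show "(F \<circ> ga) (1, \<tau>) = c (pt \<tau>)"
   using face[OF tau, of 1] F(4) by simp
 next
  fix u :: real assume "u \<in> {0..1}"
  have "c (pt 0) = x0" "c (pt 1) = x0"
   using edge_loop[of X c x0] E s by (auto simp: loops_def)
  moreover have "ga (u, 0) = simplical_face 1 (pt 0)" "ga (u, 1) = simplical_face 1 (pt 1)"
   by (auto simp: ga_def simplical_face_def pt_def fun_eq_iff)
  ultimately show "(F \<circ> ga) (u, 0) = x0" "(F \<circ> ga) (u, 1) = x0"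
   using face[of 0 1] face[of 1 1] F(4) by auto
 qed
qed

text \<open>Amenability gives a left invariant measure on the image group; composing its integral
  with inversion makes it right invariant. Every class is represented by a chosen loop
  \<open>pc C\<close>, and functions invariant under homotopy in \<open>X\<close> do not notice that
  the representative of a product is not the product of the representatives.\<close>

lemma wmean_Sing:
 assumes am: "amenable_in X U" and x0: "x0 \<in> U"
 shows "\<exists>M. mean {q\<in>Sing (subtopology X U) 1. singular_face 1 0 q = vx x0 \<and> singular_face 1 1 q = vx x0} M \<and>
   (\<forall>g\<in>Sing (subtopology X U) 1. \<forall>R f. singular_face 1 0 g = vx x0 --> singular_face 1 1 g = vx x0 --> bfun f -->
    (\<forall>q q'. kan.hom (Sing X) singular_face 1 q q' --> f q = f q') -->
    (\<forall>q. q \<in> Sing (subtopology X U) 1 --> singular_face 1 0 q = vx x0 --> singular_face 1 1 q = vx x0 -->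
     R q \<in> Sing (subtopology X U) 1 \<and> kan.tri (Sing X) singular_face q g (R q)) --> M (\<lambda>q. f (R q)) = M f)"
proof -
 let ?G = "fundamental_group_image X U x0" and ?XU = "subtopology X U"
 interpret S: kan "Sing X" singular_face
  by (rule kan_Sing)
 have ag: "amenable_group ?G"
  using am x0 by (auto simp: amenable_in_def)
 then interpret G: group ?G
  by (simp add: amenable_group_def)
 obtain \<mu> :: "(real => 'a) set set => real" where mu0: "\<forall>A. A \<subseteq> carrier ?G --> 0 \<le> \<mu> A" "\<mu> (carrier ?G) = 1"
  "\<forall>A B. A \<subseteq> carrier ?G --> B \<subseteq> carrier ?G --> A \<inter> B = {} --> \<mu> (A \<union> B) = \<mu> A + \<mu> B"
  "\<forall>g\<in>carrier ?G. \<forall>A. A \<subseteq> carrier ?G --> \<mu> ((\<lambda>x. g \<otimes>\<^bsub>?G\<^esub> x) ` A) = \<mu> A"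
  using ag unfolding amenable_group_def by (elim conjE exE) (rule that)
 note mu = mu0(1)[rule_format] mu0(2) mu0(3)[rule_format] mu0(4)[rule_format]
 obtain m where m: "mean (carrier ?G) m"
  "\<And>h f. bij_betw h (carrier ?G) (carrier ?G) ==> (\<And>A. A \<subseteq> carrier ?G ==> \<mu> (h ` A) = \<mu> A) ==> bfun f ==> m (\<lambda>x. f (h x)) = m f"
 proof (rule mean_of_fa_measure[of "carrier ?G" \<mu>])
  fix m assume "mean (carrier ?G) m"
   "\<And>h f. bij_betw h (carrier ?G) (carrier ?G) ==> (\<And>A. A \<subseteq> carrier ?G ==> \<mu> (h ` A) = \<mu> A) ==> bfun f ==> m (\<lambda>x. f (h x)) = m f"
  then show thesis
   by (rule that)
 qed (use mu(1-3) in blast)+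
 define m' where "m' f = m (\<lambda>C. f (inv\<^bsub>?G\<^esub> C))" for f
 have m'm: "mean (carrier ?G) m'"
  unfolding m'_def[abs_def] by (rule mean_map[OF m(1)]) simp
 have m'inv: "m' (\<lambda>C. f (C \<otimes>\<^bsub>?G\<^esub> g)) = m' f" if g: "g \<in> carrier ?G" and f: "bfun f" for f g
 proof -
  let ?h = "\<lambda>C. inv\<^bsub>?G\<^esub> g \<otimes>\<^bsub>?G\<^esub> C"
  have bij: "bij_betw ?h (carrier ?G) (carrier ?G)"
   by (rule bij_betw_byWitness[where f' = "\<lambda>C. g \<otimes>\<^bsub>?G\<^esub> C"]) (use g in \<open>auto simp: G.m_assoc[symmetric]\<close>)
  have "m' (\<lambda>C. f (C \<otimes>\<^bsub>?G\<^esub> g)) = m (\<lambda>C. f (inv\<^bsub>?G\<^esub> (?h C)))"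
   unfolding m'_def
   by (rule mean_cong[OF m(1)]) (use g bfun_compose[OF f] in \<open>auto simp: G.inv_mult_group\<close>)
  also have "\<dots> = m' f"
   unfolding m'_def
   by (rule m(2)[OF bij, of "\<lambda>C. f (inv\<^bsub>?G\<^esub> C)"]) (use mu(4) g bfun_compose[OF f] in auto)
  finally show ?thesis .
 qed
 have car: "carrier ?G = loop_class X x0 ` loops ?XU x0"
  by (simp add: fundamental_group_image_def)
 have mult: "A \<otimes>\<^bsub>?G\<^esub> B = {q \<in> loops X x0. \<exists>p\<in>A. \<exists>p'\<in>B. loop_homotopic X x0 (loop_concat p p') q}" for A B
  by (simp add: fundamental_group_image_def fundamental_group_def)
 have loopsX: "p \<in> loops X x0" if "p \<in> loops ?XU x0" for p
  using that by (auto simp: loops_def continuous_map_in_subtopology)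
 define pc where "pc C = (SOME p. p \<in> loops ?XU x0 \<and> loop_class X x0 p = C)" for C
 have pc: "pc C \<in> loops ?XU x0" "loop_class X x0 (pc C) = C" if "C \<in> carrier ?G" for C
 proof -
  have "\<exists>p. p \<in> loops ?XU x0 \<and> loop_class X x0 p = C"
   using that unfolding car by blast
  from someI_ex[OF this] show "pc C \<in> loops ?XU x0" "loop_class X x0 (pc C) = C"
   unfolding pc_def by blast+
 qed
 let ?L = "{q\<in>Sing ?XU 1. singular_face 1 0 q = vx x0 \<and> singular_face 1 1 q = vx x0}"
 define M where "M f = m' (\<lambda>C. f (ed (pc C)))" for f
 have "mean ?L M"
  unfolding M_def[abs_def] by (rule mean_map[OF m'm]) (use loop_edge[OF pc(1)] in auto)
 moreover have "M (\<lambda>q. f (R q)) = M f"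
  if g: "g \<in> ?L" and f: "bfun f" "\<And>q q'. S.hom 1 q q' ==> f q = f q'"
   and R: "\<And>q. q \<in> ?L ==> R q \<in> Sing ?XU 1 \<and> S.tri q g (R q)" for g R f
 proof -
  let ?pa = "\<lambda>e \<tau>. e (pt \<tau>)"
  have gl: "?pa g \<in> loops ?XU x0"
   using g by (intro edge_loop) auto
  let ?g = "loop_class X x0 (?pa g)"
  have gG: "?g \<in> carrier ?G"
   unfolding car using gl by blast
  have gg: "?pa g \<in> ?g"
   using loopsX[OF gl] by (auto simp: loop_class_def loop_homotopic_def loops_def)
  have eq: "f (R (ed (pc C))) = f (ed (pc (C \<otimes>\<^bsub>?G\<^esub> ?g)))" if C: "C \<in> carrier ?G" for C
  proof -
   let ?q = "ed (pc C)" and ?D = "C \<otimes>\<^bsub>?G\<^esub> ?g"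
   have q: "?q \<in> ?L"
    using loop_edge[OF pc(1)[OF C]] by auto
   have ql: "?pa ?q \<in> loops ?XU x0"
    using q by (intro edge_loop) auto
   have qC: "?pa ?q \<in> C"
   proof -
    have "homotopic_with (\<lambda>h. h 0 = x0 \<and> h 1 = x0) II X (pc C) (?pa ?q)"
    proof (rule homotopic_with_equal)
     show "pc C x = ?pa ?q x" if "x \<in> topspace II" for x
      using path_ed[of x "pc C"] that by simp
    qed (use loopsX[OF pc(1)[OF C]] loopsX[OF ql] in \<open>auto simp: loops_def\<close>)
    then show ?thesis
     using loopsX[OF ql] pc(2)[OF C] by (auto simp: loop_class_def loop_homotopic_def)
   qed
   have RW: "R ?q \<in> Sing ?XU 1" and T: "S.tri ?q g (R ?q)"
    using R[OF q] by auto
   have Rl: "?pa (R ?q) \<in> loops ?XU x0"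
    using S.tri_edges[OF T] q g RW by (intro edge_loop) auto
   have "loop_homotopic X x0 (loop_concat (?pa ?q) (?pa g)) (?pa (R ?q))"
    by (rule loop_homotopic_of_tri[OF T]) (use q g in auto)
   then have "?pa (R ?q) \<in> ?D"
    unfolding mult using qC gg loopsX[OF Rl] by blast
   moreover have D: "?D \<in> carrier ?G"
    using C gG by (rule G.m_closed)
   ultimately have "loop_homotopic X x0 (pc ?D) (?pa (R ?q))"
    using pc(2)[OF D] by (auto simp: loop_class_def)
   then have "S.hom 1 (ed (pc ?D)) (R ?q)"
    using hom_of_loop_homotopic ed_path[of ?XU "R ?q"] RW by fastforce
   then show ?thesis
    using f(2) by simp
  qed
  have "M (\<lambda>q. f (R q)) = m' (\<lambda>C. f (ed (pc (C \<otimes>\<^bsub>?G\<^esub> ?g))))"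
   unfolding M_def by (rule mean_cong[OF m'm]) (use eq bfun_compose[OF f(1)] in auto)
  also have "\<dots> = M f"
   unfolding M_def by (rule m'inv[OF gG bfun_compose[OF f(1), of "\<lambda>C. ed (pc C)"]])
  finally show ?thesis .
 qed
 ultimately show ?thesis
  by (intro exI[of _ M] conjI) (assumption, blast)
qed

section \<open>The Cech zigzag\<close>

definition KU :: "'a topology => 'a set => nat => ((nat => real) => 'a) set" where
 "KU X V = sat (Sing X) singular_face (Sing (subtopology X V))"

lemma Sing_subtopology: "Sing (subtopology X V) n \<subseteq> Sing X n"
 by (auto simp: singular_simplex_subtopology)

lemma kan_pair_Sing: "kan_pair (Sing X) (Sing (subtopology X V)) singular_face"
proof (intro kan_pair.intro kan_pair_axioms.intro kan_Sing)
 show "Sing (subtopology X V) n \<subseteq> Sing X n" for n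
  by (rule Sing_subtopology)
 show "\<exists>e\<in>Sing (subtopology X V) 1. singular_face 1 0 e = x \<and> singular_face 1 1 e = x"
  if "x \<in> Sing (subtopology X V) 0" for x
  using const_edge[of "subtopology X V" x] that by simp
qed

lemma KU_mono: "V \<subseteq> V' ==> KU X V n \<subseteq> KU X V' n"
 unfolding KU_def by (rule sat_mono) (use singular_simplex_mono in blast)

lemma Sing_KU: "Sing (subtopology X V) n \<subseteq> KU X V n"
 unfolding KU_def by (rule kan_pair.V_KV[OF kan_pair_Sing])

lemma KU_Sing: "KU X V n \<subseteq> Sing X n"
 unfolding KU_def by (rule kan_pair.KV_S[OF kan_pair_Sing])

text \<open>The mean lives on the loops of the member \<open>U\<close>, while the complex belongs to
  the smaller set \<open>V\<close>; \<open>kan_triple\<close> passes from one to the other.\<close>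

lemma KU_acyclic:
 assumes am: "amenable_in X U" and VU: "V \<subseteq> U"
  and z: "z \<in> supp (KU X V (Suc p))" "cyc (Suc p) z"
 shows "\<exists>b\<in>supp (KU X V (Suc (Suc p))). rchain_boundary (Suc (Suc p)) b = z"
proof -
 interpret kan_triple "Sing X" "Sing (subtopology X V)" "Sing (subtopology X U)" singular_face
 proof (intro kan_triple.intro kan_triple_axioms.intro kan_Sing kan_pair_Sing)
  show "Sing (subtopology X V) n \<subseteq> Sing (subtopology X U) n" for n
   using singular_simplex_mono[OF _ VU] by blast
  show "Sing (subtopology X U) n \<subseteq> Sing X n" for n
   by (rule Sing_subtopology)
  fix s assume "s \<in> Sing (subtopology X V) 0"
  then obtain a where "a \<in> topspace (subtopology X V)" and s: "s = vx a"
   using vertex_vx[of "subtopology X V" s] by blast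
  then have "a \<in> U"
   using VU by auto
  from wmean_Sing[OF am this] show "\<exists>M. mean {q\<in>Sing (subtopology X U) 1. singular_face 1 0 q = s \<and> singular_face 1 1 q = s} M \<and>
   (\<forall>g\<in>Sing (subtopology X U) 1. \<forall>R f. singular_face 1 0 g = s --> singular_face 1 1 g = s --> bfun f -->
    (\<forall>q q'. kan.hom (Sing X) singular_face 1 q q' --> f q = f q') -->
    (\<forall>q. q \<in> Sing (subtopology X U) 1 --> singular_face 1 0 q = s --> singular_face 1 1 q = s -->
     R q \<in> Sing (subtopology X U) 1 \<and> kan.tri (Sing X) singular_face q g (R q)) --> M (\<lambda>q. f (R q)) = M f)"
   unfolding s .
 qed
 show ?thesis
  using kan_mean_acyclic[OF kan_mean_axioms] z unfolding KU_def by blast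
qed

section \<open>The augmented Cech complex and its contraction\<close>

definition sg :: "nat => nat set => real" where
 "sg i J = (-1) ^ card {j \<in> J. j < i}"

text \<open>The Cech differential on chains indexed by sets of members: the component at
  \<open>J\<close> collects the components at all sets with one more member. \<open>J = {}\<close>
  is the augmentation.\<close>

definition cd :: "nat => (nat set => 's => real) => nat set => 's => real" where
 "cd N a J s = (\<Sum>i\<in>{..<N} - J. sg i J * a (insert i J) s)"

text \<open>The contraction: a simplex \<open>s\<close> is moved to the index set enlarged by its
  colour \<open>c s\<close>, which stands for a member containing it.\<close>

definition hh :: "('s => nat) => (nat set => 's => real) => nat set => 's => real" where
 "hh c a J s = (if c s \<in> J then sg (c s) (J - {c s}) * a (J - {c s}) s else 0)"

lemma sg_sq: "sg i J * sg i J = 1"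
 by (simp add: sg_def flip: power_add mult_2)

lemma sg_insert:
 assumes "finite J" "k \<notin> J"
 shows "sg i (insert k J) = (if k < i then - sg i J else sg i J)"
proof -
 have "{j \<in> insert k J. j < i} = (if k < i then insert k {j \<in> J. j < i} else {j \<in> J. j < i})"
  by auto
 then show ?thesis
  using assms by (simp add: sg_def)
qed

lemma cd_cd:
 assumes J: "finite J"
 shows "cd N (cd N a) J s = 0"
proof -
 let ?A = "{..<N} - J"
 let ?g = "\<lambda>i k. sg i J * (sg k (insert i J) * a (insert k (insert i J)) s)"
 let ?S = "Sigma ?A (\<lambda>i. ?A - {i})"
 have "cd N (cd N a) J s = (\<Sum>i\<in>?A. \<Sum>k\<in>?A - {i}. ?g i k)"
  unfolding cd_def sum_distrib_left by (intro sum.cong refl) auto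
 also have "\<dots> = (\<Sum>(i, k)\<in>?S. ?g i k)"
  by (rule sum.Sigma) auto
 finally have 1: "cd N (cd N a) J s = (\<Sum>(i, k)\<in>?S. ?g i k)" .
 also have "\<dots> = (\<Sum>(i, k)\<in>?S. ?g k i)"
  by (rule sum.reindex_bij_witness[where i = "\<lambda>(i, k). (k, i)" and j = "\<lambda>(i, k). (k, i)"]) auto
 also have "\<dots> = (\<Sum>(i, k)\<in>?S. - ?g i k)"
 proof (rule sum.cong[OF refl])
  fix p assume "p \<in> ?S"
  then obtain i k where p: "p = (i, k)" "i \<notin> J" "k \<notin> J" "i \<noteq> k"
   by auto
  have "insert i (insert k J) = insert k (insert i J)"
   by blast
  then show "(case p of (i, k) => ?g k i) = (case p of (i, k) => - ?g i k)"
   using p sg_insert[OF J p(2), of k] sg_insert[OF J p(3), of i] by auto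
 qed
 also have "\<dots> = - (\<Sum>(i, k)\<in>?S. ?g i k)"
  by (simp add: case_prod_unfold sum_negf)
 finally show ?thesis
  using 1 by simp
qed

text \<open>If the colour of \<open>s\<close> is not in \<open>J\<close>, one term survives, in
  which the colour is added and removed again. If it is in \<open>J\<close>, the terms that add
  another member \<open>i\<close> occur once in each summand, with opposite signs because
  \<open>i\<close> and the colour enter in the two possible orders.\<close>

lemma cech_homotopy:
 assumes J: "J \<subseteq> {..<N}" and c: "a J s \<noteq> 0 ==> c s < N"
 shows "cd N (hh c a) J s + hh c (cd N a) J s = a J s"
proof -
 let ?c = "c s"
 have fin: "finite J"
  using J finite_subset by blast
 show ?thesis
 proof (cases "?c \<in> J")
  case False
  have "cd N (hh c a) J s = (\<Sum>i\<in>{..<N} - J. if i = ?c then a J s else 0)"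
   unfolding cd_def
  proof (rule sum.cong[OF refl])
   fix i assume i: "i \<in> {..<N} - J"
   show "sg i J * hh c a (insert i J) s = (if i = ?c then a J s else 0)"
   proof (cases "i = ?c")
    case True
    then have "insert i J - {?c} = J"
     using False by auto
    then show ?thesis
     using True sg_sq[of ?c J] by (simp add: hh_def mult.assoc[symmetric])
   qed (use False in \<open>auto simp: hh_def\<close>)
  qed
  also have "\<dots> = a J s"
   using c False by auto
  finally show ?thesis
   using False by (simp add: hh_def)
 next
  case True
  define L where "L = J - {?c}"
  have L: "J = insert ?c L" "?c \<notin> L" "finite L"
   using True fin by (auto simp: L_def)
  have cN: "?c < N"
   using True J by auto
  have A: "{..<N} - L = insert ?c ({..<N} - J)"
   using cN L by auto
  have "hh c (cd N a) J s = sg ?c L * (\<Sum>i\<in>{..<N} - L. sg i L * a (insert i L) s)"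
   using True by (simp add: hh_def cd_def L_def)
  also have "\<dots> = sg ?c L * (sg ?c L * a J s + (\<Sum>i\<in>{..<N} - J. sg i L * a (insert i L) s))"
   unfolding A using True L(1) by (subst sum.insert) auto
  also have "\<dots> = a J s + (\<Sum>i\<in>{..<N} - J. sg ?c L * (sg i L * a (insert i L) s))"
   using sg_sq[of ?c L] by (simp add: distrib_left mult.assoc[symmetric] sum_distrib_left)
  finally have 1: "hh c (cd N a) J s = a J s + (\<Sum>i\<in>{..<N} - J. sg ?c L * (sg i L * a (insert i L) s))" .
  have "cd N (hh c a) J s = (\<Sum>i\<in>{..<N} - J. - (sg ?c L * (sg i L * a (insert i L) s)))"
   unfolding cd_def
  proof (rule sum.cong[OF refl])
   fix i assume i: "i \<in> {..<N} - J"
   then have ic: "i \<noteq> ?c" "i \<notin> L"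
    using L(1) by auto
   have "insert i J - {?c} = insert i L"
    using ic L by auto
   then have "hh c a (insert i J) s = sg ?c (insert i L) * a (insert i L) s"
    using True by (simp add: hh_def)
   moreover have "sg i J * sg ?c (insert i L) = - (sg ?c L * sg i L)"
    using sg_insert[OF L(3) ic(2), of ?c] sg_insert[OF L(3,2), of i] ic L(1) by auto
   ultimately show "sg i J * hh c a (insert i J) s = - (sg ?c L * (sg i L * a (insert i L) s))"
    by (metis mult.assoc mult_minus_left)
  qed
  then show ?thesis
   using 1 by (simp add: sum_negf)
 qed
qed

lemma supp_cd:
 assumes "\<And>i. i < N ==> i \<notin> J ==> a (insert i J) \<in> supp K"
 shows "cd N a J \<in> supp K"
 unfolding cd_def[abs_def] by (rule supp_sum, rule supp_scale) (use assms in auto)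

lemma bd_cd:
 assumes "\<And>i. i < N ==> i \<notin> J ==> l1 (a (insert i J))"
 shows "rchain_boundary (Suc p) (cd N a J) = cd N (\<lambda>J. rchain_boundary (Suc p) (a J)) J"
proof -
 have "rchain_boundary (Suc p) (cd N a J) = (\<lambda>t. \<Sum>i\<in>{..<N} - J. rchain_boundary (Suc p) (\<lambda>s. sg i J * a (insert i J) s) t)"
  unfolding cd_def[abs_def] by (rule bd_sum, rule l1_scale) (use assms in auto)
 also have "\<dots> = cd N (\<lambda>J. rchain_boundary (Suc p) (a J)) J"
  unfolding cd_def[abs_def]
  by (intro ext sum.cong refl) (simp add: bd_scale[OF assms])
 finally show ?thesis .
qed

lemma l1_hh:
 assumes J: "finite J" and a: "\<And>i. i \<in> J ==> l1 (a (J - {i}))"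
 shows "l1 (hh c a J)"
proof (rule l1_mono)
 show "l1 (\<lambda>s. \<Sum>i\<in>J. \<bar>a (J - {i}) s\<bar>)"
  by (rule l1_sum) (use a in \<open>simp add: l1_def\<close>)
 show "\<bar>hh c a J s\<bar> \<le> \<bar>\<Sum>i\<in>J. \<bar>a (J - {i}) s\<bar>\<bar>" for s
 proof (cases "c s \<in> J")
  case True
  have "\<bar>hh c a J s\<bar> = \<bar>a (J - {c s}) s\<bar>"
   using True by (simp add: hh_def sg_def abs_mult power_abs)
  also have "\<dots> \<le> (\<Sum>i\<in>J. \<bar>a (J - {i}) s\<bar>)"
   using J True by (intro member_le_sum[of "c s" J "\<lambda>i. \<bar>a (J - {i}) s\<bar>"]) auto
  finally show ?thesis
   by simp
 qed (simp add: hh_def)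
qed

lemma face_image: "k \<le> Suc p ==> singular_face (Suc p) k s ` standard_simplex p \<subseteq> s ` standard_simplex (Suc p)"
 using face_in_simplex[of k p] by (auto simp: singular_face_def)

section \<open>The zigzag of a cycle consisting of small simplices\<close>

locale cech =
 fixes X :: "'a topology" and W :: "nat => 'a set" and N k n :: nat and z :: "'a rchain"
 assumes am: "i < N ==> amenable_in X (W i)"
  and mult: "J \<subseteq> {..<N} ==> topspace X \<inter> \<Inter> (W ` J) \<noteq> {} ==> card J \<le> k"
  and kn: "k \<le> n" and n1: "1 \<le> n"
  and zl: "l1 z" and zs: "z s \<noteq> 0 ==> singular_simplex n X s \<and> (\<exists>i<N. s ` standard_simplex n \<subseteq> W i)"
  and zc: "cyc n z"
begin

definition small :: "nat => ((nat => real) => 'a) set" where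
 "small p = {s. singular_simplex p X s \<and> (\<exists>i<N. s ` standard_simplex p \<subseteq> W i)}"

definition col :: "nat => ((nat => real) => 'a) => nat" where
 "col p s = (SOME i. i < N \<and> s ` standard_simplex p \<subseteq> W i)"

lemma col: "s \<in> small p ==> col p s < N \<and> s ` standard_simplex p \<subseteq> W (col p s)"
 unfolding col_def by (rule someI_ex) (auto simp: small_def)

text \<open>The simplices that may occur at the index \<open>J\<close>. Being small they have a
  colour, and adding the colour to \<open>J\<close> keeps their image in the intersection; so the
  contraction respects these supports.\<close>

definition DJ :: "nat set => nat => ((nat => real) => 'a) set" where
 "DJ J p = {s \<in> small p. s ` standard_simplex p \<subseteq> \<Inter> (W ` J)}"

lemma DJ_face: "s \<in> DJ J (Suc p) ==> i \<le> Suc p ==> singular_face (Suc p) i s \<in> DJ J p"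
proof -
 assume s: "s \<in> DJ J (Suc p)" "i \<le> Suc p"
 have im: "singular_face (Suc p) i s ` standard_simplex p \<subseteq> s ` standard_simplex (Suc p)"
  by (rule face_image[OF s(2)])
 have "singular_simplex p X (singular_face (Suc p) i s)"
  using singular_simplex_singular_face[where p = "Suc p" and f = s and X = X and k = i] s by (simp add: DJ_def small_def)
 moreover have "\<exists>i<N. s ` standard_simplex (Suc p) \<subseteq> W i" "s ` standard_simplex (Suc p) \<subseteq> \<Inter> (W ` J)"
  using s(1) unfolding DJ_def small_def by auto
 ultimately show ?thesis
  using order_trans[OF im] unfolding DJ_def small_def by blast
qed

lemma DJ_KU: "DJ J p \<subseteq> KU X (\<Inter> (W ` J)) p"
 using Sing_KU[where X = X and V = "\<Inter> (W ` J)" and n = p] by (auto simp: DJ_def small_def singular_simplex_subtopology)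

lemma supp_mono: "A \<subseteq> B ==> w \<in> supp A ==> w \<in> supp B"
 by (auto simp: supp_def)

lemma supp_hh:
 assumes J: "finite J" and a: "\<And>i. i \<in> J ==> a (J - {i}) \<in> supp (DJ (J - {i}) p)"
 shows "hh (col p) a J \<in> supp (DJ J p)"
proof -
 have "s \<in> DJ J p" if "hh (col p) a J s \<noteq> 0" for s
 proof -
  have c: "col p s \<in> J" "a (J - {col p s}) s \<noteq> 0"
   using that by (auto simp: hh_def split: if_splits)
  then have "s \<in> DJ (J - {col p s}) p"
   using a[OF c(1)] by (auto simp: supp_def)
  then have s: "s \<in> small p" "\<And>j. j \<in> J ==> j \<noteq> col p s ==> s ` standard_simplex p \<subseteq> W j"
   by (auto simp: DJ_def)
  have "s ` standard_simplex p \<subseteq> W j" if "j \<in> J" for j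
   using col[OF s(1)] s(2)[OF that] by (cases "j = col p s") auto
  then show ?thesis
   using s(1) by (auto simp: DJ_def)
 qed
 moreover have "l1 (hh (col p) a J)"
  using supp_l1[OF a] by (intro l1_hh[OF J]) auto
 ultimately show ?thesis
  by (simp add: supp_def)
qed

definition Z :: "nat set => 'a rchain" where
 "Z J = (if J = {} then z else (\<lambda>_. 0))"

text \<open>The zigzag: \<open>w q\<close> is concentrated on sets of \<open>q + 1\<close> members
  and has degree \<open>n - q\<close>. By \<open>cd_w\<close> its Cech differential is the boundary
  of the preceding term.\<close>

primrec w :: "nat => nat set => 'a rchain" where
 "w 0 = hh (col n) Z"
| "w (Suc q) = hh (col (n - Suc q)) (\<lambda>J. rchain_boundary (n - q) (w q J))"

lemma Z_supp: "Z J \<in> supp (DJ J n)"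
 using zl zs by (auto simp: Z_def supp_def DJ_def small_def)

lemma w_supp: "q \<le> n ==> finite J ==> w q J \<in> supp (DJ J (n - q))"
proof (induction q arbitrary: J)
 case 0
 then show ?case
  using supp_hh[of J Z n] Z_supp by simp
next
 case (Suc q)
 then have S: "n - q = Suc (n - Suc q)"
  by simp
 show ?case
  unfolding w.simps
 proof (rule supp_hh[OF Suc.prems(2)])
  fix i assume "i \<in> J"
  have "w q (J - {i}) \<in> supp (DJ (J - {i}) (Suc (n - Suc q)))"
   using Suc.IH[of "J - {i}"] Suc.prems unfolding S[symmetric] by simp
  then show "rchain_boundary (n - q) (w q (J - {i})) \<in> supp (DJ (J - {i}) (n - Suc q))"
   unfolding S by (rule supp_bd) (rule DJ_face)
 qed
qed

lemma w_card: "finite J ==> card J \<noteq> Suc q ==> w q J = (\<lambda>_. 0)"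
proof (induction q arbitrary: J)
 case 0
 have "J - {c} \<noteq> {}" if "c \<in> J" for c
  using 0 that by (metis One_nat_def card_Suc_Diff1 card.empty)
 then show ?case
  by (auto simp: hh_def Z_def fun_eq_iff)
next
 case (Suc q)
 have "w q (J - {c}) = (\<lambda>_. 0)" if "c \<in> J" for c
  using Suc that by (intro Suc.IH) auto
 note zero = this
 show ?case
 proof
  fix s
  show "w (Suc q) J s = 0"
   by (cases "col (n - Suc q) s \<in> J") (simp_all add: hh_def zero bd_zero)
 qed
qed

text \<open>\<open>w k\<close> is concentrated on sets of \<open>k + 1\<close> members, and the
  points of a simplex occurring there would lie in all of them, against the multiplicity.\<close>

lemma w_k:
 assumes J: "J \<subseteq> {..<N}"
 shows "w k J = (\<lambda>_. 0)"
proof (rule ccontr)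
 have fin: "finite J"
  using J finite_subset by blast
 assume ne: "w k J \<noteq> (\<lambda>_. 0)"
 then have card: "card J = Suc k"
  using w_card[OF fin] by blast
 obtain s where "w k J s \<noteq> 0"
  using ne by auto
 then have s: "s \<in> DJ J (n - k)"
  using w_supp[OF kn fin] by (auto simp: supp_def)
 obtain x where x: "x \<in> standard_simplex (n - k)"
  using nonempty_standard_simplex[of "n - k"] by blast
 have "s x \<in> topspace X"
  using s x continuous_map_image_subset_topspace[of "Dt (n - k)" X s] by (auto simp: DJ_def small_def singular_simplex_def)
 moreover have "s x \<in> \<Inter> (W ` J)"
  using s x by (auto simp: DJ_def)
 ultimately have "card J \<le> k"
  using mult[OF J] by blast
 then show False
  using card by simp
qed

lemma cd_w0:
 assumes J: "J \<subseteq> {..<N}"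
 shows "cd N (w 0) J = Z J"
proof
 fix s
 have "hh (col n) (cd N Z) J s = 0"
  by (simp add: hh_def cd_def Z_def)
 moreover have "col n s < N" if "Z J s \<noteq> 0"
  using that Z_supp[of J] col[of s n] by (auto simp: supp_def DJ_def)
 ultimately show "cd N (w 0) J s = Z J s"
  using cech_homotopy[OF J, of Z s "col n"] by simp
qed

lemma DJ_ff: "s \<in> DJ J (Suc (Suc p)) ==> i < j ==> j \<le> Suc (Suc p) ==>
 singular_face (Suc p) i (singular_face (Suc (Suc p)) j s) = singular_face (Suc p) (j - 1) (singular_face (Suc (Suc p)) i s)"
 by (rule singular_face_comm)

text \<open>On Cech cycles \<open>hh\<close> is a right inverse of \<open>cd\<close>, so it has to
  be seen that the boundary of \<open>w q\<close> is a Cech cycle. The two differentials commute,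
  and \<open>cd N (w q)\<close> is the cycle \<open>z\<close> at the start and a boundary later
  on.\<close>

lemma cd_w:
 assumes "Suc q \<le> n" "J \<subseteq> {..<N}"
 shows "cd N (w (Suc q)) J = rchain_boundary (n - q) (w q J)"
 using assms
proof (induction q arbitrary: J)
 have main: "cd N (w (Suc q)) J = rchain_boundary (n - q) (w q J)"
  if q: "Suc q \<le> n" and J: "J \<subseteq> {..<N}"
   and cyc: "\<And>L. L \<subseteq> {..<N} ==> rchain_boundary (n - q) (cd N (w q) L) = (\<lambda>_. 0)" for q J
 proof
  fix s
  let ?b = "\<lambda>J. rchain_boundary (n - q) (w q J)"
  have S: "n - q = Suc (n - Suc q)"
   using q by simp
  have fin: "finite L" if "L \<subseteq> {..<N}" for L
   using that finite_subset by blast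
  have "cd N ?b L = (\<lambda>_. 0)" if L: "L \<subseteq> {..<N}" for L
  proof -
   have "cd N ?b L = rchain_boundary (n - q) (cd N (w q) L)"
    unfolding S by (rule bd_cd[symmetric]) (use q fin[OF L] in \<open>auto intro!: supp_l1[OF w_supp]\<close>)
   then show ?thesis
    using cyc[OF L] by simp
  qed
  from this[of "J - {col (n - Suc q) s}"] have "hh (col (n - Suc q)) (cd N ?b) J s = 0"
   using J by (simp add: hh_def Diff_subset[THEN subset_trans])
  moreover have "col (n - Suc q) s < N" if "?b J s \<noteq> 0"
  proof -
   have "w q J \<in> supp (DJ J (Suc (n - Suc q)))"
    using w_supp[of q J] q fin[OF J] unfolding S[symmetric] by simp
   then have "?b J \<in> supp (DJ J (n - Suc q))"
    unfolding S by (rule supp_bd) (rule DJ_face)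
   then show ?thesis
    using that col[of s "n - Suc q"] by (auto simp: supp_def DJ_def)
  qed
  ultimately show "cd N (w (Suc q)) J s = ?b J s"
   using cech_homotopy[OF J, of ?b s "col (n - Suc q)"] by simp
 qed
 {
  case 0
  show ?case
  proof (rule main[OF 0])
   fix L :: "nat set" assume "L \<subseteq> {..<N}"
   then show "rchain_boundary (n - 0) (cd N (w 0) L) = (\<lambda>_. 0)"
    using cd_w0[of L] zc by (auto simp: Z_def cyc_def bd_zero)
  qed
 next
  case (Suc q)
  show ?case
  proof (rule main[OF Suc.prems])
   fix L :: "nat set" assume L: "L \<subseteq> {..<N}"
   have S: "n - q = Suc (Suc (n - Suc (Suc q)))" "n - Suc q = Suc (n - Suc (Suc q))"
    using Suc.prems by auto
   have "w q L \<in> supp (DJ L (Suc (Suc (n - Suc (Suc q)))))"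
    using w_supp[of q L] Suc.prems finite_subset[OF L] unfolding S(1)[symmetric] by simp
   then have "rchain_boundary (n - Suc q) (rchain_boundary (n - q) (w q L)) = (\<lambda>_. 0)"
    unfolding S by (rule bd_bd) (rule DJ_ff)
   then show "rchain_boundary (n - Suc q) (cd N (w (Suc q)) L) = (\<lambda>_. 0)"
    using Suc.IH[OF _ L] Suc.prems by simp
  qed
 }
qed

text \<open>\<open>w q\<close> is a boundary up to a Cech cycle \<open>v\<close>. The chains
  \<open>a\<close> and \<open>v\<close> are taken in the saturations because only there cycles can
  be filled.\<close>

definition good :: "nat => bool" where
 "good q \<longleftrightarrow> (\<exists>a v. (\<forall>J. J \<subseteq> {..<N} --> J \<noteq> {} --> a J \<in> supp (KU X (\<Inter> (W ` J)) (Suc (n - q))) \<and>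
   v J \<in> supp (KU X (\<Inter> (W ` J)) (n - q)) \<and> w q J = (\<lambda>s. rchain_boundary (Suc (n - q)) (a J) s + v J s)) \<and>
   (\<forall>J. J \<subseteq> {..<N} --> cd N v J = (\<lambda>_. 0)))"

lemma good_k: "good k"
 unfolding good_def
 by (rule exI[of _ "\<lambda>_ _. 0"], rule exI[of _ "\<lambda>_ _. 0"])
  (auto simp: supp_zero bd_zero w_k cd_def[abs_def])

text \<open>The new Cech cycle is the Cech differential of the old \<open>a\<close>. Since
  \<open>v\<close> disappears under \<open>cd\<close>, its boundary is that of \<open>w q\<close>,
  and the difference is a cycle on the saturation of the intersection. Its degree
  \<open>n - q\<close> is positive as \<open>q < k \<le> n\<close>, so it can be filled.\<close>

lemma good_step:
 assumes q: "Suc q \<le> k" and g: "good (Suc q)"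
 shows "good q"
proof -
 define p where "p = n - Suc q"
 have p: "n - q = Suc p" "n - Suc q = p"
  using q kn by (auto simp: p_def)
 obtain a v where av0: "\<forall>J. J \<subseteq> {..<N} --> J \<noteq> {} --> a J \<in> supp (KU X (\<Inter> (W ` J)) (Suc p)) \<and>
   v J \<in> supp (KU X (\<Inter> (W ` J)) p) \<and> w (Suc q) J = (\<lambda>s. rchain_boundary (Suc p) (a J) s + v J s)"
  "\<forall>J. J \<subseteq> {..<N} --> cd N v J = (\<lambda>_. 0)"
  using g unfolding good_def p by (elim exE conjE) (rule that)
 have av: "a J \<in> supp (KU X (\<Inter> (W ` J)) (Suc p))" "w (Suc q) J = (\<lambda>s. rchain_boundary (Suc p) (a J) s + v J s)"
  if "J \<subseteq> {..<N}" "J \<noteq> {}" for J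
  using av0(1)[rule_format, OF that] by simp_all
 define v' where "v' = cd N a"
 have "\<exists>b. J \<noteq> {} --> b \<in> supp (KU X (\<Inter> (W ` J)) (Suc (Suc p))) \<and> v' J \<in> supp (KU X (\<Inter> (W ` J)) (Suc p)) \<and>
  w q J = (\<lambda>s. rchain_boundary (Suc (Suc p)) b s + v' J s)" if J: "J \<subseteq> {..<N}" for J
 proof (cases "J = {}")
  case False
  have fin: "finite J"
   using J finite_subset by blast
  have aK: "a (insert i J) \<in> supp (KU X (\<Inter> (W ` J)) (Suc p))" if "i < N" for i
   by (rule supp_mono[OF KU_mono av(1)]) (use that J in auto)
  have v'K: "v' J \<in> supp (KU X (\<Inter> (W ` J)) (Suc p))"
   unfolding v'_def by (rule supp_cd) (rule aK)
  have wK: "w q J \<in> supp (KU X (\<Inter> (W ` J)) (Suc p))"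
   using supp_mono[OF DJ_KU w_supp[OF _ fin, of q]] q kn unfolding p by simp
  have "rchain_boundary (Suc p) (v' J) = cd N (\<lambda>J. rchain_boundary (Suc p) (a J)) J"
   unfolding v'_def by (rule bd_cd) (rule supp_l1[OF aK])
  also have "\<dots> = (\<lambda>s. cd N (w (Suc q)) J s - cd N v J s)"
  proof
   fix s
   have "rchain_boundary (Suc p) (a (insert i J)) s = w (Suc q) (insert i J) s - v (insert i J) s" if "i < N" for i
    using av(2)[of "insert i J"] that J by simp
   then show "cd N (\<lambda>J. rchain_boundary (Suc p) (a J)) J s = cd N (w (Suc q)) J s - cd N v J s"
    unfolding cd_def sum_subtractf[symmetric] by (intro sum.cong refl) (simp add: right_diff_distrib del: w.simps)
  qed
  also have "\<dots> = rchain_boundary (Suc p) (w q J)"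
   using av0(2) cd_w[of q J] q kn J unfolding p by simp
  finally have eq: "rchain_boundary (Suc p) (v' J) = rchain_boundary (Suc p) (w q J)" .
  have "cyc (Suc p) (\<lambda>s. w q J s - v' J s)"
   unfolding cyc_def bd_diff[OF supp_l1[OF wK] supp_l1[OF v'K]] eq by simp
  moreover obtain i where i: "i \<in> J" "i < N"
   using False J by auto
  moreover have "\<Inter> (W ` J) \<subseteq> W i"
   using i by auto
  ultimately obtain b where b: "b \<in> supp (KU X (\<Inter> (W ` J)) (Suc (Suc p)))" "rchain_boundary (Suc (Suc p)) b = (\<lambda>s. w q J s - v' J s)"
   using KU_acyclic[OF am _ supp_diff[OF wK v'K]] by blast
  then show ?thesis
   using v'K by (intro exI[of _ b]) (auto simp: fun_eq_iff)
 qed simp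
 then obtain b where b: "\<And>J. J \<subseteq> {..<N} ==> J \<noteq> {} ==> b J \<in> supp (KU X (\<Inter> (W ` J)) (Suc (Suc p))) \<and> v' J \<in> supp (KU X (\<Inter> (W ` J)) (Suc p)) \<and>
  w q J = (\<lambda>s. rchain_boundary (Suc (Suc p)) (b J) s + v' J s)"
  using choice[of "\<lambda>J b. J \<subseteq> {..<N} --> J \<noteq> {} --> b \<in> supp (KU X (\<Inter> (W ` J)) (Suc (Suc p))) \<and> v' J \<in> supp (KU X (\<Inter> (W ` J)) (Suc p)) \<and>
  w q J = (\<lambda>s. rchain_boundary (Suc (Suc p)) b s + v' J s)"] by auto
 have "cd N v' J = (\<lambda>_. 0)" if "J \<subseteq> {..<N}" for J
  unfolding v'_def using cd_cd[of J N a] finite_subset[OF that] by auto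
 then show ?thesis
  using b unfolding good_def p by (intro exI[of _ b] exI[of _ v'] conjI) simp_all
qed

text \<open>At stage 0 the component at the empty index reads z = cd (w 0); substituting the
  decomposition of \<open>w 0\<close> leaves the boundary of \<open>cd N a {}\<close>, as the Cech
  cycle \<open>v\<close> contributes nothing.\<close>

lemma cech_boundary: "\<exists>b\<in>supp (Sing X (Suc n)). rchain_boundary (Suc n) b = z"
proof -
 have "good (k - q)" if "q \<le> k" for q
  using that
 proof (induction q)
  case 0
  then show ?case
   using good_k by simp
 next
  case (Suc q)
  have e: "Suc (k - Suc q) = k - q"
   using Suc.prems by simp
  show ?case
   by (rule good_step) (use Suc e in auto)
 qed
 from this[of k] have "good 0"
  by simp
 then obtain a v where av0: "\<forall>J. J \<subseteq> {..<N} --> J \<noteq> {} --> a J \<in> supp (KU X (\<Inter> (W ` J)) (Suc n)) \<and>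
   v J \<in> supp (KU X (\<Inter> (W ` J)) n) \<and> w 0 J = (\<lambda>s. rchain_boundary (Suc n) (a J) s + v J s)"
  "\<forall>J. J \<subseteq> {..<N} --> cd N v J = (\<lambda>_. 0)"
  unfolding good_def diff_zero by (elim exE conjE) (rule that)
 have av: "a J \<in> supp (KU X (\<Inter> (W ` J)) (Suc n))" "w 0 J = (\<lambda>s. rchain_boundary (Suc n) (a J) s + v J s)"
  if "J \<subseteq> {..<N}" "J \<noteq> {}" for J
  using av0(1)[rule_format, OF that] by simp_all
 have aS: "a (insert i {}) \<in> supp (Sing X (Suc n))" if "i < N" for i
  by (rule supp_mono[OF KU_Sing av(1)]) (use that in auto)
 have "rchain_boundary (Suc n) (cd N a {}) = cd N (\<lambda>J. rchain_boundary (Suc n) (a J)) {}"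
  by (rule bd_cd) (rule supp_l1[OF aS])
 also have "\<dots> = (\<lambda>s. cd N (w 0) {} s - cd N v {} s)"
 proof
  fix s
  have "rchain_boundary (Suc n) (a {i}) s = w 0 {i} s - v {i} s" if "i < N" for i
   using av(2)[of "{i}"] that by simp
  then show "cd N (\<lambda>J. rchain_boundary (Suc n) (a J)) {} s = cd N (w 0) {} s - cd N v {} s"
   unfolding cd_def sum_subtractf[symmetric] by (intro sum.cong refl) (simp add: right_diff_distrib del: w.simps)
 qed
 also have "\<dots> = z"
  using av0(2) cd_w0[of "{}"] by (simp add: Z_def)
 moreover have "cd N a {} \<in> supp (Sing X (Suc n))"
  by (rule supp_cd) (rule aS)
 ultimately show ?thesis
  by auto
qed

end

section \<open>Small simplices\<close>

text \<open>Subdivision and its homotopy to the identity act on integral chains; they are applied to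
  single simplices, and \<open>rl\<close> makes the results real chains.\<close>

definition rl :: "'a chain => 'a rchain" where
 "rl c s = real_of_int (Poly_Mapping.lookup c s)"

lemma rl_diff: "rl (a - b) = (\<lambda>s. rl a s - rl b s)"
 and rl_add: "rl (a + b) = (\<lambda>s. rl a s + rl b s)"
 and rl_zero: "rl 0 = (\<lambda>_. 0)"
 and rl_cmul: "rl (frag_cmul k a) = (\<lambda>s. real_of_int k * rl a s)"
 by (simp_all add: rl_def[abs_def] lookup_minus lookup_add)

lemma rl_of: "rl (frag_of s) = dl s"
 by (auto simp: rl_def dl_def fun_eq_iff)

lemma rl_sum: "rl (sum f I) = (\<lambda>s. \<Sum>i\<in>I. rl (f i) s)"
 by (induction I rule: infinite_finite_induct) (auto simp: rl_zero rl_add)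

lemma rl_keys: "rl c s \<noteq> 0 \<longleftrightarrow> s \<in> Poly_Mapping.keys c"
 by (simp add: rl_def in_keys_iff)

lemma l1_rl: "l1 (rl c)"
 by (rule l1_finite) (simp add: rl_keys)

lemma push_dl: "push h (dl s) = dl (h s)"
proof
 fix t
 show "push h (dl s) t = dl (h s) t"
 proof (cases "h s = t")
  case True
  then have "push h (dl s) t = (\<Sum>\<^sub>\<infinity>r\<in>{s}. dl s r)"
   unfolding push_def by (intro infsum_cong_neutral) (auto simp: dl_def)
  then show ?thesis
   using True by (simp add: dl_def)
 next
  case False
  then have "push h (dl s) t = 0"
   unfolding push_def by (intro infsum_0) (auto simp: dl_def)
  then show ?thesis
   using False by (simp add: dl_def)
 qed
qed

lemma bd_rl:
 fixes c :: "'a chain"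
 shows "rchain_boundary (Suc p) (rl c) = rl (chain_boundary (Suc p) c)"
proof (rule frag_induction[of c UNIV])
 fix s :: "(nat => real) => 'a"
 have "rchain_boundary (Suc p) (rl (frag_of s)) = (\<lambda>t. \<Sum>k\<le>Suc p. (-1) ^ k * dl (singular_face (Suc p) k s) t)"
  unfolding rl_of bd_eq push_dl ..
 also have "\<dots> = rl (chain_boundary (Suc p) (frag_of s))"
  unfolding chain_boundary_of by (simp add: rl_sum rl_cmul rl_of del: sum.atMost_Suc)
 finally show "rchain_boundary (Suc p) (rl (frag_of s)) = rl (chain_boundary (Suc p) (frag_of s))" .
next
 fix a b :: "'a chain"
 assume "rchain_boundary (Suc p) (rl a) = rl (chain_boundary (Suc p) a)" "rchain_boundary (Suc p) (rl b) = rl (chain_boundary (Suc p) b)"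
 then show "rchain_boundary (Suc p) (rl (a - b)) = rl (chain_boundary (Suc p) (a - b))"
  by (simp add: rl_diff chain_boundary_diff bd_diff[OF l1_rl l1_rl])
qed (simp_all add: rl_zero bd_zero)

lemma pairing_finite: "finite {s. z s \<noteq> 0} ==> pairing f z = (\<Sum>s\<in>{s. z s \<noteq> 0}. z s * f s)"
proof -
 assume fin: "finite {s. z s \<noteq> 0}"
 have "pairing f z = (\<Sum>\<^sub>\<infinity>s\<in>{s. z s \<noteq> 0}. z s * f s)"
  unfolding pairing_def by (rule infsum_cong_neutral) auto
 then show ?thesis
  using fin by simp
qed

text \<open>The condition to be a cycle, tested against an arbitrary function. The function is cut
  off outside the finitely many faces that occur, which makes it bounded and so admissible in
  \<open>pairing_bd\<close>.\<close>

lemma cycle_faces: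
 assumes fin: "finite {s. z s \<noteq> 0}" and c: "cyc (Suc m) z"
 shows "(\<Sum>s\<in>{s. z s \<noteq> 0}. z s * (\<Sum>k\<le>Suc m. (-1) ^ k * f (singular_face (Suc m) k s))) = 0"
proof -
 let ?F = "{s. z s \<noteq> 0}"
 let ?E = "(\<lambda>(s, k). singular_face (Suc m) k s) ` (?F \<times> {..Suc m})"
 define g where "g t = (if t \<in> ?E then f t else 0)" for t
 have E: "finite ?E"
  using fin by simp
 have "\<bar>g t\<bar> \<le> (\<Sum>t\<in>?E. \<bar>f t\<bar>)" for t
  using member_le_sum[of t ?E "\<lambda>t. \<bar>f t\<bar>"] E by (auto simp: g_def sum_nonneg)
 then have g: "bfun g"
  by (rule bfunI)
 have "(\<Sum>s\<in>?F. z s * (\<Sum>k\<le>Suc m. (-1) ^ k * f (singular_face (Suc m) k s)))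
  = (\<Sum>s\<in>?F. z s * (\<Sum>k\<le>Suc m. (-1) ^ k * g (singular_face (Suc m) k s)))"
 proof (intro sum.cong refl arg_cong2[where f = "(*)"])
  fix s k assume "s \<in> ?F" "k \<in> {..Suc m}"
  then have "singular_face (Suc m) k s \<in> ?E"
   by force
  then show "f (singular_face (Suc m) k s) = g (singular_face (Suc m) k s)"
   by (simp add: g_def)
 qed
 also have "\<dots> = pairing (\<lambda>s. \<Sum>k\<le>Suc m. (-1) ^ k * g (singular_face (Suc m) k s)) z"
  by (rule pairing_finite[OF fin, symmetric])
 also have "\<dots> = pairing g (rchain_boundary (Suc m) z)"
  by (rule pairing_bd[OF l1_finite[OF fin] g, symmetric])
 also have "\<dots> = 0"
  using c by (simp add: cyc_def pairing_def)
 finally show ?thesis .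
qed

text \<open>The subdivision homotopy is applied to each simplex of \<open>z\<close> separately and
  the results are combined with the real coefficients. The boundary formula leaves a term made of
  the faces of the simplices, which vanishes by \<open>cycle_faces\<close>.\<close>

lemma small_cycle:
 fixes z :: "'a rchain"
 assumes op: "\<And>U. U \<in> C ==> openin X U" and cov: "topspace X \<subseteq> \<Union> C"
  and z: "real_chain (Suc m) X z" "cyc (Suc m) z"
 obtains z' c where "finite {s. z' s \<noteq> 0}" "\<And>s. z' s \<noteq> 0 ==> singular_simplex (Suc m) X s \<and> (\<exists>V\<in>C. s ` standard_simplex (Suc m) \<subseteq> V)"
  "cyc (Suc m) z'" "c \<in> supp (Sing X (Suc (Suc m)))" "rchain_boundary (Suc (Suc m)) c = (\<lambda>s. z' s - z s)"
proof -
 let ?F = "{s. z s \<noteq> 0}"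
 have fin: "finite ?F" and Fs: "\<And>s. s \<in> ?F ==> singular_simplex (Suc m) X s"
  using z(1) by (auto simp: real_chain_def)
 have ch: "singular_chain (Suc m) X (frag_of s)" if "s \<in> ?F" for s
  using Fs[OF that] by (simp add: singular_chain_of)
 have "\<exists>n. \<forall>l f. n \<le> l --> f \<in> Poly_Mapping.keys ((singular_subdivision (Suc m) ^^ l) (frag_of s)) --> (\<exists>V\<in>C. f \<in> standard_simplex (Suc m) \<rightarrow> V)"
  if "s \<in> ?F" for s
  using sufficient_iterated_singular_subdivision_exists[OF op cov ch[OF that]] by metis
 then obtain n where n: "\<And>s l f. s \<in> ?F ==> n s \<le> l ==> f \<in> Poly_Mapping.keys ((singular_subdivision (Suc m) ^^ l) (frag_of s)) ==> \<exists>V\<in>C. f \<in> standard_simplex (Suc m) \<rightarrow> V"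
  by metis
 \<comment> \<open>One number of subdivisions has to serve all the finitely many simplices; the
   element 0 covers the zero chain.\<close>
 define M where "M = Max (insert 0 (n ` ?F))"
 have nM: "n s \<le> M" if "s \<in> ?F" for s
  unfolding M_def using fin that by (intro Max_ge) auto
 obtain h :: "nat => 'a chain => 'a chain" where h: "\<And>p. h p 0 = 0" "\<And>p c1 c2. h p (c1 - c2) = h p c1 - h p c2"
  "\<And>p X c. singular_chain p X c ==> singular_chain (Suc p) X (h p c)"
  "\<And>p X c. singular_chain p X c ==> chain_boundary (Suc p) (h p c) + h (p - Suc 0) (chain_boundary p c) = (singular_subdivision p ^^ M) c - c"
  using chain_homotopic_iterated_singular_subdivision[of M] by blast
 have hm: "h p (- c) = - h p c" for p c
  using h(2)[of p 0 c] h(1) by simp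
 have ha: "h p (c1 + c2) = h p c1 + h p c2" for p c1 c2
  using h(2)[of p c1 "- c2"] hm by simp
 have hs: "h p (sum f I) = (\<Sum>i\<in>I. h p (f i))" for p and f :: "nat => 'a chain" and I
  by (induction I rule: infinite_finite_induct) (auto simp: h(1) ha)
 \<comment> \<open>The only integral coefficients in a boundary are signs, so additivity of
   \<open>h\<close> suffices.\<close>
 have hc: "rl (h p (frag_cmul ((-1) ^ k) c)) = (\<lambda>t. (-1) ^ k * rl (h p c) t)" for p k c
  by (cases "even k") (auto simp: hm rl_def fun_eq_iff)
 define S where "S s = (singular_subdivision (Suc m) ^^ M) (frag_of s)" for s :: "(nat => real) => 'a"
 define z' where "z' t = (\<Sum>s\<in>?F. z s * rl (S s) t)" for t
 define c where "c t = (\<Sum>s\<in>?F. z s * rl (h (Suc m) (frag_of s)) t)" for t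
 have supz: "\<exists>s\<in>?F. t \<in> Poly_Mapping.keys (S s)" if nz: "z' t \<noteq> 0" for t
 proof (rule ccontr)
  assume no: "\<not> (\<exists>s\<in>?F. t \<in> Poly_Mapping.keys (S s))"
  have "z' t = 0"
   unfolding z'_def
  proof (rule sum.neutral, rule ballI)
   fix s assume "s \<in> ?F"
   then have "rl (S s) t = 0"
    using no rl_keys by blast
   then show "z s * rl (S s) t = 0"
    by simp
  qed
  then show False
   using nz by simp
 qed
 have Sch: "singular_chain (Suc m) X ((singular_subdivision (Suc m) ^^ l) (frag_of s))" if "s \<in> ?F" for s l
  by (induction l) (auto simp: singular_chain_singular_subdivision ch[OF that])
 have bc: "rchain_boundary (Suc (Suc m)) c t = z' t - z t" for t
 proof -
  have "rchain_boundary (Suc (Suc m)) c t = (\<Sum>s\<in>?F. z s * rl (chain_boundary (Suc (Suc m)) (h (Suc m) (frag_of s))) t)"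
   unfolding c_def[abs_def] by (subst bd_sum) (simp_all add: l1_scale l1_rl bd_scale bd_rl)
  also have "\<dots> = (\<Sum>s\<in>?F. z s * rl (S s) t - z s * dl s t - z s * (\<Sum>k\<le>Suc m. (-1) ^ k * rl (h m (frag_of (singular_face (Suc m) k s))) t))"
  proof (rule sum.cong[OF refl])
   fix s assume "s \<in> ?F"
   then have "chain_boundary (Suc (Suc m)) (h (Suc m) (frag_of s)) = S s - frag_of s - h m (chain_boundary (Suc m) (frag_of s))"
    using h(4)[OF ch, of s] by (simp add: S_def algebra_simps)
   moreover have "rl (h m (chain_boundary (Suc m) (frag_of s))) t = (\<Sum>k\<le>Suc m. (-1) ^ k * rl (h m (frag_of (singular_face (Suc m) k s))) t)"
    unfolding chain_boundary_of by (simp add: hs rl_sum hc del: sum.atMost_Suc)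
   ultimately show "z s * rl (chain_boundary (Suc (Suc m)) (h (Suc m) (frag_of s))) t
    = z s * rl (S s) t - z s * dl s t - z s * (\<Sum>k\<le>Suc m. (-1) ^ k * rl (h m (frag_of (singular_face (Suc m) k s))) t)"
    by (simp only: rl_diff rl_of) (simp only: right_diff_distrib)
  qed
  also have "\<dots> = z' t - (\<Sum>s\<in>?F. z s * dl s t)"
   using cycle_faces[OF fin z(2), of "\<lambda>r. rl (h m (frag_of r)) t"] by (simp only: sum_subtractf z'_def)
  also have "(\<Sum>s\<in>?F. z s * dl s t) = (\<Sum>s\<in>?F. if s = t then z t else 0)"
   by (rule sum.cong) (auto simp: dl_def)
  also have "\<dots> = z t"
   using fin by auto
  finally show ?thesis .
 qed
 show thesis
 proof (rule that[of z' c])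
  have "{t. z' t \<noteq> 0} \<subseteq> (\<Union>s\<in>?F. Poly_Mapping.keys (S s))"
   using supz by blast
  then show "finite {t. z' t \<noteq> 0}"
   by (rule finite_subset) (use fin in simp)
  show "singular_simplex (Suc m) X s \<and> (\<exists>V\<in>C. s ` standard_simplex (Suc m) \<subseteq> V)" if nz: "z' s \<noteq> 0" for s
  proof -
   obtain r where r: "r \<in> ?F" "s \<in> Poly_Mapping.keys (S r)"
    using supz[OF nz] by blast
   have "\<exists>V\<in>C. s \<in> standard_simplex (Suc m) \<rightarrow> V"
    using n[OF r(1) nM[OF r(1)]] r(2) by (simp add: S_def)
   moreover have "singular_simplex (Suc m) X s"
    using Sch[OF r(1), of M] r(2) by (auto simp: S_def singular_chain_def)
   ultimately show ?thesis
    by (auto simp: image_subset_iff Pi_iff)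
  qed
  show cs: "c \<in> supp (Sing X (Suc (Suc m)))"
   unfolding c_def[abs_def]
  proof (rule supp_sum, rule supp_scale)
   fix s assume "s \<in> ?F"
   then have "singular_chain (Suc (Suc m)) X (h (Suc m) (frag_of s))"
    by (intro h(3) ch)
   then show "rl (h (Suc m) (frag_of s)) \<in> supp (Sing X (Suc (Suc m)))"
    using l1_rl rl_keys by (auto simp: supp_def singular_chain_def)
  qed
  show "rchain_boundary (Suc (Suc m)) c = (\<lambda>s. z' s - z s)"
   using bc by (rule ext)
  have "z' = (\<lambda>s. z s + rchain_boundary (Suc (Suc m)) c s)"
   using bc by (simp add: fun_eq_iff)
  then have "rchain_boundary (Suc m) z' = (\<lambda>s. rchain_boundary (Suc m) z s + rchain_boundary (Suc m) (rchain_boundary (Suc (Suc m)) c) s)"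
   using bd_add[OF l1_finite[OF fin] l1_bd(1)[OF supp_l1[OF cs]]] by simp
  also have "rchain_boundary (Suc m) (rchain_boundary (Suc (Suc m)) c) = (\<lambda>_. 0)"
   by (rule bd_bd[OF cs singular_face_comm])
  finally show "cyc (Suc m) z'"
   using z(2) by (simp add: cyc_def)
 qed
qed

theorem theorem2:
  fixes X :: "'a topology" and I :: "'i set" and U :: "'i \<Rightarrow> 'a set"
    and k n :: nat and z :: "'a rchain"
  assumes open_cover: "\<forall>i\<in>I. openin X (U i)" "(\<Union>i\<in>I. U i) = topspace X"
    and amenable: "\<forall>i\<in>I. amenable_in X (U i)"
    and mult: "cover_multiplicity X I U k"
    and "n \<ge> k"
    and cycle: "real_chain n X z" "rchain_boundary n z = (\<lambda>_. 0)"
  shows "\<exists>b. l1_chain (Suc n) X b \<and> rchain_boundary (Suc n) b = z"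
proof -
  have card: "card J \<le> k" if "J \<subseteq> I" "topspace X \<inter> \<Inter> (U ` J) \<noteq> {}" for J
    using mult that unfolding cover_multiplicity_def by simp
  \<comment> \<open>The set attaining the multiplicity shows that \<open>X\<close> has a point. The
    point lies in some member of the cover, so \<open>k\<close> and with it \<open>n\<close> is at
    least 1.\<close>
  obtain J where "topspace X \<inter> \<Inter> (U ` J) \<noteq> {}"
    using mult unfolding cover_multiplicity_def by (elim conjE exE)
  then obtain x i where "x \<in> topspace X" "i \<in> I" "x \<in> U i"
    unfolding open_cover(2)[symmetric] by blast
  then have "card {i} \<le> k"
    by (intro card) auto
  then obtain m where m: "n = Suc m"
    using \<open>n \<ge> k\<close> by (cases n) auto
  obtain z' c where z': "finite {s. z' s \<noteq> 0}"
    "\<And>s. z' s \<noteq> 0 \<Longrightarrow> singular_simplex (Suc m) X s \<and> (\<exists>V\<in>U ` I. s ` standard_simplex (Suc m) \<subseteq> V)"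
    "cyc (Suc m) z'" and c: "c \<in> supp (Sing X (Suc (Suc m)))" "rchain_boundary (Suc (Suc m)) c = (\<lambda>s. z' s - z s)"
  proof (rule small_cycle[of "U ` I" X m z])
    show "topspace X \<subseteq> \<Union> (U ` I)"
      using open_cover(2) by simp
    show "real_chain (Suc m) X z" "cyc (Suc m) z"
      using cycle unfolding m cyc_def by auto
  qed (use open_cover(1) in blast, rule that)
  have "\<exists>i. i \<in> I \<and> s ` standard_simplex (Suc m) \<subseteq> U i" if "z' s \<noteq> 0" for s
    using z'(2)[OF that] by blast
  then obtain i where i: "\<And>s. z' s \<noteq> 0 \<Longrightarrow> i s \<in> I \<and> s ` standard_simplex (Suc m) \<subseteq> U (i s)"
    by metis
  \<comment> \<open>The small cycle involves finitely many simplices, hence finitely many members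
    suffice; numbering them injectively does not increase the multiplicity.\<close>
  define I0 where "I0 = i ` {s. z' s \<noteq> 0}"
  have I0: "finite I0" "I0 \<subseteq> I"
    using z'(1) i by (auto simp: I0_def)
  obtain e where e: "bij_betw e {0..<card I0} I0"
    using ex_bij_betw_nat_finite[OF I0(1)] by blast
  let ?N = "card I0"
  have eI: "e j \<in> I" if "j < ?N" for j
    using bij_betwE[OF e] that I0(2) by auto
  interpret cech X "\<lambda>j. U (e j)" ?N k "Suc m" z'
  proof
    show "amenable_in X (U (e j))" if "j < ?N" for j
      using amenable eI[OF that] by blast
    show "card J \<le> k" if J: "J \<subseteq> {..<?N}" "topspace X \<inter> \<Inter> ((\<lambda>j. U (e j)) ` J) \<noteq> {}" for J
    proof -
      have "inj_on e J"
        using bij_betw_imp_inj_on[OF e] by (rule inj_on_subset) (use J in auto)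
      then have "card (e ` J) = card J"
        by (rule card_image)
      moreover have "card (e ` J) \<le> k"
        using J eI by (intro card) (auto simp: image_image)
      ultimately show ?thesis
        by simp
    qed
    show "k \<le> Suc m"
      using \<open>n \<ge> k\<close> m by simp
    show "singular_simplex (Suc m) X s \<and> (\<exists>j<?N. s ` standard_simplex (Suc m) \<subseteq> U (e j))" if s: "z' s \<noteq> 0" for s
    proof -
      have "i s \<in> I0"
        using s by (auto simp: I0_def)
      then obtain j where "j < ?N" "e j = i s"
        using bij_betw_imp_surj_on[OF e] by force
      then show ?thesis
        using z'(2)[OF s] i[OF s] by (intro conjI exI[of _ j]) simp_all
    qed
  qed (use z' l1_finite in auto)
  obtain b where b: "b \<in> supp (Sing X (Suc (Suc m)))" "rchain_boundary (Suc (Suc m)) b = z'"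
    using cech_boundary by blast
  have "rchain_boundary (Suc n) (\<lambda>s. b s - c s) = z"
    unfolding m bd_diff[OF supp_l1[OF b(1)] supp_l1[OF c(1)]] b(2) c(2) by simp
  moreover have "l1_chain (Suc n) X (\<lambda>s. b s - c s)"
    using supp_diff[OF b(1) c(1)] by (auto simp: m supp_def l1_chain_def l1_def)
  ultimately show ?thesis
    by blast
qed

end
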